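(* Let $x_0\in\mathbb Z$, let $0<\beta_L\le\beta_R<\infty$ and $\kappa>0$, and let ${\rm P}(n)=\omega_{\rm B}(A_n)$, $n\in\mathbb N$, be the nonequilibrium steady state emptiness formation probability described in the context. Then, as $n\to\infty$, $$ {\rm P}(n)=\mathcal O\big({\rm e}^{-\Gamma n}\big),$$ where $\Gamma:=\Gamma_R+\Gamma_{\rm B}>0$ with $$\Gamma_R:=-\frac12\int_{-\pi}^{\pi}\frac{dk}{2\pi}\,\log[\hat s_{-,R}(k)],\qquad \Gamma_{\rm B}:=-\frac12\int_{-\pi}^{\pi}\frac{dk}{2\pi}\,\log\big[\sigma_{\rm B}(k)\hat s_{-,L}(k)+(1-\sigma_{\rm B}(k))\hat s_{-,R}(k)\big],$$ $\hat s_{-,\alpha}(k):=\tfrac12\big(1-\tanh[\tfrac12\beta_\alpha\cos k]\big)$ for $\alpha=L,R$, and $\sigma_{\rm B}(k):=\dfrac{\sin^2 k}{\sin^2 k+\kappa^2}$.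
   Context: Setting. Let $\mathfrak h=\ell^2(\mathbb Z)$ with inner product $(\cdot,\cdot)$ antilinear in the first argument, $\delta_x$ ($x\in\mathbb Z$) the Kronecker basis vectors, $u$ the shift $(uf)(x)=f(x-1)$, $p_0=(\delta_0,\cdot)\delta_0$, and ${\rm Re}(A)=(A+A^* )/2$. Fix an integer $N\ge0$ and $\kappa>0$. Define $h={\rm Re}(u)$, $h_{\rm B}=h+\kappa p_0$, $v_L={\rm Re}(u^{-(N+1)}p_0u^N)$, $v_R={\rm Re}(u^Np_0u^{-(N+1)})$, $h_0=h-v_L-v_R$. On $\mathfrak h\oplus\mathfrak h$ let $H_{\rm B}=h_{\rm B}\oplus(-h_{\rm B})$, and let $J[f_1,f_2]=[\bar f_2,\bar f_1]$. Let $\mathfrak A$ be the C*-algebra on the fermionic Fock space over $\mathfrak h$ generated by $B(F)=a^*(f_1)+a(\bar f_2)$, $F=[f_1,f_2]\in\mathfrak h\oplus\mathfrak h$ (so $\{B^*(F),B(G)\}=(F,G)$, $B^*(F)=B(JF)$), with dynamics $\tau_{\rm B}^t(B(F))=B({\rm e}^{itH_{\rm B}}F)$ (Bogoliubov automorphisms). A state $\omega$ on $\mathfrak A$ is quasifree with density $S$ (an operator on $\mathfrak h\oplus\mathfrak h$ with $0\le S=S^*\le1$, $JSJ=1-S$) if $\omega(B^*(F)B(G))=(F,SG)$, $\omega$ vanishes on odd monomials in the $B(F)$'s, and $\omega(B(F_1)\cdots B(F_{2n}))$ is the Pfaffian of the skew-symmetric matrix with entries $\omega(B(F_i)B(F_j))$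 for $i<j$. Let $\mathbb Z_L=\{x\le-(N+1)\}$, $\mathbb Z_{\mathcal S}=\{-N\le x\le N\}$, $\mathbb Z_R=\{x\ge N+1\}$, $\mathfrak h_\alpha=\ell^2(\mathbb Z_\alpha)$, $i_\alpha:\mathfrak h_\alpha\to\mathfrak h$ extension by zero, $h_\alpha=i_\alpha^*hi_\alpha$. Let $k_0=\beta_Lh_L\oplus0\oplus\beta_Rh_R$ on $\mathfrak h\cong\mathfrak h_L\oplus\mathfrak h_{\mathcal S}\oplus\mathfrak h_R$, $s_{0,\pm}=(1+{\rm e}^{\pm k_0})^{-1}$, and $\omega_0$ the quasifree state with density $S_0=s_{0,-}\oplus s_{0,+}$. The net $\{\frac1T\int_0^T\omega_0\circ\tau_{\rm B}^t\,dt\}_{T>0}$ has a unique weak-* limit point as $T\to\infty$, denoted $\omega_{\rm B}$ (the NESS). For $x_0\in\mathbb Z$ set $G_1=[0,\delta_{x_0-1}]$, $G_2=JG_1$, $F_{2i-1}=(u^i\oplus u^i)G_1$, $F_{2i}=(u^i\oplus u^i)G_2$, and $A_n=\prod_{i=1}^{2n}B(F_i)$ (equivalently $A_n=\prod_{x=x_0}^{x_0+n-1}a_xa_x^*$). *)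

theory Defs
  imports "HOL-Analysis.Analysis" "HOL-Computational_Algebra.Polynomial" "HOL-Library.Landau_Symbols"
begin

text \<open>Vectors of h = l2(Z) are represented by their coordinate functions Z -> C;
 vectors of h (+) h by pairs. All operators below are defined pointwise on
 coordinate functions; on square-summable vectors they coincide with the
 bounded operators of the paper.\<close>

type_synonym vec = "int \<Rightarrow> complex"
type_synonym vec2 = "vec \<times> vec"

definition delta :: "int \<Rightarrow> vec" where
  "delta a = (\<lambda>x. if x = a then 1 else 0)"

definition shift :: "vec \<Rightarrow> vec" where
  "shift f = (\<lambda>x. f (x - 1))"

definition shift_inv :: "vec \<Rightarrow> vec" where
  "shift_inv f = (\<lambda>x. f (x + 1))"

definition hop :: "vec \<Rightarrow> vec" where
  "hop f = (\<lambda>x. (shift f x + shift_inv f x) / 2)"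

definition p0 :: "vec \<Rightarrow> vec" where
  "p0 f = (\<lambda>x. f 0 * delta 0 x)"

definition hB :: "real \<Rightarrow> vec \<Rightarrow> vec" where
  "hB \<kappa> f = (\<lambda>x. hop f x + of_real \<kappa> * p0 f x)"

definition HB :: "real \<Rightarrow> vec2 \<Rightarrow> vec2" where
  "HB \<kappa> F = (hB \<kappa> (fst F), (\<lambda>x. - hB \<kappa> (snd F) x))"

definition expHB :: "real \<Rightarrow> real \<Rightarrow> vec2 \<Rightarrow> vec2" where
  "expHB \<kappa> t F =
     ((\<lambda>x. \<Sum>n. ((\<i> * of_real t) ^ n / of_nat (fact n)) * fst ((HB \<kappa> ^^ n) F) x),
      (\<lambda>x. \<Sum>n. ((\<i> * of_real t) ^ n / of_nat (fact n)) * snd ((HB \<kappa> ^^ n) F) x))"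

definition Jop :: "vec2 \<Rightarrow> vec2" where
  "Jop F = ((\<lambda>x. cnj (snd F x)), (\<lambda>x. cnj (fst F x)))"

definition ip :: "vec2 \<Rightarrow> vec2 \<Rightarrow> complex" where
  "ip F G = infsum (\<lambda>x. cnj (fst F x) * fst G x) UNIV
          + infsum (\<lambda>x. cnj (snd F x) * snd G x) UNIV"

definition ZL :: "nat \<Rightarrow> int set" where "ZL N = {x. x \<le> - (int N + 1)}"
definition ZS :: "nat \<Rightarrow> int set" where "ZS N = {x. - int N \<le> x \<and> x \<le> int N}"
definition ZR :: "nat \<Rightarrow> int set" where "ZR N = {x. int N + 1 \<le> x}"

definition proj :: "int set \<Rightarrow> vec \<Rightarrow> vec" where
  "proj A f = (\<lambda>x. if x \<in> A then f x else 0)"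

text \<open>k_0 = beta_L h_L (+) 0 (+) beta_R h_R on h = h_L (+) h_S (+) h_R,
  where h_alpha = i_alpha^* h i_alpha\<close>
definition k0 :: "nat \<Rightarrow> real \<Rightarrow> real \<Rightarrow> vec \<Rightarrow> vec" where
  "k0 N \<beta>L \<beta>R f = (\<lambda>x. of_real \<beta>L * proj (ZL N) (hop (proj (ZL N) f)) x
                       + of_real \<beta>R * proj (ZR N) (hop (proj (ZR N) f)) x)"

definition polyop :: "real poly \<Rightarrow> (vec \<Rightarrow> vec) \<Rightarrow> vec \<Rightarrow> vec" where
  "polyop p A f = (\<lambda>x. \<Sum>i\<le>degree p. of_real (coeff p i) * (A ^^ i) f x)"

text \<open>Continuous functional calculus g(A) of a self-adjoint operator A with
  norm at most r: g(A) is the (strong, hence coordinatewise) limit of p_k(A)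
  for any sequence of real polynomials p_k converging uniformly to g on [-r,r].\<close>
definition fcalc :: "real \<Rightarrow> (real \<Rightarrow> real) \<Rightarrow> (vec \<Rightarrow> vec) \<Rightarrow> vec \<Rightarrow> vec" where
  "fcalc r g A f = (\<lambda>x. THE c. \<forall>P :: nat \<Rightarrow> real poly.
      (\<forall>\<epsilon>>0. \<forall>\<^sub>F k in sequentially. \<forall>s\<in>{-r..r}. \<bar>poly (P k) s - g s\<bar> < \<epsilon>)
      \<longrightarrow> ((\<lambda>k. polyop (P k) A f x) \<longlonglongrightarrow> c))"

text \<open>s_{0,-} = (1 + e^{-k_0})^{-1}, s_{0,+} = (1 + e^{k_0})^{-1};
  note norm k_0 <= max beta_L beta_R <= beta_L + beta_R\<close>
definition s0m :: "nat \<Rightarrow> real \<Rightarrow> real \<Rightarrow> vec \<Rightarrow> vec" where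
  "s0m N \<beta>L \<beta>R = fcalc (\<beta>L + \<beta>R) (\<lambda>s. 1 / (1 + exp (- s))) (k0 N \<beta>L \<beta>R)"

definition s0p :: "nat \<Rightarrow> real \<Rightarrow> real \<Rightarrow> vec \<Rightarrow> vec" where
  "s0p N \<beta>L \<beta>R = fcalc (\<beta>L + \<beta>R) (\<lambda>s. 1 / (1 + exp s)) (k0 N \<beta>L \<beta>R)"

definition S0 :: "nat \<Rightarrow> real \<Rightarrow> real \<Rightarrow> vec2 \<Rightarrow> vec2" where
  "S0 N \<beta>L \<beta>R F = (s0m N \<beta>L \<beta>R (fst F), s0p N \<beta>L \<beta>R (snd F))"

text \<open>Pfaffian of the skew-symmetric matrix with upper entries w(F_i,F_j), i<j,
  by expansion along the first row; odd length gives 0.\<close>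
fun pf :: "('a \<Rightarrow> 'a \<Rightarrow> complex) \<Rightarrow> 'a list \<Rightarrow> complex" where
  "pf w [] = 1"
| "pf w (x # xs) = (\<Sum>j<length xs. (-1) ^ j * w x (xs ! j) * pf w (take j xs @ drop (Suc j) xs))"

text \<open>value of the quasifree state with density S on the monomial B(F_1)...B(F_m):
  omega(B(F)B(G)) = omega(B^*(JF)B(G)) = (JF, S G)\<close>
definition qf_state :: "(vec2 \<Rightarrow> vec2) \<Rightarrow> vec2 list \<Rightarrow> complex" where
  "qf_state S Fs = pf (\<lambda>F G. ip (Jop F) (S G)) Fs"

definition G1 :: "int \<Rightarrow> vec2" where "G1 x0 = ((\<lambda>_. 0), delta (x0 - 1))"
definition G2 :: "int \<Rightarrow> vec2" where "G2 x0 = Jop (G1 x0)"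

definition shift2 :: "nat \<Rightarrow> vec2 \<Rightarrow> vec2" where
  "shift2 i G = ((shift ^^ i) (fst G), (shift ^^ i) (snd G))"

definition Fs :: "int \<Rightarrow> nat \<Rightarrow> vec2 list" where
  "Fs x0 n = concat (map (\<lambda>i. [shift2 i (G1 x0), shift2 i (G2 x0)]) [1..<n+1])"

text \<open>omega_0 o tau_B^t (A_n) = omega_0 (prod_i B(e^{itH_B} F_i))\<close>
definition evolved_value :: "nat \<Rightarrow> real \<Rightarrow> real \<Rightarrow> real \<Rightarrow> int \<Rightarrow> nat \<Rightarrow> real \<Rightarrow> complex" where
  "evolved_value N \<kappa> \<beta>L \<beta>R x0 n t =
     qf_state (S0 N \<beta>L \<beta>R) (map (expHB \<kappa> t) (Fs x0 n))"

definition cesaro_value :: "nat \<Rightarrow> real \<Rightarrow> real \<Rightarrow> real \<Rightarrow> int \<Rightarrow> nat \<Rightarrow> real \<Rightarrow> complex" where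
  "cesaro_value N \<kappa> \<beta>L \<beta>R x0 n T =
     of_real (1 / T) * integral {0..T} (evolved_value N \<kappa> \<beta>L \<beta>R x0 n)"

definition s_hat_minus :: "real \<Rightarrow> real \<Rightarrow> real" where
  "s_hat_minus \<beta> k = (1 - tanh (\<beta> * cos k / 2)) / 2"

definition sigmaB :: "real \<Rightarrow> real \<Rightarrow> real" where
  "sigmaB \<kappa> k = (sin k)\<^sup>2 / ((sin k)\<^sup>2 + \<kappa>\<^sup>2)"

definition GammaR :: "real \<Rightarrow> real" where
  "GammaR \<beta>R = - (1/2) * integral {-pi..pi} (\<lambda>k. ln (s_hat_minus \<beta>R k) / (2 * pi))"

definition GammaB :: "real \<Rightarrow> real \<Rightarrow> real \<Rightarrow> real" where
  "GammaB \<kappa> \<beta>L \<beta>R = - (1/2) * integral {-pi..pi}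
     (\<lambda>k. ln (sigmaB \<kappa> k * s_hat_minus \<beta>L k + (1 - sigmaB \<kappa> k) * s_hat_minus \<beta>R k) / (2 * pi))"

end

theory Submission
  imports Defs "Jordan_Normal_Form.Determinant" "HOL-Real_Asymp.Real_Asymp"
begin

text \<open>The Pfaffian of the evolved state is a determinant whose entries are matrix elements of the initial
  one-particle density between the vectors psi obtained by propagating the basis vectors. The propagator
  is explicit (plane waves, waves reflected at the origin, one bound state). For a large time t a plane
  wave with momentum p sits at distance about t sin p from the origin, so that the entries converge to integrals
  over half of the momenta, and so do their time averages.

  For positive sites the limit matrix is a Toeplitz matrix plus a Hankel matrix with summable symbol
  coefficients. It is positive semidefinite, hence by Hadamard's inequality its determinant is at most
  the product of its quadratic form at the vectors of any unitriangular basis. Taking as basis the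
  truncated Taylor coefficients of the outer function of the inverse Toeplitz symbol, each factor is the
  geometric mean of the symbol up to an error that is summable over the sites. The logarithm of that
  geometric mean is minus Gamma.\<close>

section \<open>Fourier coefficients and square-summable families\<close>

text \<open>Why the Toeplitz symbol looks as it does: on the right half line a wave with one sign of
  sin p has come in undisturbed from the right reservoir; for the other sign it is outgoing, either
  reflected, with probability 1 - \<open>sigmaB\<close>, or transmitted from the left, with
  probability \<open>sigmaB\<close>. Hence the mean of its logarithm splits into two halves, which
  give \<open>GammaR\<close> and \<open>GammaB\<close>. The two regimes meet where sin p = 0, and
  there \<open>sigmaB\<close> vanishes to second order because \<kappa> is nonzero; so the symbol is
  continuously differentiable and its logarithm has absolutely summable Fourier coefficients, which
  a jump would destroy. The bound state does not spoil convergence in time: the initial density does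
  not couple the two components of the doubled space, so its phases cancel in the product of two
  propagated vectors, and its products with waves decay. The two-point function thus converges even
  before averaging. An upper bound on the determinant suffices, which makes Hadamard's inequality
  the right tool. The finitely many nonpositive sites among x0, x0 + 1, ... only cost a constant
  factor.\<close>

definition avg :: "(real \<Rightarrow> complex) \<Rightarrow> complex" where
  "avg F = integral {-pi..pi} F / (2 * pi)"

text \<open>The sign of the exponent makes \<open>fc F m\<close> the classical Fourier coefficient
  of index -m. Hence the expansion of F in \<open>Fourier_inversion\<close> carries
  \<open>cis (- of_int m * p)\<close>, and functions analytic in the disc have coefficients at m <=
  0 only.\<close>

definition fc :: "(real \<Rightarrow> complex) \<Rightarrow> int \<Rightarrow> complex" where
  "fc F m = avg (\<lambda>p. F p * cis (of_int m * p))"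

definition msq :: "(real \<Rightarrow> complex) \<Rightarrow> real" where
  "msq F = integral {-pi..pi} (\<lambda>p. (cmod (F p))\<^sup>2) / (2 * pi)"

definition periodic :: "(real \<Rightarrow> complex) \<Rightarrow> bool" where
  "periodic F \<longleftrightarrow> (\<forall>p. F (p + 2 * pi) = F p)"

lemma integrable_cont:
  fixes F :: "real \<Rightarrow> 'a::euclidean_space"
  assumes "continuous_on UNIV F" shows "F integrable_on {a..b}"
  using assms continuous_on_subset integrable_continuous_real by blast

lemma avg_add: "continuous_on UNIV F \<Longrightarrow> continuous_on UNIV G \<Longrightarrow> avg (\<lambda>p. F p + G p) = avg F + avg G"
  unfolding avg_def by (simp add: integral_add integrable_cont add_divide_distrib)

lemma avg_diff: "continuous_on UNIV F \<Longrightarrow> continuous_on UNIV G \<Longrightarrow> avg (\<lambda>p. F p - G p) = avg F - avg G"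
  unfolding avg_def by (simp add: integral_diff integrable_cont diff_divide_distrib)

lemma avg_cmult: "avg (\<lambda>p. c * F p) = c * avg F"
  unfolding avg_def by simp

lemma avg_zero [simp]: "avg (\<lambda>p. 0) = 0"
  unfolding avg_def by simp

lemma avg_sum:
  assumes "\<And>i. i \<in> I \<Longrightarrow> continuous_on UNIV (F i)"
  shows "avg (\<lambda>p. \<Sum>i\<in>I. F i p) = (\<Sum>i\<in>I. avg (F i))"
proof (cases "finite I")
  case True
  then show ?thesis unfolding avg_def
    by (simp add: integral_sum integrable_cont assms sum_divide_distrib)
qed simp

lemma avg_cnj: "avg (\<lambda>p. cnj (F p)) = cnj (avg F)"
  unfolding avg_def by (simp add: integral_cnj)

lemma avg_norm_le:
  assumes "continuous_on UNIV F" "\<And>p. p \<in> {-pi..pi} \<Longrightarrow> cmod (F p) \<le> K"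
  shows "cmod (avg F) \<le> K"
proof -
  have "cmod (integral {-pi..pi} F) \<le> K * (pi - (- pi))"
    by (rule integral_bound) (use assms continuous_on_subset[OF assms(1)] in auto)
  then show ?thesis unfolding avg_def by (simp add: norm_divide field_simps)
qed

lemma avg_cis: "avg (\<lambda>p. cis (of_int m * p)) = (if m = 0 then 1 else 0)"
proof (cases "m = 0")
  case True
  then show ?thesis by (simp add: avg_def scaleR_conv_of_real)
next
  case False
  have "((\<lambda>p. cis (of_int m * p)) has_integral
     cis (of_int m * pi) / (\<i> * of_int m) - cis (of_int m * (- pi)) / (\<i> * of_int m)) {-pi..pi}"
  proof (rule fundamental_theorem_of_calculus)
    fix x :: real
    have "((\<lambda>z. exp (\<i> * of_int m * z) / (\<i> * of_int m)) has_field_derivative exp (\<i> * of_int m * of_real x)) (at (of_real x))"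
      using False by (auto intro!: derivative_eq_intros simp: field_simps)
    from has_vector_derivative_real_field[OF this]
    show "((\<lambda>p. cis (of_int m * p) / (\<i> * of_int m)) has_vector_derivative cis (of_int m * x)) (at x within {-pi..pi})"
      by (simp add: cis_conv_exp mult.assoc)
  qed simp
  moreover have "cis (of_int m * pi) = cis (of_int m * (- pi))"
    by (auto simp: complex_eq_iff sin_times_pi_eq_0)
  ultimately show ?thesis using False by (auto simp: avg_def dest: integral_unique)
qed

lemma cont_cis [continuous_intros]:
  fixes f :: "'a::topological_space \<Rightarrow> real"
  shows "continuous_on S f \<Longrightarrow> continuous_on S (\<lambda>x. cis (f x))"
  by (simp add: cis_conv_exp) (intro continuous_intros)

lemma fc_add: "continuous_on UNIV F \<Longrightarrow> continuous_on UNIV G \<Longrightarrow> fc (\<lambda>p. F p + G p) m = fc F m + fc G m"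
  unfolding fc_def by (simp add: distrib_right) (rule avg_add; intro continuous_intros; assumption)

lemma fc_diff: "continuous_on UNIV F \<Longrightarrow> continuous_on UNIV G \<Longrightarrow> fc (\<lambda>p. F p - G p) m = fc F m - fc G m"
  unfolding fc_def by (simp add: left_diff_distrib) (rule avg_diff; intro continuous_intros; assumption)

lemma fc_cmult: "fc (\<lambda>p. c * F p) m = c * fc F m"
  unfolding fc_def by (simp add: mult.assoc avg_cmult)

lemma fc_zero [simp]: "fc (\<lambda>p. 0) m = 0"
  unfolding fc_def by simp

lemma fc_cis_mult: "fc (\<lambda>p. cis (of_int k * p) * F p) m = fc F (m + k)"
  unfolding fc_def by (simp add: cis_mult[symmetric] distrib_right distrib_left mult_ac)

lemma fc_cis: "fc (\<lambda>p. cis (of_int k * p)) m = (if k + m = 0 then 1 else 0)"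
  unfolding fc_def using avg_cis[of "k + m"] by (simp add: cis_mult distrib_right)

lemma fc_norm_le:
  assumes "continuous_on UNIV F" "\<And>p. cmod (F p) \<le> K"
  shows "cmod (fc F m) \<le> K"
  unfolding fc_def by (rule avg_norm_le) (use assms in \<open>auto simp: norm_mult intro!: continuous_intros\<close>)

text \<open>Bounding all finite sections records square-summability and a norm bound at once; c may
  be any upper bound, so the predicate passes to sums and limits with explicit constants.\<close>

definition l2le :: "('a \<Rightarrow> complex) \<Rightarrow> real \<Rightarrow> bool" where
  "l2le f c \<longleftrightarrow> (\<forall>I. finite I \<longrightarrow> L2_set (\<lambda>a. cmod (f a)) I \<le> c)"

lemma l2le_nonneg: "l2le f c \<Longrightarrow> 0 \<le> c"
  unfolding l2le_def by (metis L2_set_empty finite.emptyI)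

lemma l2le_mono: "l2le f c \<Longrightarrow> (\<And>a. cmod (g a) \<le> cmod (f a)) \<Longrightarrow> c \<le> d \<Longrightarrow> l2le g d"
  unfolding l2le_def
proof (intro allI impI)
  fix I :: "'a set" assume *: "\<forall>I. finite I \<longrightarrow> L2_set (\<lambda>a. cmod (f a)) I \<le> c" "\<And>a. cmod (g a) \<le> cmod (f a)"
    "c \<le> d" "finite I"
  have "L2_set (\<lambda>a. cmod (g a)) I \<le> L2_set (\<lambda>a. cmod (f a)) I"
    by (rule L2_set_mono) (use * in auto)
  then show "L2_set (\<lambda>a. cmod (g a)) I \<le> d" using * by force
qed

lemma l2le_add: "l2le f c \<Longrightarrow> l2le g d \<Longrightarrow> l2le (\<lambda>a. f a + g a) (c + d)"
  unfolding l2le_def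
proof (intro allI impI)
  fix I :: "'a set" assume *: "\<forall>I. finite I \<longrightarrow> L2_set (\<lambda>a. cmod (f a)) I \<le> c"
    "\<forall>I. finite I \<longrightarrow> L2_set (\<lambda>a. cmod (g a)) I \<le> d" "finite I"
  have "L2_set (\<lambda>a. cmod (f a + g a)) I \<le> L2_set (\<lambda>a. cmod (f a) + cmod (g a)) I"
    by (rule L2_set_mono) (auto simp: norm_triangle_ineq)
  also have "\<dots> \<le> L2_set (\<lambda>a. cmod (f a)) I + L2_set (\<lambda>a. cmod (g a)) I"
    by (rule L2_set_triangle_ineq)
  finally show "L2_set (\<lambda>a. cmod (f a + g a)) I \<le> c + d" using * by force
qed

lemma l2le_cmult: "l2le f c \<Longrightarrow> l2le (\<lambda>a. k * f a) (cmod k * c)"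
  unfolding l2le_def
  by (simp add: norm_mult flip: L2_set_right_distrib) (simp add: mult_left_mono)

lemma l2le_diff: "l2le f c \<Longrightarrow> l2le g d \<Longrightarrow> l2le (\<lambda>a. f a - g a) (c + d)"
  using l2le_add[of f c "\<lambda>a. -1 * g a" d] l2le_cmult[of g d "-1"] by simp

lemma l2le_reindex:
  fixes h :: "'b \<Rightarrow> 'a"
  shows "l2le f c \<Longrightarrow> inj h \<Longrightarrow> l2le (\<lambda>a. f (h a)) c"
  unfolding l2le_def
proof (intro allI impI)
  fix I :: "'b set" assume *: "\<forall>I. finite I \<longrightarrow> L2_set (\<lambda>a. cmod (f a)) I \<le> c" "inj h" "finite I"
  have "L2_set (\<lambda>a. cmod (f (h a))) I = L2_set (\<lambda>a. cmod (f a)) (h ` I)"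
    unfolding L2_set_def using inj_on_subset[OF *(2), of I] by (simp add: sum.reindex)
  then show "L2_set (\<lambda>a. cmod (f (h a))) I \<le> c" using * by auto
qed

lemma l2le_restrict: "l2le f c \<Longrightarrow> l2le (\<lambda>a. if P a then f a else 0) c"
  by (erule l2le_mono) (auto dest: l2le_nonneg)

lemma l2le_bound: "l2le f c \<Longrightarrow> cmod (f a) \<le> c"
  unfolding l2le_def by (drule spec[of _ "{a}"]) (simp add: L2_set_def)

lemma l2le_sum_sq: "l2le f c \<Longrightarrow> finite I \<Longrightarrow> (\<Sum>a\<in>I. (cmod (f a))\<^sup>2) \<le> c\<^sup>2"
  using power_mono[of "L2_set (\<lambda>a. cmod (f a)) I" c 2] by (auto simp: l2le_def L2_set_def sum_nonneg)

lemma l2le_I_sq: "(\<And>I. finite I \<Longrightarrow> (\<Sum>a\<in>I. (cmod (f a))\<^sup>2) \<le> c\<^sup>2) \<Longrightarrow> 0 \<le> c \<Longrightarrow> l2le f c"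
  unfolding l2le_def L2_set_def by (metis real_le_lsqrt)

lemma l2le_CS_finite:
  assumes "l2le f c" "l2le g d" "finite I"
  shows "(\<Sum>a\<in>I. cmod (f a) * cmod (g a)) \<le> c * d"
proof -
  have "(\<Sum>a\<in>I. cmod (f a) * cmod (g a)) \<le> L2_set (\<lambda>a. cmod (f a)) I * L2_set (\<lambda>a. cmod (g a)) I"
    using L2_set_mult_ineq[of "\<lambda>a. cmod (f a)" "\<lambda>a. cmod (g a)" I] by simp
  also have "\<dots> \<le> c * d"
    using assms by (intro mult_mono) (auto simp: l2le_def l2le_nonneg)
  finally show ?thesis .
qed

lemma l2le_abs_summable:
  assumes "l2le f c" "l2le g d"
  shows "(\<lambda>a. cmod (cnj (f a) * g a)) summable_on A"
proof -
  have "bdd_above (sum (\<lambda>a. cmod (cnj (f a) * g a)) ` {F. F \<subseteq> A \<and> finite F})"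
    by (rule bdd_aboveI[of _ "c * d"]) (auto simp: norm_mult intro: l2le_CS_finite[OF assms])
  then show ?thesis by (intro nonneg_bdd_above_summable_on) auto
qed

lemma l2le_summable:
  assumes "l2le f c" "l2le g d"
  shows "(\<lambda>a. cnj (f a) * g a) summable_on A"
  by (rule abs_summable_summable[OF l2le_abs_summable[OF assms]])

lemma l2le_CS:
  assumes "l2le f c" "l2le g d"
  shows "cmod (\<Sum>\<^sub>\<infinity>a\<in>A. cnj (f a) * g a) \<le> c * d"
proof -
  have "cmod (\<Sum>\<^sub>\<infinity>a\<in>A. cnj (f a) * g a) \<le> (\<Sum>\<^sub>\<infinity>a\<in>A. cmod (cnj (f a) * g a))"
    by (rule norm_infsum_bound[OF l2le_abs_summable[OF assms]])
  also have "\<dots> \<le> c * d"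
    by (rule infsum_le_finite_sums[OF l2le_abs_summable[OF assms]])
      (auto simp: norm_mult intro: l2le_CS_finite[OF assms])
  finally show ?thesis .
qed

lemma avg_norm_sq_msq:
  assumes "continuous_on UNIV F"
  shows "avg (\<lambda>p. cnj (F p) * F p) = of_real (msq F)"
proof -
  have "(\<lambda>p. cnj (F p) * F p) = (\<lambda>p. of_real ((cmod (F p))\<^sup>2))"
    using complex_norm_square by (metis mult.commute)
  moreover have "integral {-pi..pi} (\<lambda>p. complex_of_real ((cmod (F p))\<^sup>2)) = of_real (integral {-pi..pi} (\<lambda>p. (cmod (F p))\<^sup>2))"
    by (rule integral_linear[OF integrable_cont bounded_linear_of_real, unfolded o_def])
      (use assms in \<open>auto intro!: continuous_intros\<close>)
  ultimately show ?thesis unfolding avg_def msq_def by simp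
qed

lemma msq_nonneg: "0 \<le> msq F"
  unfolding msq_def
  by (cases "(\<lambda>p. (cmod (F p))\<^sup>2) integrable_on {-pi..pi}") (auto intro!: integral_nonneg divide_nonneg_pos simp: not_integrable_integral)

text \<open>The mean square of F minus its Fourier sum over I equals \<open>msq F\<close> minus the
  sum of squares over I, and it is nonnegative.\<close>

lemma Bessel:
  assumes F: "continuous_on UNIV F"
  shows "l2le (fc F) (sqrt (msq F))"
proof (rule l2le_I_sq)
  fix I :: "int set" assume I: "finite I"
  define S where "S = (\<lambda>p. \<Sum>m\<in>I. fc F m * cis (of_int (- m) * p))"
  have S: "continuous_on UNIV S" unfolding S_def by (intro continuous_intros)
  have e: "avg (\<lambda>p. cnj (S p) * G p) = (\<Sum>m\<in>I. cnj (fc F m) * fc G m)"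
    if "continuous_on UNIV G" for G
  proof -
    have "(\<lambda>p. cnj (S p) * G p) = (\<lambda>p. \<Sum>m\<in>I. cnj (fc F m) * (G p * cis (of_int m * p)))"
      unfolding S_def by (simp add: sum_distrib_right sum_distrib_left cis_cnj mult_ac)
    then show ?thesis
      by (simp, subst avg_sum) (auto intro!: continuous_intros that simp: avg_cmult fc_def)
  qed
  have fcS: "fc S m = fc F m" if "m \<in> I" for m
  proof -
    have "fc S m = (\<Sum>k\<in>I. fc F k * fc (\<lambda>p. cis (of_int (- k) * p)) m)"
    proof -
      have "(\<lambda>p. S p * cis (of_int m * p)) = (\<lambda>p. \<Sum>k\<in>I. fc F k * (cis (of_int (- k) * p) * cis (of_int m * p)))"
        unfolding S_def by (simp only: sum_distrib_right mult.assoc)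
      then have "fc S m = avg (\<lambda>p. \<Sum>k\<in>I. fc F k * (cis (of_int (- k) * p) * cis (of_int m * p)))"
        unfolding fc_def by simp
      also have "\<dots> = (\<Sum>k\<in>I. fc F k * avg (\<lambda>p. cis (of_int (- k) * p) * cis (of_int m * p)))"
        by (subst avg_sum) (intro continuous_intros, simp only: avg_cmult)
      finally show ?thesis by (simp only: fc_def)
    qed
    also have "\<dots> = (\<Sum>k\<in>I. if k = m then fc F k else 0)"
      by (rule sum.cong) (auto simp: fc_cis simp del: of_int_minus)
    finally show ?thesis using I that by simp
  qed
  have "of_real (msq (\<lambda>p. F p - S p)) = avg (\<lambda>p. cnj (F p - S p) * (F p - S p))"
    by (subst avg_norm_sq_msq) (auto intro!: continuous_intros F S)
  also have "\<dots> = avg (\<lambda>p. (cnj (F p) * F p - cnj (S p) * F p) - (cnj (cnj (S p) * F p) - cnj (S p) * S p))"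
    by (rule arg_cong[of _ _ avg]) (auto simp: algebra_simps)
  also have "\<dots> = (avg (\<lambda>p. cnj (F p) * F p) - avg (\<lambda>p. cnj (S p) * F p)) - (cnj (avg (\<lambda>p. cnj (S p) * F p)) - avg (\<lambda>p. cnj (S p) * S p))"
    by (subst avg_diff, intro continuous_intros F S, intro continuous_intros F S,
        subst avg_diff, intro continuous_intros F S, intro continuous_intros F S,
        subst avg_diff, intro continuous_intros F S, intro continuous_intros F S, simp only: avg_cnj)
  also have "\<dots> = of_real (msq F) - (\<Sum>m\<in>I. cnj (fc F m) * fc F m) - (cnj (\<Sum>m\<in>I. cnj (fc F m) * fc F m) - (\<Sum>m\<in>I. cnj (fc F m) * fc F m))"
    unfolding e[OF F] e[OF S] avg_norm_sq_msq[OF F] by (simp add: fcS)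
  also have "\<dots> = of_real (msq F) - (\<Sum>m\<in>I. cnj (fc F m) * fc F m)"
    by (simp add: mult.commute)
  also have "(\<Sum>m\<in>I. cnj (fc F m) * fc F m) = of_real (\<Sum>m\<in>I. (cmod (fc F m))\<^sup>2)"
    by (simp only: of_real_sum complex_norm_square mult.commute)
  finally have "msq (\<lambda>p. F p - S p) = msq F - (\<Sum>m\<in>I. (cmod (fc F m))\<^sup>2)"
    by (simp only: of_real_diff[symmetric] of_real_eq_iff)
  then show "(\<Sum>m\<in>I. (cmod (fc F m))\<^sup>2) \<le> (sqrt (msq F))\<^sup>2"
    using msq_nonneg[of "\<lambda>p. F p - S p"] msq_nonneg[of F] by simp
qed (simp add: msq_nonneg)

lemma msq_le:
  assumes "continuous_on UNIV F" "\<And>p. cmod (F p) \<le> K"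
  shows "msq F \<le> K\<^sup>2"
proof -
  have "cmod (avg (\<lambda>p. cnj (F p) * F p)) \<le> K\<^sup>2"
    by (rule avg_norm_le)
      (use assms in \<open>auto simp: norm_mult power2_eq_square intro!: continuous_intros mult_mono order_trans[OF norm_ge_zero assms(2)]\<close>)
  then show ?thesis using msq_nonneg[of F] by (simp add: avg_norm_sq_msq assms)
qed

lemma Bessel_sup:
  assumes "continuous_on UNIV F" "\<And>p. cmod (F p) \<le> K"
  shows "l2le (fc F) K"
proof -
  have "0 \<le> K" using assms(2)[of 0] norm_ge_zero order_trans by blast
  then have "sqrt (msq F) \<le> K" using msq_le[OF assms] by (simp add: real_le_lsqrt msq_nonneg)
  then show ?thesis using Bessel[OF assms(1)] l2le_mono by blast
qed

section \<open>Trigonometric polynomials, Parseval's identity and Fourier inversion\<close>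

inductive_set trigpoly :: "(real \<Rightarrow> complex) set" where
  cis: "(\<lambda>p. cis (of_int m * p)) \<in> trigpoly"
| add: "F \<in> trigpoly \<Longrightarrow> G \<in> trigpoly \<Longrightarrow> (\<lambda>p. F p + G p) \<in> trigpoly"
| cmult: "F \<in> trigpoly \<Longrightarrow> (\<lambda>p. c * F p) \<in> trigpoly"

lemma trigpoly_cont: "F \<in> trigpoly \<Longrightarrow> continuous_on UNIV F"
  by (induction rule: trigpoly.induct) (auto intro!: continuous_intros)

lemma cis_periodic: "cis (of_int m * (p + 2 * pi)) = cis (of_int m * p)"
proof -
  have "cis (of_int m * (p + 2 * pi)) = cis (of_int m * p) * cis (2 * pi * of_int m)"
    by (simp add: cis_mult ring_distribs mult_ac)
  then show ?thesis by (simp only: cis_multiple_2pi[OF Ints_of_int] mult_1_right)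
qed

lemma trigpoly_periodic: "F \<in> trigpoly \<Longrightarrow> periodic F"
  by (induction rule: trigpoly.induct) (auto simp: periodic_def cis_periodic)

lemma trigpoly_const: "(\<lambda>p. c) \<in> trigpoly"
  using trigpoly.cmult[OF trigpoly.cis[of 0], of c] by simp

lemma trigpoly_cis_mult: "F \<in> trigpoly \<Longrightarrow> (\<lambda>p. cis (of_int m * p) * F p) \<in> trigpoly"
proof (induction rule: trigpoly.induct)
  case (cis k)
  then show ?case using trigpoly.cis[of "m + k"] by (simp add: cis_mult distrib_right)
next
  case (add F G)
  then show ?case using trigpoly.add[OF add.IH] by (simp add: distrib_left)
next
  case (cmult F c)
  then show ?case using trigpoly.cmult[OF cmult.IH, of c] by (simp add: mult_ac)
qed

lemma trigpoly_mult: "F \<in> trigpoly \<Longrightarrow> G \<in> trigpoly \<Longrightarrow> (\<lambda>p. F p * G p) \<in> trigpoly"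
proof (induction rule: trigpoly.induct)
  case (cis k)
  then show ?case by (rule trigpoly_cis_mult)
next
  case (add F H)
  then show ?case using trigpoly.add[OF add.IH(1)[OF add.prems] add.IH(2)[OF add.prems]] by (simp add: distrib_right)
next
  case (cmult F c)
  then show ?case using trigpoly.cmult[OF cmult.IH, of c] by (simp add: mult_ac)
qed

lemma trigpoly_cos: "(\<lambda>p. of_real (cos p)) \<in> trigpoly"
proof -
  have "(\<lambda>p. complex_of_real (cos p)) = (\<lambda>p. (1/2) * cis (of_int 1 * p) + (1/2) * cis (of_int (-1) * p))"
    by (auto simp: complex_eq_iff)
  then show ?thesis by (simp only: trigpoly.intros)
qed

lemma trigpoly_sin: "(\<lambda>p. of_real (sin p)) \<in> trigpoly"
proof -
  have "(\<lambda>p. complex_of_real (sin p)) = (\<lambda>p. (-\<i>/2) * cis (of_int 1 * p) + (\<i>/2) * cis (of_int (-1) * p))"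
    by (auto simp: complex_eq_iff)
  then show ?thesis by (simp only: trigpoly.intros)
qed

lemma trigpoly_deriv:
  "F \<in> trigpoly \<Longrightarrow> \<exists>F'\<in>trigpoly. \<forall>p. (F has_vector_derivative F' p) (at p)"
proof (induction rule: trigpoly.induct)
  case (cis m)
  have "((\<lambda>p. cis (of_int m * p)) has_vector_derivative \<i> * of_int m * cis (of_int m * p)) (at p)" for p
  proof -
    have "((\<lambda>z. exp (\<i> * of_int m * z)) has_field_derivative \<i> * of_int m * exp (\<i> * of_int m * of_real p)) (at (of_real p))"
      by (auto intro!: derivative_eq_intros)
    from has_vector_derivative_real_field[OF this] show ?thesis
      by (simp add: cis_conv_exp mult.assoc)
  qed
  then show ?case using trigpoly.cmult[OF trigpoly.cis, of "\<i> * of_int m" m] by (intro bexI) auto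
next
  case (add F G)
  then obtain F' G' where "F'\<in>trigpoly" "\<forall>p. (F has_vector_derivative F' p) (at p)"
    "G'\<in>trigpoly" "\<forall>p. (G has_vector_derivative G' p) (at p)" by blast
  then show ?case using trigpoly.add[of F' G'] by (intro bexI[of _ "\<lambda>p. F' p + G' p"]) (auto intro: has_vector_derivative_add)
next
  case (cmult F c)
  then obtain F' where "F'\<in>trigpoly" "\<forall>p. (F has_vector_derivative F' p) (at p)" by blast
  then show ?case using trigpoly.cmult[of F' c] by (intro bexI[of _ "\<lambda>p. c * F' p"]) (auto intro: has_vector_derivative_mult_right)
qed

lemma trigpoly_real_polynomial:
  fixes g :: "complex \<Rightarrow> real"
  shows "real_polynomial_function g \<Longrightarrow> (\<lambda>p. of_real (g (cis p))) \<in> trigpoly"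
proof (induction rule: real_polynomial_function.induct)
  case (linear f)
  interpret bounded_linear f by fact
  have "f (cis p) = cos p * f 1 + sin p * f \<i>" for p
  proof -
    have "cis p = cos p *\<^sub>R 1 + sin p *\<^sub>R \<i>" by (simp add: complex_eq_iff)
    then show ?thesis by (metis add scaleR real_scaleR_def)
  qed
  then have "(\<lambda>p. complex_of_real (f (cis p))) = (\<lambda>p. of_real (f 1) * of_real (cos p) + of_real (f \<i>) * of_real (sin p))"
    by (simp add: mult.commute)
  then show ?case by (simp only: trigpoly.add trigpoly.cmult trigpoly_cos trigpoly_sin)
next
  case (const c)
  then show ?case by (rule trigpoly_const)
next
  case (add f g)
  then show ?case using trigpoly.add by simp
next
  case (mult f g)
  then show ?case using trigpoly_mult by simp
qed

lemma periodic_reduce: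
  assumes "periodic F"
  obtains q where "q \<in> {-pi..pi}" "F p = F q" "cis p = cis q"
proof -
  have per: "F (x + 2 * pi * of_int k) = F x" for x k
  proof (induction k rule: int_induct[of _ 0])
    case (step1 i)
    have "F (x + 2 * pi * of_int (i + 1)) = F ((x + 2 * pi * of_int i) + 2 * pi)" by (simp add: algebra_simps)
    then show ?case using step1 assms by (simp add: periodic_def)
  next
    case (step2 i)
    have "F (x + 2 * pi * of_int i) = F ((x + 2 * pi * of_int (i - 1)) + 2 * pi)" by (simp add: algebra_simps)
    then show ?case using step2 assms by (simp add: periodic_def)
  qed simp
  define k where "k = \<lfloor>(p + pi) / (2 * pi)\<rfloor>"
  define q where "q = p + 2 * pi * of_int (- k)"
  have "of_int k \<le> (p + pi) / (2 * pi)" "(p + pi) / (2 * pi) < of_int k + 1"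
    unfolding k_def by linarith+
  then have "q \<in> {-pi..pi}" unfolding q_def by (auto simp: field_simps)
  moreover have "F q = F p" unfolding q_def by (rule per)
  moreover have "cis q = cis p"
    unfolding q_def by (simp only: cis_mult[symmetric] cis_multiple_2pi[OF Ints_of_int] mult_1_right)
  ultimately show thesis using that by metis
qed

text \<open>Stone-Weierstrass on the unit circle: polynomials in the real and imaginary parts of cis
  p are trigonometric polynomials.\<close>

lemma trigpoly_dense:
  assumes F: "continuous_on UNIV F" "periodic F" and e: "0 < e"
  obtains T where "T \<in> trigpoly" "\<And>p. cmod (F p - T p) < e"
proof -
  define f where "f z = F (Arg z)" for z
  have fF: "f (cis p) = F p" if "p \<in> {-pi..pi}" for p
  proof (cases "p = -pi")
    case True
    have "cis (-pi) = -1" by (simp add: complex_eq_iff)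
    then have "f (cis p) = F pi" using True Arg_eq_pi[of "-1"] unfolding f_def by simp
    also have "\<dots> = F (- pi)" using F(2)[unfolded periodic_def, rule_format, of "-pi"] by simp
    finally show ?thesis using True by simp
  next
    case False
    then show ?thesis using that by (simp add: f_def cis_Arg_unique Arg_cis)
  qed
  have im: "cis ` {-pi..pi} = sphere (0::complex) 1"
  proof
    show "sphere (0::complex) 1 \<subseteq> cis ` {-pi..pi}"
    proof
      fix z :: complex assume "z \<in> sphere 0 1"
      moreover from this have "z \<noteq> 0" by auto
      ultimately have "cis (Arg z) = z" "Arg z \<in> {-pi..pi}"
        using Arg_le_pi[of z] mpi_less_Arg[of z] by (auto simp: cis_Arg sgn_div_norm simp del: Arg_le_pi)
      then show "z \<in> cis ` {-pi..pi}" by force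
    qed
  qed auto
  \<comment> \<open>\<open>Arg\<close> jumps at the negative axis, so continuity cannot be read off
    from F directly. Preimages of closed sets are images under cis of compact sets, hence
    closed.\<close>
  have "continuous_on (sphere 0 1) f"
    unfolding continuous_on_closed_vimage[OF closed_sphere]
  proof (intro allI impI)
    fix B :: "complex set" assume B: "closed B"
    have "f -` B \<inter> sphere 0 1 = cis ` ({-pi..pi} \<inter> F -` B)"
      using fF im[symmetric] by auto
    moreover have "compact ({-pi..pi} \<inter> F -` B)"
      using B F(1) continuous_on_subset by (intro compact_Int_closed) (auto simp: closed_vimage)
    moreover have "continuous_on ({-pi..pi} \<inter> F -` B) cis" by (intro continuous_intros)
    ultimately show "closed (f -` B \<inter> sphere 0 1)"
      using compact_continuous_image compact_imp_closed by metis
  qed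
  then obtain g where g: "polynomial_function g" "\<And>z. z \<in> sphere 0 1 \<Longrightarrow> norm (f z - g z) < e"
    using Stone_Weierstrass_polynomial_function[OF compact_sphere _ e] by metis
  define T where "T p = g (cis p)" for p
  have "real_polynomial_function (Re \<circ> g)" "real_polynomial_function (Im \<circ> g)"
    using g(1) bounded_linear_Re bounded_linear_Im unfolding polynomial_function_def by auto
  from this[THEN trigpoly_real_polynomial]
  have "(\<lambda>p. of_real (Re (g (cis p))) + \<i> * of_real (Im (g (cis p)))) \<in> trigpoly"
    by (auto intro: trigpoly.intros simp: o_def)
  then have T: "T \<in> trigpoly" unfolding T_def by (simp add: complex_eq[symmetric])
  have "cmod (F p - T p) < e" for p
  proof -
    obtain q where q: "q \<in> {-pi..pi}" "F p = F q" "cis p = cis q" using periodic_reduce[OF F(2), of p] by blast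
    then show ?thesis using g(2)[of "cis q"] fF[OF q(1)] by (simp add: T_def)
  qed
  then show thesis using that T by blast
qed

lemma cont_periodic_bounded:
  assumes F: "continuous_on UNIV F" "periodic F"
  obtains K where "0 < K" "\<And>p. cmod (F p) \<le> K"
proof -
  have "compact (F ` {-pi..pi})" using F(1) by (intro compact_continuous_image) (auto intro: continuous_on_subset)
  then obtain K where K: "0 < K" "\<And>p. p \<in> {-pi..pi} \<Longrightarrow> cmod (F p) \<le> K"
    using compact_imp_bounded[of "F ` {-pi..pi}"] unfolding bounded_pos by auto
  have "cmod (F p) \<le> K" for p
    by (rule periodic_reduce[OF F(2), of p]) (use K(2) in auto)
  then show thesis using that K by blast
qed

text \<open>Only finitely many coefficients of T are nonzero, so the identity is exact for every
  finite index set that contains their indices.\<close>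

lemma Parseval_trigpoly:
  assumes F: "continuous_on UNIV F" and "T \<in> trigpoly"
  shows "\<exists>I0. finite I0 \<and> (\<forall>I. finite I \<longrightarrow> I0 \<subseteq> I \<longrightarrow> (\<Sum>m\<in>I. cnj (fc F m) * fc T m) = avg (\<lambda>p. cnj (F p) * T p))"
  using assms(2)
proof (induction rule: trigpoly.induct)
  case (cis m)
  have "(\<Sum>k\<in>I. cnj (fc F k) * fc (\<lambda>p. cis (of_int m * p)) k) = avg (\<lambda>p. cnj (F p) * cis (of_int m * p))"
    if "finite I" "{-m} \<subseteq> I" for I
  proof -
    have "(\<Sum>k\<in>I. cnj (fc F k) * fc (\<lambda>p. cis (of_int m * p)) k) = (\<Sum>k\<in>I. if k = - m then cnj (fc F k) else 0)"
      by (rule sum.cong) (auto simp: fc_cis)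
    also have "\<dots> = cnj (fc F (- m))" using that by simp
    also have "\<dots> = avg (\<lambda>p. cnj (F p * cis (of_int (- m) * p)))" by (simp only: fc_def avg_cnj)
    finally show ?thesis by (simp add: cis_cnj)
  qed
  then show ?case by (intro exI[of _ "{-m}"]) auto
next
  case (add T S)
  obtain I where I: "finite I"
    "\<forall>K. finite K \<longrightarrow> I \<subseteq> K \<longrightarrow> (\<Sum>m\<in>K. cnj (fc F m) * fc T m) = avg (\<lambda>p. cnj (F p) * T p)"
    using add.IH(1) by (elim exE conjE)
  obtain J where J: "finite J"
    "\<forall>K. finite K \<longrightarrow> J \<subseteq> K \<longrightarrow> (\<Sum>m\<in>K. cnj (fc F m) * fc S m) = avg (\<lambda>p. cnj (F p) * S p)"
    using add.IH(2) by (elim exE conjE)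
  have c: "continuous_on UNIV T" "continuous_on UNIV S" using add trigpoly_cont by auto
  show ?case
    by (intro exI[of _ "I \<union> J"])
      (use I J c F in \<open>auto simp: fc_add distrib_left sum.distrib avg_add continuous_on_mult continuous_on_cnj\<close>)
next
  case (cmult T c)
  obtain I where I: "finite I"
    "\<forall>K. finite K \<longrightarrow> I \<subseteq> K \<longrightarrow> (\<Sum>m\<in>K. cnj (fc F m) * fc T m) = avg (\<lambda>p. cnj (F p) * T p)"
    using cmult.IH by (elim exE conjE)
  have "(\<Sum>m\<in>K. cnj (fc F m) * fc (\<lambda>p. c * T p) m) = c * (\<Sum>m\<in>K. cnj (fc F m) * fc T m)" for K
    by (simp add: fc_cmult sum_distrib_left mult_ac)
  moreover have "avg (\<lambda>p. cnj (F p) * (c * T p)) = c * avg (\<lambda>p. cnj (F p) * T p)"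
    by (subst avg_cmult[symmetric]) (simp add: mult_ac)
  ultimately show ?case by (intro exI[of _ I]) (use I in auto)
qed

lemma has_sum_metricI:
  fixes f :: "'a \<Rightarrow> 'b::{comm_monoid_add,metric_space}"
  assumes "\<And>e. 0 < e \<Longrightarrow> \<exists>X. finite X \<and> X \<subseteq> A \<and> (\<forall>Y. finite Y \<and> X \<subseteq> Y \<and> Y \<subseteq> A \<longrightarrow> dist (sum f Y) s < e)"
  shows "(f has_sum s) A"
  unfolding has_sum_def tendsto_iff eventually_finite_subsets_at_top using assms by blast

text \<open>Approximate G uniformly by a trigonometric polynomial; Bessel's inequality bounds the
  error of the partial sums uniformly in the index set.\<close>

lemma Parseval:
  assumes F: "continuous_on UNIV F" "periodic F" and G: "continuous_on UNIV G" "periodic G"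
  shows "((\<lambda>m. cnj (fc F m) * fc G m) has_sum avg (\<lambda>p. cnj (F p) * G p)) UNIV"
proof (rule has_sum_metricI)
  fix e :: real assume e: "0 < e"
  obtain K where K: "0 < K" "\<And>p. cmod (F p) \<le> K" using cont_periodic_bounded[OF F] by metis
  obtain T where T: "T \<in> trigpoly" "\<And>p. cmod (G p - T p) < e / (4 * K)"
    using trigpoly_dense[OF G, of "e / (4 * K)"] e K by auto
  note Tc = trigpoly_cont[OF T(1)]
  obtain I0 where I0: "finite I0" "\<And>I. finite I \<Longrightarrow> I0 \<subseteq> I \<Longrightarrow> (\<Sum>m\<in>I. cnj (fc F m) * fc T m) = avg (\<lambda>p. cnj (F p) * T p)"
    using Parseval_trigpoly[OF F(1) T(1)] by (elim exE conjE) blast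
  have D: "continuous_on UNIV (\<lambda>p. G p - T p)" using G Tc by (intro continuous_intros)
  show "\<exists>X. finite X \<and> X \<subseteq> UNIV \<and> (\<forall>Y. finite Y \<and> X \<subseteq> Y \<and> Y \<subseteq> UNIV \<longrightarrow> dist (\<Sum>m\<in>Y. cnj (fc F m) * fc G m) (avg (\<lambda>p. cnj (F p) * G p)) < e)"
  proof (intro exI[of _ I0] conjI allI impI)
    fix I assume "finite I \<and> I0 \<subseteq> I \<and> I \<subseteq> UNIV"
    then have I: "finite I" "I0 \<subseteq> I" by auto
    have 1: "cmod (\<Sum>m\<in>I. cnj (fc F m) * fc (\<lambda>p. G p - T p) m) \<le> K * (e / (4 * K))"
    proof -
      have "cmod (\<Sum>m\<in>I. cnj (fc F m) * fc (\<lambda>p. G p - T p) m) \<le> (\<Sum>m\<in>I. cmod (fc F m) * cmod (fc (\<lambda>p. G p - T p) m))"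
        by (rule order_trans[OF norm_sum]) (simp add: norm_mult)
      also have "\<dots> \<le> K * (e / (4 * K))"
        by (rule l2le_CS_finite[OF Bessel_sup[OF F(1) K(2)] Bessel_sup[OF D] I(1)]) (use T(2) less_imp_le in blast)
      finally show ?thesis .
    qed
    have 2: "cmod (avg (\<lambda>p. cnj (F p) * (T p - G p))) \<le> K * (e / (4 * K))"
    proof (intro avg_norm_le continuous_intros F G Tc)
      show "cmod (cnj (F p) * (T p - G p)) \<le> K * (e / (4 * K))" for p
        unfolding norm_mult complex_mod_cnj norm_minus_commute[of "T p"]
        by (rule mult_mono) (use K T(2)[of p] in auto)
    qed
    have "(\<Sum>m\<in>I. cnj (fc F m) * fc G m) - avg (\<lambda>p. cnj (F p) * G p)
      = (\<Sum>m\<in>I. cnj (fc F m) * fc (\<lambda>p. G p - T p) m) + avg (\<lambda>p. cnj (F p) * (T p - G p))"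
    proof -
      have "avg (\<lambda>p. cnj (F p) * (T p - G p)) = avg (\<lambda>p. cnj (F p) * T p) - avg (\<lambda>p. cnj (F p) * G p)"
        unfolding right_diff_distrib by (intro avg_diff continuous_intros F G Tc)
      then show ?thesis
        by (simp add: fc_diff G Tc right_diff_distrib sum_subtractf I0(2)[OF I])
    qed
    then have "dist (\<Sum>m\<in>I. cnj (fc F m) * fc G m) (avg (\<lambda>p. cnj (F p) * G p)) \<le> K * (e / (4 * K)) + K * (e / (4 * K))"
      unfolding dist_norm using norm_triangle_mono[OF 1 2] by simp
    then show "dist (\<Sum>m\<in>I. cnj (fc F m) * fc G m) (avg (\<lambda>p. cnj (F p) * G p)) < e"
      using K e by (simp add: field_simps)
  qed (use I0 in auto)
qed

lemma fc_eq_0_imp_eq_0: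
  assumes F: "continuous_on UNIV F" "periodic F" and "\<And>m. fc F m = 0"
  shows "F p = 0"
proof -
  have "avg (\<lambda>p. cnj (F p) * F p) = 0"
    using Parseval[OF F F] assms(3) by (simp add: has_sum_0_simp has_sum_unique)
  then have "msq F = 0" by (simp add: avg_norm_sq_msq F)
  then have "integral {-pi..pi} (\<lambda>p. (cmod (F p))\<^sup>2) = 0" by (simp add: msq_def)
  then have *: "F q = 0" if "q \<in> {-pi..pi}" for q
    using that F(1) by (subst (asm) integral_eq_0_iff) (auto intro!: continuous_intros continuous_on_subset[OF F(1)])
  show ?thesis by (rule periodic_reduce[OF F(2), of p]) (use * in auto)
qed

text \<open>The series converges uniformly, so its sum S is continuous; S has the coefficients of F,
  and a continuous periodic function all of whose coefficients vanish is 0.\<close>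

lemma Fourier_inversion:
  assumes F: "continuous_on UNIV F" "periodic F" and s: "(\<lambda>m. cmod (fc F m)) summable_on UNIV"
  shows "((\<lambda>m. fc F m * cis (- of_int m * p)) has_sum F p) UNIV"
proof -
  define S where "S p = (\<Sum>\<^sub>\<infinity>m. fc F m * cis (- of_int m * p))" for p
  have abs: "(\<lambda>m. cmod (fc F m * cis (- of_int m * p))) summable_on A" for A p
    using s summable_on_subset_banach[of _ UNIV A] by (simp add: norm_mult)
  have hS: "((\<lambda>m. fc F m * cis (- of_int m * p)) has_sum S p) UNIV" for p
    unfolding S_def by (rule has_sum_infsum[OF abs_summable_summable[OF abs]])
  have app: "\<exists>I. finite I \<and> (\<forall>J. finite J \<longrightarrow> I \<subseteq> J \<longrightarrow> (\<forall>p. cmod (S p - (\<Sum>m\<in>J. fc F m * cis (- of_int m * p))) \<le> e))"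
    if e: "0 < e" for e
  proof -
    obtain I where I: "finite I" "\<bar>(\<Sum>m\<in>I. cmod (fc F m)) - (\<Sum>\<^sub>\<infinity>m. cmod (fc F m))\<bar> \<le> e"
      using infsum_finite_approximation[OF s e] by (auto simp: dist_norm)
    have "cmod (S p - (\<Sum>m\<in>J. fc F m * cis (- of_int m * p))) \<le> e" if J: "finite J" "I \<subseteq> J" for J p
    proof -
      have "S p = (\<Sum>m\<in>J. fc F m * cis (- of_int m * p)) + (\<Sum>\<^sub>\<infinity>m\<in>-J. fc F m * cis (- of_int m * p))"
        unfolding S_def using infsum_Un_disjoint[of "\<lambda>m. fc F m * cis (- of_int m * p)" J "-J"] J(1)
          abs_summable_summable[OF abs[of p "-J"]] by simp
      moreover have "cmod (\<Sum>\<^sub>\<infinity>m\<in>-J. fc F m * cis (- of_int m * p)) \<le> (\<Sum>\<^sub>\<infinity>m\<in>-J. cmod (fc F m))"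
        using norm_infsum_bound[OF abs[of p "-J"]] by (simp add: norm_mult)
      moreover have "(\<Sum>\<^sub>\<infinity>m\<in>-J. cmod (fc F m)) = (\<Sum>\<^sub>\<infinity>m. cmod (fc F m)) - (\<Sum>m\<in>J. cmod (fc F m))"
        using infsum_Un_disjoint[of "\<lambda>m. cmod (fc F m)" J "-J"] J s summable_on_subset_banach[OF s, of "-J"] by simp
      moreover have "(\<Sum>m\<in>I. cmod (fc F m)) \<le> (\<Sum>m\<in>J. cmod (fc F m))"
        using J by (intro sum_mono2) auto
      ultimately show ?thesis using I(2) by simp
    qed
    then show ?thesis using I(1) by blast
  qed
  have Sc: "continuous_on UNIV S"
  proof (rule uniform_limit_theorem[where F = "finite_subsets_at_top UNIV"])
    show "\<forall>\<^sub>F I in finite_subsets_at_top UNIV. continuous_on UNIV (\<lambda>p. \<Sum>m\<in>I. fc F m * cis (- of_int m * p))"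
      by (intro always_eventually allI continuous_intros)
    show "uniform_limit UNIV (\<lambda>I p. \<Sum>m\<in>I. fc F m * cis (- of_int m * p)) S (finite_subsets_at_top UNIV)"
    proof (rule uniform_limitI)
      fix e :: real assume "0 < e"
      then obtain I where I: "finite I" "\<And>J p. finite J \<Longrightarrow> I \<subseteq> J \<Longrightarrow> cmod (S p - (\<Sum>m\<in>J. fc F m * cis (- of_int m * p))) \<le> e/2"
        using app[of "e/2"] by auto
      have "dist (\<Sum>m\<in>J. fc F m * cis (- of_int m * p)) (S p) < e" if "finite J" "I \<subseteq> J" for J p
        using I(2)[OF that, of p] \<open>0 < e\<close> by (simp add: dist_norm norm_minus_commute)
      then show "\<forall>\<^sub>F J in finite_subsets_at_top UNIV. \<forall>p\<in>UNIV. dist (\<Sum>m\<in>J. fc F m * cis (- of_int m * p)) (S p) < e"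
        unfolding eventually_finite_subsets_at_top using I(1) by blast
    qed
  qed simp
  have Sp: "periodic S" unfolding periodic_def S_def using cis_periodic[of "- m" for m] by simp
  have fcS: "fc S k = fc F k" for k
  proof -
    have "cmod (fc S k - fc F k) \<le> e" if e: "0 < e" for e
    proof -
      obtain I where I: "finite I" "\<And>J p. finite J \<Longrightarrow> I \<subseteq> J \<Longrightarrow> cmod (S p - (\<Sum>m\<in>J. fc F m * cis (- of_int m * p))) \<le> e"
        using app[OF e] by auto
      define J where "J = insert k I"
      define T where "T p = (\<Sum>m\<in>J. fc F m * cis (of_int (- m) * p))" for p
      have Tc: "continuous_on UNIV T" unfolding T_def by (intro continuous_intros)
      have "fc T k = (\<Sum>m\<in>J. fc F m * fc (\<lambda>p. cis (of_int (- m) * p)) k)"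
        unfolding fc_def[of T] T_def sum_distrib_right mult.assoc
        by (subst avg_sum) (intro continuous_intros, simp only: avg_cmult fc_def)
      also have "\<dots> = (\<Sum>m\<in>J. if m = k then fc F m else 0)"
        by (rule sum.cong) (auto simp: fc_cis simp del: of_int_minus)
      finally have "fc T k = fc F k" using I(1) unfolding J_def by simp
      moreover have "cmod (fc (\<lambda>p. S p - T p) k) \<le> e"
        by (rule fc_norm_le) (use Sc Tc I(2)[of J] I(1) in \<open>auto intro!: continuous_intros simp: T_def J_def\<close>)
      ultimately show ?thesis by (simp add: fc_diff Sc Tc)
    qed
    then show ?thesis by (metis eq_iff_diff_eq_0 field_le_epsilon add_0 norm_le_zero_iff)
  qed
  have "F p - S p = 0"
    by (rule fc_eq_0_imp_eq_0) (use F Sc Sp in \<open>auto simp: fc_diff fcS periodic_def intro!: continuous_intros\<close>)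
  then show ?thesis using hS by simp
qed

section \<open>Fourier coefficients of continuously differentiable functions\<close>

lemma inverse_squares_summable_int: "(\<lambda>m::int. 1 / (of_int m)\<^sup>2 :: real) summable_on UNIV"
proof -
  have n: "(\<lambda>n::nat. 1 / (real n)\<^sup>2) summable_on UNIV"
    using inverse_power_summable[of 2, where ?'a = real] by (simp add: summable_on_UNIV_nonneg_real_iff field_simps inverse_eq_divide)
  have "(\<lambda>m::int. 1 / (of_int m)\<^sup>2 :: real) summable_on range int"
    using n by (subst summable_on_reindex) (auto simp: o_def)
  moreover have "(\<lambda>m::int. 1 / (of_int m)\<^sup>2 :: real) summable_on range (\<lambda>n. - int n)"
    using n by (subst summable_on_reindex) (auto simp: o_def inj_def)
  ultimately have "(\<lambda>m::int. 1 / (of_int m)\<^sup>2 :: real) summable_on (range int \<union> range (\<lambda>n. - int n))"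
    by (rule summable_on_union)
  moreover have "range int \<union> range (\<lambda>n. - int n) = UNIV"
    by (auto simp: image_iff) (metis int_cases2)
  ultimately show ?thesis by simp
qed

text \<open>F(p) cis(m p) is periodic, so its derivative has mean zero.\<close>

lemma fc_deriv:
  assumes d: "\<And>p. (F has_vector_derivative F' p) (at p)" and F': "continuous_on UNIV F'" and p: "periodic F"
  shows "fc F' m = - \<i> * of_int m * fc F m"
proof -
  have Fc: "continuous_on UNIV F"
    by (intro continuous_at_imp_continuous_on ballI has_vector_derivative_continuous[OF d])
  define D where "D p = F' p * cis (of_int m * p) + \<i> * of_int m * (F p * cis (of_int m * p))" for p
  have dc: "((\<lambda>p. cis (of_int m * p)) has_vector_derivative \<i> * of_int m * cis (of_int m * p)) (at p)" for p
  proof -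
    have "((\<lambda>z. exp (\<i> * of_int m * z)) has_field_derivative \<i> * of_int m * exp (\<i> * of_int m * of_real p)) (at (of_real p))"
      by (auto intro!: derivative_eq_intros)
    from has_vector_derivative_real_field[OF this] show ?thesis
      by (simp add: cis_conv_exp mult.assoc)
  qed
  have dD: "((\<lambda>p. F p * cis (of_int m * p)) has_vector_derivative D p) (at p)" for p
    using has_vector_derivative_mult[OF d[of p] dc[of p]] unfolding D_def by (simp add: mult_ac add.commute)
  have "(D has_integral F pi * cis (of_int m * pi) - F (- pi) * cis (of_int m * (- pi))) {-pi..pi}"
    by (rule fundamental_theorem_of_calculus, simp, rule has_vector_derivative_at_within[OF dD])
  moreover have "F pi * cis (of_int m * pi) = F (- pi) * cis (of_int m * (- pi))"
    using p[unfolded periodic_def, rule_format, of "-pi"] cis_periodic[of m "-pi"] by simp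
  ultimately have "avg D = 0" unfolding avg_def using integral_unique by force
  moreover have "avg D = fc F' m + \<i> * of_int m * fc F m"
    unfolding D_def fc_def by (subst avg_add) (auto intro!: continuous_intros F' Fc simp: avg_cmult)
  ultimately show ?thesis by (simp add: add_eq_0_iff mult.assoc)
qed

lemma summable_of_weighted_l2:
  assumes "l2le (\<lambda>m::int. of_int m * f m) c"
  shows "(\<lambda>m. cmod (f m)) summable_on UNIV"
proof -
  \<comment> \<open>Cauchy-Schwarz against 1/m, whose value at m = 0 is 0; that index is left out
    and added back at the end.\<close>
  have "l2le (\<lambda>m::int. 1 / of_int m) (sqrt (\<Sum>\<^sub>\<infinity>m::int. 1 / (of_int m)\<^sup>2))"
  proof (rule l2le_I_sq)
    fix I :: "int set" assume "finite I"
    then have "(\<Sum>m\<in>I. 1 / (of_int m)\<^sup>2 :: real) \<le> (\<Sum>\<^sub>\<infinity>m::int. 1 / (of_int m)\<^sup>2)"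
      using inverse_squares_summable_int by (intro finite_sum_le_infsum) auto
    moreover have "0 \<le> (\<Sum>\<^sub>\<infinity>m::int. 1 / (of_int m)\<^sup>2 :: real)" by (intro infsum_nonneg) auto
    ultimately show "(\<Sum>m\<in>I. (cmod (1 / of_int m))\<^sup>2) \<le> (sqrt (\<Sum>\<^sub>\<infinity>m::int. 1 / (of_int m)\<^sup>2))\<^sup>2"
      by (simp add: norm_divide power_divide)
  qed (auto intro!: infsum_nonneg)
  from l2le_abs_summable[OF this assms, of "-{0}"]
  have "(\<lambda>m. cmod (f m)) summable_on -{0}"
    by (rule summable_on_cong[THEN iffD1, rotated]) (auto simp: norm_mult norm_divide)
  then have "(\<lambda>m. cmod (f m)) summable_on insert 0 (-{0})"
    by (simp add: summable_on_insert_iff)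
  then show ?thesis by (simp add: insert_Diff_single Compl_eq_Diff_UNIV)
qed

lemma fc_weighted_l2:
  assumes d: "\<And>p. (F has_vector_derivative F' p) (at p)" and F': "continuous_on UNIV F'" and p: "periodic F"
  shows "l2le (\<lambda>m. of_int m * fc F m) (sqrt (msq F'))"
  by (rule l2le_mono[OF Bessel[OF F']]) (auto simp: fc_deriv[OF assms] norm_mult)

lemma fc_summable:
  assumes d: "\<And>p. (F has_vector_derivative F' p) (at p)" and F': "continuous_on UNIV F'" and p: "periodic F"
  shows "(\<lambda>m. cmod (fc F m)) summable_on UNIV"
  by (rule summable_of_weighted_l2[OF fc_weighted_l2[OF assms]])

section \<open>Long-time limits of free lattice waves\<close>

text \<open>\<open>cis (t * cos p)\<close> is the multiplier of exp(i t h) for the free hopping h;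
  the value at a is the amplitude at site a, at time t, of the wave with momentum profile
  \<Phi>.\<close>

definition wave :: "real \<Rightarrow> (real \<Rightarrow> complex) \<Rightarrow> int \<Rightarrow> complex" where
  "wave t \<Phi> = fc (\<lambda>p. cis (t * cos p) * \<Phi> p)"

lemma cont_phase [continuous_intros]: "continuous_on S \<Phi> \<Longrightarrow> continuous_on S (\<lambda>p. cis (t * cos p) * \<Phi> p)"
  by (intro continuous_intros)

lemma periodic_phase: "periodic \<Phi> \<Longrightarrow> periodic (\<lambda>p. cis (t * cos p) * \<Phi> p)"
  by (simp add: periodic_def)

lemma wave_add: "continuous_on UNIV F \<Longrightarrow> continuous_on UNIV G \<Longrightarrow> wave t (\<lambda>p. F p + G p) a = wave t F a + wave t G a"
  unfolding wave_def by (simp add: distrib_left fc_add cont_phase)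

lemma wave_diff: "continuous_on UNIV F \<Longrightarrow> continuous_on UNIV G \<Longrightarrow> wave t (\<lambda>p. F p - G p) a = wave t F a - wave t G a"
  unfolding wave_def by (simp add: right_diff_distrib fc_diff cont_phase)

lemma wave_cmult: "wave t (\<lambda>p. c * F p) a = c * wave t F a"
  unfolding wave_def by (simp add: mult.left_commute[of _ c] fc_cmult)

lemma wave_cis_mult: "wave t (\<lambda>p. cis (of_int k * p) * F p) a = wave t F (a + k)"
  unfolding wave_def by (simp add: mult.left_commute[of _ "cis (of_int k * _)"] fc_cis_mult)

lemma wave_l2le: "continuous_on UNIV F \<Longrightarrow> l2le (wave t F) (sqrt (msq F))"
  using Bessel[OF cont_phase[of UNIV F t]] unfolding wave_def msq_def by (simp add: norm_mult)

lemma wave_l2le_sup: "continuous_on UNIV F \<Longrightarrow> (\<And>p. cmod (F p) \<le> K) \<Longrightarrow> l2le (wave t F) K"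
  unfolding wave_def by (rule Bessel_sup) (auto intro!: continuous_intros simp: norm_mult)

lemma wave_norm_le: "continuous_on UNIV F \<Longrightarrow> (\<And>p. cmod (F p) \<le> K) \<Longrightarrow> cmod (wave t F a) \<le> K"
  using l2le_bound[OF wave_l2le_sup] by blast

lemma wave_Parseval:
  assumes "continuous_on UNIV F" "periodic F" "continuous_on UNIV G" "periodic G"
  shows "((\<lambda>a. cnj (wave t F a) * wave t G a) has_sum avg (\<lambda>p. cnj (F p) * G p)) UNIV"
proof -
  have "(\<lambda>p. cnj (cis (t * cos p) * F p) * (cis (t * cos p) * G p)) = (\<lambda>p. cnj (F p) * G p)"
  proof
    fix p
    have "cnj (cis (t * cos p) * F p) * (cis (t * cos p) * G p) = (cnj (cis (t * cos p)) * cis (t * cos p)) * (cnj (F p) * G p)"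
      by (simp add: mult_ac)
    also have "cnj (cis (t * cos p)) * cis (t * cos p) = 1" by (simp add: cis_cnj cis_mult)
    finally show "cnj (cis (t * cos p) * F p) * (cis (t * cos p) * G p) = cnj (F p) * G p" by simp
  qed
  then show ?thesis
    using Parseval[of "\<lambda>p. cis (t * cos p) * F p" "\<lambda>p. cis (t * cos p) * G p"] assms
    unfolding wave_def by (simp add: cont_phase periodic_phase)
qed

text \<open>Free motion in position space: position becomes t sin p plus its action at time 0, since
  the phase t cos p has derivative -t sin p.\<close>

lemma wave_by_parts:
  assumes d: "\<And>p. (F has_vector_derivative F' p) (at p)" and F': "continuous_on UNIV F'" and p: "periodic F"
  shows "of_int a * wave t F a = of_real t * wave t (\<lambda>p. of_real (sin p) * F p) a + \<i> * wave t F' a"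
proof -
  have Fc: "continuous_on UNIV F"
    by (intro continuous_at_imp_continuous_on ballI has_vector_derivative_continuous[OF d])
  define D where "D p = (- \<i> * of_real t) * (cis (t * cos p) * (of_real (sin p) * F p)) + cis (t * cos p) * F' p" for p
  have dc: "((\<lambda>p. cis (t * cos p)) has_vector_derivative - \<i> * of_real t * of_real (sin p) * cis (t * cos p)) (at p)" for p
  proof -
    have "((\<lambda>z. exp (\<i> * of_real t * cos z)) has_field_derivative (- \<i> * of_real t * sin (of_real p) * exp (\<i> * of_real t * cos (of_real p)))) (at (of_real p))"
      by (auto intro!: derivative_eq_intros)
    from has_vector_derivative_real_field[OF this] show ?thesis
      by (simp add: cis_conv_exp mult.assoc cos_of_real sin_of_real)
  qed
  have dD: "((\<lambda>p. cis (t * cos p) * F p) has_vector_derivative D p) (at p)" for p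
    using has_vector_derivative_mult[OF dc[of p] d[of p]] unfolding D_def by (simp add: mult_ac add.commute)
  have Dc: "continuous_on UNIV D" unfolding D_def by (intro continuous_intros Fc F')
  have "fc D a = - \<i> * of_int a * wave t F a"
    unfolding wave_def by (rule fc_deriv[OF dD Dc periodic_phase[OF p]])
  moreover have "fc D a = (- \<i> * of_real t) * wave t (\<lambda>p. of_real (sin p) * F p) a + wave t F' a"
    unfolding D_def wave_def by (subst fc_add, intro continuous_intros Fc, intro continuous_intros F', simp only: fc_cmult)
  ultimately have "\<i> * (- \<i> * of_int a * wave t F a) = \<i> * ((- \<i> * of_real t) * wave t (\<lambda>p. of_real (sin p) * F p) a + wave t F' a)"
    by simp
  then show ?thesis by (simp add: algebra_simps)
qed

section \<open>Polynomial approximation of the sign of the velocity, and the position at large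
  times\<close>

lemma poly_approx:
  fixes f :: "real \<Rightarrow> real"
  assumes "continuous_on {a..b} f" "0 < e"
  obtains P :: "real poly" where "\<And>x. x \<in> {a..b} \<Longrightarrow> \<bar>f x - poly P x\<bar> < e"
proof -
  obtain g where g: "real_polynomial_function g" "\<And>x. x \<in> {a..b} \<Longrightarrow> \<bar>f x - g x\<bar> < e"
    using Stone_Weierstrass_real_polynomial_function[OF compact_Icc assms] by metis
  then obtain c n where "g = (\<lambda>x. \<Sum>i\<le>n. c i * x ^ i)"
    using real_polynomial_function_iff_sum by auto
  then have "poly (\<Sum>i\<le>n. monom (c i) i) x = g x" for x
    by (simp add: poly_sum poly_monom)
  then show thesis using that[of "\<Sum>i\<le>n. monom (c i) i"] g(2) by simp
qed

text \<open>The integrands are at most 1 and tend to the indicator of the zeros of sin, a negligible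
  set. Momenta with sin p near 0 have velocity near 0; for them the sign of the position stays
  undecided, and the lemma says that they carry little weight.\<close>

lemma integral_resolvent_small:
  assumes "0 < e"
  obtains \<eta> :: real where "0 < \<eta>" "integral {-pi..pi} (\<lambda>p. \<eta> / ((sin p)\<^sup>2 + \<eta>)) < e"
proof -
  define f where "f n p = (1 / real (Suc n)) / ((sin p)\<^sup>2 + 1 / real (Suc n))" for n p
  define g :: "real \<Rightarrow> real" where "g p = (if sin p = 0 then 1 else 0)" for p
  have pos: "(sin p)\<^sup>2 + 1 / real (Suc n) > 0" for p n by (simp add: add_nonneg_pos)
  have lim: "(\<lambda>n. f n p) \<longlonglongrightarrow> g p" for p
  proof (cases "sin p = 0")
    case False
    have "(\<lambda>n. f n p) \<longlonglongrightarrow> 0 / ((sin p)\<^sup>2 + 0)"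
      unfolding f_def by (intro tendsto_intros LIMSEQ_Suc lim_1_over_n) (use False in auto)
    then show ?thesis using False by (simp add: g_def)
  qed (simp add: f_def g_def)
  have "(\<lambda>n. integral {-pi..pi} (f n)) \<longlonglongrightarrow> integral {-pi..pi} g"
  proof (rule dominated_convergence(2))
    show "f n integrable_on {-pi..pi}" for n
      unfolding f_def by (intro integrable_continuous_real continuous_intros) (use pos[of _ n] in \<open>auto simp: less_imp_neq[symmetric]\<close>)
    show "(\<lambda>p. 1) integrable_on {-pi..pi::real}" by (rule integrable_const_ivl)
    show "norm (f n p) \<le> 1" for n p
    proof -
      have *: "0 \<le> e / (x + e) \<and> e / (x + e) \<le> 1" if "0 \<le> x" "0 < e" for x e :: real
        using that by (auto simp: divide_le_eq)
      show ?thesis using *[of "(sin p)\<^sup>2" "1 / real (Suc n)"] unfolding f_def by simp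
    qed
  qed (use lim in auto)
  moreover have "integral {-pi..pi} g = 0"
  proof -
    have "integral {-pi..pi} g = integral {-pi..pi} (\<lambda>p. 0 :: real)"
    proof (rule integral_spike)
      show "negligible {-pi, 0, pi}" by simp
      show "0 = g p" if p: "p \<in> {-pi..pi} - {-pi, 0, pi}" for p
      proof -
        have "sin p \<noteq> 0"
        proof (cases "p > 0")
          case True then show ?thesis using sin_gt_zero[of p] p by auto
        next
          case False then show ?thesis using sin_gt_zero[of "-p"] p by auto
        qed
        then show ?thesis by (simp add: g_def)
      qed
    qed
    then show ?thesis by simp
  qed
  ultimately have "\<forall>\<^sub>F n in sequentially. integral {-pi..pi} (f n) < e"
    using assms by (simp add: order_tendstoD)
  then obtain n where "integral {-pi..pi} (f n) < e" by (auto simp: eventually_sequentially)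
  then show thesis using that[of "1 / real (Suc n)"] unfolding f_def by simp
qed

text \<open>Since f has the sign of its argument, (sgn s - f s)^2 <= |1 - (f s)^2|, and the right-hand
  side is again polynomial, so it can be estimated on the unbounded range of the rescaled
  position by its moments.\<close>
lemma sgn_poly:
  assumes "0 < e"
  obtains h :: "real poly" where "\<And>s. 0 \<le> poly h s"
    "\<And>s. s \<in> {-1..1} \<Longrightarrow> \<bar>1 - (s * poly h s)\<^sup>2\<bar> \<le> 2"
    "integral {-pi..pi} (\<lambda>p. \<bar>1 - (sin p * poly h (sin p))\<^sup>2\<bar>) \<le> e"
proof -
  obtain \<eta> where \<eta>: "0 < \<eta>" "integral {-pi..pi} (\<lambda>p. \<eta> / ((sin p)\<^sup>2 + \<eta>)) < e / 2"
    using integral_resolvent_small[of "e/2"] assms by auto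
  define c where "c = min 1 (e / (4 * pi))"
  have c: "0 < c" "c \<le> 1" "c * (2 * pi) \<le> e / 2" using assms by (auto simp: c_def min_def field_simps)
  \<comment> \<open>\<open>k y\<close> is (y + \<eta>)^(-1/4). With H close to k, the polynomial
    h(s) = H(s^2)^2 is nonnegative and close to (s^2 + \<eta>)^(-1/2), so that s h(s) is a smoothed
    sign of s. The local \<kappa> is the largest value of k on [0, 1], not the coupling.\<close>
  define k where "k y = inverse (sqrt (sqrt (y + \<eta>)))" for y
  define \<kappa> where "\<kappa> = inverse (sqrt (sqrt \<eta>))"
  have \<kappa>: "0 < \<kappa>" using \<eta> by (simp add: \<kappa>_def)
  \<comment> \<open>The factor is a Lipschitz bound for the fourth power on arguments of size at
    most \<kappa> + 1, so that u^4 stays within c of v^4 below.\<close>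
  define d where "d = min 1 (c / ((2 * \<kappa> + 1) * (2 * (\<kappa> + 1)\<^sup>2)))"
  have d: "0 < d" "d \<le> 1" "d * ((2 * \<kappa> + 1) * (2 * (\<kappa> + 1)\<^sup>2)) \<le> c"
  proof -
    have *: "d = min 1 (c / L) \<Longrightarrow> 0 < L \<Longrightarrow> 0 < d \<and> d \<le> 1 \<and> d * L \<le> c" for L
      using c by (auto simp: min_def field_simps)
    have "0 < (2 * \<kappa> + 1) * (2 * (\<kappa> + 1)\<^sup>2)" using \<kappa> by simp
    from *[OF d_def this] show "0 < d" "d \<le> 1" "d * ((2 * \<kappa> + 1) * (2 * (\<kappa> + 1)\<^sup>2)) \<le> c"
      by auto
  qed
  have "continuous_on {0..1} k" unfolding k_def by (intro continuous_intros) (use \<eta> in auto)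
  then obtain H :: "real poly" where H: "\<And>y. y \<in> {0..1} \<Longrightarrow> \<bar>k y - poly H y\<bar> < d"
    using poly_approx d(1) by blast
  define h where "h = (pcompose H [:0, 0, 1:])\<^sup>2"
  have ph: "poly h s = (poly H (s\<^sup>2))\<^sup>2" for s
    by (simp add: h_def poly_pcompose power2_eq_square)
  have est: "\<bar>1 - (s * poly h s)\<^sup>2\<bar> \<le> \<eta> / (s\<^sup>2 + \<eta>) + c" if s: "s \<in> {-1..1}" for s
  proof -
    define y where "y = s\<^sup>2"
    have y: "y \<in> {0..1}" using s abs_square_le_1[of s] by (auto simp: y_def)
    define u where "u = poly H y"
    define v where "v = k y"
    have v0: "0 < v" "v \<le> \<kappa>" using \<eta> y unfolding v_def k_def \<kappa>_def by (auto intro!: le_imp_inverse_le)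
    have v4: "v ^ 4 = 1 / (y + \<eta>)"
    proof -
      have "sqrt (sqrt (y + \<eta>)) ^ 4 = y + \<eta>"
        using \<eta> y by (simp add: power4_eq_xxxx) (metis add_nonneg_nonneg less_imp_le mult.assoc real_sqrt_ge_zero real_sqrt_mult_self abs_of_nonneg)
      then show ?thesis unfolding v_def k_def by (simp add: power_one_over inverse_eq_divide)
    qed
    have uv: "\<bar>u - v\<bar> \<le> d" using H[OF y] unfolding u_def v_def by (simp add: abs_minus_commute less_imp_le)
    have u: "\<bar>u\<bar> \<le> \<kappa> + 1" using uv v0 d by linarith
    have "\<bar>u ^ 4 - v ^ 4\<bar> = \<bar>u - v\<bar> * (\<bar>u + v\<bar> * (u\<^sup>2 + v\<^sup>2))"
    proof -
      have "u ^ 4 - v ^ 4 = (u - v) * ((u + v) * (u\<^sup>2 + v\<^sup>2))" by (simp add: power4_eq_xxxx power2_eq_square algebra_simps)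
      then show ?thesis by (simp add: abs_mult)
    qed
    also have "\<dots> \<le> d * ((2 * \<kappa> + 1) * (2 * (\<kappa> + 1)\<^sup>2))"
    proof (intro mult_mono)
      have "u\<^sup>2 \<le> (\<kappa> + 1)\<^sup>2" using u \<kappa> by (simp add: abs_le_square_iff[symmetric])
      moreover have "v\<^sup>2 \<le> (\<kappa> + 1)\<^sup>2" using v0 \<kappa> by (simp add: abs_le_square_iff[symmetric])
      ultimately show "u\<^sup>2 + v\<^sup>2 \<le> 2 * (\<kappa> + 1)\<^sup>2" by simp
      show "\<bar>u + v\<bar> \<le> 2 * \<kappa> + 1" using u v0 by linarith
    qed (use uv d \<kappa> in auto)
    also have "\<dots> \<le> c" by (rule d(3))
    finally have "\<bar>u ^ 4 - v ^ 4\<bar> \<le> c" .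
    then have "y * \<bar>u ^ 4 - v ^ 4\<bar> \<le> c" using y mult_mono[of y 1 "\<bar>u ^ 4 - v ^ 4\<bar>" c] by auto
    moreover have "(s * poly h s)\<^sup>2 = y * u ^ 4" by (simp add: ph y_def u_def power_mult_distrib flip: power_mult)
    moreover have "1 - y * u ^ 4 = \<eta> / (y + \<eta>) - y * (u ^ 4 - v ^ 4)"
    proof -
      have "\<eta> / (y + \<eta>) + y / (y + \<eta>) = 1" using \<eta> y by (simp flip: add_divide_distrib)
      then show ?thesis unfolding right_diff_distrib v4 by simp
    qed
    moreover have "0 \<le> \<eta> / (y + \<eta>)" using \<eta> y by auto
    moreover have "\<bar>y * (u ^ 4 - v ^ 4)\<bar> = y * \<bar>u ^ 4 - v ^ 4\<bar>" using y by (simp add: abs_mult)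
    ultimately show ?thesis unfolding y_def[symmetric] by linarith
  qed
  show thesis
  proof (rule that[of h])
    show "0 \<le> poly h s" for s by (simp add: ph)
    show "\<bar>1 - (s * poly h s)\<^sup>2\<bar> \<le> 2" if "s \<in> {-1..1}" for s
    proof -
      have "\<eta> / (s\<^sup>2 + \<eta>) \<le> 1" using \<eta> by (simp add: divide_le_eq add_nonneg_pos)
      then show ?thesis using est[OF that] c by linarith
    qed
    have i1: "(\<lambda>p. \<eta> / ((sin p)\<^sup>2 + \<eta>)) integrable_on {-pi..pi}"
      by (intro integrable_continuous_real continuous_intros) (use \<eta> in \<open>auto simp: add_nonneg_eq_0_iff\<close>)
    have "integral {-pi..pi} (\<lambda>p. \<bar>1 - (sin p * poly h (sin p))\<^sup>2\<bar>) \<le> integral {-pi..pi} (\<lambda>p. \<eta> / ((sin p)\<^sup>2 + \<eta>) + c)"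
      by (intro integral_le integrable_add i1 integrable_continuous_real continuous_intros est) auto
    also have "\<dots> = integral {-pi..pi} (\<lambda>p. \<eta> / ((sin p)\<^sup>2 + \<eta>)) + c * (2 * pi)"
      by (subst integral_add) (use i1 in auto)
    finally show "integral {-pi..pi} (\<lambda>p. \<bar>1 - (sin p * poly h (sin p))\<^sup>2\<bar>) \<le> e" using \<eta>(2) c by linarith
  qed
qed

lemma trigpoly_poly_sin: "\<Phi> \<in> trigpoly \<Longrightarrow> (\<lambda>p. of_real (poly f (sin p)) * \<Phi> p) \<in> trigpoly"
proof (induction f arbitrary: \<Phi>)
  case 0
  then show ?case using trigpoly_const[of 0] by simp
next
  case (pCons c f)
  have "(\<lambda>p. of_real (poly (pCons c f) (sin p)) * \<Phi> p) = (\<lambda>p. of_real c * \<Phi> p + of_real (poly f (sin p)) * (of_real (sin p) * \<Phi> p))"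
    by (simp add: algebra_simps)
  also have "\<dots> \<in> trigpoly"
    by (intro trigpoly.add trigpoly.cmult pCons.IH trigpoly_mult trigpoly_sin pCons.prems)
  finally show ?case .
qed

text \<open>Induction on f: one more factor a/t is turned by \<open>wave_by_parts\<close> into a
  factor sin p of the profile, at the cost of a term of order 1/t that involves the derivative of
  the profile. Trigonometric polynomials are closed under both operations.\<close>

lemma position_poly:
  assumes "\<Phi> \<in> trigpoly" "0 < e"
  shows "\<forall>\<^sub>F t in at_top. l2le (\<lambda>a. of_real (poly f (of_int a / t)) * wave t \<Phi> a - wave t (\<lambda>p. of_real (poly f (sin p)) * \<Phi> p) a) e"
  using assms
proof (induction f arbitrary: \<Phi> e)
  case 0
  then show ?case by (auto simp: wave_def l2le_def L2_set_def)
next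
  case (pCons c f)
  obtain \<Phi>' where \<Phi>': "\<Phi>' \<in> trigpoly" "\<And>p. (\<Phi> has_vector_derivative \<Phi>' p) (at p)"
    using trigpoly_deriv[OF pCons.prems(1)] by blast
  have s\<Phi>: "(\<lambda>p. of_real (sin p) * \<Phi> p) \<in> trigpoly" by (intro trigpoly_mult trigpoly_sin pCons.prems)
  have f\<Phi>': "(\<lambda>p. of_real (poly f (sin p)) * \<Phi>' p) \<in> trigpoly" by (intro trigpoly_poly_sin \<Phi>')
  obtain K where K: "0 < K" "\<And>p. cmod (of_real (poly f (sin p)) * \<Phi>' p) \<le> K"
    using cont_periodic_bounded[OF trigpoly_cont[OF f\<Phi>'] trigpoly_periodic[OF f\<Phi>']] by blast
  have one: "0 < (1::real)" by simp
  have "\<forall>\<^sub>F t in at_top. (1 / t) * (1 + K) < e / 2"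
    using pCons.prems(2) by real_asymp
  then show ?case
    using pCons.IH[OF s\<Phi> half_gt_zero[OF pCons.prems(2)]] pCons.IH[OF \<Phi>'(1) one] eventually_gt_at_top[of "0::real"]
  proof eventually_elim
    case (elim t)
    define A where "A a = of_real (poly f (of_int a / t)) * wave t (\<lambda>p. of_real (sin p) * \<Phi> p) a - wave t (\<lambda>p. of_real (poly f (sin p)) * (of_real (sin p) * \<Phi> p)) a" for a
    \<comment> \<open>Bounded but not small; the prefactor 1/t makes its contribution small.\<close>
    define B where "B a = (of_real (poly f (of_int a / t)) * wave t \<Phi>' a - wave t (\<lambda>p. of_real (poly f (sin p)) * \<Phi>' p) a) + wave t (\<lambda>p. of_real (poly f (sin p)) * \<Phi>' p) a" for a
    have A: "l2le A (e / 2)" using elim pCons.prems unfolding A_def by simp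
    have B: "l2le B (1 + K)" unfolding B_def
      by (intro l2le_add wave_l2le_sup trigpoly_cont[OF f\<Phi>'] K) (use elim in simp)
    have eq: "of_real (poly (pCons c f) (of_int a / t)) * wave t \<Phi> a - wave t (\<lambda>p. of_real (poly (pCons c f) (sin p)) * \<Phi> p) a
        = A a + (\<i> / of_real t) * B a" for a
    proof -
      have 1: "(\<lambda>p. of_real (poly (pCons c f) (sin p)) * \<Phi> p) = (\<lambda>p. of_real c * \<Phi> p + of_real (poly f (sin p)) * (of_real (sin p) * \<Phi> p))"
        by (simp add: algebra_simps)
      have 2: "wave t (\<lambda>p. of_real (poly (pCons c f) (sin p)) * \<Phi> p) a = of_real c * wave t \<Phi> a + wave t (\<lambda>p. of_real (poly f (sin p)) * (of_real (sin p) * \<Phi> p)) a"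
        unfolding 1 by (subst wave_add) (auto intro!: trigpoly_cont trigpoly.cmult trigpoly_poly_sin s\<Phi> pCons.prems simp: wave_cmult)
      have 3: "wave t \<Phi> a * of_int a / of_real t = wave t (\<lambda>p. of_real (sin p) * \<Phi> p) a + (\<i> / of_real t) * wave t \<Phi>' a"
        using wave_by_parts[OF \<Phi>'(2) trigpoly_cont[OF \<Phi>'(1)] trigpoly_periodic[OF pCons.prems(1)], of a t] elim(4)
        by (simp add: field_simps)
      have "of_real (poly (pCons c f) (of_int a / t)) * wave t \<Phi> a = of_real c * wave t \<Phi> a + of_real (poly f (of_int a / t)) * (wave t \<Phi> a * of_int a / of_real t)"
        by (simp add: algebra_simps)
      then show ?thesis unfolding 2 3 A_def B_def by (simp add: algebra_simps)
    qed
    have L: "l2le (\<lambda>a. A a + (\<i> / of_real t) * B a) (e / 2 + cmod (\<i> / of_real t) * (1 + K))"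
      by (intro l2le_add A l2le_cmult B)
    have le: "e / 2 + cmod (\<i> / of_real t) * (1 + K) \<le> e"
    proof -
      have "cmod (\<i> / of_real t) = 1 / t" using elim(4) by (simp add: norm_divide)
      then have "cmod (\<i> / of_real t) * (1 + K) < e / 2" using elim(1) by (simp only:)
      then show ?thesis by linarith
    qed
    show ?case unfolding eq by (rule l2le_mono[OF L _ le]) simp
  qed
qed

text \<open>With f(s) = s h(s), the part f(a/t) is handled by \<open>position_poly\<close>. For the
  rest, the sum of (sgn - f)^2 |wave|^2 is at most the sum of |g| |wave|^2 with g = 1 - f^2.
  Cauchy-Schwarz between g times the wave, of norm at most d + K d, and the wave, of norm at most K,
  gives the square root in the bound.\<close>

lemma position_sgn:
  assumes \<Psi>: "\<Psi> \<in> trigpoly" "\<And>p. cmod (\<Psi> p) \<le> K" and h: "\<And>s. 0 \<le> poly h s"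
    and m: "msq (\<lambda>p. of_real (1 - (sin p * poly h (sin p))\<^sup>2)) \<le> d\<^sup>2" and d: "0 < d"
  shows "\<forall>\<^sub>F t in at_top. l2le (\<lambda>a. of_int (sgn a) * wave t \<Psi> a - wave t (\<lambda>p. of_real (sin p * poly h (sin p)) * \<Psi> p) a)
     (sqrt ((d + K * d) * K) + d)"
proof -
  define f where "f = [:0, 1:] * h"
  have pf: "poly f s = s * poly h s" for s by (simp add: f_def)
  define g where "g = 1 - f\<^sup>2"
  have pg: "poly g s = 1 - (poly f s)\<^sup>2" for s by (simp add: g_def)
  have K: "0 \<le> K" using \<Psi>(2)[of 0] norm_ge_zero order_trans by blast
  note c = trigpoly_cont[OF \<Psi>(1)]
  show ?thesis
    using position_poly[OF \<Psi>(1) d, of f] position_poly[OF \<Psi>(1) d, of g] eventually_gt_at_top[of "0::real"]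
  proof eventually_elim
    case (elim t)
    have gW: "l2le (wave t (\<lambda>p. of_real (poly g (sin p)) * \<Psi> p)) (K * d)"
    proof (rule l2le_mono[OF wave_l2le[of _ t]])
      show ct: "continuous_on UNIV (\<lambda>p. of_real (poly g (sin p)) * \<Psi> p)" by (intro continuous_intros c)
      have ct': "continuous_on UNIV (\<lambda>p. of_real (poly g (sin p)) :: complex)" by (intro continuous_intros c)
      have "msq (\<lambda>p. of_real (poly g (sin p)) * \<Psi> p) \<le> K\<^sup>2 * msq (\<lambda>p. of_real (poly g (sin p)))"
      proof -
        have "integral {-pi..pi} (\<lambda>p. (cmod (of_real (poly g (sin p)) * \<Psi> p))\<^sup>2)
           \<le> integral {-pi..pi} (\<lambda>p. K\<^sup>2 * (cmod (of_real (poly g (sin p))))\<^sup>2)"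
        proof (rule integral_le)
          show "(\<lambda>p. (cmod (of_real (poly g (sin p)) * \<Psi> p))\<^sup>2) integrable_on {-pi..pi}"
            by (intro integrable_cont continuous_intros ct)
          show "(\<lambda>p. K\<^sup>2 * (cmod (of_real (poly g (sin p))))\<^sup>2) integrable_on {-pi..pi}"
            by (intro integrable_cont continuous_intros ct')
          show "(cmod (of_real (poly g (sin p)) * \<Psi> p))\<^sup>2 \<le> K\<^sup>2 * (cmod (of_real (poly g (sin p))))\<^sup>2" for p
            using mult_right_mono[OF power_mono[OF \<Psi>(2)[of p] norm_ge_zero, of 2], of "(cmod (of_real (poly g (sin p))))\<^sup>2"]
            by (simp add: norm_mult power_mult_distrib mult.commute)
        qed
        then show ?thesis unfolding msq_def by (simp add: divide_right_mono)
      qed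
      also have "\<dots> \<le> K\<^sup>2 * d\<^sup>2" using m by (intro mult_left_mono) (auto simp: pg pf)
      finally show "sqrt (msq (\<lambda>p. of_real (poly g (sin p)) * \<Psi> p)) \<le> K * d"
        using K d by (simp add: real_le_lsqrt msq_nonneg power_mult_distrib)
    qed simp
    have G: "l2le (\<lambda>a. of_real (poly g (of_int a / t)) * wave t \<Psi> a) (d + K * d)"
      using l2le_add[OF elim(2) gW] by simp
    have W: "l2le (wave t \<Psi>) K" by (rule wave_l2le_sup[OF c \<Psi>(2)])
    have "l2le (\<lambda>a. of_real (of_int (sgn a) - poly f (of_int a / t)) * wave t \<Psi> a) (sqrt ((d + K * d) * K))"
    proof (rule l2le_I_sq)
      fix I :: "int set" assume I: "finite I"
      have le: "(of_int (sgn a) - poly f (of_int a / t))\<^sup>2 \<le> \<bar>poly g (of_int a / t)\<bar>" for a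
      proof -
        define s where "s = real_of_int a / t"
        have sg: "of_int (sgn a) = sgn s" using elim(3) unfolding s_def by (auto simp: sgn_if zero_less_divide_iff)
        show ?thesis
        proof (cases "s = 0")
          case True then show ?thesis unfolding sg s_def[symmetric] by (simp add: pf pg)
        next
          case False
          define u where "u = \<bar>s\<bar> * poly h s"
          have u: "0 \<le> u" using h by (simp add: u_def)
          have fu: "poly f s = sgn s * u" by (simp add: pf u_def sgn_mult_abs mult.assoc[symmetric])
          have ss: "(sgn s)\<^sup>2 = 1" using False by (simp add: sgn_if)
          have "(sgn s - sgn s * u)\<^sup>2 = (sgn s)\<^sup>2 * (1 - u)\<^sup>2" by (simp add: power2_eq_square algebra_simps)
          then have "(sgn s - poly f s)\<^sup>2 = \<bar>1 - u\<bar> * \<bar>1 - u\<bar>" unfolding fu ss by (simp add: power2_eq_square abs_mult[symmetric])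
          also have "\<dots> \<le> \<bar>1 - u\<bar> * \<bar>1 + u\<bar>" using u by (intro mult_left_mono) auto
          also have "\<dots> = \<bar>1 - u\<^sup>2\<bar>" by (simp add: abs_mult[symmetric] power2_eq_square algebra_simps)
          also have "u\<^sup>2 = (poly f s)\<^sup>2" unfolding fu power_mult_distrib ss by simp
          finally show ?thesis unfolding sg s_def[symmetric] by (simp add: pg)
        qed
      qed
      have "(\<Sum>a\<in>I. (cmod (of_real (of_int (sgn a) - poly f (of_int a / t)) * wave t \<Psi> a))\<^sup>2)
         = (\<Sum>a\<in>I. (of_int (sgn a) - poly f (of_int a / t))\<^sup>2 * (cmod (wave t \<Psi> a))\<^sup>2)"
        by (simp only: norm_mult power_mult_distrib norm_of_real power2_abs)
      also have "\<dots> \<le> (\<Sum>a\<in>I. \<bar>poly g (of_int a / t)\<bar> * (cmod (wave t \<Psi> a))\<^sup>2)"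
        by (intro sum_mono mult_right_mono le) auto
      also have "\<dots> = (\<Sum>a\<in>I. cmod (of_real (poly g (of_int a / t)) * wave t \<Psi> a) * cmod (wave t \<Psi> a))"
        by (simp only: norm_mult norm_of_real power2_eq_square mult.assoc)
      also have "\<dots> \<le> (d + K * d) * K" by (rule l2le_CS_finite[OF G W I])
      finally show "(\<Sum>a\<in>I. (cmod (of_real (of_int (sgn a) - poly f (of_int a / t)) * wave t \<Psi> a))\<^sup>2) \<le> (sqrt ((d + K * d) * K))\<^sup>2"
        using K d by simp
    qed (use K d in simp)
    from l2le_add[OF this elim(1)] show ?case
      by (simp add: pf algebra_simps)
  qed
qed

text \<open>The mean of F times the sign of sin p, which is positive on (0, pi) and negative on
  (-pi, 0).\<close>

definition half_diff :: "(real \<Rightarrow> complex) \<Rightarrow> complex" where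
  "half_diff F = (integral {0..pi} F - integral {-pi..0} F) / (2 * pi)"

text \<open>As f = s h(s) has the sign of s, |f - 1| <= |1 - f^2| where sin p >= 0 and |f + 1| <= |1
  - f^2| where sin p <= 0.\<close>

lemma avg_sgn_approx:
  assumes F: "continuous_on UNIV F" "\<And>p. cmod (F p) \<le> K" and h: "\<And>s. 0 \<le> poly h s"
    and i: "integral {-pi..pi} (\<lambda>p. \<bar>1 - (sin p * poly h (sin p))\<^sup>2\<bar>) \<le> e"
  shows "cmod (avg (\<lambda>p. of_real (sin p * poly h (sin p)) * F p) - half_diff F) \<le> K * e"
proof -
  define f where "f p = sin p * poly h (sin p)" for p
  define G where "G p = \<bar>1 - (f p)\<^sup>2\<bar>" for p
  have fc: "continuous_on UNIV f" unfolding f_def by (intro continuous_intros)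
  have Gc: "continuous_on UNIV G" unfolding G_def by (intro continuous_intros fc)
  have K: "0 \<le> K" using F(2)[of 0] norm_ge_zero order_trans by blast
  have sp: "integral {-pi..pi} H = integral {-pi..0} H + integral {0..pi} H" if "continuous_on UNIV H" for H :: "real \<Rightarrow> 'a::euclidean_space"
    by (rule Henstock_Kurzweil_Integration.integral_combine[symmetric]) (use that in \<open>auto intro: integrable_cont\<close>)
  have "avg (\<lambda>p. of_real (f p) * F p) - half_diff F
     = (integral {0..pi} (\<lambda>p. of_real (f p) * F p - F p) + integral {-pi..0} (\<lambda>p. of_real (f p) * F p + F p)) / (2 * pi)"
  proof -
    have c: "continuous_on UNIV (\<lambda>p. of_real (f p) * F p)" by (intro continuous_intros fc F)
    have a: "integral {0..pi} (\<lambda>p. of_real (f p) * F p - F p) = integral {0..pi} (\<lambda>p. of_real (f p) * F p) - integral {0..pi} F"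
      by (rule integral_diff[OF integrable_cont[OF c] integrable_cont[OF F(1)]])
    have b: "integral {-pi..0} (\<lambda>p. of_real (f p) * F p + F p) = integral {-pi..0} (\<lambda>p. of_real (f p) * F p) + integral {-pi..0} F"
      by (rule integral_add[OF integrable_cont[OF c] integrable_cont[OF F(1)]])
    show ?thesis unfolding avg_def half_diff_def sp[OF c] a b by (simp add: add_divide_distrib diff_divide_distrib)
  qed
  moreover have "cmod (integral {0..pi} (\<lambda>p. of_real (f p) * F p - F p)) \<le> integral {0..pi} (\<lambda>p. K * G p)"
  proof (rule integral_norm_bound_integral)
    show "cmod (of_real (f p) * F p - F p) \<le> K * G p" if "p \<in> {0..pi}" for p
    proof -
      have "0 \<le> f p" using that h by (simp add: f_def sin_ge_zero)
      then have "\<bar>f p - 1\<bar> * 1 \<le> \<bar>f p - 1\<bar> * \<bar>f p + 1\<bar>" by (intro mult_left_mono) auto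
      also have "\<dots> = G p" unfolding G_def by (simp add: abs_mult[symmetric] power2_eq_square algebra_simps abs_minus_commute)
      finally have "\<bar>f p - 1\<bar> \<le> G p" by simp
      moreover have "of_real (f p) * F p - F p = of_real (f p - 1) * F p" by (simp add: algebra_simps)
      ultimately show ?thesis using mult_mono[OF F(2)[of p], of "\<bar>f p - 1\<bar>" "G p"] K by (simp only: norm_mult norm_of_real) (simp add: mult.commute)
    qed
  qed (intro integrable_cont continuous_intros fc F Gc)+
  moreover have "cmod (integral {-pi..0} (\<lambda>p. of_real (f p) * F p + F p)) \<le> integral {-pi..0} (\<lambda>p. K * G p)"
  proof (rule integral_norm_bound_integral)
    show "cmod (of_real (f p) * F p + F p) \<le> K * G p" if "p \<in> {-pi..0}" for p
    proof -
      have "sin p \<le> 0" using that sin_ge_zero[of "-p"] by simp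
      then have "f p \<le> 0" using h by (simp add: f_def mult_nonpos_nonneg)
      then have "\<bar>f p + 1\<bar> * 1 \<le> \<bar>f p + 1\<bar> * \<bar>f p - 1\<bar>" by (intro mult_left_mono) auto
      also have "\<dots> = G p" unfolding G_def by (simp add: abs_mult[symmetric] power2_eq_square algebra_simps abs_minus_commute)
      finally have "\<bar>f p + 1\<bar> \<le> G p" by simp
      moreover have "of_real (f p) * F p + F p = of_real (f p + 1) * F p" by (simp add: algebra_simps)
      ultimately show ?thesis using mult_mono[OF F(2)[of p], of "\<bar>f p + 1\<bar>" "G p"] K by (simp only: norm_mult norm_of_real) (simp add: mult.commute)
    qed
  qed (intro integrable_cont continuous_intros fc F Gc)+
  ultimately have "cmod (avg (\<lambda>p. of_real (f p) * F p) - half_diff F) \<le> (integral {-pi..pi} (\<lambda>p. K * G p)) / (2 * pi)"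
    using norm_triangle_ineq[of "integral {0..pi} (\<lambda>p. of_real (f p) * F p - F p)" "integral {-pi..0} (\<lambda>p. of_real (f p) * F p + F p)"]
      sp[of "\<lambda>p. K * G p"] Gc by (simp add: norm_divide divide_right_mono continuous_on_mult_left)
  also have "\<dots> = K * (integral {-pi..pi} G / (2 * pi))" by simp
  also have "\<dots> \<le> K * e"
  proof (rule mult_left_mono[OF _ K])
    have "0 \<le> integral {-pi..pi} G" by (intro integral_nonneg integrable_cont Gc) (simp add: G_def)
    then have "integral {-pi..pi} G / (2 * pi) \<le> integral {-pi..pi} G / 1"
      using pi_gt3 by (intro divide_left_mono) auto
    then show "integral {-pi..pi} G / (2 * pi) \<le> e" using i unfolding G_def f_def by simp
  qed
  finally show ?thesis unfolding f_def .
qed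

text \<open>The pointwise bound 2 on the integrand turns the bound on its integral into one on the
  integral of its square.\<close>

lemma msq_sgn_poly:
  assumes "\<And>s. s \<in> {-1..1} \<Longrightarrow> \<bar>1 - (s * poly h s)\<^sup>2\<bar> \<le> 2"
    and "integral {-pi..pi} (\<lambda>p. \<bar>1 - (sin p * poly h (sin p))\<^sup>2\<bar>) \<le> e"
  shows "msq (\<lambda>p. of_real (1 - (sin p * poly h (sin p))\<^sup>2)) \<le> e"
proof -
  define G where "G p = \<bar>1 - (sin p * poly h (sin p))\<^sup>2\<bar>" for p
  have Gc: "continuous_on UNIV G" unfolding G_def by (intro continuous_intros)
  have "integral {-pi..pi} (\<lambda>p. (G p)\<^sup>2) \<le> integral {-pi..pi} (\<lambda>p. 2 * G p)"
  proof (intro integral_le integrable_cont continuous_intros Gc)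
    show "(G p)\<^sup>2 \<le> 2 * G p" for p
      using assms(1)[of "sin p"] unfolding G_def power2_eq_square by (intro mult_right_mono) auto
  qed
  also have "\<dots> \<le> 2 * e" using assms(2) unfolding G_def by simp
  finally have "integral {-pi..pi} (\<lambda>p. (G p)\<^sup>2) / (2 * pi) \<le> 2 * e / (2 * pi)" by (intro divide_right_mono) auto
  also have "2 * e / (2 * pi) \<le> e"
  proof -
    have "0 \<le> integral {-pi..pi} G" by (intro integral_nonneg integrable_cont Gc) (simp add: G_def)
    then have "0 \<le> e" using assms(2) unfolding G_def by linarith
    then have "e * 1 \<le> e * pi" using pi_gt3 by (intro mult_left_mono) auto
    then show ?thesis by (simp add: divide_le_eq)
  qed
  finally show ?thesis unfolding msq_def norm_of_real G_def by simp
qed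

lemma wave_sgn_limit_trigpoly:
  assumes \<Phi>: "\<Phi> \<in> trigpoly" and \<Psi>: "\<Psi> \<in> trigpoly"
  shows "((\<lambda>t. \<Sum>\<^sub>\<infinity>a. cnj (wave t \<Phi> a) * (of_int (sgn a) * wave t \<Psi> a)) \<longlongrightarrow> half_diff (\<lambda>p. cnj (\<Phi> p) * \<Psi> p)) at_top"
proof (rule tendstoI)
  fix \<epsilon> :: real assume \<epsilon>: "0 < \<epsilon>"
  obtain K1 where K1: "0 < K1" "\<And>p. cmod (\<Phi> p) \<le> K1" using cont_periodic_bounded[OF trigpoly_cont[OF \<Phi>] trigpoly_periodic[OF \<Phi>]] by blast
  obtain K2 where K2: "0 < K2" "\<And>p. cmod (\<Psi> p) \<le> K2" using cont_periodic_bounded[OF trigpoly_cont[OF \<Psi>] trigpoly_periodic[OF \<Psi>]] by blast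
  \<comment> \<open>The first summand bounds the error of replacing the sign of a by a polynomial in
    a/t, the second that of replacing this polynomial in sin p by the sign of sin p. The total
    vanishes with d, so d is fixed before t grows.\<close>
  define B where "B d = K1 * (sqrt ((d + K2 * d) * K2) + d) + K1 * K2 * d\<^sup>2" for d
  have "(B \<longlongrightarrow> 0) (at_right 0)" unfolding B_def by (auto intro!: tendsto_eq_intros)
  then have "\<forall>\<^sub>F d in at_right 0. B d < \<epsilon>" using \<epsilon> by (simp add: order_tendstoD)
  then have "\<forall>\<^sub>F d in at_right 0. B d < \<epsilon> \<and> 0 < d"
    by (intro eventually_conj eventually_at_right_less)
  then obtain d where d: "B d < \<epsilon>" "0 < d" using eventually_happens trivial_limit_at_right_real by blast
  obtain h :: "real poly" where h: "\<And>s. 0 \<le> poly h s"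
    "\<And>s. s \<in> {-1..1} \<Longrightarrow> \<bar>1 - (s * poly h s)\<^sup>2\<bar> \<le> 2"
    "integral {-pi..pi} (\<lambda>p. \<bar>1 - (sin p * poly h (sin p))\<^sup>2\<bar>) \<le> d\<^sup>2"
    using sgn_poly[of "d\<^sup>2"] d(2) by auto
  note c1 = trigpoly_cont[OF \<Phi>] and c2 = trigpoly_cont[OF \<Psi>]
  note p1 = trigpoly_periodic[OF \<Phi>] and p2 = trigpoly_periodic[OF \<Psi>]
  have m: "msq (\<lambda>p. of_real (1 - (sin p * poly h (sin p))\<^sup>2)) \<le> d\<^sup>2"
    by (rule msq_sgn_poly) (use h(2,3) in auto)
  show "\<forall>\<^sub>F t in at_top. dist (\<Sum>\<^sub>\<infinity>a. cnj (wave t \<Phi> a) * (of_int (sgn a) * wave t \<Psi> a)) (half_diff (\<lambda>p. cnj (\<Phi> p) * \<Psi> p)) < \<epsilon>"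
    using position_sgn[OF \<Psi> K2(2) h(1) m d(2)]
  proof eventually_elim
    case (elim t)
    define F where "F p = of_real (sin p * poly h (sin p)) * \<Psi> p" for p
    have Fc: "continuous_on UNIV F" unfolding F_def by (intro continuous_intros c2)
    have Fp: "periodic F" using p2 unfolding F_def periodic_def by simp
    have W1: "l2le (wave t \<Phi>) K1" by (rule wave_l2le_sup[OF c1 K1(2)])
    have W2: "l2le (\<lambda>a. of_int (sgn a) * wave t \<Psi> a) K2"
      by (rule l2le_mono[OF wave_l2le_sup[OF c2 K2(2), of t]]) (auto simp: norm_mult sgn_if)
    have "(\<Sum>\<^sub>\<infinity>a. cnj (wave t \<Phi> a) * (of_int (sgn a) * wave t \<Psi> a)) - avg (\<lambda>p. cnj (\<Phi> p) * F p)
       = (\<Sum>\<^sub>\<infinity>a. cnj (wave t \<Phi> a) * (of_int (sgn a) * wave t \<Psi> a - wave t F a))"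
    proof -
      have "((\<lambda>a. cnj (wave t \<Phi> a) * (of_int (sgn a) * wave t \<Psi> a) + - (cnj (wave t \<Phi> a) * wave t F a)) has_sum
        (\<Sum>\<^sub>\<infinity>a. cnj (wave t \<Phi> a) * (of_int (sgn a) * wave t \<Psi> a)) + - avg (\<lambda>p. cnj (\<Phi> p) * F p)) UNIV"
        by (intro has_sum_add has_sum_infsum l2le_summable[OF W1 W2] has_sum_uminusI wave_Parseval c1 p1 Fc Fp)
      from infsumI[OF this] show ?thesis by (simp add: right_diff_distrib)
    qed
    also have "cmod \<dots> \<le> K1 * (sqrt ((d + K2 * d) * K2) + d)"
      by (rule l2le_CS[OF W1 elim[folded F_def]])
    finally have 1: "cmod ((\<Sum>\<^sub>\<infinity>a. cnj (wave t \<Phi> a) * (of_int (sgn a) * wave t \<Psi> a)) - avg (\<lambda>p. cnj (\<Phi> p) * F p)) \<le> K1 * (sqrt ((d + K2 * d) * K2) + d)" .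
    have "cmod (avg (\<lambda>p. of_real (sin p * poly h (sin p)) * (cnj (\<Phi> p) * \<Psi> p)) - half_diff (\<lambda>p. cnj (\<Phi> p) * \<Psi> p)) \<le> (K1 * K2) * d\<^sup>2"
      by (rule avg_sgn_approx[OF _ _ h(1) h(3)])
        (auto intro!: continuous_intros c1 c2 mult_mono K1(2) K2(2) simp: norm_mult less_imp_le[OF K1(1)])
    moreover have "(\<lambda>p. of_real (sin p * poly h (sin p)) * (cnj (\<Phi> p) * \<Psi> p)) = (\<lambda>p. cnj (\<Phi> p) * F p)"
      unfolding F_def by (simp add: mult_ac)
    ultimately have 2: "cmod (avg (\<lambda>p. cnj (\<Phi> p) * F p) - half_diff (\<lambda>p. cnj (\<Phi> p) * \<Psi> p)) \<le> K1 * K2 * d\<^sup>2" by simp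
    show ?case using norm_triangle_mono[OF 1 2] d(1) unfolding B_def dist_norm by simp
  qed
qed

lemma msq_mult_le:
  assumes "continuous_on UNIV F" "continuous_on UNIV \<Psi>" "\<And>p. cmod (\<Psi> p) \<le> K"
  shows "msq (\<lambda>p. F p * \<Psi> p) \<le> K\<^sup>2 * msq F"
proof -
  have "integral {-pi..pi} (\<lambda>p. (cmod (F p * \<Psi> p))\<^sup>2) \<le> integral {-pi..pi} (\<lambda>p. K\<^sup>2 * (cmod (F p))\<^sup>2)"
  proof (rule integral_le)
    show "(\<lambda>p. (cmod (F p * \<Psi> p))\<^sup>2) integrable_on {-pi..pi}" "(\<lambda>p. K\<^sup>2 * (cmod (F p))\<^sup>2) integrable_on {-pi..pi}"
      by (intro integrable_cont continuous_intros assms)+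
    show "(cmod (F p * \<Psi> p))\<^sup>2 \<le> K\<^sup>2 * (cmod (F p))\<^sup>2" for p
      using mult_right_mono[OF power_mono[OF assms(3)[of p] norm_ge_zero, of 2], of "(cmod (F p))\<^sup>2"]
      by (simp add: norm_mult power_mult_distrib mult.commute)
  qed
  then show ?thesis unfolding msq_def by (simp add: divide_right_mono)
qed

text \<open>Local decay: with f = sin p h(sin p), the part (1 - f^2) \<Phi> has small norm, while
  f^2 \<Phi> is a multiple of sin p, for which \<open>wave_by_parts\<close> at the fixed site a
  gives decay like 1/t.\<close>

lemma wave_tendsto_0_trigpoly:
  assumes \<Phi>: "\<Phi> \<in> trigpoly"
  shows "((\<lambda>t. wave t \<Phi> a) \<longlongrightarrow> 0) at_top"
proof (rule tendstoI)
  fix e :: real assume e: "0 < e"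
  note c = trigpoly_cont[OF \<Phi>]
  obtain K where K: "0 < K" "\<And>p. cmod (\<Phi> p) \<le> K" using cont_periodic_bounded[OF c trigpoly_periodic[OF \<Phi>]] by blast
  define d where "d = e / (2 * K)"
  have d: "0 < d" using e K by (simp add: d_def)
  obtain h :: "real poly" where h: "\<And>s. 0 \<le> poly h s"
    "\<And>s. s \<in> {-1..1} \<Longrightarrow> \<bar>1 - (s * poly h s)\<^sup>2\<bar> \<le> 2"
    "integral {-pi..pi} (\<lambda>p. \<bar>1 - (sin p * poly h (sin p))\<^sup>2\<bar>) \<le> d\<^sup>2"
    using sgn_poly[of "d\<^sup>2"] d by auto
  have m: "msq (\<lambda>p. of_real (1 - (sin p * poly h (sin p))\<^sup>2)) \<le> d\<^sup>2"
    by (rule msq_sgn_poly) (use h(2,3) in auto)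
  \<comment> \<open>Arranged so that sin p times \<xi> is f^2 \<Phi> with f = sin p h(sin
    p).\<close>
  define \<xi> where "\<xi> p = of_real (poly ([:0, 1:] * h\<^sup>2) (sin p)) * \<Phi> p" for p
  have \<xi>: "\<xi> \<in> trigpoly" unfolding \<xi>_def by (rule trigpoly_poly_sin[OF \<Phi>])
  obtain \<xi>' where \<xi>': "\<xi>' \<in> trigpoly" "\<And>p. (\<xi> has_vector_derivative \<xi>' p) (at p)"
    using trigpoly_deriv[OF \<xi>] by blast
  obtain K1 where K1: "0 < K1" "\<And>p. cmod (\<xi> p) \<le> K1" using cont_periodic_bounded[OF trigpoly_cont[OF \<xi>] trigpoly_periodic[OF \<xi>]] by blast
  obtain K2 where K2: "0 < K2" "\<And>p. cmod (\<xi>' p) \<le> K2" using cont_periodic_bounded[OF trigpoly_cont[OF \<xi>'(1)] trigpoly_periodic[OF \<xi>'(1)]] by blast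
  have "\<forall>\<^sub>F t in at_top. (1 / t) * (\<bar>of_int a\<bar> * K1 + K2) < e / 2"
    using e by real_asymp
  then show "\<forall>\<^sub>F t in at_top. dist (wave t \<Phi> a) 0 < e"
    using eventually_gt_at_top[of "0::real"]
  proof eventually_elim
    case (elim t)
    have 1: "wave t \<Phi> a = wave t (\<lambda>p. of_real (1 - (sin p * poly h (sin p))\<^sup>2) * \<Phi> p) a + wave t (\<lambda>p. of_real (sin p) * \<xi> p) a"
    proof -
      have "\<Phi> = (\<lambda>p. of_real (1 - (sin p * poly h (sin p))\<^sup>2) * \<Phi> p + of_real (sin p) * \<xi> p)"
        unfolding \<xi>_def by (auto simp: algebra_simps power2_eq_square)
      then have "wave t \<Phi> a = wave t (\<lambda>p. of_real (1 - (sin p * poly h (sin p))\<^sup>2) * \<Phi> p + of_real (sin p) * \<xi> p) a" by simp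
      also have "\<dots> = wave t (\<lambda>p. of_real (1 - (sin p * poly h (sin p))\<^sup>2) * \<Phi> p) a + wave t (\<lambda>p. of_real (sin p) * \<xi> p) a"
        by (rule wave_add) (intro continuous_intros c trigpoly_cont[OF \<xi>])+
      finally show ?thesis .
    qed
    have "cmod (wave t (\<lambda>p. of_real (1 - (sin p * poly h (sin p))\<^sup>2) * \<Phi> p) a) \<le> sqrt (msq (\<lambda>p. of_real (1 - (sin p * poly h (sin p))\<^sup>2) * \<Phi> p))"
      by (rule l2le_bound[OF wave_l2le]) (intro continuous_intros c)
    also have "\<dots> \<le> sqrt (K\<^sup>2 * d\<^sup>2)"
      by (rule real_sqrt_le_mono, rule order_trans[OF msq_mult_le[OF _ c K(2)]])
        (use m in \<open>auto intro!: continuous_intros mult_left_mono\<close>)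
    also have "\<dots> = e / 2" using K e unfolding d_def by (simp add: real_sqrt_mult)
    finally have 2: "cmod (wave t (\<lambda>p. of_real (1 - (sin p * poly h (sin p))\<^sup>2) * \<Phi> p) a) \<le> e / 2" .
    have "wave t (\<lambda>p. of_real (sin p) * \<xi> p) a = (of_int a * wave t \<xi> a - \<i> * wave t \<xi>' a) / of_real t"
      using wave_by_parts[OF \<xi>'(2) trigpoly_cont[OF \<xi>'(1)] trigpoly_periodic[OF \<xi>], of a t] elim(2)
      by (simp add: field_simps)
    then have "cmod (wave t (\<lambda>p. of_real (sin p) * \<xi> p) a) = (1 / t) * cmod (of_int a * wave t \<xi> a - \<i> * wave t \<xi>' a)"
      using elim(2) by (simp add: norm_divide)
    also have "\<dots> \<le> (1 / t) * (\<bar>of_int a\<bar> * K1 + K2)"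
    proof (rule mult_left_mono)
      have "cmod (of_int a * wave t \<xi> a - \<i> * wave t \<xi>' a) \<le> cmod (of_int a * wave t \<xi> a) + cmod (\<i> * wave t \<xi>' a)"
        by (rule norm_triangle_ineq4)
      also have "\<dots> \<le> \<bar>of_int a\<bar> * K1 + K2"
        using wave_norm_le[OF trigpoly_cont[OF \<xi>] K1(2), of t a] wave_norm_le[OF trigpoly_cont[OF \<xi>'(1)] K2(2), of t a]
        by (intro add_mono) (auto simp: norm_mult intro!: mult_left_mono)
      finally show "cmod (of_int a * wave t \<xi> a - \<i> * wave t \<xi>' a) \<le> \<bar>of_int a\<bar> * K1 + K2" .
    qed (use elim in auto)
    finally have 3: "cmod (wave t (\<lambda>p. of_real (sin p) * \<xi> p) a) < e / 2" using elim(1) by linarith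
    have "cmod (wave t \<Phi> a) \<le> cmod (wave t (\<lambda>p. of_real (1 - (sin p * poly h (sin p))\<^sup>2) * \<Phi> p) a) + cmod (wave t (\<lambda>p. of_real (sin p) * \<xi> p) a)"
      unfolding 1 by (rule norm_triangle_ineq)
    then show ?case using 2 3 by simp
  qed
qed

lemma wave_tendsto_0:
  assumes \<Phi>: "continuous_on UNIV \<Phi>" "periodic \<Phi>"
  shows "((\<lambda>t. wave t \<Phi> a) \<longlongrightarrow> 0) at_top"
proof (rule tendstoI)
  fix e :: real assume e: "0 < e"
  obtain T where T: "T \<in> trigpoly" "\<And>p. cmod (\<Phi> p - T p) < e/2" using trigpoly_dense[OF \<Phi>, of "e/2"] e by auto
  note Tc = trigpoly_cont[OF T(1)]
  have "\<forall>\<^sub>F t in at_top. dist (wave t T a) 0 < e/2"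
    using tendstoD[OF wave_tendsto_0_trigpoly[OF T(1)] half_gt_zero[OF e]] .
  then show "\<forall>\<^sub>F t in at_top. dist (wave t \<Phi> a) 0 < e"
  proof eventually_elim
    case (elim t)
    have "cmod (wave t (\<lambda>p. \<Phi> p - T p) a) \<le> e/2"
      by (rule wave_norm_le) (intro continuous_intros \<Phi> Tc, rule less_imp_le[OF T(2)])
    then show ?case using elim norm_triangle_ineq[of "wave t \<Phi> a - wave t T a" "wave t T a"]
      by (simp add: wave_diff \<Phi> Tc)
  qed
qed

lemma half_diff_norm_le:
  assumes "continuous_on UNIV F" "\<And>p. cmod (F p) \<le> K"
  shows "cmod (half_diff F) \<le> K"
proof -
  have "cmod (integral {0..pi} F) \<le> K * (pi - 0)" "cmod (integral {-pi..0} F) \<le> K * (0 - - pi)"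
    by (rule integral_bound; use assms(2) continuous_on_subset[OF assms(1)] in auto)+
  then have "cmod (integral {0..pi} F - integral {-pi..0} F) \<le> K * (2 * pi)"
    using norm_triangle_ineq4[of "integral {0..pi} F" "integral {-pi..0} F"] by simp
  then show ?thesis unfolding half_diff_def by (simp add: norm_divide divide_le_eq)
qed

lemma half_diff_diff:
  assumes "continuous_on UNIV F" "continuous_on UNIV G"
  shows "half_diff (\<lambda>p. F p - G p) = half_diff F - half_diff G"
  unfolding half_diff_def
  by (simp add: integral_diff integrable_cont assms diff_divide_distrib)

text \<open>By density: the form is bounded by the product of the sup norms of the profiles,
  uniformly in t.\<close>

lemma wave_sgn_limit:
  assumes \<Phi>: "continuous_on UNIV \<Phi>" "periodic \<Phi>" and \<Psi>: "continuous_on UNIV \<Psi>" "periodic \<Psi>"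
  shows "((\<lambda>t. \<Sum>\<^sub>\<infinity>a. cnj (wave t \<Phi> a) * (of_int (sgn a) * wave t \<Psi> a)) \<longlongrightarrow> half_diff (\<lambda>p. cnj (\<Phi> p) * \<Psi> p)) at_top"
proof (rule tendstoI)
  fix e :: real assume e: "0 < e"
  obtain K1 where K1: "0 < K1" "\<And>p. cmod (\<Phi> p) \<le> K1" using cont_periodic_bounded[OF \<Phi>] by blast
  obtain K2 where K2: "0 < K2" "\<And>p. cmod (\<Psi> p) \<le> K2" using cont_periodic_bounded[OF \<Psi>] by blast
  define d where "d = min 1 (e / (4 * (K1 + K2 + 1)))"
  have d: "0 < d" "d \<le> 1" "d * (K1 + K2 + 1) \<le> e / 4"
  proof -
    have *: "0 < d \<and> d \<le> 1 \<and> d * L \<le> e / 4" if "d = min 1 (e / (4 * L))" "0 < L" for L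
      using that e by (auto simp: min_def field_simps)
    have "0 < K1 + K2 + 1" using K1(1) K2(1) by simp
    from *[OF d_def this] show "0 < d" "d \<le> 1" "d * (K1 + K2 + 1) \<le> e / 4" by auto
  qed
  obtain T where T: "T \<in> trigpoly" "\<And>p. cmod (\<Phi> p - T p) < d" using trigpoly_dense[OF \<Phi> d(1)] by blast
  obtain S where S: "S \<in> trigpoly" "\<And>p. cmod (\<Psi> p - S p) < d" using trigpoly_dense[OF \<Psi> d(1)] by blast
  note Tc = trigpoly_cont[OF T(1)] and Sc = trigpoly_cont[OF S(1)]
  have T1: "cmod (T p) \<le> K1 + 1" for p
    using norm_triangle_ineq3[of "T p" "\<Phi> p"] T(2)[of p] K1(2)[of p] d(2) by (simp add: norm_minus_commute)
  define Q where "Q t F G = (\<Sum>\<^sub>\<infinity>a. cnj (wave t F a) * (of_int (sgn a) * wave t G a))" for t F G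
  have b: "l2le (\<lambda>a. of_int (sgn a) * wave t G a) K" if "continuous_on UNIV G" "\<And>p. cmod (G p) \<le> K" for t G K
    by (rule l2le_mono[OF wave_l2le_sup[OF that, of t]]) (auto simp: norm_mult sgn_if)
  have "\<forall>\<^sub>F t in at_top. dist (Q t T S) (half_diff (\<lambda>p. cnj (T p) * S p)) < e/2"
    using tendstoD[OF wave_sgn_limit_trigpoly[OF T(1) S(1)] half_gt_zero[OF e]] unfolding Q_def .
  then show "\<forall>\<^sub>F t in at_top. dist (\<Sum>\<^sub>\<infinity>a. cnj (wave t \<Phi> a) * (of_int (sgn a) * wave t \<Psi> a)) (half_diff (\<lambda>p. cnj (\<Phi> p) * \<Psi> p)) < e"
  proof eventually_elim
    case (elim t)
    have dc: "continuous_on UNIV (\<lambda>p. \<Phi> p - T p)" "continuous_on UNIV (\<lambda>p. \<Psi> p - S p)" by (intro continuous_intros \<Phi> \<Psi> Tc Sc)+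
    have db: "cmod (\<Phi> p - T p) \<le> d" "cmod (\<Psi> p - S p) \<le> d" for p using T(2)[of p] S(2)[of p] by auto
    have l1: "l2le (wave t (\<lambda>p. \<Phi> p - T p)) d" by (rule wave_l2le_sup[OF dc(1) db(1)])
    have l2: "l2le (\<lambda>a. of_int (sgn a) * wave t \<Psi> a) K2" by (rule b[OF \<Psi>(1) K2(2)])
    have l3: "l2le (wave t T) (K1 + 1)" by (rule wave_l2le_sup[OF Tc T1])
    have l4: "l2le (\<lambda>a. of_int (sgn a) * wave t (\<lambda>p. \<Psi> p - S p) a) d" by (rule b[OF dc(2) db(2)])
    have l5: "l2le (\<lambda>a. of_int (sgn a) * wave t S a) (K2 + d)"
    proof (rule b[OF Sc])
      show "cmod (S p) \<le> K2 + d" for p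
        using norm_triangle_ineq3[of "S p" "\<Psi> p"] db(2)[of p] K2(2)[of p] by (simp add: norm_minus_commute)
    qed
    have Qeq: "Q t \<Phi> \<Psi> = Q t (\<lambda>p. \<Phi> p - T p) \<Psi> + (Q t T (\<lambda>p. \<Psi> p - S p) + Q t T S)"
    proof -
      have "((\<lambda>a. cnj (wave t (\<lambda>p. \<Phi> p - T p) a) * (of_int (sgn a) * wave t \<Psi> a) +
          (cnj (wave t T a) * (of_int (sgn a) * wave t (\<lambda>p. \<Psi> p - S p) a) + cnj (wave t T a) * (of_int (sgn a) * wave t S a)))
         has_sum (Q t (\<lambda>p. \<Phi> p - T p) \<Psi> + (Q t T (\<lambda>p. \<Psi> p - S p) + Q t T S))) UNIV"
        unfolding Q_def
        by (intro has_sum_add has_sum_infsum l2le_summable[OF l1 l2] l2le_summable[OF l3 l4] l2le_summable[OF l3 l5])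
      moreover have "(\<lambda>a. cnj (wave t (\<lambda>p. \<Phi> p - T p) a) * (of_int (sgn a) * wave t \<Psi> a) +
          (cnj (wave t T a) * (of_int (sgn a) * wave t (\<lambda>p. \<Psi> p - S p) a) + cnj (wave t T a) * (of_int (sgn a) * wave t S a)))
          = (\<lambda>a. cnj (wave t \<Phi> a) * (of_int (sgn a) * wave t \<Psi> a))"
        by (auto simp: wave_diff \<Phi> \<Psi> Tc Sc algebra_simps)
      ultimately show ?thesis unfolding Q_def[of t \<Phi>] by (simp add: infsumI)
    qed
    have f1: "cmod (Q t (\<lambda>p. \<Phi> p - T p) \<Psi>) \<le> d * K2" unfolding Q_def by (rule l2le_CS[OF l1 l2])
    have f2: "cmod (Q t T (\<lambda>p. \<Psi> p - S p)) \<le> (K1 + 1) * d" unfolding Q_def by (rule l2le_CS[OF l3 l4])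
    have f3: "cmod (half_diff (\<lambda>p. cnj (T p) * S p) - half_diff (\<lambda>p. cnj (\<Phi> p) * \<Psi> p)) \<le> d * K2 + (K1 + 1) * d"
    proof -
      have "half_diff (\<lambda>p. cnj (T p) * S p) - half_diff (\<lambda>p. cnj (\<Phi> p) * \<Psi> p) = half_diff (\<lambda>p. cnj (T p) * S p - cnj (\<Phi> p) * \<Psi> p)"
        by (rule half_diff_diff[symmetric]) (intro continuous_intros Tc Sc \<Phi> \<Psi>)+
      moreover have "cmod (cnj (T p) * S p - cnj (\<Phi> p) * \<Psi> p) \<le> d * K2 + (K1 + 1) * d" for p
      proof -
        have "cnj (T p) * S p - cnj (\<Phi> p) * \<Psi> p = - (cnj (\<Phi> p - T p) * \<Psi> p + cnj (T p) * (\<Psi> p - S p))" by (simp add: algebra_simps)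
        also have "cmod \<dots> \<le> cmod (cnj (\<Phi> p - T p) * \<Psi> p) + cmod (cnj (T p) * (\<Psi> p - S p))"
          unfolding norm_minus_cancel by (rule norm_triangle_ineq)
        also have "\<dots> \<le> d * K2 + (K1 + 1) * d"
          unfolding norm_mult complex_mod_cnj
          by (intro add_mono mult_mono db K2(2) T1) (use d K1 in auto)
        finally show ?thesis .
      qed
      ultimately show ?thesis
        using half_diff_norm_le[of "\<lambda>p. cnj (T p) * S p - cnj (\<Phi> p) * \<Psi> p" "d * K2 + (K1 + 1) * d"]
        by (simp add: continuous_on_diff continuous_on_mult continuous_on_cnj Tc Sc \<Phi> \<Psi>)
    qed
    have f4: "2 * (d * K2 + (K1 + 1) * d) \<le> e / 2" using d(3) by (simp add: algebra_simps)
    have f5: "cmod (Q t T S - half_diff (\<lambda>p. cnj (T p) * S p)) < e/2" using elim by (simp add: dist_norm)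
    have feq: "Q t \<Phi> \<Psi> - half_diff (\<lambda>p. cnj (\<Phi> p) * \<Psi> p) = (Q t (\<lambda>p. \<Phi> p - T p) \<Psi> + Q t T (\<lambda>p. \<Psi> p - S p))
       + ((Q t T S - half_diff (\<lambda>p. cnj (T p) * S p)) + (half_diff (\<lambda>p. cnj (T p) * S p) - half_diff (\<lambda>p. cnj (\<Phi> p) * \<Psi> p)))"
      using Qeq by simp
    have gen: "cmod ((A + B) + (C + D)) < e"
      if "cmod A \<le> U" "cmod B \<le> V" "cmod D \<le> U + V" "2 * (U + V) \<le> e / 2" "cmod C < e / 2" for A B C D U V
    proof -
      have "cmod ((A + B) + (C + D)) \<le> (cmod A + cmod B) + (cmod C + cmod D)"
        by (meson add_mono norm_triangle_ineq order_trans)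
      also have "\<dots> < (U + V) + (e/2 + (U + V))" using that by linarith
      also have "\<dots> = 2 * (U + V) + e/2" by simp
      also have "\<dots> \<le> e" using that(4) by linarith
      finally show ?thesis .
    qed
    have "cmod (Q t \<Phi> \<Psi> - half_diff (\<lambda>p. cnj (\<Phi> p) * \<Psi> p)) < e"
      unfolding feq by (rule gen[OF f1 f2 f3 f4 f5])
    then show ?case unfolding Q_def dist_norm .
  qed
qed

text \<open>Normalised by the full circle, so that the contributions of the two halves add up to
  \<open>avg\<close>.\<close>

definition havg :: "(real \<Rightarrow> complex) \<Rightarrow> complex" where
  "havg F = integral {0..pi} F / (2 * pi)"

lemma havg_eq:
  assumes "continuous_on UNIV F"
  shows "havg F = (avg F + half_diff F) / 2"
proof -
  have "integral {-pi..pi} F = integral {-pi..0} F + integral {0..pi} F"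
    by (rule Henstock_Kurzweil_Integration.integral_combine[symmetric]) (use assms in \<open>auto intro: integrable_cont\<close>)
  then show ?thesis unfolding havg_def avg_def half_diff_def by (simp add: add_divide_distrib diff_divide_distrib)
qed

text \<open>The indicator of a > N is half of 1 + sgn a, up to the finitely many sites 0, ..., N,
  where waves decay; site 0 enters with weight 1/2 since sgn 0 = 0.\<close>

lemma wave_right_limit:
  assumes \<Phi>: "continuous_on UNIV \<Phi>" "periodic \<Phi>" and \<Psi>: "continuous_on UNIV \<Psi>" "periodic \<Psi>" and N: "0 \<le> N"
  shows "((\<lambda>t. \<Sum>\<^sub>\<infinity>a\<in>{N<..}. cnj (wave t \<Phi> a) * wave t \<Psi> a) \<longlongrightarrow> havg (\<lambda>p. cnj (\<Phi> p) * \<Psi> p)) at_top"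
proof -
  obtain K1 where K1: "0 < K1" "\<And>p. cmod (\<Phi> p) \<le> K1" using cont_periodic_bounded[OF \<Phi>] by blast
  obtain K2 where K2: "0 < K2" "\<And>p. cmod (\<Psi> p) \<le> K2" using cont_periodic_bounded[OF \<Psi>] by blast
  define x where "x t a = cnj (wave t \<Phi> a) * wave t \<Psi> a" for t a
  have c: "continuous_on UNIV (\<lambda>p. cnj (\<Phi> p) * \<Psi> p)" by (intro continuous_intros \<Phi> \<Psi>)
  have eq: "(\<Sum>\<^sub>\<infinity>a\<in>{N<..}. x t a) = (avg (\<lambda>p. cnj (\<Phi> p) * \<Psi> p) + (\<Sum>\<^sub>\<infinity>a. cnj (wave t \<Phi> a) * (of_int (sgn a) * wave t \<Psi> a))) / 2
      - (x t 0 / 2 + (\<Sum>a\<in>{0<..N}. x t a))" for t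
  proof -
    have l1: "l2le (wave t \<Phi>) K1" by (rule wave_l2le_sup[OF \<Phi>(1) K1(2)])
    have l2: "l2le (\<lambda>a. of_int (sgn a) * wave t \<Psi> a) K2"
      by (rule l2le_mono[OF wave_l2le_sup[OF \<Psi>(1) K2(2), of t]]) (auto simp: norm_mult sgn_if)
    have fin: "((\<lambda>a. if a = 0 then x t 0 / 2 else if a \<in> {0<..N} then x t a else 0) has_sum (x t 0 / 2 + (\<Sum>a\<in>{0<..N}. x t a))) UNIV"
    proof (rule has_sum_finite_neutralI[where B = "insert 0 {0<..N}"])
      have "(\<Sum>a\<in>{0<..N}. if a = 0 then x t 0 / 2 else if a \<in> {0<..N} then x t a else 0) = (\<Sum>a\<in>{0<..N}. x t a)"
        by (rule sum.cong) auto
      then show "x t 0 / 2 + (\<Sum>a\<in>{0<..N}. x t a) = (\<Sum>a\<in>insert 0 {0<..N}. if a = 0 then x t 0 / 2 else if a \<in> {0<..N} then x t a else 0)"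
        by simp
    qed auto
    have "((\<lambda>a. (x t a + cnj (wave t \<Phi> a) * (of_int (sgn a) * wave t \<Psi> a)) * (1/2) + - (if a = 0 then x t 0 / 2 else if a \<in> {0<..N} then x t a else 0))
        has_sum (avg (\<lambda>p. cnj (\<Phi> p) * \<Psi> p) + (\<Sum>\<^sub>\<infinity>a. cnj (wave t \<Phi> a) * (of_int (sgn a) * wave t \<Psi> a))) * (1/2) + - (x t 0 / 2 + (\<Sum>a\<in>{0<..N}. x t a))) UNIV"
      unfolding x_def[of t]
      by (intro has_sum_add has_sum_cmult_left wave_Parseval \<Phi> \<Psi> has_sum_infsum l2le_summable[OF l1 l2] has_sum_uminusI fin[unfolded x_def])
    moreover have "(\<lambda>a. (x t a + cnj (wave t \<Phi> a) * (of_int (sgn a) * wave t \<Psi> a)) * (1/2) + - (if a = 0 then x t 0 / 2 else if a \<in> {0<..N} then x t a else 0))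
       = (\<lambda>a. if a \<in> {N<..} then x t a else 0)"
      using N by (auto simp: x_def sgn_if)
    ultimately have "((\<lambda>a. if a \<in> {N<..} then x t a else 0) has_sum (avg (\<lambda>p. cnj (\<Phi> p) * \<Psi> p) + (\<Sum>\<^sub>\<infinity>a. cnj (wave t \<Phi> a) * (of_int (sgn a) * wave t \<Psi> a))) * (1/2) + - (x t 0 / 2 + (\<Sum>a\<in>{0<..N}. x t a))) UNIV"
      by simp
    then have "((\<lambda>a. x t a) has_sum (avg (\<lambda>p. cnj (\<Phi> p) * \<Psi> p) + (\<Sum>\<^sub>\<infinity>a. cnj (wave t \<Phi> a) * (of_int (sgn a) * wave t \<Psi> a))) * (1/2) + - (x t 0 / 2 + (\<Sum>a\<in>{0<..N}. x t a))) {N<..}"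
      by (rule has_sum_cong_neutral[THEN iffD1, rotated 3]) auto
    from infsumI[OF this] show ?thesis by simp
  qed
  have x0: "((\<lambda>t. x t a) \<longlongrightarrow> 0) at_top" for a
    unfolding x_def using tendsto_mult[OF tendsto_cnj[OF wave_tendsto_0[OF \<Phi>, of a]] wave_tendsto_0[OF \<Psi>, of a]] by simp
  have "((\<lambda>t. \<Sum>\<^sub>\<infinity>a\<in>{N<..}. x t a) \<longlongrightarrow> (avg (\<lambda>p. cnj (\<Phi> p) * \<Psi> p) + half_diff (\<lambda>p. cnj (\<Phi> p) * \<Psi> p)) / 2 - (0 / 2 + (\<Sum>a\<in>{0<..N}. 0))) at_top"
    unfolding eq by (intro tendsto_intros wave_sgn_limit \<Phi> \<Psi> x0) auto
  then show ?thesis unfolding x_def havg_eq[OF c] by simp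
qed

section \<open>The propagator with a point interaction\<close>

text \<open>The reflection amplitude of the point interaction at the origin; the bound state it creates has
  energy the square root of 1 + kappa^2 and is proportional to (sqrt (1 + kappa^2) - kappa)^|x|.\<close>
definition rcoef :: "real \<Rightarrow> real \<Rightarrow> complex" where
  "rcoef \<kappa> p = - of_real \<kappa> / (of_real \<kappa> + \<i> * of_real (sin p))"

definition bs_energy :: "real \<Rightarrow> real" where "bs_energy \<kappa> = sqrt (\<kappa>\<^sup>2 + 1)"

definition bs_decay :: "real \<Rightarrow> real" where "bs_decay \<kappa> = sqrt (\<kappa>\<^sup>2 + 1) - \<kappa>"

text \<open>The inverse of the sum over x of \<open>bs_decay \<kappa> ^ (2 * |x|)\<close>;
  multiplied by \<open>bs_decay \<kappa> ^ (|x| + |y|)\<close> it is the kernel of the projection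
  onto the bound state.\<close>

definition bs_weight :: "real \<Rightarrow> real" where "bs_weight \<kappa> = \<kappa> / sqrt (\<kappa>\<^sup>2 + 1)"

text \<open>Meant as the kernel of a function of \<open>hB\<close>: \<phi> gives its values on the
  band, as an even function of the momentum, and v its value at \<open>bs_energy\<close>.\<close>

definition kern :: "real \<Rightarrow> (real \<Rightarrow> complex) \<Rightarrow> complex \<Rightarrow> int \<Rightarrow> int \<Rightarrow> complex" where
  "kern \<kappa> \<phi> v x y = fc \<phi> (x - y) + fc (\<lambda>p. \<phi> p * rcoef \<kappa> p) (\<bar>x\<bar> + \<bar>y\<bar>)
     + v * of_real (bs_weight \<kappa> * bs_decay \<kappa> ^ nat (\<bar>x\<bar> + \<bar>y\<bar>))"

lemma bs_facts:
  assumes "0 < \<kappa>"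
  shows "0 < bs_decay \<kappa>" "bs_decay \<kappa> < 1" "bs_decay \<kappa> + \<kappa> = bs_energy \<kappa>"
    "1 = bs_decay \<kappa> * (2 * \<kappa> + bs_decay \<kappa>)" "0 < bs_weight \<kappa>" "0 < bs_energy \<kappa>" "bs_weight \<kappa> * bs_energy \<kappa> = \<kappa>"
proof -
  have s: "sqrt (\<kappa>\<^sup>2 + 1) ^ 2 = \<kappa>\<^sup>2 + 1" by simp
  have g: "\<kappa> < sqrt (\<kappa>\<^sup>2 + 1)" using assms by (simp add: real_less_rsqrt)
  have l: "sqrt (\<kappa>\<^sup>2 + 1) < 1 + \<kappa>" using assms by (intro real_less_lsqrt) (auto simp: power2_eq_square algebra_simps)
  show "0 < bs_decay \<kappa>" "bs_decay \<kappa> < 1" "bs_decay \<kappa> + \<kappa> = bs_energy \<kappa>" "0 < bs_energy \<kappa>" "0 < bs_weight \<kappa>"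
    "bs_weight \<kappa> * bs_energy \<kappa> = \<kappa>"
    using g l assms less_trans[OF assms g] by (auto simp: bs_decay_def bs_energy_def bs_weight_def)
  show "1 = bs_decay \<kappa> * (2 * \<kappa> + bs_decay \<kappa>)" using s by (simp add: bs_decay_def power2_eq_square algebra_simps)
qed

lemma rcoef_cont: "\<kappa> \<noteq> 0 \<Longrightarrow> continuous_on S (rcoef \<kappa>)"
  unfolding rcoef_def by (intro continuous_intros) (auto simp: complex_eq_iff)

lemma rcoef_periodic: "periodic (rcoef \<kappa>)"
  by (simp add: periodic_def rcoef_def)

lemma rcoef_mult: "\<kappa> \<noteq> 0 \<Longrightarrow> rcoef \<kappa> p * (of_real \<kappa> + \<i> * of_real (sin p)) = - of_real \<kappa>"
  unfolding rcoef_def by (simp add: complex_eq_iff)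

lemma rcoef_norm: "\<kappa> \<noteq> 0 \<Longrightarrow> (cmod (rcoef \<kappa> p))\<^sup>2 = \<kappa>\<^sup>2 / ((sin p)\<^sup>2 + \<kappa>\<^sup>2)"
  unfolding rcoef_def by (simp add: norm_divide power_divide cmod_power2 add.commute)

lemma rcoef_norm_le: "\<kappa> \<noteq> 0 \<Longrightarrow> cmod (rcoef \<kappa> p) \<le> 1"
proof -
  assume k: "\<kappa> \<noteq> 0"
  have "0 < (sin p)\<^sup>2 + \<kappa>\<^sup>2" using k by (simp add: add_nonneg_pos)
  then have "(cmod (rcoef \<kappa> p))\<^sup>2 \<le> 1\<^sup>2" unfolding rcoef_norm[OF k] by (simp add: divide_le_eq)
  then show ?thesis by (rule power2_le_imp_le) simp
qed

section \<open>Fourier coefficients of the reflection amplitude\<close>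

lemma avg_reflect: "avg (\<lambda>p. F (- p)) = avg F"
  unfolding avg_def using Henstock_Kurzweil_Integration.integral_reflect_real[where a = "-pi" and b = pi and f = F] by simp

lemma fc_even:
  assumes "\<And>p. F (- p) = F p"
  shows "fc F (- m) = fc F m"
  unfolding fc_def using avg_reflect[of "\<lambda>p. F p * cis (of_int m * p)"] assms by simp

lemma cos_cis: "complex_of_real (cos p) = (cis p + cis (- p)) / 2"
  by (simp add: complex_eq_iff)

lemma sin_cis: "\<i> * complex_of_real (sin p) = (cis p - cis (- p)) / 2"
  by (simp add: complex_eq_iff)

lemma fc_cos:
  assumes F: "continuous_on UNIV F"
  shows "fc (\<lambda>p. of_real (cos p) * F p) m = (fc F (m - 1) + fc F (m + 1)) / 2"
proof -
  have "(\<lambda>p. of_real (cos p) * F p) = (\<lambda>p. (1/2) * (cis (of_int (-1) * p) * F p) + (1/2) * (cis (of_int 1 * p) * F p))"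
    by (simp add: cos_cis algebra_simps add_divide_distrib)
  then have "fc (\<lambda>p. of_real (cos p) * F p) m = fc (\<lambda>p. (1/2) * (cis (of_int (-1) * p) * F p) + (1/2) * (cis (of_int 1 * p) * F p)) m" by simp
  also have "\<dots> = (1/2) * fc F (m + (-1)) + (1/2) * fc F (m + 1)"
    by (subst fc_add, intro continuous_intros F, intro continuous_intros F, simp only: fc_cmult fc_cis_mult)
  finally show ?thesis by (simp add: add_divide_distrib)
qed

lemma fc_isin:
  assumes F: "continuous_on UNIV F"
  shows "fc (\<lambda>p. \<i> * of_real (sin p) * F p) m = (fc F (m + 1) - fc F (m - 1)) / 2"
proof -
  have "(\<lambda>p. \<i> * of_real (sin p) * F p) = (\<lambda>p. (1/2) * (cis (of_int 1 * p) * F p) - (1/2) * (cis (of_int (-1) * p) * F p))"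
    by (simp add: sin_cis algebra_simps diff_divide_distrib)
  then have "fc (\<lambda>p. \<i> * of_real (sin p) * F p) m = fc (\<lambda>p. (1/2) * (cis (of_int 1 * p) * F p) - (1/2) * (cis (of_int (-1) * p) * F p)) m" by simp
  also have "\<dots> = (1/2) * fc F (m + 1) - (1/2) * fc F (m + (-1))"
    by (subst fc_diff, intro continuous_intros F, intro continuous_intros F, simp only: fc_cmult fc_cis_mult)
  finally show ?thesis by (simp add: diff_divide_distrib)
qed

text \<open>Excludes the growing solution of a recursion once the sequence is known to be
  bounded.\<close>

lemma geometric_zero:
  fixes d :: "nat \<Rightarrow> complex"
  assumes "\<And>m. d (Suc m) = c * d m" "\<And>m. cmod (d m) \<le> K" "1 < cmod c"
  shows "d 0 = 0"
proof (rule ccontr)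
  assume "d 0 \<noteq> 0"
  have p: "d m = c ^ m * d 0" for m by (induction m) (auto simp: assms(1))
  obtain m where "K / cmod (d 0) < cmod c ^ m" using real_arch_pow[OF assms(3)] by blast
  then have "K < cmod (d m)" using \<open>d 0 \<noteq> 0\<close> unfolding p[of m] by (simp add: norm_mult norm_power divide_less_eq)
  then show False using assms(2)[of m] by simp
qed

text \<open>Multiplying \<open>rcoef\<close> by its denominator gives a three-term recursion for the
  coefficients with characteristic roots q and -1/q, where q = \<open>bs_decay\<close>. Boundedness
  leaves the factor q per step to the right of 0 and -q per step to the left; the inhomogeneous
  equation at 0 fixes the value there.\<close>

lemma fc_rcoef:
  assumes \<kappa>: "0 < \<kappa>"
  shows "fc (rcoef \<kappa>) (int m) = - of_real (bs_weight \<kappa> * bs_decay \<kappa> ^ m)"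
proof -
  define r where "r = fc (rcoef \<kappa>)"
  define q where "q = bs_decay \<kappa>"
  note b = bs_facts[OF \<kappa>]
  have c: "continuous_on UNIV (rcoef \<kappa>)" using \<kappa> by (intro rcoef_cont) auto
  have rec: "of_real \<kappa> * r m + (r (m + 1) - r (m - 1)) / 2 = (if m = 0 then - of_real \<kappa> else 0)" for m
  proof -
    have "(\<lambda>p. of_real \<kappa> * rcoef \<kappa> p + \<i> * of_real (sin p) * rcoef \<kappa> p) = (\<lambda>p. - of_real \<kappa> * cis (of_int 0 * p))"
      using rcoef_mult[of \<kappa>] \<kappa> by (auto simp: algebra_simps)
    moreover have "fc (\<lambda>p. of_real \<kappa> * rcoef \<kappa> p + \<i> * of_real (sin p) * rcoef \<kappa> p) m = of_real \<kappa> * r m + (r (m + 1) - r (m - 1)) / 2"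
      unfolding r_def by (subst fc_add, intro continuous_intros c, intro continuous_intros c, simp only: fc_cmult fc_isin[OF c])
    moreover have "fc (\<lambda>p. - of_real \<kappa> * cis (of_int 0 * p)) m = (if m = 0 then - of_real \<kappa> else 0)"
      unfolding fc_cmult fc_cis by simp
    ultimately show ?thesis by simp
  qed
  have bd: "cmod (r m) \<le> 1" for m unfolding r_def by (rule fc_norm_le[OF c rcoef_norm_le]) (use \<kappa> in auto)
  have q0: "of_real q \<noteq> (0::complex)" using b by (simp add: q_def)
  have qk: "2 * of_real \<kappa> + of_real q = (1 / of_real q :: complex)"
  proof -
    have "of_real (q * (2 * \<kappa> + q)) = (1 :: complex)" using b(4) unfolding q_def by simp
    then show ?thesis using q0 by (simp add: field_simps)
  qed
  have inv: "1 < 1 / q" using b by (simp add: q_def)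
  have qb: "cmod (of_real q * r m) \<le> q" for m
    using mult_left_mono[OF bd[of m], of q] b by (simp add: norm_mult q_def)
  \<comment> \<open>The combination r(m+1) - q r(m) removes the decaying root, so it is multiplied
    by -1/q in each step and must vanish.\<close>
  have up: "r (int m + 1) = of_real q * r (int m)" for m
  proof -
    have "r (int (m + n) + 2) - of_real q * r (int (m + n) + 1) = - (1 / of_real q) * (r (int (m + n) + 1) - of_real q * r (int (m + n)))" for n
    proof -
      have "r (int (m + n) + 2) = r (int (m + n)) - 2 * of_real \<kappa> * r (int (m + n) + 1)"
        using rec[of "int (m + n) + 1"] by (simp add: field_simps split: if_splits)
      then have "r (int (m + n) + 2) - of_real q * r (int (m + n) + 1) = r (int (m + n)) - (2 * of_real \<kappa> + of_real q) * r (int (m + n) + 1)"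
        by (simp add: algebra_simps)
      also have "\<dots> = - (1 / of_real q) * (r (int (m + n) + 1) - of_real q * r (int (m + n)))"
        unfolding qk using q0 by (simp add: field_simps)
      finally show ?thesis .
    qed
    then have "r (int (m + 0) + 1) - of_real q * r (int (m + 0)) = 0"
    proof (intro geometric_zero[of "\<lambda>n. r (int (m + n) + 1) - of_real q * r (int (m + n))" "- (1 / of_real q)" "1 + q"])
      show "cmod (r (int (m + n) + 1) - of_real q * r (int (m + n))) \<le> 1 + q" for n
        unfolding norm_minus_commute[of "r (int (m + n) + 1)"] using bd
        by (intro order_trans[OF norm_triangle_ineq4] order_trans[OF add_mono[OF qb bd]]) simp
    qed (use inv b in \<open>auto simp: norm_divide q_def algebra_simps\<close>)
    then show ?thesis by simp
  qed
  have down: "r (-1) = - of_real q * r 0"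
  proof -
    have rr: "r (- int n - 2) + of_real q * r (- int n - 1) = (1 / of_real q) * (r (- int n - 1) + of_real q * r (- int n))" for n
    proof -
      have "r (- int n - 2) = r (- int n) + 2 * of_real \<kappa> * r (- int n - 1)"
        using rec[of "- int n - 1"] by (simp add: field_simps split: if_splits)
      then have "r (- int n - 2) + of_real q * r (- int n - 1) = r (- int n) + (2 * of_real \<kappa> + of_real q) * r (- int n - 1)"
        by (simp add: algebra_simps)
      also have "\<dots> = (1 / of_real q) * (r (- int n - 1) + of_real q * r (- int n))"
        unfolding qk using q0 by (simp add: field_simps)
      finally show ?thesis .
    qed
    have "r (- int 0 - 1) + of_real q * r (- int 0) = 0"
    proof (intro geometric_zero[of "\<lambda>n. r (- int n - 1) + of_real q * r (- int n)" "1 / of_real q" "1 + q"])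
      have e: "- int (Suc n) - 1 = - int n - 2" "- int (Suc n) = - int n - 1" for n by auto
      show "r (- int (Suc n) - 1) + of_real q * r (- int (Suc n)) = (1 / of_real q) * (r (- int n - 1) + of_real q * r (- int n))" for n
        using rr[of n] e(1)[of n] e(2)[of n] by (simp only: )
      show "cmod (r (- int n - 1) + of_real q * r (- int n)) \<le> 1 + q" for n
        by (intro order_trans[OF norm_triangle_ineq] add_mono bd qb)
    qed (use inv b in \<open>auto simp: norm_divide q_def\<close>)
    then show ?thesis by (simp add: add_eq_0_iff)
  qed
  \<comment> \<open>At m = 0 the recursion reads (\<kappa> + q) r 0 = -\<kappa>, and \<kappa> + q is
    the energy of the bound state.\<close>
  have "of_real \<kappa> * r 0 + (of_real q * r 0 + of_real q * r 0) / 2 = - of_real \<kappa>"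
    using rec[of 0] up[of 0] down by simp
  then have "of_real (bs_energy \<kappa>) * r 0 = - of_real \<kappa>"
    unfolding b(3)[symmetric] q_def[symmetric] by (simp add: algebra_simps)
  then have r0: "r 0 = - of_real (bs_weight \<kappa>)"
  proof -
    have w: "bs_weight \<kappa> = \<kappa> / bs_energy \<kappa>" by (simp add: bs_weight_def bs_energy_def)
    have "of_real (bs_energy \<kappa>) \<noteq> (0::complex)" using b by simp
    then show ?thesis unfolding w using \<open>of_real (bs_energy \<kappa>) * r 0 = - of_real \<kappa>\<close> by (simp add: field_simps)
  qed
  have "r (int m) = of_real q ^ m * r 0"
  proof (induction m)
    case (Suc m)
    have "r (int (Suc m)) = r (int m + 1)" by (simp add: add.commute)
    then show ?case using up[of m] Suc by simp
  qed simp
  then show ?thesis unfolding r0 unfolding r_def q_def by simp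
qed

text \<open>Completeness of scattering states and bound state: the bound state term cancels the
  coefficient of \<open>rcoef\<close>.\<close>

lemma kern_delta:
  assumes "0 < \<kappa>" shows "kern \<kappa> (\<lambda>p. 1) 1 x y = delta y x"
proof -
  have "fc (\<lambda>p. 1) (x - y) = (if x = y then 1 else 0)" using fc_cis[of 0 "x - y"] by simp
  moreover have "fc (\<lambda>p. 1 * rcoef \<kappa> p) (\<bar>x\<bar> + \<bar>y\<bar>) = - of_real (bs_weight \<kappa> * bs_decay \<kappa> ^ nat (\<bar>x\<bar> + \<bar>y\<bar>))"
    using fc_rcoef[OF assms, of "nat (\<bar>x\<bar> + \<bar>y\<bar>)"] by simp
  ultimately show ?thesis unfolding kern_def delta_def by simp
qed

text \<open>Away from the origin, hopping acts on the direct, the reflected and the bound state part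
  separately, as multiplication by cos p or by the energy. At the origin |x| has a kink, and the
  defining equation of \<open>rcoef\<close> balances it against the potential.\<close>

lemma kern_step:
  assumes \<kappa>: "0 < \<kappa>" and \<phi>: "continuous_on UNIV \<phi>" "\<And>p. \<phi> (- p) = \<phi> p"
  shows "hB \<kappa> (\<lambda>x. kern \<kappa> \<phi> v x y) = (\<lambda>x. kern \<kappa> (\<lambda>p. of_real (cos p) * \<phi> p) (of_real (bs_energy \<kappa>) * v) x y)"
proof
  fix x
  define R where "R = fc (\<lambda>p. \<phi> p * rcoef \<kappa> p)"
  define Q :: "nat \<Rightarrow> complex" where "Q n = of_real (bs_weight \<kappa> * bs_decay \<kappa> ^ n)" for n
  note b = bs_facts[OF \<kappa>]
  have c: "continuous_on UNIV (\<lambda>p. \<phi> p * rcoef \<kappa> p)" using \<kappa> by (intro continuous_intros \<phi> rcoef_cont) auto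
  have Rc: "fc (\<lambda>p. of_real (cos p) * \<phi> p * rcoef \<kappa> p) m = (R (m - 1) + R (m + 1)) / 2" for m
    using fc_cos[OF c, of m] unfolding R_def by (simp add: mult.assoc)
  have Q1: "Q (Suc n) = of_real (bs_decay \<kappa>) * Q n" for n by (simp add: Q_def)
  have QQ: "(Q n + Q (Suc (Suc n))) / 2 = of_real (bs_energy \<kappa>) * Q (Suc n)" for n
  proof -
    have "1 + bs_decay \<kappa> * bs_decay \<kappa> = 2 * bs_energy \<kappa> * bs_decay \<kappa>"
      using b(3,4) by (simp add: algebra_simps flip: b(3))
    then have e: "of_real (1 + bs_decay \<kappa> * bs_decay \<kappa>) = (of_real (2 * bs_energy \<kappa> * bs_decay \<kappa>) :: complex)" by simp
    have "(Q n + Q (Suc (Suc n))) / 2 = of_real (1 + bs_decay \<kappa> * bs_decay \<kappa>) * Q n / 2" unfolding Q1 by (simp add: algebra_simps)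
    then show ?thesis unfolding e Q1 by (simp add: mult.assoc)
  qed
  have k: "kern \<kappa> \<phi> v x y = fc \<phi> (x - y) + R (\<bar>x\<bar> + \<bar>y\<bar>) + v * Q (nat (\<bar>x\<bar> + \<bar>y\<bar>))" for x
    unfolding kern_def R_def Q_def by simp
  have k': "kern \<kappa> (\<lambda>p. of_real (cos p) * \<phi> p) (of_real (bs_energy \<kappa>) * v) x y
     = (fc \<phi> (x - y - 1) + fc \<phi> (x - y + 1)) / 2 + (R (\<bar>x\<bar> + \<bar>y\<bar> - 1) + R (\<bar>x\<bar> + \<bar>y\<bar> + 1)) / 2
       + of_real (bs_energy \<kappa>) * v * Q (nat (\<bar>x\<bar> + \<bar>y\<bar>))" for x
    unfolding kern_def fc_cos[OF \<phi>(1)] Rc Q_def by simp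
  show "hB \<kappa> (\<lambda>x. kern \<kappa> \<phi> v x y) x = kern \<kappa> (\<lambda>p. of_real (cos p) * \<phi> p) (of_real (bs_energy \<kappa>) * v) x y"
  proof (cases "x = 0")
    case False
    \<comment> \<open>The smaller of the two neighbouring exponents, so that only n, n + 1 and n + 2
      occur; it does not underflow because x is nonzero.\<close>
    define n where "n = nat (\<bar>x\<bar> + \<bar>y\<bar> - 1)"
    have n: "nat (\<bar>x\<bar> + \<bar>y\<bar>) = Suc n" "nat (\<bar>x\<bar> + \<bar>y\<bar> - 1) = n" "nat (\<bar>x\<bar> + \<bar>y\<bar> + 1) = Suc (Suc n)"
      using False by (auto simp: n_def)
    have "hB \<kappa> (\<lambda>x. kern \<kappa> \<phi> v x y) x = (kern \<kappa> \<phi> v (x - 1) y + kern \<kappa> \<phi> v (x + 1) y) / 2"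
      using False by (simp add: hB_def hop_def shift_def shift_inv_def p0_def delta_def)
    also have "\<dots> = (fc \<phi> (x - y - 1) + fc \<phi> (x - y + 1)) / 2 + (R (\<bar>x\<bar> + \<bar>y\<bar> - 1) + R (\<bar>x\<bar> + \<bar>y\<bar> + 1)) / 2
       + v * ((Q n + Q (Suc (Suc n))) / 2)"
    proof (cases "x > 0")
      case True
      then have "\<bar>x - 1\<bar> + \<bar>y\<bar> = \<bar>x\<bar> + \<bar>y\<bar> - 1" "\<bar>x + 1\<bar> + \<bar>y\<bar> = \<bar>x\<bar> + \<bar>y\<bar> + 1"
        "x - 1 - y = x - y - 1" "x + 1 - y = x - y + 1" by auto
      then show ?thesis unfolding k by (simp only: n) (simp add: field_simps)
    next
      case False2: False
      then have "\<bar>x - 1\<bar> + \<bar>y\<bar> = \<bar>x\<bar> + \<bar>y\<bar> + 1" "\<bar>x + 1\<bar> + \<bar>y\<bar> = \<bar>x\<bar> + \<bar>y\<bar> - 1"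
        "x - 1 - y = x - y - 1" "x + 1 - y = x - y + 1" using False by auto
      then show ?thesis unfolding k by (simp only: n) (simp add: field_simps)
    qed
    finally show ?thesis unfolding k' n QQ by simp
  next
    case True
    have e1: "fc \<phi> \<bar>y\<bar> = fc \<phi> (- y)" using fc_even[of \<phi> "\<bar>y\<bar>"] fc_even[of \<phi> y] \<phi>(2) by (auto simp: abs_if)
    have "(\<lambda>p. of_real \<kappa> * (\<phi> p * rcoef \<kappa> p) + \<i> * of_real (sin p) * (\<phi> p * rcoef \<kappa> p)) = (\<lambda>p. - of_real \<kappa> * \<phi> p)"
    proof
      fix p
      have "of_real \<kappa> * (\<phi> p * rcoef \<kappa> p) + \<i> * of_real (sin p) * (\<phi> p * rcoef \<kappa> p) = \<phi> p * (rcoef \<kappa> p * (of_real \<kappa> + \<i> * of_real (sin p)))"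
        by (simp add: algebra_simps)
      then show "of_real \<kappa> * (\<phi> p * rcoef \<kappa> p) + \<i> * of_real (sin p) * (\<phi> p * rcoef \<kappa> p) = - of_real \<kappa> * \<phi> p"
        using rcoef_mult[of \<kappa> p] \<kappa> by simp
    qed
    moreover have "fc (\<lambda>p. of_real \<kappa> * (\<phi> p * rcoef \<kappa> p) + \<i> * of_real (sin p) * (\<phi> p * rcoef \<kappa> p)) \<bar>y\<bar> = of_real \<kappa> * R \<bar>y\<bar> + (R (\<bar>y\<bar> + 1) - R (\<bar>y\<bar> - 1)) / 2"
      unfolding R_def by (subst fc_add, intro continuous_intros c, intro continuous_intros c, simp only: fc_cmult fc_isin[OF c])
    ultimately have rr: "of_real \<kappa> * R \<bar>y\<bar> + (R (\<bar>y\<bar> + 1) - R (\<bar>y\<bar> - 1)) / 2 = - of_real \<kappa> * fc \<phi> (- y)"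
      unfolding e1[symmetric] fc_cmult[symmetric] by simp
    \<comment> \<open>Both neighbours of the origin contribute the argument |y| + 1, whereas
      multiplication by cos p requires |y| - 1 and |y| + 1; \<open>rr\<close> says that the
      potential term makes up the difference.\<close>
    have "hB \<kappa> (\<lambda>x. kern \<kappa> \<phi> v x y) x = (kern \<kappa> \<phi> v (- 1) y + kern \<kappa> \<phi> v 1 y) / 2 + of_real \<kappa> * kern \<kappa> \<phi> v 0 y"
      using True by (simp add: hB_def hop_def shift_def shift_inv_def p0_def delta_def)
    also have "\<dots> = (fc \<phi> (- y - 1) + fc \<phi> (- y + 1)) / 2 + R (\<bar>y\<bar> + 1) + v * Q (Suc (nat \<bar>y\<bar>))
        + of_real \<kappa> * (fc \<phi> (- y) + R \<bar>y\<bar> + v * Q (nat \<bar>y\<bar>))"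
      unfolding k by (simp add: nat_add_distrib field_simps minus_diff_commute)
    also have "\<dots> = (fc \<phi> (- y - 1) + fc \<phi> (- y + 1)) / 2 + R (\<bar>y\<bar> + 1) + (of_real \<kappa> * R \<bar>y\<bar> - (- of_real \<kappa> * fc \<phi> (- y)))
        + v * ((of_real (bs_decay \<kappa>) + of_real \<kappa>) * Q (nat \<bar>y\<bar>))"
      unfolding Q1 by (simp add: algebra_simps)
    also have "\<dots> = (fc \<phi> (- y - 1) + fc \<phi> (- y + 1)) / 2 + (R (\<bar>y\<bar> - 1) + R (\<bar>y\<bar> + 1)) / 2
        + v * ((of_real (bs_decay \<kappa>) + of_real \<kappa>) * Q (nat \<bar>y\<bar>))"
      unfolding rr[symmetric] by (simp add: field_simps)
    also have "of_real (bs_decay \<kappa>) + of_real \<kappa> = (of_real (bs_energy \<kappa>) :: complex)" using b(3) by (metis of_real_add)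
    finally show ?thesis unfolding k' True by (simp add: mult_ac)
  qed
qed

lemma kern_power:
  assumes \<kappa>: "0 < \<kappa>" and \<phi>: "continuous_on UNIV \<phi>" "\<And>p. \<phi> (- p) = \<phi> p"
  shows "(hB \<kappa> ^^ n) (\<lambda>x. kern \<kappa> \<phi> v x y) = (\<lambda>x. kern \<kappa> (\<lambda>p. of_real (cos p) ^ n * \<phi> p) (of_real (bs_energy \<kappa>) ^ n * v) x y)"
proof (induction n)
  case (Suc n)
  have "continuous_on UNIV (\<lambda>p. of_real (cos p) ^ n * \<phi> p)" by (intro continuous_intros \<phi>)
  from kern_step[OF \<kappa> this, of "of_real (bs_energy \<kappa>) ^ n * v" y] \<phi>(2)
  show ?case by (simp add: Suc mult.assoc)
qed simp

lemma hB_power_delta: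
  assumes "0 < \<kappa>"
  shows "(hB \<kappa> ^^ n) (delta y) x = kern \<kappa> (\<lambda>p. of_real (cos p) ^ n) (of_real (bs_energy \<kappa>) ^ n) x y"
proof -
  have "delta y = (\<lambda>x. kern \<kappa> (\<lambda>p. 1) 1 x y)" using kern_delta[OF assms] by auto
  then show ?thesis using kern_power[OF assms, of "\<lambda>p. 1" n 1 y] by simp
qed

section \<open>The propagator as the sum of its exponential series\<close>

lemma fc_exp_sums:
  assumes \<phi>: "continuous_on UNIV \<phi>" "\<And>p. cmod (\<phi> p) \<le> K"
  shows "(\<lambda>n. ((\<i> * of_real t) ^ n / of_nat (fact n)) * fc (\<lambda>p. of_real (cos p) ^ n * \<phi> p) m) sums fc (\<lambda>p. cis (t * cos p) * \<phi> p) m"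
proof -
  define f where "f n p = ((\<i> * of_real t) ^ n / of_nat (fact n)) * of_real (cos p) ^ n" for n p
  have s: "(\<lambda>n. f n p) sums cis (t * cos p)" for p
  proof -
    have "(\<lambda>n. (\<i> * of_real (t * cos p)) ^ n /\<^sub>R fact n) sums exp (\<i> * of_real (t * cos p))" by (rule exp_converges)
    then show ?thesis unfolding f_def cis_conv_exp by (simp add: scaleR_conv_of_real power_mult_distrib field_simps)
  qed
  have u: "uniform_limit UNIV (\<lambda>N p. \<Sum>n<N. f n p) (\<lambda>p. \<Sum>n. f n p) sequentially"
  proof (rule Weierstrass_m_test)
    show "cmod (f n p) \<le> \<bar>t\<bar> ^ n / fact n" for n p
    proof -
      have "\<bar>cos p\<bar> ^ n \<le> 1" by (intro power_le_one) auto
      then have "\<bar>t\<bar> ^ n / fact n * \<bar>cos p\<bar> ^ n \<le> \<bar>t\<bar> ^ n / fact n * 1" by (intro mult_left_mono) auto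
      then show ?thesis unfolding f_def by (simp add: norm_mult norm_divide norm_power)
    qed
    show "summable (\<lambda>n. \<bar>t\<bar> ^ n / fact n)" using summable_exp[of "\<bar>t\<bar>"] by (simp add: field_simps)
  qed
  have K: "0 \<le> K" using \<phi>(2)[of 0] norm_ge_zero order_trans by blast
  have part: "(\<Sum>n<N. ((\<i> * of_real t) ^ n / of_nat (fact n)) * fc (\<lambda>p. of_real (cos p) ^ n * \<phi> p) m) = fc (\<lambda>p. (\<Sum>n<N. f n p) * \<phi> p) m" for N
  proof (induction N)
    case (Suc N)
    have "fc (\<lambda>p. (\<Sum>n<Suc N. f n p) * \<phi> p) m = fc (\<lambda>p. (\<Sum>n<N. f n p) * \<phi> p + ((\<i> * of_real t) ^ N / of_nat (fact N)) * (of_real (cos p) ^ N * \<phi> p)) m"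
      by (simp add: f_def distrib_right mult.assoc)
    also have "\<dots> = fc (\<lambda>p. (\<Sum>n<N. f n p) * \<phi> p) m + ((\<i> * of_real t) ^ N / of_nat (fact N)) * fc (\<lambda>p. of_real (cos p) ^ N * \<phi> p) m"
      unfolding f_def by (subst fc_add, intro continuous_intros \<phi>, intro continuous_intros \<phi>, simp only: fc_cmult)
    finally show ?case using Suc by simp
  qed simp
  show ?thesis unfolding sums_def part
  proof (rule LIMSEQ_I)
    fix e :: real assume e: "0 < e"
    then have "0 < e / (2 * (K + 1))" using K by simp
    from uniform_limitD[OF u this] obtain N0 where N0: "\<And>N p. N0 \<le> N \<Longrightarrow> dist (\<Sum>n<N. f n p) (\<Sum>n. f n p) < e / (2 * (K + 1))"
      unfolding eventually_sequentially by auto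
    show "\<exists>N0. \<forall>N\<ge>N0. norm (fc (\<lambda>p. (\<Sum>n<N. f n p) * \<phi> p) m - fc (\<lambda>p. cis (t * cos p) * \<phi> p) m) < e"
    proof (intro exI[of _ N0] allI impI)
      fix N assume N: "N0 \<le> N"
      have cf: "continuous_on UNIV (\<lambda>p. \<Sum>n<N. f n p)" unfolding f_def by (intro continuous_intros)
      have "fc (\<lambda>p. (\<Sum>n<N. f n p) * \<phi> p) m - fc (\<lambda>p. cis (t * cos p) * \<phi> p) m = fc (\<lambda>p. ((\<Sum>n<N. f n p) * \<phi> p) - (cis (t * cos p) * \<phi> p)) m"
        by (rule fc_diff[symmetric]) (intro continuous_intros cf \<phi>)+
      also have "cmod \<dots> \<le> (e / (2 * (K + 1))) * K"
      proof (rule fc_norm_le)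
        show "continuous_on UNIV (\<lambda>p. ((\<Sum>n<N. f n p) * \<phi> p) - (cis (t * cos p) * \<phi> p))" by (intro continuous_intros cf \<phi>)
        show "cmod ((\<Sum>n<N. f n p) * \<phi> p - cis (t * cos p) * \<phi> p) \<le> (e / (2 * (K + 1))) * K" for p
          unfolding left_diff_distrib[symmetric] norm_mult
          by (intro mult_mono \<phi>) (use N0[OF N, of p] sums_unique[OF s[of p]] K e in \<open>auto simp: dist_norm\<close>)
      qed
      also have "\<dots> < e" using K e by (simp add: divide_simps)
      finally show "norm (fc (\<lambda>p. (\<Sum>n<N. f n p) * \<phi> p) m - fc (\<lambda>p. cis (t * cos p) * \<phi> p) m) < e" .
    qed
  qed
qed

lemma kern_exp_sums:
  assumes \<kappa>: "0 < \<kappa>" and \<phi>: "continuous_on UNIV \<phi>" "\<And>p. cmod (\<phi> p) \<le> K"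
  shows "(\<lambda>n. ((\<i> * of_real t) ^ n / of_nat (fact n)) * kern \<kappa> (\<lambda>p. of_real (cos p) ^ n * \<phi> p) (of_real (bs_energy \<kappa>) ^ n * v) x y)
    sums kern \<kappa> (\<lambda>p. cis (t * cos p) * \<phi> p) (cis (t * bs_energy \<kappa>) * v) x y"
proof -
  have e: "(\<lambda>n. ((\<i> * of_real t) ^ n / of_nat (fact n)) * of_real (bs_energy \<kappa>) ^ n) sums cis (t * bs_energy \<kappa>)"
  proof -
    have "(\<lambda>n. (\<i> * of_real (t * bs_energy \<kappa>)) ^ n /\<^sub>R fact n) sums exp (\<i> * of_real (t * bs_energy \<kappa>))" by (rule exp_converges)
    then show ?thesis unfolding cis_conv_exp by (simp add: scaleR_conv_of_real power_mult_distrib field_simps)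
  qed
  have c: "continuous_on UNIV (\<lambda>p. \<phi> p * rcoef \<kappa> p)" using \<kappa> by (intro continuous_intros \<phi> rcoef_cont) auto
  have b: "cmod (\<phi> p * rcoef \<kappa> p) \<le> K * 1" for p unfolding norm_mult
    by (intro mult_mono \<phi> rcoef_norm_le) (use \<kappa> order_trans[OF norm_ge_zero \<phi>(2)] in auto)
  define B where "B = v * of_real (bs_weight \<kappa> * bs_decay \<kappa> ^ nat (\<bar>x\<bar> + \<bar>y\<bar>))"
  have "(\<lambda>n. (((\<i> * of_real t) ^ n / of_nat (fact n)) * fc (\<lambda>p. of_real (cos p) ^ n * \<phi> p) (x - y)
     + ((\<i> * of_real t) ^ n / of_nat (fact n)) * fc (\<lambda>p. of_real (cos p) ^ n * (\<phi> p * rcoef \<kappa> p)) (\<bar>x\<bar> + \<bar>y\<bar>))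
     + (((\<i> * of_real t) ^ n / of_nat (fact n)) * of_real (bs_energy \<kappa>) ^ n) * B)
    sums ((fc (\<lambda>p. cis (t * cos p) * \<phi> p) (x - y) + fc (\<lambda>p. cis (t * cos p) * (\<phi> p * rcoef \<kappa> p)) (\<bar>x\<bar> + \<bar>y\<bar>)) + cis (t * bs_energy \<kappa>) * B)"
    by (intro sums_add sums_mult2 e fc_exp_sums[OF \<phi>] fc_exp_sums[OF c b])
  then show ?thesis unfolding kern_def B_def by (simp add: algebra_simps)
qed

text \<open>The vector exp(i t hB) delta_y at site x. The initial site is the first of the two,
  since the columns are the vectors that enter the two-point function.\<close>

definition psi :: "real \<Rightarrow> real \<Rightarrow> int \<Rightarrow> int \<Rightarrow> complex" where
  "psi \<kappa> t y x = kern \<kappa> (\<lambda>p. cis (t * cos p)) (cis (t * bs_energy \<kappa>)) x y"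

lemma psi_sums:
  assumes "0 < \<kappa>"
  shows "(\<lambda>n. ((\<i> * of_real t) ^ n / of_nat (fact n)) * (hB \<kappa> ^^ n) (delta y) x) sums psi \<kappa> t y x"
  using kern_exp_sums[OF assms, of "\<lambda>p. 1" 1 t 1 x y] unfolding hB_power_delta[OF assms] psi_def by simp

section \<open>Group law and unitarity of the propagator\<close>

lemma double_summable:
  fixes F :: "'a \<Rightarrow> 'b \<Rightarrow> complex"
  assumes "\<And>n. n \<in> A \<Longrightarrow> ((\<lambda>x. cmod (F n x)) has_sum g n) B" "g summable_on A"
  shows "(\<lambda>(n, x). F n x) summable_on (A \<times> B)"
proof -
  have "(\<lambda>z. cmod ((\<lambda>(n, x). F n x) z)) summable_on (A \<times> B)"
    by (rule summable_on_SigmaI[where g = g]) (use assms in auto)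
  then show ?thesis by (rule abs_summable_summable)
qed

lemma has_sum_shift:
  fixes f :: "int \<Rightarrow> 'a::{comm_monoid_add,topological_space}"
  shows "((\<lambda>x. f (x + c)) has_sum s) UNIV \<longleftrightarrow> (f has_sum s) UNIV"
  by (rule has_sum_reindex_bij_betw) (rule bij_plus_right)

lemma hB_apply: "hB \<kappa> f x = (f (x + (- 1)) + f (x + 1)) / 2 + of_real \<kappa> * (if x = 0 then f 0 else 0)"
  by (simp add: hB_def hop_def shift_def shift_inv_def p0_def delta_def)

text \<open>Growth is measured in the l1 norm, where delta vectors have norm 1: this makes the
  double series in \<open>psi_group\<close> absolutely summable against merely bounded
  functions.\<close>

lemma hB_l1:
  assumes \<kappa>: "0 < \<kappa>" and g: "((\<lambda>x. cmod (g x)) has_sum s) UNIV"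
  shows "\<exists>s'. ((\<lambda>x. cmod (hB \<kappa> g x)) has_sum s') UNIV \<and> s' \<le> (1 + \<kappa>) * s"
proof -
  have d: "((\<lambda>x::int. if x = 0 then cmod (g 0) else 0) has_sum cmod (g 0)) UNIV"
    by (rule has_sum_finite_neutralI[where B = "{0}"]) auto
  have b: "((\<lambda>x. (cmod (g (x + (- 1))) + cmod (g (x + 1))) * (1/2) + \<kappa> * (if x = 0 then cmod (g 0) else 0)) has_sum (s + s) * (1/2) + \<kappa> * cmod (g 0)) UNIV"
    by (intro has_sum_add has_sum_cmult_left has_sum_cmult_right has_sum_shift[of "\<lambda>x. cmod (g x)", THEN iffD2] g d)
  have le: "cmod (hB \<kappa> g x) \<le> (cmod (g (x + (- 1))) + cmod (g (x + 1))) * (1/2) + \<kappa> * (if x = 0 then cmod (g 0) else 0)" for x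
  proof -
    have "cmod (hB \<kappa> g x) \<le> cmod ((g (x + (- 1)) + g (x + 1)) / 2) + cmod (of_real \<kappa> * (if x = 0 then g 0 else 0))"
      unfolding hB_apply by (rule norm_triangle_ineq)
    also have "cmod ((g (x + (- 1)) + g (x + 1)) / 2) \<le> (cmod (g (x + (- 1))) + cmod (g (x + 1))) * (1/2)"
      using norm_triangle_ineq[of "g (x + (- 1))" "g (x + 1)"] by (simp add: norm_divide)
    finally show ?thesis using \<kappa> by (cases "x = 0") (simp_all add: norm_mult)
  qed
  have sm: "(\<lambda>x. cmod (hB \<kappa> g x)) summable_on UNIV"
    by (rule summable_on_comparison_test[OF has_sum_imp_summable[OF b]]) (use le in auto)
  have g0: "cmod (g 0) \<le> s"
    using finite_sum_le_has_sum[OF g, of "{0}"] by simp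
  have "(\<Sum>\<^sub>\<infinity>x. cmod (hB \<kappa> g x)) \<le> (s + s) * (1/2) + \<kappa> * cmod (g 0)"
    by (rule has_sum_mono[OF has_sum_infsum[OF sm] b le])
  also have "\<dots> \<le> (1 + \<kappa>) * s" using mult_left_mono[OF g0, of \<kappa>] \<kappa> by (simp add: algebra_simps)
  finally show ?thesis using has_sum_infsum[OF sm] by blast
qed

lemma hB_power_l1:
  assumes \<kappa>: "0 < \<kappa>"
  shows "\<exists>s. ((\<lambda>x. cmod ((hB \<kappa> ^^ n) (delta y) x)) has_sum s) UNIV \<and> s \<le> (1 + \<kappa>) ^ n"
proof (induction n)
  case 0
  have "((\<lambda>x. cmod (delta y x)) has_sum 1) UNIV"
    by (rule has_sum_finite_neutralI[where B = "{y}"]) (auto simp: delta_def)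
  then show ?case by (intro exI[of _ 1]) auto
next
  case (Suc n)
  then obtain s where s: "((\<lambda>x. cmod ((hB \<kappa> ^^ n) (delta y) x)) has_sum s) UNIV" "s \<le> (1 + \<kappa>) ^ n" by blast
  obtain s' where s': "((\<lambda>x. cmod (hB \<kappa> ((hB \<kappa> ^^ n) (delta y)) x)) has_sum s') UNIV" "s' \<le> (1 + \<kappa>) * s"
    using hB_l1[OF \<kappa> s(1)] by blast
  have "s' \<le> (1 + \<kappa>) * (1 + \<kappa>) ^ n" by (rule order_trans[OF s'(2) mult_left_mono[OF s(2)]]) (use \<kappa> in simp)
  then show ?case using s' by auto
qed

lemma bounded_mult_summable:
  assumes g: "(\<lambda>x. cmod (g x)) summable_on A" and f: "\<And>x. cmod (f x) \<le> C"
  shows "(\<lambda>x. cmod (g x * f x)) summable_on A"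
proof -
  have "(\<lambda>x. cmod (g x) * C) summable_on A" by (rule summable_on_cmult_left[OF g])
  then show ?thesis
    by (rule summable_on_comparison_test) (auto simp: norm_mult intro: mult_left_mono f)
qed

text \<open>Symmetry of \<open>hB\<close> for the bilinear pairing of a summable with a bounded
  family: shifting the summation index moves each hop to the other factor.\<close>

lemma hB_adjoint:
  assumes \<kappa>: "0 < \<kappa>" and g: "(\<lambda>x. cmod (g x)) summable_on UNIV" and f: "\<And>x. cmod (f x) \<le> C"
    and s: "((\<lambda>x. g x * hB \<kappa> f x) has_sum s) UNIV"
  shows "((\<lambda>x. hB \<kappa> g x * f x) has_sum s) UNIV"
proof -
  have sm: "(\<lambda>x. g x * f (x + c)) summable_on UNIV" for c
    by (rule abs_summable_summable[OF bounded_mult_summable[OF g]]) (rule f)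
  define S where "S c = (\<Sum>\<^sub>\<infinity>x. g x * f (x + c))" for c
  have S: "((\<lambda>x. g x * f (x + c)) has_sum S c) UNIV" for c unfolding S_def by (rule has_sum_infsum[OF sm])
  have S': "((\<lambda>x. g (x + c) * f x) has_sum S (- c)) UNIV" for c
    using has_sum_shift[of "\<lambda>x. g x * f (x + (- c))" c "S (- c)"] S[of "- c"] by simp
  have d: "((\<lambda>x::int. if x = 0 then g 0 * f 0 else 0) has_sum g 0 * f 0) UNIV"
    by (rule has_sum_finite_neutralI[where B = "{0}"]) auto
  have 1: "((\<lambda>x. (g x * f (x + (- 1)) + g x * f (x + 1)) * (1/2) + of_real \<kappa> * (if x = 0 then g 0 * f 0 else 0)) has_sum (S (- 1) + S 1) * (1/2) + of_real \<kappa> * (g 0 * f 0)) UNIV"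
    by (intro has_sum_add has_sum_cmult_left has_sum_cmult_right S d)
  have 2: "((\<lambda>x. (g (x + 1) * f x + g (x + (- 1)) * f x) * (1/2) + of_real \<kappa> * (if x = 0 then g 0 * f 0 else 0)) has_sum (S (- 1) + S 1) * (1/2) + of_real \<kappa> * (g 0 * f 0)) UNIV"
    using S'[of 1] S'[of "-1"] by (intro has_sum_add has_sum_cmult_left has_sum_cmult_right d) auto
  have "s = (S (- 1) + S 1) * (1/2) + of_real \<kappa> * (g 0 * f 0)"
  proof -
    have "(\<lambda>x. (g x * f (x + (- 1)) + g x * f (x + 1)) * (1/2) + of_real \<kappa> * (if x = 0 then g 0 * f 0 else 0)) = (\<lambda>x. g x * hB \<kappa> f x)"
      by (rule ext) (auto simp: hB_apply algebra_simps add_divide_distrib)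
    then show ?thesis using has_sum_unique[OF s] 1 by simp
  qed
  moreover have "(\<lambda>x. (g (x + 1) * f x + g (x + (- 1)) * f x) * (1/2) + of_real \<kappa> * (if x = 0 then g 0 * f 0 else 0)) = (\<lambda>x. hB \<kappa> g x * f x)"
    by (rule ext) (auto simp: hB_apply algebra_simps add_divide_distrib)
  ultimately show ?thesis using 2 by simp
qed

lemma hB_bounded:
  assumes \<kappa>: "0 < \<kappa>" and f: "\<And>x. cmod (f x) \<le> C"
  shows "cmod (hB \<kappa> f x) \<le> (1 + \<kappa>) * C"
proof -
  have "cmod (hB \<kappa> f x) \<le> cmod ((f (x + (- 1)) + f (x + 1)) / 2) + cmod (of_real \<kappa> * (if x = 0 then f 0 else 0))"
    unfolding hB_apply by (rule norm_triangle_ineq)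
  also have "cmod ((f (x + (- 1)) + f (x + 1)) / 2) \<le> C"
    using norm_triangle_ineq[of "f (x + (- 1))" "f (x + 1)"] f[of "x + (-1)"] f[of "x + 1"] by (simp add: norm_divide)
  also have "cmod (of_real \<kappa> * (if x = 0 then f 0 else 0)) \<le> \<kappa> * C"
    using \<kappa> f[of 0] order_trans[OF norm_ge_zero f[of 0]] by (simp add: norm_mult)
  finally show ?thesis by (simp add: algebra_simps)
qed

lemma hB_power_pairing:
  assumes \<kappa>: "0 < \<kappa>" and f: "\<And>x. cmod (f x) \<le> C"
  shows "((\<lambda>x. (hB \<kappa> ^^ n) (delta i) x * f x) has_sum (hB \<kappa> ^^ n) f i) UNIV"
  using f
proof (induction n arbitrary: f C)
  case 0
  show ?case by (rule has_sum_finite_neutralI[where B = "{i}"]) (auto simp: delta_def)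
next
  case (Suc n)
  have "(\<lambda>x. cmod ((hB \<kappa> ^^ n) (delta i) x)) summable_on UNIV"
    using hB_power_l1[OF \<kappa>] has_sum_imp_summable by blast
  moreover have "((\<lambda>x. (hB \<kappa> ^^ n) (delta i) x * hB \<kappa> f x) has_sum (hB \<kappa> ^^ n) (hB \<kappa> f) i) UNIV"
    by (rule Suc.IH[of "hB \<kappa> f" "(1 + \<kappa>) * C"]) (rule hB_bounded[OF \<kappa> Suc.prems])
  ultimately have "((\<lambda>x. hB \<kappa> ((hB \<kappa> ^^ n) (delta i)) x * f x) has_sum (hB \<kappa> ^^ n) (hB \<kappa> f) i) UNIV"
    by (rule hB_adjoint[OF \<kappa> _ Suc.prems])
  then show ?case by (simp add: funpow_swap1)
qed

lemma hB_power_delta_real: "cnj ((hB \<kappa> ^^ n) (delta y) x) = (hB \<kappa> ^^ n) (delta y) x"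
  by (induction n arbitrary: x) (auto simp: delta_def hB_apply)

lemma cnj_psi:
  assumes "0 < \<kappa>" shows "cnj (psi \<kappa> t y x) = psi \<kappa> (- t) y x"
proof -
  have "(\<lambda>n. cnj (((\<i> * of_real t) ^ n / of_nat (fact n)) * (hB \<kappa> ^^ n) (delta y) x)) sums cnj (psi \<kappa> t y x)"
    using psi_sums[OF assms] by (simp only: sums_cnj)
  then have "(\<lambda>n. ((\<i> * of_real (- t)) ^ n / of_nat (fact n)) * (hB \<kappa> ^^ n) (delta y) x) sums cnj (psi \<kappa> t y x)"
    by (simp add: hB_power_delta_real)
  then show ?thesis using psi_sums[OF assms, of "- t"] sums_unique2 by blast
qed

lemma phase_even: "cis (t * cos (- p)) = cis (t * cos p)" by simp

lemma psi_bounded: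
  assumes \<kappa>: "0 < \<kappa>" shows "cmod (psi \<kappa> t y x) \<le> 3"
proof -
  have c: "continuous_on UNIV (\<lambda>p. cis (t * cos p))" by (intro continuous_intros)
  have c': "continuous_on UNIV (\<lambda>p. cis (t * cos p) * rcoef \<kappa> p)" using \<kappa> by (intro continuous_intros rcoef_cont) auto
  note b = bs_facts[OF \<kappa>]
  have w: "bs_weight \<kappa> \<le> 1" unfolding bs_weight_def using b(1) unfolding bs_decay_def using \<kappa> by (simp add: divide_le_eq not_less add_nonneg_nonneg)
  have "cmod (fc (\<lambda>p. cis (t * cos p)) (x - y)) \<le> 1" by (rule fc_norm_le[OF c]) simp
  moreover have "cmod (fc (\<lambda>p. cis (t * cos p) * rcoef \<kappa> p) (\<bar>x\<bar> + \<bar>y\<bar>)) \<le> 1"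
    by (rule fc_norm_le[OF c']) (use \<kappa> rcoef_norm_le in \<open>auto simp: norm_mult\<close>)
  moreover have "cmod (cis (t * bs_energy \<kappa>) * of_real (bs_weight \<kappa> * bs_decay \<kappa> ^ nat (\<bar>x\<bar> + \<bar>y\<bar>))) \<le> 1"
  proof -
    have "bs_weight \<kappa> * bs_decay \<kappa> ^ nat (\<bar>x\<bar> + \<bar>y\<bar>) \<le> 1 * 1"
      by (intro mult_mono w power_le_one) (use b in auto)
    then show ?thesis using b by (simp add: norm_mult norm_power)
  qed
  ultimately show ?thesis unfolding psi_def kern_def
    using norm_triangle_mono[OF norm_triangle_mono] by fastforce
qed

text \<open>Expand the conjugated factor in its exponential series and interchange the sums: the
  powers of \<open>hB\<close> move onto the other factor, where \<open>kern_power\<close> and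
  \<open>kern_exp_sums\<close> resum them to the time difference. Isometry, orthonormality and
  continuity in time all rest on this identity.\<close>

lemma psi_group:
  assumes \<kappa>: "0 < \<kappa>"
  shows "((\<lambda>x. cnj (psi \<kappa> s i x) * psi \<kappa> t j x) has_sum psi \<kappa> (t - s) j i) UNIV"
proof -
  define a where "a n = ((\<i> * of_real (- s)) ^ n / of_nat (fact n))" for n :: nat
  define k where "k n = (hB \<kappa> ^^ n) (delta i)" for n
  define f where "f = psi \<kappa> t j"
  define F where "F n x = a n * (k n x * f x)" for n x
  have fb: "cmod (f x) \<le> 3" for x unfolding f_def by (rule psi_bounded[OF \<kappa>])
  have an: "cmod (a n) = \<bar>s\<bar> ^ n / fact n" for n unfolding a_def by (simp add: norm_divide norm_power norm_mult)
  have kn: "(\<lambda>x. cmod (k n x)) summable_on UNIV" "(\<Sum>\<^sub>\<infinity>x. cmod (k n x)) \<le> (1 + \<kappa>) ^ n" for n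
    using hB_power_l1[OF \<kappa>, of n i] unfolding k_def by (auto simp: has_sum_iff)
  have ex: "summable (\<lambda>n. (\<bar>s\<bar> ^ n / fact n) * ((1 + \<kappa>) ^ n * 3))"
  proof -
    have "summable (\<lambda>n. ((\<bar>s\<bar> * (1 + \<kappa>)) ^ n / fact n) * 3)"
      using summable_exp[of "\<bar>s\<bar> * (1 + \<kappa>)"] by (intro summable_mult2) (simp add: field_simps)
    moreover have "(\<lambda>n. (\<bar>s\<bar> ^ n / fact n) * ((1 + \<kappa>) ^ n * 3)) = (\<lambda>n. ((\<bar>s\<bar> * (1 + \<kappa>)) ^ n / fact n) * 3)"
      by (auto simp: power_mult_distrib)
    ultimately show ?thesis by simp
  qed
  have Fn: "((\<lambda>x. cmod (F n x)) has_sum cmod (a n) * (\<Sum>\<^sub>\<infinity>x. cmod (k n x * f x))) UNIV" for n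
    unfolding F_def norm_mult[of "a n"]
    by (intro has_sum_cmult_right has_sum_infsum bounded_mult_summable[OF kn(1) fb])
  have gs: "(\<lambda>n. cmod (a n) * (\<Sum>\<^sub>\<infinity>x. cmod (k n x * f x))) summable_on UNIV"
  proof (rule summable_on_comparison_test[OF summable_nonneg_imp_summable_on[OF ex]])
    fix n
    have "(\<Sum>\<^sub>\<infinity>x. cmod (k n x * f x)) \<le> (\<Sum>\<^sub>\<infinity>x. cmod (k n x) * 3)"
      by (intro infsum_mono bounded_mult_summable[OF kn(1) fb] summable_on_cmult_left kn(1))
        (auto simp: norm_mult intro: mult_left_mono fb)
    also have "\<dots> = (\<Sum>\<^sub>\<infinity>x. cmod (k n x)) * 3" by (rule infsum_cmult_left) (use kn in auto)
    also have "\<dots> \<le> (1 + \<kappa>) ^ n * 3" using kn(2)[of n] by simp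
    finally show "cmod (a n) * (\<Sum>\<^sub>\<infinity>x. cmod (k n x * f x)) \<le> (\<bar>s\<bar> ^ n / fact n) * ((1 + \<kappa>) ^ n * 3)"
      unfolding an by (intro mult_left_mono) auto
    show "0 \<le> cmod (a n) * (\<Sum>\<^sub>\<infinity>x. cmod (k n x * f x))" by (intro mult_nonneg_nonneg infsum_nonneg) auto
  qed (use \<kappa> in auto)
  have sm: "(\<lambda>(n, x). F n x) summable_on (UNIV \<times> UNIV)"
    by (rule double_summable[OF Fn gs])
  define S where "S = infsum (\<lambda>(n, x). F n x) (UNIV \<times> UNIV)"
  have hs: "((\<lambda>(n, x). F n x) has_sum S) (UNIV \<times> UNIV)" unfolding S_def by (rule has_sum_infsum[OF sm])
  have hs': "((\<lambda>(x, n). F n x) has_sum S) (UNIV \<times> UNIV)"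
    using hs by (subst (asm) has_sum_swap) (simp add: case_prod_unfold)
  have col: "((\<lambda>n. F n x) has_sum cnj (psi \<kappa> s i x) * f x) UNIV" for x
  proof -
    have "(\<lambda>n. (a n * k n x) * f x) sums (psi \<kappa> (- s) i x * f x)"
      unfolding a_def k_def by (intro sums_mult2 psi_sums[OF \<kappa>])
    then have 1: "(\<lambda>n. F n x) sums (cnj (psi \<kappa> s i x) * f x)" unfolding F_def cnj_psi[OF \<kappa>] by (simp add: mult.assoc)
    have "(\<lambda>n. F n x) summable_on UNIV"
      using summable_on_SigmaD1[of "\<lambda>x n. F n x" UNIV "\<lambda>_. UNIV" x] has_sum_imp_summable[OF hs'] by simp
    then show ?thesis using 1 has_sum_imp_sums[OF has_sum_infsum] sums_unique2 has_sum_infsum by metis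
  qed
  have "((\<lambda>x. cnj (psi \<kappa> s i x) * f x) has_sum S) UNIV"
    by (rule has_sum_SigmaD[OF hs']) (use col in simp)
  moreover have "S = psi \<kappa> (t - s) j i"
  proof -
    have row: "((\<lambda>x. F n x) has_sum a n * (hB \<kappa> ^^ n) f i) UNIV" for n
      unfolding F_def k_def by (intro has_sum_cmult_right hB_power_pairing[OF \<kappa> fb])
    have "((\<lambda>n. a n * (hB \<kappa> ^^ n) f i) has_sum S) UNIV"
      by (rule has_sum_SigmaD[OF hs]) (use row in simp)
    then have 1: "(\<lambda>n. a n * (hB \<kappa> ^^ n) f i) sums S" by (rule has_sum_imp_sums)
    have f: "f = (\<lambda>x. kern \<kappa> (\<lambda>p. cis (t * cos p)) (cis (t * bs_energy \<kappa>)) x j)" unfolding f_def psi_def ..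
    have c: "continuous_on UNIV (\<lambda>p. cis (t * cos p))" by (intro continuous_intros)
    have "(hB \<kappa> ^^ n) f i = kern \<kappa> (\<lambda>p. of_real (cos p) ^ n * cis (t * cos p)) (of_real (bs_energy \<kappa>) ^ n * cis (t * bs_energy \<kappa>)) i j" for n
      unfolding f kern_power[OF \<kappa> c phase_even] ..
    then have "(\<lambda>n. a n * (hB \<kappa> ^^ n) f i) sums kern \<kappa> (\<lambda>p. cis ((- s) * cos p) * cis (t * cos p)) (cis ((- s) * bs_energy \<kappa>) * cis (t * bs_energy \<kappa>)) i j"
      using kern_exp_sums[OF \<kappa> c, of 1 "- s" "cis (t * bs_energy \<kappa>)" i j] unfolding a_def by simp
    moreover have "(\<lambda>p. cis ((- s) * cos p) * cis (t * cos p)) = (\<lambda>p. cis ((t - s) * cos p))"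
      "cis ((- s) * bs_energy \<kappa>) * cis (t * bs_energy \<kappa>) = cis ((t - s) * bs_energy \<kappa>)"
      by (auto simp: cis_mult algebra_simps)
    ultimately show ?thesis using 1 sums_unique2 unfolding psi_def by metis
  qed
  ultimately show ?thesis unfolding f_def by simp
qed

lemma psi_0: "0 < \<kappa> \<Longrightarrow> psi \<kappa> 0 y x = delta y x"
  unfolding psi_def by (simp add: kern_delta)

lemma has_sum_sq_l2le:
  assumes "((\<lambda>x. cnj (f x) * f x) has_sum s) UNIV"
  shows "l2le f (sqrt (Re s))"
proof -
  have "((\<lambda>x. Re (cnj (f x) * f x)) has_sum Re s) UNIV" by (rule has_sum_Re[OF assms])
  moreover have "(\<lambda>x. Re (cnj (f x) * f x)) = (\<lambda>x. (cmod (f x))\<^sup>2)"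
    by (rule ext) (simp only: cmod_power2, simp add: power2_eq_square)
  ultimately have h: "((\<lambda>x. (cmod (f x))\<^sup>2) has_sum Re s) UNIV" by simp
  then have n: "0 \<le> Re s" by (rule has_sum_nonneg) auto
  show ?thesis
    by (rule l2le_I_sq) (use finite_sum_le_has_sum[OF h] n in auto)
qed

lemma psi_l2le: "0 < \<kappa> \<Longrightarrow> l2le (psi \<kappa> t y) 1"
  using has_sum_sq_l2le[OF psi_group[of \<kappa> t y t y]] psi_0[of \<kappa> y y] by (simp add: delta_def)

lemma psi_orthonormal: "0 < \<kappa> \<Longrightarrow> ((\<lambda>x. cnj (psi \<kappa> t i x) * psi \<kappa> t j x) has_sum (if i = j then 1 else 0)) UNIV"
  using psi_group[of \<kappa> t i t j] psi_0[of \<kappa> j i] by (simp add: delta_def)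

lemma psi_diff_l2le:
  assumes \<kappa>: "0 < \<kappa>"
  shows "l2le (\<lambda>x. psi \<kappa> t y x - psi \<kappa> s y x) (sqrt (2 - 2 * Re (psi \<kappa> (t - s) y y)))"
proof -
  have p: "psi \<kappa> 0 y y = 1" using psi_0[OF \<kappa>] by (simp add: delta_def)
  have c: "psi \<kappa> (s - t) y y = cnj (psi \<kappa> (t - s) y y)" using cnj_psi[OF \<kappa>, of "t - s"] by simp
  have "((\<lambda>x. (cnj (psi \<kappa> t y x) * psi \<kappa> t y x + - (cnj (psi \<kappa> s y x) * psi \<kappa> t y x)) + (- (cnj (psi \<kappa> t y x) * psi \<kappa> s y x) + cnj (psi \<kappa> s y x) * psi \<kappa> s y x))
     has_sum ((psi \<kappa> (t - t) y y + - psi \<kappa> (t - s) y y) + (- psi \<kappa> (s - t) y y + psi \<kappa> (s - s) y y))) UNIV"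
    by (intro has_sum_add has_sum_uminusI psi_group[OF \<kappa>])
  then have "((\<lambda>x. cnj (psi \<kappa> t y x - psi \<kappa> s y x) * (psi \<kappa> t y x - psi \<kappa> s y x))
     has_sum ((1 + - psi \<kappa> (t - s) y y) + (- psi \<kappa> (s - t) y y + 1))) UNIV"
    by (simp add: algebra_simps p)
  from has_sum_sq_l2le[OF this] show ?thesis by (simp add: c)
qed

lemma norm_cis_minus_1: "cmod (cis a - 1) \<le> \<bar>a\<bar>"
proof -
  have "(cmod (cis a - 1))\<^sup>2 = (cos a - 1)\<^sup>2 + (sin a)\<^sup>2" by (simp add: cmod_power2)
  also have "\<dots> = 2 - 2 * cos a" using sin_cos_squared_add[of a] by (simp add: power2_eq_square algebra_simps)
  also have "\<dots> = (2 * sin (a / 2))\<^sup>2" using cos_double_sin[of "a / 2"] by (simp add: power2_eq_square)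
  also have "\<dots> \<le> \<bar>a\<bar>\<^sup>2" using abs_sin_x_le_abs_x[of "a / 2"] power_mono[of "\<bar>2 * sin (a / 2)\<bar>" "\<bar>a\<bar>" 2] by (simp add: abs_mult)
  finally show ?thesis by (rule power2_le_imp_le) simp
qed

lemma psi_diag_tendsto:
  assumes \<kappa>: "0 < \<kappa>" shows "((\<lambda>t. psi \<kappa> t y y) \<longlongrightarrow> 1) (at 0)"
proof -
  have f: "((\<lambda>t. fc (\<lambda>p. cis (t * cos p) * \<phi> p) m) \<longlongrightarrow> fc \<phi> m) (at 0)"
    if \<phi>: "continuous_on UNIV \<phi>" "\<And>p. cmod (\<phi> p) \<le> 1" for \<phi> m
  proof -
    have c: "continuous_on UNIV (\<lambda>p. cis (t * cos p) * \<phi> p)" for t by (intro continuous_intros \<phi>)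
    have bnd: "cmod (fc (\<lambda>p. cis (t * cos p) * \<phi> p) m - fc \<phi> m) \<le> \<bar>t\<bar>" for t
    proof -
      have "fc (\<lambda>p. cis (t * cos p) * \<phi> p) m - fc \<phi> m = fc (\<lambda>p. cis (t * cos p) * \<phi> p - \<phi> p) m"
        by (rule fc_diff[symmetric, OF c \<phi>(1)])
      also have "cmod \<dots> \<le> \<bar>t\<bar>"
      proof (rule fc_norm_le)
        show "continuous_on UNIV (\<lambda>p. cis (t * cos p) * \<phi> p - \<phi> p)" by (intro continuous_intros \<phi>)
        fix p
        have "cmod (cis (t * cos p) * \<phi> p - \<phi> p) = cmod (cis (t * cos p) - 1) * cmod (\<phi> p)"
          by (simp add: norm_mult[symmetric] algebra_simps)
        also have "\<dots> \<le> \<bar>t * cos p\<bar> * 1" by (intro mult_mono norm_cis_minus_1 \<phi>) auto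
        also have "\<dots> \<le> \<bar>t\<bar>" using mult_left_mono[OF abs_cos_le_one[of p], of "\<bar>t\<bar>"] by (simp add: abs_mult)
        finally show "cmod (cis (t * cos p) * \<phi> p - \<phi> p) \<le> \<bar>t\<bar>" .
      qed
      finally show ?thesis .
    qed
    have "((\<lambda>t. fc (\<lambda>p. cis (t * cos p) * \<phi> p) m - fc \<phi> m) \<longlongrightarrow> 0) (at 0)"
      by (rule Lim_null_comparison[OF always_eventually[OF allI[OF bnd]]]) (rule tendsto_rabs_zero[OF tendsto_ident_at])
    then show ?thesis by (rule LIM_zero_cancel)
  qed
  have c: "continuous_on UNIV (rcoef \<kappa>)" using \<kappa> by (intro rcoef_cont) auto
  have "((\<lambda>t. fc (\<lambda>p. cis (t * cos p) * 1) (y - y) + fc (\<lambda>p. cis (t * cos p) * rcoef \<kappa> p) (\<bar>y\<bar> + \<bar>y\<bar>)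
     + cis (t * bs_energy \<kappa>) * of_real (bs_weight \<kappa> * bs_decay \<kappa> ^ nat (\<bar>y\<bar> + \<bar>y\<bar>)))
    \<longlongrightarrow> fc (\<lambda>p. 1) (y - y) + fc (rcoef \<kappa>) (\<bar>y\<bar> + \<bar>y\<bar>) + 1 * of_real (bs_weight \<kappa> * bs_decay \<kappa> ^ nat (\<bar>y\<bar> + \<bar>y\<bar>))) (at 0)"
  proof (intro tendsto_add tendsto_mult tendsto_const f c rcoef_norm_le)
    have "((\<lambda>t. cis (t * bs_energy \<kappa>)) \<longlongrightarrow> cis (0 * bs_energy \<kappa>)) (at 0)"
      unfolding cis_conv_exp by (intro tendsto_intros)
    then show "((\<lambda>t. cis (t * bs_energy \<kappa>)) \<longlongrightarrow> 1) (at 0)" by simp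
  qed (use \<kappa> in auto)
  moreover have "fc (\<lambda>p. 1) (y - y) + fc (rcoef \<kappa>) (\<bar>y\<bar> + \<bar>y\<bar>) + 1 * of_real (bs_weight \<kappa> * bs_decay \<kappa> ^ nat (\<bar>y\<bar> + \<bar>y\<bar>)) = 1"
    using kern_delta[OF \<kappa>, of y y] unfolding kern_def by (simp add: delta_def)
  ultimately show ?thesis unfolding psi_def kern_def by simp
qed

section \<open>The initial one-particle density\<close>

text \<open>Method of images: kernel on the half line x > N of a function of the hopping operator with a
  Dirichlet wall at N.\<close>
definition refl_kern :: "(real \<Rightarrow> complex) \<Rightarrow> nat \<Rightarrow> int \<Rightarrow> int \<Rightarrow> complex" where
  "refl_kern F N a b = fc F (a - b) - fc F (a + b - 2 * int N)"

lemma refl_kern_add: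
  "continuous_on UNIV F \<Longrightarrow> continuous_on UNIV G \<Longrightarrow> refl_kern (\<lambda>p. F p + G p) N a b = refl_kern F N a b + refl_kern G N a b"
  unfolding refl_kern_def by (simp add: fc_add)

lemma refl_kern_diff:
  "continuous_on UNIV F \<Longrightarrow> continuous_on UNIV G \<Longrightarrow> refl_kern (\<lambda>p. F p - G p) N a b = refl_kern F N a b - refl_kern G N a b"
  unfolding refl_kern_def by (simp add: fc_diff)

lemma refl_kern_cmult: "refl_kern (\<lambda>p. c * F p) N a b = c * refl_kern F N a b"
  unfolding refl_kern_def by (simp add: fc_cmult right_diff_distrib)

lemma refl_kern_one: "a \<in> ZR N \<Longrightarrow> b \<in> ZR N \<Longrightarrow> refl_kern (\<lambda>p. 1) N a b = (if a = b then 1 else 0)"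
  unfolding refl_kern_def ZR_def using fc_cis[of 0 "a - b"] fc_cis[of 0 "a + b - 2 * int N"] by simp

lemma refl_kern_cos:
  assumes "continuous_on UNIV F"
  shows "refl_kern (\<lambda>p. of_real (cos p) * F p) N a b = (refl_kern F N (a - 1) b + refl_kern F N (a + 1) b) / 2"
  unfolding refl_kern_def fc_cos[OF assms] by (simp add: field_simps)

text \<open>Evenness makes the image term cancel the direct one at site N; this realises the
  Dirichlet condition.\<close>

lemma refl_kern_wall:
  assumes "\<And>p. F (- p) = F p"
  shows "refl_kern F N (int N) b = 0"
proof -
  have "int N + b - 2 * int N = - (int N - b)" by simp
  then show ?thesis unfolding refl_kern_def by (simp only: fc_even[of F "int N - b", OF assms] diff_self)
qed

lemma refl_kern_l2le:
  assumes "continuous_on UNIV F" "\<And>p. cmod (F p) \<le> K"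
  shows "l2le (\<lambda>b. cnj (refl_kern F N a b)) (K + K)"
proof -
  have 1: "l2le (\<lambda>b. fc F (a - b)) K" by (rule l2le_reindex[OF Bessel_sup[OF assms]]) (auto simp: inj_def)
  have 2: "l2le (\<lambda>b. fc F (a + b - 2 * int N)) K" by (rule l2le_reindex[OF Bessel_sup[OF assms]]) (auto simp: inj_def)
  show ?thesis by (rule l2le_mono[OF l2le_diff[OF 1 2]]) (auto simp: refl_kern_def simp flip: complex_cnj_diff)
qed

lemma refl_kern_summable:
  assumes "continuous_on UNIV F" "\<And>p. cmod (F p) \<le> K" "l2le f c"
  shows "(\<lambda>b. refl_kern F N a b * f b) summable_on A"
  using l2le_summable[OF refl_kern_l2le[OF assms(1,2)] assms(3), of N a A] by simp

lemma refl_kern_bound: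
  assumes "continuous_on UNIV F" "\<And>p. cmod (F p) \<le> K" "l2le f c"
  shows "cmod (\<Sum>\<^sub>\<infinity>b\<in>A. refl_kern F N a b * f b) \<le> (K + K) * c"
  using l2le_CS[OF refl_kern_l2le[OF assms(1,2)] assms(3), of N a A] by simp

section \<open>Functional calculus of the decoupled initial Hamiltonian\<close>

lemma k0_apply_ZR:
  assumes "x \<in> ZR N"
  shows "k0 N \<beta>L \<beta>R f x = of_real \<beta>R * ((if x - 1 \<in> ZR N then f (x - 1) else 0) + f (x + 1)) / 2"
  using assms by (auto simp: k0_def proj_def hop_def shift_def shift_inv_def ZL_def ZR_def)

lemma k0_apply_ZS:
  assumes "x \<in> ZS N" shows "k0 N \<beta>L \<beta>R f x = 0"
  using assms by (auto simp: k0_def proj_def ZL_def ZR_def ZS_def)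

text \<open>The mirror image exchanges the two reservoirs, so that only the right half line has to
  be treated.\<close>

lemma k0_reflect: "k0 N \<beta>L \<beta>R f (- x) = k0 N \<beta>R \<beta>L (\<lambda>x. f (- x)) x"
proof -
  have e: "- x - 1 = - (x + 1)" "- x + 1 = - (x - 1)" by auto
  show ?thesis by (auto simp: k0_def proj_def hop_def shift_def shift_inv_def ZL_def ZR_def e simp del: minus_add_distrib minus_diff_eq)
      (auto simp: add.commute)
qed

lemma k0_power_reflect: "(k0 N \<beta>L \<beta>R ^^ i) f (- x) = (k0 N \<beta>R \<beta>L ^^ i) (\<lambda>x. f (- x)) x"
proof (induction i arbitrary: x)
  case (Suc i)
  have "(k0 N \<beta>L \<beta>R ^^ Suc i) f (- x) = k0 N \<beta>R \<beta>L (\<lambda>x. (k0 N \<beta>L \<beta>R ^^ i) f (- x)) x" by (simp add: k0_reflect)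
  also have "\<dots> = (k0 N \<beta>R \<beta>L ^^ Suc i) (\<lambda>x. f (- x)) x" unfolding Suc by simp
  finally show ?case .
qed simp

lemma cos_pow_bounded: "cmod (of_real (\<beta> * cos p) ^ i) \<le> \<bar>\<beta>\<bar> ^ i"
proof -
  have "\<bar>\<beta> * cos p\<bar> \<le> \<bar>\<beta>\<bar>" using mult_left_mono[OF abs_cos_le_one[of p], of "\<bar>\<beta>\<bar>"] by (simp add: abs_mult)
  from power_mono[OF this abs_ge_zero, of i] show ?thesis unfolding norm_power norm_of_real .
qed

text \<open>In the induction the hop from the forbidden site N may be included, because the kernel
  vanishes there; both hops together then give cos p by \<open>refl_kern_cos\<close>.\<close>

lemma k0_power_ZR:
  assumes f: "l2le f c" and x: "x \<in> ZR N"
  shows "(k0 N \<beta>L \<beta>R ^^ i) f x = (\<Sum>\<^sub>\<infinity>b\<in>ZR N. refl_kern (\<lambda>p. of_real (\<beta>R * cos p) ^ i) N x b * f b)"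
  using x
proof (induction i arbitrary: x)
  case 0
  have "((\<lambda>b. refl_kern (\<lambda>p. of_real (\<beta>R * cos p) ^ 0) N x b * f b) has_sum f x) (ZR N)"
    by (rule has_sum_finite_neutralI[where B = "{x}"]) (use 0 in \<open>auto simp: refl_kern_one\<close>)
  then show ?case by (simp add: infsumI)
next
  case (Suc i)
  define F where "F = (\<lambda>p. complex_of_real (\<beta>R * cos p) ^ i)"
  have F: "continuous_on UNIV F" unfolding F_def by (intro continuous_intros)
  note sm = refl_kern_summable[OF F, of "\<bar>\<beta>R\<bar> ^ i", OF _ f]
  have b: "cmod (F p) \<le> \<bar>\<beta>R\<bar> ^ i" for p unfolding F_def by (rule cos_pow_bounded)
  define s where "s x = (\<Sum>\<^sub>\<infinity>b\<in>ZR N. refl_kern F N x b * f b)" for x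
  have hs: "((\<lambda>b. refl_kern F N x b * f b) has_sum s x) (ZR N)" for x
    unfolding s_def by (rule has_sum_infsum[OF sm[OF b]])
  have IH: "(k0 N \<beta>L \<beta>R ^^ i) f y = s y" if "y \<in> ZR N" for y
    using Suc.IH[OF that] unfolding s_def F_def .
  have wall: "s (int N) = 0" unfolding s_def using refl_kern_wall[of F N] by (simp add: F_def)
  have "(k0 N \<beta>L \<beta>R ^^ Suc i) f x = of_real \<beta>R * ((if x - 1 \<in> ZR N then s (x - 1) else 0) + s (x + 1)) / 2"
    using Suc.prems IH[of "x - 1"] IH[of "x + 1"] by (simp add: k0_apply_ZR ZR_def)
  also have "(if x - 1 \<in> ZR N then s (x - 1) else 0) = s (x - 1)"
  proof (cases "x - 1 \<in> ZR N")
    case False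
    then have "x - 1 = int N" using Suc.prems by (auto simp: ZR_def)
    then show ?thesis using wall by simp
  qed simp
  also have "of_real \<beta>R * (s (x - 1) + s (x + 1)) / 2 = (\<Sum>\<^sub>\<infinity>b\<in>ZR N. refl_kern (\<lambda>p. of_real (\<beta>R * cos p) ^ Suc i) N x b * f b)"
  proof (rule infsumI[symmetric])
    have e: "(\<lambda>p. complex_of_real (\<beta>R * cos p) ^ Suc i) = (\<lambda>p. of_real \<beta>R * (of_real (cos p) * F p))"
      unfolding F_def by (simp add: mult_ac)
    have "((\<lambda>b. (of_real \<beta>R / 2) * (refl_kern F N (x - 1) b * f b + refl_kern F N (x + 1) b * f b)) has_sum (of_real \<beta>R / 2) * (s (x - 1) + s (x + 1))) (ZR N)"
      by (intro has_sum_cmult_right has_sum_add hs)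
    then show "((\<lambda>b. refl_kern (\<lambda>p. of_real (\<beta>R * cos p) ^ Suc i) N x b * f b) has_sum of_real \<beta>R * (s (x - 1) + s (x + 1)) / 2) (ZR N)"
      unfolding e refl_kern_cmult refl_kern_cos[OF F] by (simp add: algebra_simps add_divide_distrib)
  qed
  finally show ?case .
qed

lemma has_sum_sum:
  fixes f :: "'i \<Rightarrow> 'a \<Rightarrow> complex"
  assumes "\<And>i. i \<in> I \<Longrightarrow> (f i has_sum s i) A"
  shows "((\<lambda>x. \<Sum>i\<in>I. f i x) has_sum (\<Sum>i\<in>I. s i)) A"
proof (cases "finite I")
  case True
  then show ?thesis using assms by (induction I) (auto intro: has_sum_add)
qed simp

lemma polyop_ge_degree:
  assumes "degree P \<le> n"
  shows "polyop P A f x = (\<Sum>i\<le>n. of_real (coeff P i) * (A ^^ i) f x)"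
  unfolding polyop_def
  by (rule sum.mono_neutral_left) (use assms in \<open>auto simp: coeff_eq_0\<close>)

lemma poly_ge_degree:
  fixes P :: "real poly"
  shows "complex_of_real (poly P s) = (\<Sum>i\<le>degree P. of_real (coeff P i) * of_real s ^ i)"
  by (simp add: poly_altdef)

lemma polyop_ZR:
  assumes f: "l2le f c" and x: "x \<in> ZR N"
  shows "polyop P (k0 N \<beta>L \<beta>R) f x = (\<Sum>\<^sub>\<infinity>b\<in>ZR N. refl_kern (\<lambda>p. of_real (poly P (\<beta>R * cos p))) N x b * f b)"
proof (rule infsumI[symmetric])
  define G where "G i = (\<lambda>p. complex_of_real (\<beta>R * cos p) ^ i)" for i
  have G: "continuous_on UNIV (G i)" for i unfolding G_def by (intro continuous_intros)
  have lin: "refl_kern (\<lambda>p. \<Sum>i\<in>I. of_real (coeff P i) * G i p) N x b = (\<Sum>i\<in>I. of_real (coeff P i) * refl_kern (G i) N x b)" if "finite I" for I b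
    using that
  proof (induction I)
    case empty then show ?case by (simp add: refl_kern_def)
  next
    case (insert i I)
    then show ?case
      by (simp, subst refl_kern_add) (auto intro!: continuous_intros G simp: refl_kern_cmult)
  qed
  have hs: "((\<lambda>b. refl_kern (G i) N x b * f b) has_sum (k0 N \<beta>L \<beta>R ^^ i) f x) (ZR N)" for i
    unfolding k0_power_ZR[OF assms] G_def
    by (intro has_sum_infsum refl_kern_summable[OF _ cos_pow_bounded f] continuous_intros)
  have "((\<lambda>b. \<Sum>i\<le>degree P. of_real (coeff P i) * (refl_kern (G i) N x b * f b)) has_sum (\<Sum>i\<le>degree P. of_real (coeff P i) * (k0 N \<beta>L \<beta>R ^^ i) f x)) (ZR N)"
    by (intro has_sum_sum has_sum_cmult_right hs)
  then show "((\<lambda>b. refl_kern (\<lambda>p. of_real (poly P (\<beta>R * cos p))) N x b * f b) has_sum polyop P (k0 N \<beta>L \<beta>R) f x) (ZR N)"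
    unfolding poly_ge_degree polyop_def using lin[of "{..degree P}"] unfolding G_def by (simp add: sum_distrib_right mult.assoc)
qed

text \<open>Uniqueness behind the description operator requires at least one sequence of polynomials
  that converges to g, supplied by Weierstrass approximation; otherwise every c would qualify
  vacuously.\<close>

lemma fcalc_eqI:
  assumes g: "continuous_on {-r..r} g"
    and c: "\<And>P. (\<forall>\<epsilon>>0. \<forall>\<^sub>F k in sequentially. \<forall>s\<in>{-r..r}. \<bar>poly (P k) s - g s\<bar> < \<epsilon>) \<Longrightarrow> (\<lambda>k. polyop (P k) A f x) \<longlonglongrightarrow> c"
  shows "fcalc r g A f x = c"
  unfolding fcalc_def
proof (rule the_equality)
  show "\<forall>P. (\<forall>\<epsilon>>0. \<forall>\<^sub>F k in sequentially. \<forall>s\<in>{-r..r}. \<bar>poly (P k) s - g s\<bar> < \<epsilon>) \<longrightarrow> (\<lambda>k. polyop (P k) A f x) \<longlonglongrightarrow> c"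
    using c by blast
  fix c' assume c': "\<forall>P. (\<forall>\<epsilon>>0. \<forall>\<^sub>F k in sequentially. \<forall>s\<in>{-r..r}. \<bar>poly (P k) s - g s\<bar> < \<epsilon>) \<longrightarrow> (\<lambda>k. polyop (P k) A f x) \<longlonglongrightarrow> c'"
  have "\<exists>P :: real poly. \<forall>s\<in>{-r..r}. \<bar>g s - poly P s\<bar> < 1 / real (Suc k)" for k
  proof -
    have pos: "0 < 1 / real (Suc k)" by simp
    obtain P :: "real poly" where P: "\<And>s. s \<in> {-r..r} \<Longrightarrow> \<bar>g s - poly P s\<bar> < 1 / real (Suc k)"
      by (rule poly_approx[OF g pos], rule that)
    show ?thesis by (rule exI[of _ P]) (use P in blast)
  qed
  then obtain P :: "nat \<Rightarrow> real poly" where P: "\<And>k s. s \<in> {-r..r} \<Longrightarrow> \<bar>g s - poly (P k) s\<bar> < 1 / real (Suc k)" by metis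
  have "\<forall>\<^sub>F k in sequentially. \<forall>s\<in>{-r..r}. \<bar>poly (P k) s - g s\<bar> < \<epsilon>" if "0 < \<epsilon>" for \<epsilon>
  proof -
    have "\<forall>\<^sub>F k in sequentially. 1 / real (Suc k) < \<epsilon>"
      using order_tendstoD(2)[OF LIMSEQ_Suc[OF lim_1_over_n] that] .
    then show ?thesis
    proof eventually_elim
      case (elim k)
      show ?case by (intro ballI) (subst abs_minus_commute, rule less_trans[OF P elim])
    qed
  qed
  then have a: "\<forall>\<epsilon>>0. \<forall>\<^sub>F k in sequentially. \<forall>s\<in>{-r..r}. \<bar>poly (P k) s - g s\<bar> < \<epsilon>" by blast
  show "c' = c" by (rule LIMSEQ_unique[OF c'[rule_format, OF a[rule_format]] c[OF a]])
qed

text \<open>The kernel is linear in its symbol, and its pairing with f is bounded by twice the sup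
  norm of the symbol times the norm of f. Uniform convergence on [-r, r], which contains all values
  \<beta>R cos p, is therefore enough.\<close>

lemma polyop_tendsto_ZR:
  assumes g: "continuous_on UNIV g" and f: "l2le f c" and x: "x \<in> ZR N" and \<beta>: "0 \<le> \<beta>R" "\<beta>R \<le> r"
    and P: "\<forall>\<epsilon>>0. \<forall>\<^sub>F k in sequentially. \<forall>s\<in>{-r..r}. \<bar>poly (P k) s - g s\<bar> < \<epsilon>"
  shows "(\<lambda>k. polyop (P k) (k0 N \<beta>L \<beta>R) f x) \<longlonglongrightarrow> (\<Sum>\<^sub>\<infinity>b\<in>ZR N. refl_kern (\<lambda>p. of_real (g (\<beta>R * cos p))) N x b * f b)"
proof -
  define G where "G = (\<lambda>p. complex_of_real (g (\<beta>R * cos p)))"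
  define Q where "Q k = (\<lambda>p. complex_of_real (poly (P k) (\<beta>R * cos p)))" for k
  have gc: "continuous_on UNIV (\<lambda>p. g (\<beta>R * cos p))"
    by (rule continuous_on_compose2[OF g]) (auto intro!: continuous_intros)
  have G: "continuous_on UNIV G" unfolding G_def by (intro continuous_intros gc)
  have Q: "continuous_on UNIV (Q k)" for k unfolding Q_def by (intro continuous_intros)
  have GQp: "periodic G" "periodic (Q k)" for k by (auto simp: G_def Q_def periodic_def)
  obtain KG where KG: "0 < KG" "\<And>p. cmod (G p) \<le> KG" using cont_periodic_bounded[OF G GQp(1)] by blast
  have in_r: "\<beta>R * cos p \<in> {-r..r}" for p
  proof -
    have "\<bar>\<beta>R * cos p\<bar> \<le> \<beta>R" using mult_left_mono[OF abs_cos_le_one[of p] \<beta>(1)] \<beta>(1) by (simp add: abs_mult)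
    then show ?thesis using \<beta>(2) by auto
  qed
  have c0: "0 \<le> c" by (rule l2le_nonneg[OF f])
  show "(\<lambda>k. polyop (P k) (k0 N \<beta>L \<beta>R) f x) \<longlonglongrightarrow> (\<Sum>\<^sub>\<infinity>b\<in>ZR N. refl_kern (\<lambda>p. of_real (g (\<beta>R * cos p))) N x b * f b)"
  proof (rule tendstoI)
    fix e :: real assume e: "0 < e"
    define d where "d = e / (2 * (c + 1))"
    have d: "0 < d" using e c0 by (simp add: d_def)
    have dc: "(d + d) * c < e"
    proof -
      have "d + d = e / (c + 1)" unfolding d_def using c0 by (simp add: divide_simps)
      then have "(d + d) * c = e * (c / (c + 1))" by simp
      also have "\<dots> < e * 1" using e c0 by (intro mult_strict_left_mono) auto
      finally show ?thesis by simp
    qed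
    from P d have "\<forall>\<^sub>F k in sequentially. \<forall>s\<in>{-r..r}. \<bar>poly (P k) s - g s\<bar> < d" by blast
    then show "\<forall>\<^sub>F k in sequentially. dist (polyop (P k) (k0 N \<beta>L \<beta>R) f x) (\<Sum>\<^sub>\<infinity>b\<in>ZR N. refl_kern (\<lambda>p. of_real (g (\<beta>R * cos p))) N x b * f b) < e"
    proof eventually_elim
      case (elim k)
      obtain KQ where KQ: "0 < KQ" "\<And>p. cmod (Q k p) \<le> KQ" using cont_periodic_bounded[OF Q GQp(2)] by blast
      have D: "continuous_on UNIV (\<lambda>p. Q k p - G p)" by (intro continuous_intros G Q)
      have Db: "cmod (Q k p - G p) \<le> d" for p
        using bspec[OF elim in_r[of p]] unfolding Q_def G_def of_real_diff[symmetric] norm_of_real by (rule less_imp_le)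
      have "((\<lambda>b. refl_kern (Q k) N x b * f b + - (refl_kern G N x b * f b)) has_sum ((\<Sum>\<^sub>\<infinity>b\<in>ZR N. refl_kern (Q k) N x b * f b) + - (\<Sum>\<^sub>\<infinity>b\<in>ZR N. refl_kern G N x b * f b))) (ZR N)"
        by (intro has_sum_add has_sum_uminusI has_sum_infsum refl_kern_summable[OF Q KQ(2) f] refl_kern_summable[OF G KG(2) f])
      moreover have "(\<lambda>b. refl_kern (Q k) N x b * f b + - (refl_kern G N x b * f b)) = (\<lambda>b. refl_kern (\<lambda>p. Q k p - G p) N x b * f b)"
        by (simp add: refl_kern_diff Q G left_diff_distrib)
      ultimately have "(\<Sum>\<^sub>\<infinity>b\<in>ZR N. refl_kern (Q k) N x b * f b) - (\<Sum>\<^sub>\<infinity>b\<in>ZR N. refl_kern G N x b * f b) = (\<Sum>\<^sub>\<infinity>b\<in>ZR N. refl_kern (\<lambda>p. Q k p - G p) N x b * f b)"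
        by (simp add: infsumI)
      then show ?case using refl_kern_bound[OF D Db f, of N x "ZR N"] dc
        unfolding dist_norm polyop_ZR[OF f x] Q_def G_def by simp
    qed
  qed
qed

text \<open>On the sample \<open>k0\<close> gives 0, so only the constant terms of the polynomials
  survive.\<close>

lemma polyop_tendsto_ZS:
  assumes x: "x \<in> ZS N" and r: "0 \<le> r"
    and P: "\<forall>\<epsilon>>0. \<forall>\<^sub>F k in sequentially. \<forall>s\<in>{-r..r}. \<bar>poly (P k) s - g s\<bar> < \<epsilon>"
  shows "(\<lambda>k. polyop (P k) (k0 N \<beta>L \<beta>R) f x) \<longlonglongrightarrow> of_real (g 0) * f x"
proof -
  have z: "(k0 N \<beta>L \<beta>R ^^ i) f x = (if i = 0 then f x else 0)" for i
    by (cases i) (auto simp: k0_apply_ZS[OF x])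
  have "polyop (P k) (k0 N \<beta>L \<beta>R) f x = of_real (poly (P k) 0) * f x" for k
  proof -
    have "polyop (P k) (k0 N \<beta>L \<beta>R) f x = (\<Sum>i\<le>degree (P k). if i = 0 then of_real (coeff (P k) 0) * f x else 0)"
      unfolding polyop_def z by (rule sum.cong) auto
    then show ?thesis by (simp add: poly_0_coeff_0)
  qed
  moreover have "(\<lambda>k. poly (P k) 0) \<longlonglongrightarrow> g 0"
  proof (rule tendstoI)
    fix e :: real assume "0 < e"
    with P have "\<forall>\<^sub>F k in sequentially. \<forall>s\<in>{-r..r}. \<bar>poly (P k) s - g s\<bar> < e" by blast
    then show "\<forall>\<^sub>F k in sequentially. dist (poly (P k) 0) (g 0) < e"
      by eventually_elim (use r in \<open>auto simp: dist_real_def\<close>)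
  qed
  ultimately show "(\<lambda>k. polyop (P k) (k0 N \<beta>L \<beta>R) f x) \<longlonglongrightarrow> of_real (g 0) * f x"
    by (simp only:) (intro tendsto_intros)
qed

lemma polyop_reflect: "polyop P (k0 N \<beta>L \<beta>R) f x = polyop P (k0 N \<beta>R \<beta>L) (\<lambda>x. f (- x)) (- x)"
  unfolding polyop_def using k0_power_reflect[where x = "- x" and f = f] by simp

text \<open>Reduces \<open>s0p\<close> to \<open>s0m\<close>, as the Fermi functions of s and of -s
  add up to 1.\<close>

lemma fcalc_compl:
  assumes g: "continuous_on UNIV g" and c: "\<And>P. (\<forall>\<epsilon>>0. \<forall>\<^sub>F k in sequentially. \<forall>s\<in>{-r..r}. \<bar>poly (P k) s - g s\<bar> < \<epsilon>) \<Longrightarrow> (\<lambda>k. polyop (P k) A f x) \<longlonglongrightarrow> c"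
  shows "fcalc r (\<lambda>s. 1 - g s) A f x = f x - c"
proof (rule fcalc_eqI)
  show "continuous_on {-r..r} (\<lambda>s. 1 - g s)" using g continuous_on_subset by (intro continuous_intros) blast
  fix P :: "nat \<Rightarrow> real poly"
  assume P: "\<forall>\<epsilon>>0. \<forall>\<^sub>F k in sequentially. \<forall>s\<in>{-r..r}. \<bar>poly (P k) s - (1 - g s)\<bar> < \<epsilon>"
  have "\<bar>poly (1 - P k) s - g s\<bar> = \<bar>poly (P k) s - (1 - g s)\<bar>" for k s by simp
  then have "\<forall>\<epsilon>>0. \<forall>\<^sub>F k in sequentially. \<forall>s\<in>{-r..r}. \<bar>poly (1 - P k) s - g s\<bar> < \<epsilon>" using P by simp
  from c[OF this] have "(\<lambda>k. polyop (1 - P k) A f x) \<longlonglongrightarrow> c" .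
  moreover have "polyop (1 - P k) A f x = f x - polyop (P k) A f x" for k
  proof -
    define n where "n = degree (P k)"
    have d: "degree (1 - P k) \<le> n" unfolding n_def by (rule degree_diff_le) auto
    have "polyop (1 - P k) A f x = (\<Sum>i\<le>n. (if i = 0 then f x else 0) - of_real (coeff (P k) i) * (A ^^ i) f x)"
      unfolding polyop_ge_degree[OF d] by (rule sum.cong) (auto simp: algebra_simps)
    then show ?thesis unfolding polyop_def sum_subtractf n_def by simp
  qed
  ultimately have "(\<lambda>k. f x - (f x - polyop (P k) A f x)) \<longlonglongrightarrow> f x - c" by (intro tendsto_intros) simp
  then show "(\<lambda>k. polyop (P k) A f x) \<longlonglongrightarrow> f x - c" by simp
qed

definition fermi :: "real \<Rightarrow> real \<Rightarrow> complex" where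
  "fermi \<beta> p = of_real (1 / (1 + exp (- (\<beta> * cos p))))"

text \<open>The factor 1/2 on the sample is the Fermi function at energy 0; the left reservoir is
  mirrored onto the right half line.\<close>

definition s0_val :: "nat \<Rightarrow> real \<Rightarrow> real \<Rightarrow> (int \<Rightarrow> complex) \<Rightarrow> int \<Rightarrow> complex" where
  "s0_val N \<beta>L \<beta>R f x =
    (if x \<in> ZR N then \<Sum>\<^sub>\<infinity>b\<in>ZR N. refl_kern (fermi \<beta>R) N x b * f b
     else if x \<in> ZS N then f x / 2
     else \<Sum>\<^sub>\<infinity>b\<in>ZR N. refl_kern (fermi \<beta>L) N (- x) b * f (- b))"

lemma fermi_fun_cont: "continuous_on UNIV (\<lambda>s::real. 1 / (1 + exp (- s)))"
  by (intro continuous_intros) (simp add: add_nonneg_eq_0_iff)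

lemma polyop_tendsto_fermi:
  assumes f: "l2le f c" and \<beta>: "0 < \<beta>L" "0 < \<beta>R"
    and P: "\<forall>\<epsilon>>0. \<forall>\<^sub>F k in sequentially. \<forall>s\<in>{-(\<beta>L + \<beta>R)..\<beta>L + \<beta>R}. \<bar>poly (P k) s - 1 / (1 + exp (- s))\<bar> < \<epsilon>"
  shows "(\<lambda>k. polyop (P k) (k0 N \<beta>L \<beta>R) f x) \<longlonglongrightarrow> s0_val N \<beta>L \<beta>R f x"
proof -
  have "x \<in> ZR N \<or> x \<in> ZS N \<or> - x \<in> ZR N" by (simp add: ZR_def ZS_def) linarith
  then consider "x \<in> ZR N" | "x \<in> ZS N" "x \<notin> ZR N" | "x \<notin> ZR N" "x \<notin> ZS N" "- x \<in> ZR N"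
    by blast
  then show ?thesis
  proof cases
    case 1
    show ?thesis using polyop_tendsto_ZR[OF fermi_fun_cont f 1 _ _ P] \<beta> 1 unfolding s0_val_def fermi_def by simp
  next
    case 2
    show ?thesis using polyop_tendsto_ZS[OF 2(1) _ P] \<beta> 2 unfolding s0_val_def by simp
  next
    case 3
    have f': "l2le (\<lambda>x. f (- x)) c" by (rule l2le_reindex[OF f]) (auto simp: inj_def)
    show ?thesis unfolding polyop_reflect[of _ N \<beta>L]
      using polyop_tendsto_ZR[OF fermi_fun_cont f' 3(3) _ _ P, of \<beta>L \<beta>R] \<beta> 3 unfolding s0_val_def fermi_def by simp
  qed
qed

lemma s0m_eq:
  assumes "l2le f c" "0 < \<beta>L" "0 < \<beta>R"
  shows "s0m N \<beta>L \<beta>R f x = s0_val N \<beta>L \<beta>R f x"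
  unfolding s0m_def
  by (rule fcalc_eqI) (rule continuous_on_subset[OF fermi_fun_cont subset_UNIV], rule polyop_tendsto_fermi[OF assms])

lemma s0p_eq:
  assumes "l2le f c" "0 < \<beta>L" "0 < \<beta>R"
  shows "s0p N \<beta>L \<beta>R f x = f x - s0_val N \<beta>L \<beta>R f x"
proof -
  have e: "1 / (1 + exp s) = 1 - 1 / (1 + exp (- s))" for s :: real
  proof -
    have "1 + exp s \<noteq> 0" "1 + exp (- s) \<noteq> 0" using exp_gt_zero[of s] exp_gt_zero[of "- s"] by linarith+
    then show ?thesis by (simp add: field_simps exp_minus)
  qed
  have e': "(\<lambda>s::real. 1 / (1 + exp s)) = (\<lambda>s. 1 - 1 / (1 + exp (- s)))" by (rule ext) (rule e)
  show ?thesis unfolding s0p_def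
    by (subst e', rule fcalc_compl[OF fermi_fun_cont polyop_tendsto_fermi[OF assms]])
qed

section \<open>Long-time limit of the two-point function\<close>

text \<open>Dominated convergence for sums: one finite set J carries all of g up to e/4, and hence
  all of each sum and of the limit up to e/4.\<close>

lemma tannery_infsum:
  fixes f :: "real \<Rightarrow> 'a \<Rightarrow> complex"
  assumes lim: "\<And>a. a \<in> A \<Longrightarrow> ((\<lambda>t. f t a) \<longlongrightarrow> l a) F" and dom: "\<And>t a. a \<in> A \<Longrightarrow> cmod (f t a) \<le> g a"
    and g: "g summable_on A" and F: "F \<noteq> bot"
  shows "((\<lambda>t. \<Sum>\<^sub>\<infinity>a\<in>A. f t a) \<longlongrightarrow> (\<Sum>\<^sub>\<infinity>a\<in>A. l a)) F"
proof (rule tendstoI)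
  fix e :: real assume e: "0 < e"
  have g0: "0 \<le> g a" if "a \<in> A" for a using dom[OF that] norm_ge_zero order_trans by blast
  have ld: "cmod (l a) \<le> g a" if "a \<in> A" for a
    by (rule tendsto_upperbound[OF tendsto_norm[OF lim[OF that]]]) (use dom[OF that] F in auto)
  have fs: "(\<lambda>a. cmod (f t a)) summable_on B" if "B \<subseteq> A" for t B
    by (rule summable_on_comparison_test[OF summable_on_subset_banach[OF g that]]) (use dom that in auto)
  have ls: "(\<lambda>a. cmod (l a)) summable_on B" if "B \<subseteq> A" for B
    by (rule summable_on_comparison_test[OF summable_on_subset_banach[OF g that]]) (use ld that in auto)
  have e4: "0 < e / 4" using e by simp
  obtain J where J: "finite J" "J \<subseteq> A" "dist (sum g J) (infsum g A) \<le> e / 4"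
    using infsum_finite_approximation[OF g e4] by blast
  have tail: "infsum g (A - J) \<le> e / 4"
  proof -
    have "infsum g A = sum g J + infsum g (A - J)"
      using infsum_Un_disjoint[of g J "A - J"] J summable_on_subset_banach[OF g, of "A - J"]
      by (simp add: Un_absorb1)
    then show ?thesis using J(3) by (simp add: dist_real_def)
  qed
  have split: "infsum h A = sum h J + infsum h (A - J)" "cmod (infsum h (A - J)) \<le> e / 4"
    if h: "\<And>B. B \<subseteq> A \<Longrightarrow> (\<lambda>a. cmod (h a)) summable_on B" and hd: "\<And>a. a \<in> A \<Longrightarrow> cmod (h a) \<le> g a" for h :: "'a \<Rightarrow> complex"
  proof -
    have "h summable_on (A - J)" by (rule abs_summable_summable[OF h]) auto
    then show "infsum h A = sum h J + infsum h (A - J)"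
      using infsum_Un_disjoint[of h J "A - J"] J by (simp add: Un_absorb1)
    have "cmod (infsum h (A - J)) \<le> infsum (\<lambda>a. cmod (h a)) (A - J)"
      by (rule norm_infsum_bound[OF h]) auto
    also have "\<dots> \<le> infsum g (A - J)"
      by (rule infsum_mono[OF h summable_on_subset_banach[OF g]]) (use hd in auto)
    finally show "cmod (infsum h (A - J)) \<le> e / 4" using tail by linarith
  qed
  have "((\<lambda>t. sum (f t) J) \<longlongrightarrow> sum l J) F" by (rule tendsto_sum) (use lim J in auto)
  from tendstoD[OF this e4] show "\<forall>\<^sub>F t in F. dist (\<Sum>\<^sub>\<infinity>a\<in>A. f t a) (\<Sum>\<^sub>\<infinity>a\<in>A. l a) < e"
  proof eventually_elim
    case (elim t)
    have 1: "infsum (f t) A = sum (f t) J + infsum (f t) (A - J)" "cmod (infsum (f t) (A - J)) \<le> e / 4"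
      by (rule split; use fs dom in blast)+
    have 2: "infsum l A = sum l J + infsum l (A - J)" "cmod (infsum l (A - J)) \<le> e / 4"
      by (rule split; use ls ld in blast)+
    have "infsum (f t) A - infsum l A = (sum (f t) J - sum l J) + (infsum (f t) (A - J) - infsum l (A - J))"
      unfolding 1(1) 2(1) by simp
    also have "cmod \<dots> \<le> cmod (sum (f t) J - sum l J) + (cmod (infsum (f t) (A - J)) + cmod (infsum l (A - J)))"
      by (intro order_trans[OF norm_triangle_ineq] add_mono norm_triangle_ineq4 order_refl)
    also have "\<dots> < e" using elim 1(2) 2(2) e unfolding dist_norm by linarith
    finally show ?case unfolding dist_norm .
  qed
qed

section \<open>Quadratic forms of the initial density\<close>

definition rst :: "nat \<Rightarrow> (int \<Rightarrow> complex) \<Rightarrow> int \<Rightarrow> complex" where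
  "rst N f a = (if a \<in> ZR N then f a else 0)"

lemma rst_l2le: "l2le f c \<Longrightarrow> l2le (rst N f) c"
  unfolding rst_def by (rule l2le_restrict)

text \<open>Pairs (a, b) sorted by the index m of the Fourier coefficient in
  \<open>refl_kern\<close>: m = a - b in the direct term and m = a + b - 2N in the image
  term.\<close>

definition dform :: "nat \<Rightarrow> int \<Rightarrow> (int \<Rightarrow> complex) \<Rightarrow> (int \<Rightarrow> complex) \<Rightarrow> complex" where
  "dform N m f g = (\<Sum>\<^sub>\<infinity>a. cnj (rst N f a) * (rst N g (a - m) - rst N g (m + 2 * int N - a)))"

text \<open>The outer sum runs over the Fourier index, so that the limit in time can be taken for
  each m separately, dominated by the summable coefficients of F.\<close>

definition rform :: "(real \<Rightarrow> complex) \<Rightarrow> nat \<Rightarrow> (int \<Rightarrow> complex) \<Rightarrow> (int \<Rightarrow> complex) \<Rightarrow> complex" where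
  "rform F N f g = (\<Sum>\<^sub>\<infinity>m. fc F m * dform N m f g)"

text \<open>Young's inequality for l1 and l2: by Cauchy-Schwarz the inner sums are bounded uniformly
  in m, so summable weights make the double series absolutely convergent.\<close>

lemma young_has_sum:
  fixes f :: "'a \<Rightarrow> complex" and u :: "int \<Rightarrow> 'a \<Rightarrow> complex"
  assumes f: "l2le f c" and u: "\<And>m. l2le (u m) d" and w: "(\<lambda>m. cmod (w m)) summable_on UNIV"
  shows "((\<lambda>(m, a). w m * (cnj (f a) * u m a)) has_sum (\<Sum>\<^sub>\<infinity>m. w m * (\<Sum>\<^sub>\<infinity>a. cnj (f a) * u m a))) (UNIV \<times> UNIV)"
    and "((\<lambda>m. w m * (\<Sum>\<^sub>\<infinity>a. cnj (f a) * u m a)) has_sum (\<Sum>\<^sub>\<infinity>m. w m * (\<Sum>\<^sub>\<infinity>a. cnj (f a) * u m a))) UNIV"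
proof -
  have cd: "0 \<le> c * d" using l2le_nonneg[OF f] l2le_nonneg[OF u] by simp
  have a: "((\<lambda>a. cmod (w m * (cnj (f a) * u m a))) has_sum cmod (w m) * (\<Sum>\<^sub>\<infinity>a. cmod (cnj (f a) * u m a))) UNIV" for m
    unfolding norm_mult[of "w m"] by (intro has_sum_cmult_right has_sum_infsum l2le_abs_summable[OF f u])
  have b: "(\<lambda>m. cmod (w m) * (\<Sum>\<^sub>\<infinity>a. cmod (cnj (f a) * u m a))) summable_on UNIV"
  proof (rule summable_on_comparison_test[OF summable_on_cmult_left[OF w, of "c * d"]])
    fix m
    have "(\<Sum>\<^sub>\<infinity>a. cmod (cnj (f a) * u m a)) \<le> c * d"
      by (rule infsum_le_finite_sums[OF l2le_abs_summable[OF f u]])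
        (auto simp: norm_mult intro: l2le_CS_finite[OF f u])
    then show "cmod (w m) * (\<Sum>\<^sub>\<infinity>a. cmod (cnj (f a) * u m a)) \<le> cmod (w m) * (c * d)" by (rule mult_left_mono) simp
    show "0 \<le> cmod (w m) * (\<Sum>\<^sub>\<infinity>a. cmod (cnj (f a) * u m a))" by (intro mult_nonneg_nonneg infsum_nonneg) auto
  qed
  have sm: "(\<lambda>(m, a). w m * (cnj (f a) * u m a)) summable_on (UNIV \<times> UNIV)" by (rule double_summable[OF a b])
  have hs: "((\<lambda>(m, a). w m * (cnj (f a) * u m a)) has_sum infsum (\<lambda>(m, a). w m * (cnj (f a) * u m a)) (UNIV \<times> UNIV)) (UNIV \<times> UNIV)"
    by (rule has_sum_infsum[OF sm])
  have row: "((\<lambda>m. w m * (\<Sum>\<^sub>\<infinity>a. cnj (f a) * u m a)) has_sum infsum (\<lambda>(m, a). w m * (cnj (f a) * u m a)) (UNIV \<times> UNIV)) UNIV"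
  proof (rule has_sum_SigmaD[OF hs])
    fix m :: int
    show "((\<lambda>a. (case (m, a) of (m, a) \<Rightarrow> w m * (cnj (f a) * u m a))) has_sum w m * (\<Sum>\<^sub>\<infinity>a. cnj (f a) * u m a)) UNIV"
      unfolding prod.case by (intro has_sum_cmult_right has_sum_infsum l2le_summable[OF f u])
  qed
  show "((\<lambda>(m, a). w m * (cnj (f a) * u m a)) has_sum (\<Sum>\<^sub>\<infinity>m. w m * (\<Sum>\<^sub>\<infinity>a. cnj (f a) * u m a))) (UNIV \<times> UNIV)"
    using hs infsumI[OF row] by simp
  show "((\<lambda>m. w m * (\<Sum>\<^sub>\<infinity>a. cnj (f a) * u m a)) has_sum (\<Sum>\<^sub>\<infinity>m. w m * (\<Sum>\<^sub>\<infinity>a. cnj (f a) * u m a))) UNIV"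
    using row infsumI[OF row] by simp
qed

lemma dform_split:
  assumes f: "l2le f c" and g: "l2le g d"
  shows "dform N m f g = (\<Sum>\<^sub>\<infinity>a. cnj (rst N f a) * rst N g (a - m)) - (\<Sum>\<^sub>\<infinity>a. cnj (rst N f a) * rst N g (m + 2 * int N - a))"
proof -
  have 1: "l2le (\<lambda>a. rst N g (a - m)) d" "l2le (\<lambda>a. rst N g (m + 2 * int N - a)) d"
    by (rule l2le_reindex[OF rst_l2le[OF g]], auto simp: inj_def)+
  have "((\<lambda>a. cnj (rst N f a) * rst N g (a - m) + - (cnj (rst N f a) * rst N g (m + 2 * int N - a))) has_sum
    (\<Sum>\<^sub>\<infinity>a. cnj (rst N f a) * rst N g (a - m)) + - (\<Sum>\<^sub>\<infinity>a. cnj (rst N f a) * rst N g (m + 2 * int N - a))) UNIV"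
    by (intro has_sum_add has_sum_uminusI has_sum_infsum l2le_summable[OF rst_l2le[OF f] 1(1)] l2le_summable[OF rst_l2le[OF f] 1(2)])
  from infsumI[OF this] show ?thesis unfolding dform_def by (simp add: right_diff_distrib)
qed

lemma dform_bound:
  assumes f: "l2le f c" and g: "l2le g d"
  shows "cmod (dform N m f g) \<le> c * (d + d)"
proof -
  have 1: "l2le (\<lambda>a. rst N g (a - m)) d" "l2le (\<lambda>a. rst N g (m + 2 * int N - a)) d"
    by (rule l2le_reindex[OF rst_l2le[OF g]], auto simp: inj_def)+
  show ?thesis unfolding dform_def by (rule l2le_CS[OF rst_l2le[OF f] l2le_diff[OF 1]])
qed

lemma rform_bound:
  assumes f: "l2le f c" and g: "l2le g d" and F: "(\<lambda>m. cmod (fc F m)) summable_on UNIV"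
  shows "cmod (rform F N f g) \<le> (\<Sum>\<^sub>\<infinity>m. cmod (fc F m)) * (c * (d + d))"
proof -
  have s: "(\<lambda>m. cmod (fc F m * dform N m f g)) summable_on UNIV"
    by (rule bounded_mult_summable[OF F dform_bound[OF f g]])
  have "cmod (rform F N f g) \<le> (\<Sum>\<^sub>\<infinity>m. cmod (fc F m * dform N m f g))"
    unfolding rform_def by (rule norm_infsum_bound[OF s])
  also have "\<dots> \<le> (\<Sum>\<^sub>\<infinity>m. cmod (fc F m) * (c * (d + d)))"
    by (rule infsum_mono[OF s summable_on_cmult_left[OF F]]) (simp only: norm_mult, rule mult_left_mono[OF dform_bound[OF f g] norm_ge_zero])
  also have "\<dots> = (\<Sum>\<^sub>\<infinity>m. cmod (fc F m)) * (c * (d + d))" by (rule infsum_cmult_left) (use F in auto)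
  finally show ?thesis .
qed

text \<open>Change of variables from (m, a) back to (a, b), separately for the direct and the image
  term; any order of summation can then be taken from one unordered double sum.\<close>

lemma pair_has_sum:
  assumes f: "l2le f c" and g: "l2le g d" and F: "(\<lambda>m. cmod (fc F m)) summable_on UNIV"
  shows "((\<lambda>(a, b). cnj (rst N f a) * refl_kern F N a b * rst N g b) has_sum rform F N f g) (UNIV \<times> UNIV)"
proof -
  have 1: "l2le (\<lambda>a. rst N g (a - m)) d" "l2le (\<lambda>a. rst N g (m + 2 * int N - a)) d" for m
    by (rule l2le_reindex[OF rst_l2le[OF g]], auto simp: inj_def)+
  define S1 where "S1 = (\<Sum>\<^sub>\<infinity>m. fc F m * (\<Sum>\<^sub>\<infinity>a. cnj (rst N f a) * rst N g (a - m)))"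
  define S2 where "S2 = (\<Sum>\<^sub>\<infinity>m. fc F m * (\<Sum>\<^sub>\<infinity>a. cnj (rst N f a) * rst N g (m + 2 * int N - a)))"
  have y1: "((\<lambda>(m, a). fc F m * (cnj (rst N f a) * rst N g (a - m))) has_sum S1) (UNIV \<times> UNIV)"
    "((\<lambda>m. fc F m * (\<Sum>\<^sub>\<infinity>a. cnj (rst N f a) * rst N g (a - m))) has_sum S1) UNIV"
    unfolding S1_def by (rule young_has_sum[OF rst_l2le[OF f] 1(1) F])+
  have y2: "((\<lambda>(m, a). fc F m * (cnj (rst N f a) * rst N g (m + 2 * int N - a))) has_sum S2) (UNIV \<times> UNIV)"
    "((\<lambda>m. fc F m * (\<Sum>\<^sub>\<infinity>a. cnj (rst N f a) * rst N g (m + 2 * int N - a))) has_sum S2) UNIV"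
    unfolding S2_def by (rule young_has_sum[OF rst_l2le[OF f] 1(2) F])+
  have "rform F N f g = S1 + - S2"
    unfolding rform_def
    by (rule infsumI, rule has_sum_cong[THEN iffD1, OF _ has_sum_add[OF y1(2) has_sum_uminusI[OF y2(2)]]])
      (simp add: dform_split[OF f g] right_diff_distrib)
  moreover have "((\<lambda>(a, b). cnj (rst N f a) * fc F (a - b) * rst N g b) has_sum S1) (UNIV \<times> UNIV)"
  proof (rule has_sum_cong[THEN iffD1, OF _ has_sum_reindex_bij_betw[THEN iffD2, OF _ y1(1)]])
    show "bij_betw (\<lambda>(a, b). (a - b, a)) (UNIV \<times> UNIV) (UNIV \<times> (UNIV :: int set))"
      by (rule bij_betw_byWitness[where f' = "\<lambda>(m, a). (a, a - m)"]) auto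
  qed auto
  moreover have "((\<lambda>(a, b). cnj (rst N f a) * fc F (a + b - 2 * int N) * rst N g b) has_sum S2) (UNIV \<times> UNIV)"
  proof (rule has_sum_cong[THEN iffD1, OF _ has_sum_reindex_bij_betw[THEN iffD2, OF _ y2(1)]])
    show "bij_betw (\<lambda>(a, b). (a + b - 2 * int N, a)) (UNIV \<times> UNIV) (UNIV \<times> (UNIV :: int set))"
      by (rule bij_betw_byWitness[where f' = "\<lambda>(m, a). (a, m + 2 * int N - a)"]) auto
  qed auto
  ultimately show ?thesis
    by (simp only:) (rule has_sum_cong[THEN iffD1, OF _ has_sum_add[OF _ has_sum_uminusI]],
      auto simp: refl_kern_def algebra_simps)
qed

text \<open>Summation over b first is the order in which the density is applied before the inner
  product is taken.\<close>

lemma row_has_sum: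
  assumes f: "l2le f c" and g: "l2le g d" and F: "(\<lambda>m. cmod (fc F m)) summable_on UNIV"
    and Fc: "continuous_on UNIV F" "periodic F"
  shows "((\<lambda>a. cnj (f a) * (\<Sum>\<^sub>\<infinity>b\<in>ZR N. refl_kern F N a b * g b)) has_sum rform F N f g) (ZR N)"
proof -
  obtain K where K: "0 < K" "\<And>p. cmod (F p) \<le> K" using cont_periodic_bounded[OF Fc] by blast
  have "((\<lambda>a. cnj (rst N f a) * (\<Sum>\<^sub>\<infinity>b\<in>ZR N. refl_kern F N a b * g b)) has_sum rform F N f g) UNIV"
  proof (rule has_sum_SigmaD[OF pair_has_sum[OF f g F]])
    fix a
    have "((\<lambda>b. refl_kern F N a b * g b) has_sum (\<Sum>\<^sub>\<infinity>b\<in>ZR N. refl_kern F N a b * g b)) (ZR N)"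
      by (rule has_sum_infsum[OF refl_kern_summable[OF Fc(1) K(2) g]])
    then have "((\<lambda>b. refl_kern F N a b * rst N g b) has_sum (\<Sum>\<^sub>\<infinity>b\<in>ZR N. refl_kern F N a b * g b)) UNIV"
      by (rule has_sum_cong_neutral[THEN iffD1, rotated 3]) (auto simp: rst_def)
    from has_sum_cmult_right[OF this, of "cnj (rst N f a)"]
    show "((\<lambda>b. case (a, b) of (a, b) \<Rightarrow> cnj (rst N f a) * refl_kern F N a b * rst N g b) has_sum cnj (rst N f a) * (\<Sum>\<^sub>\<infinity>b\<in>ZR N. refl_kern F N a b * g b)) UNIV"
      by (simp add: mult.assoc)
  qed
  then show ?thesis by (rule has_sum_cong_neutral[THEN iffD1, rotated 3]) (auto simp: rst_def)
qed

text \<open>The form of the initial density between f and g, as \<open>sform_has_sum\<close> shows,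
  arranged so that limits in time can be taken.\<close>

definition sform :: "nat \<Rightarrow> real \<Rightarrow> real \<Rightarrow> (int \<Rightarrow> complex) \<Rightarrow> (int \<Rightarrow> complex) \<Rightarrow> complex" where
  "sform N \<beta>L \<beta>R f g = rform (fermi \<beta>R) N f g + ((\<Sum>a\<in>ZS N. cnj (f a) * g a / 2) + rform (fermi \<beta>L) N (\<lambda>x. f (- x)) (\<lambda>x. g (- x)))"

lemma one_plus_exp_neq_0: "1 + exp (x::real) \<noteq> 0"
  using exp_gt_zero[of x] by linarith

lemma fermi_cont: "continuous_on UNIV (fermi \<beta>)"
  unfolding fermi_def by (intro continuous_intros ballI one_plus_exp_neq_0)

lemma fermi_periodic: "periodic (fermi \<beta>)" by (simp add: periodic_def fermi_def)

lemma fermi_even: "fermi \<beta> (- p) = fermi \<beta> p" by (simp add: fermi_def)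

definition rfermi :: "real \<Rightarrow> real \<Rightarrow> real" where
  "rfermi \<beta> p = 1 / (1 + exp (- (\<beta> * cos p)))"

lemma fermi_rfermi: "fermi \<beta> p = of_real (rfermi \<beta> p)"
  unfolding fermi_def rfermi_def ..

lemma rfermi_deriv:
  "\<exists>D. continuous_on UNIV D \<and> (\<forall>p. (rfermi \<beta> has_real_derivative D p) (at p))"
proof -
  define D where "D p = - (exp (- (\<beta> * cos p)) * (\<beta> * sin p)) / (1 + exp (- (\<beta> * cos p)))\<^sup>2" for p
  have "(rfermi \<beta> has_real_derivative D p) (at p)" for p
    unfolding D_def rfermi_def using one_plus_exp_neq_0[of "- (\<beta> * cos p)"]
    by (auto intro!: derivative_eq_intros simp: power2_eq_square)
  moreover have "continuous_on UNIV D"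
    unfolding D_def by (intro continuous_intros ballI) (use one_plus_exp_neq_0 in auto)
  ultimately show ?thesis by blast
qed

lemma fermi_deriv:
  "\<exists>F'. continuous_on UNIV F' \<and> (\<forall>p. (fermi \<beta> has_vector_derivative F' p) (at p))"
proof -
  obtain D where D: "continuous_on UNIV D" "\<And>p. (rfermi \<beta> has_real_derivative D p) (at p)" using rfermi_deriv by blast
  have "(fermi \<beta> has_vector_derivative of_real (D p)) (at p)" for p
    unfolding fermi_rfermi[abs_def] by (rule has_vector_derivative_of_real[OF D(2)])
  moreover have "continuous_on UNIV (\<lambda>p. complex_of_real (D p))" by (intro continuous_intros D(1))
  ultimately show ?thesis by blast
qed

lemma fermi_summable: "(\<lambda>m. cmod (fc (fermi \<beta>) m)) summable_on UNIV"
proof -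
  obtain F' where F': "continuous_on UNIV F'" "\<forall>p. (fermi \<beta> has_vector_derivative F' p) (at p)" using fermi_deriv by blast
  show ?thesis by (rule fc_summable[OF F'(2)[rule_format] F'(1) fermi_periodic])
qed

lemma ZS_finite: "finite (ZS N)"
proof -
  have "ZS N = {- int N..int N}" by (auto simp: ZS_def)
  then show ?thesis by simp
qed

lemma sform_has_sum:
  assumes f: "l2le f c" and g: "l2le g d"
  shows "((\<lambda>x. cnj (f x) * s0_val N \<beta>L \<beta>R g x) has_sum sform N \<beta>L \<beta>R f g) UNIV"
proof -
  have f': "l2le (\<lambda>x. f (- x)) c" by (rule l2le_reindex[OF f]) (auto simp: inj_def)
  have g': "l2le (\<lambda>x. g (- x)) d" by (rule l2le_reindex[OF g]) (auto simp: inj_def)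
  have R: "((\<lambda>x. cnj (f x) * s0_val N \<beta>L \<beta>R g x) has_sum rform (fermi \<beta>R) N f g) (ZR N)"
    by (rule has_sum_cong[THEN iffD1, OF _ row_has_sum[OF f g fermi_summable fermi_cont fermi_periodic]]) (simp add: s0_val_def)
  have S: "((\<lambda>x. cnj (f x) * s0_val N \<beta>L \<beta>R g x) has_sum (\<Sum>a\<in>ZS N. cnj (f a) * g a / 2)) (ZS N)"
    by (rule has_sum_finiteI[OF ZS_finite], rule sum.cong) (auto simp: s0_val_def ZR_def ZS_def)
  have "((\<lambda>x. cnj (f (- x)) * s0_val N \<beta>L \<beta>R g (- x)) has_sum rform (fermi \<beta>L) N (\<lambda>x. f (- x)) (\<lambda>x. g (- x))) (ZR N)"
    by (rule has_sum_cong[THEN iffD1, OF _ row_has_sum[OF f' g' fermi_summable fermi_cont fermi_periodic]])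
      (auto simp: s0_val_def ZR_def ZS_def)
  moreover have "bij_betw uminus (ZR N) (ZL N)"
    by (rule bij_betw_byWitness[where f' = uminus]) (auto simp: ZR_def ZL_def)
  ultimately have L: "((\<lambda>x. cnj (f x) * s0_val N \<beta>L \<beta>R g x) has_sum rform (fermi \<beta>L) N (\<lambda>x. f (- x)) (\<lambda>x. g (- x))) (ZL N)"
    using has_sum_reindex_bij_betw[of uminus "ZR N" "ZL N" "\<lambda>x. cnj (f x) * s0_val N \<beta>L \<beta>R g x"] by simp
  have SL: "((\<lambda>x. cnj (f x) * s0_val N \<beta>L \<beta>R g x) has_sum ((\<Sum>a\<in>ZS N. cnj (f a) * g a / 2) + rform (fermi \<beta>L) N (\<lambda>x. f (- x)) (\<lambda>x. g (- x)))) (ZS N \<union> ZL N)"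
    by (rule has_sum_Un_disjoint[OF S L]) (auto simp: ZS_def ZL_def)
  have "((\<lambda>x. cnj (f x) * s0_val N \<beta>L \<beta>R g x) has_sum sform N \<beta>L \<beta>R f g) (ZR N \<union> (ZS N \<union> ZL N))"
    unfolding sform_def by (rule has_sum_Un_disjoint[OF R SL]) (auto simp: ZS_def ZL_def ZR_def)
  moreover have "ZR N \<union> (ZS N \<union> ZL N) = UNIV" by (auto simp: ZS_def ZL_def ZR_def)
  ultimately show ?thesis by simp
qed

text \<open>Scattering states: plane wave plus the wave reflected at the origin.\<close>
definition scat :: "real \<Rightarrow> int \<Rightarrow> real \<Rightarrow> complex" where
  "scat \<kappa> y p = cis (of_int (- y) * p) + cis (of_int \<bar>y\<bar> * p) * rcoef \<kappa> p"

text \<open>Column y of the projection onto the bound state, without its time phase.\<close>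

definition bstate :: "real \<Rightarrow> int \<Rightarrow> int \<Rightarrow> complex" where
  "bstate \<kappa> y b = of_real (bs_weight \<kappa> * bs_decay \<kappa> ^ nat (\<bar>b\<bar> + \<bar>y\<bar>))"

lemma scat_cont: "\<kappa> \<noteq> 0 \<Longrightarrow> continuous_on UNIV (scat \<kappa> y)"
  unfolding scat_def by (intro continuous_intros rcoef_cont)

lemma scat_periodic: "periodic (scat \<kappa> y)"
  using rcoef_periodic[of \<kappa>] unfolding periodic_def scat_def by (auto simp only: cis_periodic)

text \<open>For b >= 0 the modulus of the position in \<open>kern\<close> disappears, so that the
  direct and the reflected part combine into one free wave with profile \<open>scat\<close>.
  Negative positions are reached through \<open>psi_reflect\<close>.\<close>

lemma psi_eq_wave:
  assumes \<kappa>: "0 < \<kappa>" and b: "0 \<le> b"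
  shows "psi \<kappa> t y b = wave t (scat \<kappa> y) b + cis (t * bs_energy \<kappa>) * bstate \<kappa> y b"
proof -
  have c: "continuous_on UNIV (\<lambda>p. cis (of_int (- y) * p) * 1)" "continuous_on UNIV (\<lambda>p. cis (of_int \<bar>y\<bar> * p) * rcoef \<kappa> p)"
    using \<kappa> by (intro continuous_intros rcoef_cont; simp)+
  have "wave t (scat \<kappa> y) b = wave t (\<lambda>p. cis (of_int (- y) * p) * 1) b + wave t (\<lambda>p. cis (of_int \<bar>y\<bar> * p) * rcoef \<kappa> p) b"
    using wave_add[OF c, of t b] unfolding scat_def by simp
  also have "\<dots> = wave t (\<lambda>p. 1) (b + (- y)) + wave t (rcoef \<kappa>) (b + \<bar>y\<bar>)"
    unfolding wave_cis_mult ..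
  finally show ?thesis using b unfolding psi_def kern_def bstate_def wave_def by simp
qed

lemma bs_geometric: "0 < \<kappa> \<Longrightarrow> (\<lambda>a::int. bs_decay \<kappa> ^ nat \<bar>a\<bar>) summable_on UNIV"
proof -
  assume \<kappa>: "0 < \<kappa>"
  note b = bs_facts[OF \<kappa>]
  have n: "(\<lambda>n::nat. bs_decay \<kappa> ^ n) summable_on UNIV"
    using b by (intro summable_nonneg_imp_summable_on summable_geometric) auto
  have "(\<lambda>a::int. bs_decay \<kappa> ^ nat \<bar>a\<bar>) summable_on range int"
    using n by (subst summable_on_reindex) (auto simp: o_def)
  moreover have "(\<lambda>a::int. bs_decay \<kappa> ^ nat \<bar>a\<bar>) summable_on range (\<lambda>n. - int n)"
    using n by (subst summable_on_reindex) (auto simp: o_def inj_def)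
  ultimately have "(\<lambda>a::int. bs_decay \<kappa> ^ nat \<bar>a\<bar>) summable_on (range int \<union> range (\<lambda>n. - int n))"
    by (rule summable_on_union)
  moreover have "range int \<union> range (\<lambda>n. - int n) = UNIV"
    by (auto simp: image_iff) (metis int_cases2)
  ultimately show ?thesis by simp
qed

lemma bstate_factor: "bstate \<kappa> y b = of_real (bs_decay \<kappa> ^ nat \<bar>y\<bar>) * bstate \<kappa> 0 b"
  unfolding bstate_def by (simp add: nat_add_distrib power_add)

lemma bstate_norm_le:
  assumes \<kappa>: "0 < \<kappa>" shows "cmod (bstate \<kappa> y b) \<le> bs_decay \<kappa> ^ nat \<bar>b\<bar>"
proof -
  note b = bs_facts[OF \<kappa>]
  have w: "bs_weight \<kappa> \<le> 1"
  proof (rule ccontr)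
    assume "\<not> bs_weight \<kappa> \<le> 1"
    then have "1 * bs_energy \<kappa> < bs_weight \<kappa> * bs_energy \<kappa>" using b by (intro mult_strict_right_mono) auto
    then show False using b by linarith
  qed
  have "bs_weight \<kappa> * bs_decay \<kappa> ^ nat \<bar>y\<bar> \<le> 1 * 1" by (intro mult_mono w power_le_one) (use b in auto)
  then have "bs_decay \<kappa> ^ nat \<bar>b\<bar> * (bs_weight \<kappa> * bs_decay \<kappa> ^ nat \<bar>y\<bar>) \<le> bs_decay \<kappa> ^ nat \<bar>b\<bar> * 1"
    using b by (intro mult_left_mono) auto
  then show ?thesis using b unfolding bstate_def by (simp add: nat_add_distrib power_add norm_mult norm_power mult_ac)
qed

lemma bstate_l2le: "0 < \<kappa> \<Longrightarrow> \<exists>c. l2le (bstate \<kappa> y) c"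
proof -
  assume \<kappa>: "0 < \<kappa>"
  note b = bs_facts[OF \<kappa>]
  define S where "S = (\<Sum>\<^sub>\<infinity>a::int. bs_decay \<kappa> ^ nat \<bar>a\<bar>)"
  have S0: "0 \<le> S" unfolding S_def using b by (intro infsum_nonneg) auto
  have "l2le (bstate \<kappa> y) (sqrt S)"
  proof (rule l2le_I_sq)
    fix I :: "int set" assume I: "finite I"
    have "(\<Sum>a\<in>I. (cmod (bstate \<kappa> y a))\<^sup>2) \<le> (\<Sum>a\<in>I. bs_decay \<kappa> ^ nat \<bar>a\<bar>)"
    proof (rule sum_mono)
      fix a
      have q: "bs_decay \<kappa> ^ nat \<bar>a\<bar> \<le> 1" using b by (intro power_le_one) auto
      have "cmod (bstate \<kappa> y a) * cmod (bstate \<kappa> y a) \<le> bs_decay \<kappa> ^ nat \<bar>a\<bar> * 1"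
        by (intro mult_mono bstate_norm_le[OF \<kappa>] order_trans[OF bstate_norm_le[OF \<kappa>] q]) (use b in auto)
      then show "(cmod (bstate \<kappa> y a))\<^sup>2 \<le> bs_decay \<kappa> ^ nat \<bar>a\<bar>" by (simp add: power2_eq_square)
    qed
    also have "\<dots> \<le> S" unfolding S_def by (rule finite_sum_le_infsum[OF bs_geometric[OF \<kappa>] I]) (use b in auto)
    finally show "(\<Sum>a\<in>I. (cmod (bstate \<kappa> y a))\<^sup>2) \<le> (sqrt S)\<^sup>2" using S0 by simp
  qed (use S0 in simp)
  then show ?thesis by blast
qed

text \<open>The image term involves only the finitely many sites between N and N + m, where waves
  decay; in the limit it sees the bound state alone.\<close>

lemma dform_explicit:
  assumes f: "l2le f c" and g: "l2le g d"
  shows "dform N m f g = (\<Sum>\<^sub>\<infinity>a\<in>{max (int N) (int N + m)<..}. cnj (f a) * g (a - m)) - (\<Sum>a\<in>{int N<..<int N + m}. cnj (f a) * g (m + 2 * int N - a))"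
proof -
  have "(\<Sum>\<^sub>\<infinity>a. cnj (rst N f a) * rst N g (a - m)) = (\<Sum>\<^sub>\<infinity>a\<in>{max (int N) (int N + m)<..}. cnj (f a) * g (a - m))"
    by (rule infsum_cong_neutral) (auto simp: rst_def ZR_def)
  moreover have "(\<Sum>\<^sub>\<infinity>a. cnj (rst N f a) * rst N g (m + 2 * int N - a)) = (\<Sum>\<^sub>\<infinity>a\<in>{int N<..<int N + m}. cnj (f a) * g (m + 2 * int N - a))"
    by (rule infsum_cong_neutral) (auto simp: rst_def ZR_def)
  ultimately show ?thesis unfolding dform_split[OF f g] by simp
qed

text \<open>The phases of the bound state cancel because both factors carry the same one, and every
  term that contains a wave tends to 0.\<close>

lemma psi_tendsto_product:
  assumes \<kappa>: "0 < \<kappa>" and "0 \<le> a" "0 \<le> b"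
  shows "((\<lambda>t. cnj (psi \<kappa> t x a) * psi \<kappa> t y b) \<longlongrightarrow> cnj (bstate \<kappa> x a) * bstate \<kappa> y b) at_top"
proof -
  have k: "\<kappa> \<noteq> 0" using \<kappa> by simp
  define e where "e t = cis (t * bs_energy \<kappa>)" for t
  have ee: "cnj (e t) * e t = 1" for t unfolding e_def by (simp add: cis_cnj cis_mult)
  define W where "W t = wave t (scat \<kappa> x) a" for t
  define V where "V t = wave t (scat \<kappa> y) b" for t
  have W: "(W \<longlongrightarrow> 0) at_top" unfolding W_def by (rule wave_tendsto_0[OF scat_cont[OF k] scat_periodic])
  have V: "(V \<longlongrightarrow> 0) at_top" unfolding V_def by (rule wave_tendsto_0[OF scat_cont[OF k] scat_periodic])
  have eW: "((\<lambda>t. cnj (W t) * e t) \<longlongrightarrow> 0) at_top"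
    by (rule Lim_null_comparison[OF _ tendsto_norm_zero[OF W]]) (simp add: norm_mult e_def)
  have eV: "((\<lambda>t. cnj (e t) * V t) \<longlongrightarrow> 0) at_top"
    by (rule Lim_null_comparison[OF _ tendsto_norm_zero[OF V]]) (simp add: norm_mult e_def)
  have "((\<lambda>t. cnj (W t) * V t + ((cnj (W t) * e t) * bstate \<kappa> y b + (cnj (e t) * V t) * cnj (bstate \<kappa> x a)) + cnj (bstate \<kappa> x a) * bstate \<kappa> y b)
     \<longlongrightarrow> cnj 0 * 0 + (0 * bstate \<kappa> y b + 0 * cnj (bstate \<kappa> x a)) + cnj (bstate \<kappa> x a) * bstate \<kappa> y b) at_top"
    by (intro tendsto_intros W V eW eV)
  moreover have "cnj (W t) * V t + ((cnj (W t) * e t) * bstate \<kappa> y b + (cnj (e t) * V t) * cnj (bstate \<kappa> x a)) + cnj (bstate \<kappa> x a) * bstate \<kappa> y b = cnj (psi \<kappa> t x a) * psi \<kappa> t y b" for t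
  proof -
    have "cnj (psi \<kappa> t x a) * psi \<kappa> t y b = cnj (W t) * V t + ((cnj (W t) * e t) * bstate \<kappa> y b + (cnj (e t) * V t) * cnj (bstate \<kappa> x a)) + (cnj (e t) * e t) * (cnj (bstate \<kappa> x a) * bstate \<kappa> y b)"
      unfolding psi_eq_wave[OF \<kappa> assms(2)] psi_eq_wave[OF \<kappa> assms(3)] W_def V_def e_def by (simp add: algebra_simps)
    then show ?thesis unfolding ee by simp
  qed
  ultimately show ?thesis by simp
qed

text \<open>Wave times wave converges by \<open>wave_right_limit\<close>; the mixed terms vanish by
  dominated convergence, with the decay of the bound state as majorant; bound state times bound
  state does not depend on t.\<close>

lemma dform_psi_limit:
  assumes \<kappa>: "0 < \<kappa>"
  shows "((\<lambda>t. dform N m (psi \<kappa> t x) (psi \<kappa> t y)) \<longlongrightarrow>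
     havg (\<lambda>p. cis (- of_int m * p) * (cnj (scat \<kappa> x p) * scat \<kappa> y p)) + dform N m (bstate \<kappa> x) (bstate \<kappa> y)) at_top"
proof -
  have k: "\<kappa> \<noteq> 0" using \<kappa> by simp
  note b = bs_facts[OF \<kappa>]
  obtain c1 where c1: "l2le (bstate \<kappa> x) c1" using bstate_l2le[OF \<kappa>] by blast
  obtain c2 where c2: "l2le (bstate \<kappa> y) c2" using bstate_l2le[OF \<kappa>] by blast
  \<comment> \<open>Beyond N' both a and a - m exceed N, in particular they are nonnegative, so
    \<open>psi_eq_wave\<close> applies to both factors.\<close>
  define N' where "N' = max (int N) (int N + m)"
  have N': "0 \<le> N'" by (simp add: N'_def)
  define e where "e t = cis (t * bs_energy \<kappa>)" for t
  have ee: "cnj (e t) * e t = 1" for t unfolding e_def by (simp add: cis_cnj cis_mult)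
  \<comment> \<open>A shift of the position by m is a phase of the profile.\<close>
  define \<Psi> where "\<Psi> p = cis (of_int (- m) * p) * scat \<kappa> y p" for p
  have \<Psi>: "continuous_on UNIV \<Psi>" "periodic \<Psi>"
    unfolding \<Psi>_def using scat_periodic[of \<kappa> y] by (auto intro!: continuous_intros scat_cont[OF k] simp: periodic_def cis_periodic simp del: of_int_minus)
  note \<Phi> = scat_cont[OF k, of x] scat_periodic[of \<kappa> x]
  obtain K1 where K1: "0 < K1" "\<And>p. cmod (scat \<kappa> x p) \<le> K1" using cont_periodic_bounded[OF \<Phi>] by blast
  obtain K2 where K2: "0 < K2" "\<And>p. cmod (\<Psi> p) \<le> K2" using cont_periodic_bounded[OF \<Psi>] by blast
  define W where "W t = wave t (scat \<kappa> x)" for t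
  define V where "V t = wave t \<Psi>" for t
  have Wl: "l2le (W t) K1" for t unfolding W_def by (rule wave_l2le_sup[OF \<Phi>(1) K1(2)])
  have Vl: "l2le (V t) K2" for t unfolding V_def by (rule wave_l2le_sup[OF \<Psi>(1) K2(2)])
  define b1 where "b1 = bstate \<kappa> x"
  define b2 where "b2 a = bstate \<kappa> y (a - m)" for a
  have b2l: "l2le b2 c2" unfolding b2_def by (rule l2le_reindex[OF c2]) (auto simp: inj_def)
  have cross: "((\<lambda>t. \<Sum>\<^sub>\<infinity>a\<in>{N'<..}. cnj (W t a) * (e t * b2 a) + cnj (e t * b1 a) * V t a) \<longlongrightarrow> (\<Sum>\<^sub>\<infinity>a\<in>{N'<..}. 0)) at_top"
  proof (rule tannery_infsum)
    show "((\<lambda>t. cnj (W t a) * (e t * b2 a) + cnj (e t * b1 a) * V t a) \<longlongrightarrow> 0) at_top" for a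
    proof -
      have "((\<lambda>t. W t a) \<longlongrightarrow> 0) at_top" "((\<lambda>t. V t a) \<longlongrightarrow> 0) at_top"
        unfolding W_def V_def by (rule wave_tendsto_0[OF \<Phi>], rule wave_tendsto_0[OF \<Psi>])
      then have "((\<lambda>t. cmod (W t a) * cmod (b2 a) + cmod (b1 a) * cmod (V t a)) \<longlongrightarrow> 0 * cmod (b2 a) + cmod (b1 a) * 0) at_top"
        by (intro tendsto_intros tendsto_norm_zero)
      then have l: "((\<lambda>t. cmod (W t a) * cmod (b2 a) + cmod (b1 a) * cmod (V t a)) \<longlongrightarrow> 0) at_top" by simp
      show ?thesis
        by (rule Lim_null_comparison[OF _ l], rule always_eventually, rule allI, rule order_trans[OF norm_triangle_ineq])
          (simp add: norm_mult e_def)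
    qed
    show "cmod (cnj (W t a) * (e t * b2 a) + cnj (e t * b1 a) * V t a) \<le> K1 * bs_decay \<kappa> ^ nat \<bar>a + (- m)\<bar> + bs_decay \<kappa> ^ nat \<bar>a\<bar> * K2" for t a
    proof -
      have "cmod (cnj (W t a) * (e t * b2 a) + cnj (e t * b1 a) * V t a) \<le> cmod (W t a) * cmod (b2 a) + cmod (b1 a) * cmod (V t a)"
        by (rule order_trans[OF norm_triangle_ineq]) (simp add: norm_mult e_def)
      also have "\<dots> \<le> K1 * bs_decay \<kappa> ^ nat \<bar>a + (- m)\<bar> + bs_decay \<kappa> ^ nat \<bar>a\<bar> * K2"
        using bstate_norm_le[OF \<kappa>, of y "a - m"] bstate_norm_le[OF \<kappa>, of x a] l2le_bound[OF Wl, of t a] l2le_bound[OF Vl, of t a] b K1 K2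
        unfolding b1_def b2_def by (intro add_mono mult_mono) auto
      finally show ?thesis .
    qed
    have sh: "(\<lambda>a::int. bs_decay \<kappa> ^ nat \<bar>a + (- m)\<bar>) summable_on UNIV"
      using has_sum_shift[of "\<lambda>a::int. bs_decay \<kappa> ^ nat \<bar>a\<bar>" "- m"] bs_geometric[OF \<kappa>] unfolding summable_on_def by blast
    have "(\<lambda>a::int. K1 * bs_decay \<kappa> ^ nat \<bar>a + (- m)\<bar> + bs_decay \<kappa> ^ nat \<bar>a\<bar> * K2) summable_on UNIV"
      by (intro summable_on_add summable_on_cmult_left summable_on_cmult_right bs_geometric[OF \<kappa>] sh)
    then show "(\<lambda>a::int. K1 * bs_decay \<kappa> ^ nat \<bar>a + (- m)\<bar> + bs_decay \<kappa> ^ nat \<bar>a\<bar> * K2) summable_on {N'<..}"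
      by (rule summable_on_subset_banach) simp
  qed simp
  have main: "(\<Sum>\<^sub>\<infinity>a\<in>{N'<..}. cnj (psi \<kappa> t x a) * psi \<kappa> t y (a - m)) =
     (\<Sum>\<^sub>\<infinity>a\<in>{N'<..}. cnj (W t a) * V t a) + ((\<Sum>\<^sub>\<infinity>a\<in>{N'<..}. cnj (W t a) * (e t * b2 a) + cnj (e t * b1 a) * V t a) + (\<Sum>\<^sub>\<infinity>a\<in>{N'<..}. cnj (b1 a) * b2 a))" for t
  proof (rule infsumI)
    have l3: "l2le (\<lambda>a. e t * b2 a) (1 * c2)" using l2le_cmult[OF b2l, of "e t"] by (simp add: e_def)
    have l4: "l2le (\<lambda>a. e t * b1 a) (1 * c1)" using l2le_cmult[OF c1, of "e t"] unfolding b1_def by (simp add: e_def)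
    have "((\<lambda>a. cnj (W t a) * V t a + ((cnj (W t a) * (e t * b2 a) + cnj (e t * b1 a) * V t a) + cnj (b1 a) * b2 a)) has_sum
      (\<Sum>\<^sub>\<infinity>a\<in>{N'<..}. cnj (W t a) * V t a) + ((\<Sum>\<^sub>\<infinity>a\<in>{N'<..}. cnj (W t a) * (e t * b2 a) + cnj (e t * b1 a) * V t a) + (\<Sum>\<^sub>\<infinity>a\<in>{N'<..}. cnj (b1 a) * b2 a))) {N'<..}"
      by (intro has_sum_add has_sum_infsum summable_on_add l2le_summable[OF Wl Vl] l2le_summable[OF Wl l3] l2le_summable[OF l4 Vl] l2le_summable[OF c1[folded b1_def] b2l])
    moreover have "cnj (W t a) * V t a + ((cnj (W t a) * (e t * b2 a) + cnj (e t * b1 a) * V t a) + cnj (b1 a) * b2 a) = cnj (psi \<kappa> t x a) * psi \<kappa> t y (a - m)"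
      if "a \<in> {N'<..}" for a
    proof -
      have a: "0 \<le> a" "0 \<le> a - m" using that by (auto simp: N'_def)
      have v: "V t a = wave t (scat \<kappa> y) (a - m)" unfolding V_def \<Psi>_def wave_cis_mult by simp
      have "cnj (psi \<kappa> t x a) * psi \<kappa> t y (a - m) = cnj (W t a) * V t a + ((cnj (W t a) * (e t * b2 a) + cnj (e t * b1 a) * V t a) + (cnj (e t) * e t) * (cnj (b1 a) * b2 a))"
        unfolding psi_eq_wave[OF \<kappa> a(1)] psi_eq_wave[OF \<kappa> a(2)] v W_def e_def b1_def b2_def by (simp add: algebra_simps)
      then show ?thesis unfolding ee by simp
    qed
    ultimately show "((\<lambda>a. cnj (psi \<kappa> t x a) * psi \<kappa> t y (a - m)) has_sum
      (\<Sum>\<^sub>\<infinity>a\<in>{N'<..}. cnj (W t a) * V t a) + ((\<Sum>\<^sub>\<infinity>a\<in>{N'<..}. cnj (W t a) * (e t * b2 a) + cnj (e t * b1 a) * V t a) + (\<Sum>\<^sub>\<infinity>a\<in>{N'<..}. cnj (b1 a) * b2 a))) {N'<..}"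
      by (rule has_sum_cong[THEN iffD1, rotated]) 
  qed
  have W1: "((\<lambda>t. \<Sum>\<^sub>\<infinity>a\<in>{N'<..}. cnj (W t a) * V t a) \<longlongrightarrow> havg (\<lambda>p. cnj (scat \<kappa> x p) * \<Psi> p)) at_top"
    unfolding W_def V_def by (rule wave_right_limit[OF \<Phi> \<Psi> N'])
  have fin: "((\<lambda>t. \<Sum>a\<in>{int N<..<int N + m}. cnj (psi \<kappa> t x a) * psi \<kappa> t y (m + 2 * int N - a)) \<longlongrightarrow>
     (\<Sum>a\<in>{int N<..<int N + m}. cnj (bstate \<kappa> x a) * bstate \<kappa> y (m + 2 * int N - a))) at_top"
    by (intro tendsto_sum psi_tendsto_product[OF \<kappa>]) auto
  have "((\<lambda>t. ((\<Sum>\<^sub>\<infinity>a\<in>{N'<..}. cnj (W t a) * V t a) + ((\<Sum>\<^sub>\<infinity>a\<in>{N'<..}. cnj (W t a) * (e t * b2 a) + cnj (e t * b1 a) * V t a) + (\<Sum>\<^sub>\<infinity>a\<in>{N'<..}. cnj (b1 a) * b2 a)))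
      - (\<Sum>a\<in>{int N<..<int N + m}. cnj (psi \<kappa> t x a) * psi \<kappa> t y (m + 2 * int N - a))) \<longlongrightarrow>
    (havg (\<lambda>p. cnj (scat \<kappa> x p) * \<Psi> p) + ((\<Sum>\<^sub>\<infinity>a\<in>{N'<..}. 0) + (\<Sum>\<^sub>\<infinity>a\<in>{N'<..}. cnj (b1 a) * b2 a)))
      - (\<Sum>a\<in>{int N<..<int N + m}. cnj (bstate \<kappa> x a) * bstate \<kappa> y (m + 2 * int N - a))) at_top"
    by (intro tendsto_diff tendsto_add tendsto_const W1 cross fin)
  then show ?thesis
    unfolding dform_explicit[OF psi_l2le[OF \<kappa>] psi_l2le[OF \<kappa>]] dform_explicit[OF c1 c2] N'_def[symmetric] main
    unfolding b1_def b2_def \<Psi>_def by (simp add: mult_ac add_diff_eq)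
qed

lemma has_sum_tail:
  fixes f :: "'a \<Rightarrow> complex"
  assumes f: "(f has_sum s) UNIV" "(\<lambda>a. cmod (f a)) summable_on UNIV" and Y: "finite Y"
  shows "cmod (s - sum f Y) \<le> (\<Sum>\<^sub>\<infinity>a. cmod (f a)) - (\<Sum>a\<in>Y. cmod (f a))"
proof -
  have n: "(\<lambda>a. cmod (f a)) summable_on (- Y)" by (rule summable_on_subset_banach[OF f(2)]) simp
  have "s = sum f Y + infsum f (- Y)"
    using infsum_Un_disjoint[of f Y "- Y"] Y abs_summable_summable[OF n] infsumI[OF f(1)] by simp
  moreover have "(\<Sum>\<^sub>\<infinity>a. cmod (f a)) = (\<Sum>a\<in>Y. cmod (f a)) + (\<Sum>\<^sub>\<infinity>a\<in>-Y. cmod (f a))"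
    using infsum_Un_disjoint[of "\<lambda>a. cmod (f a)" Y "- Y"] Y n by simp
  ultimately show ?thesis using norm_infsum_bound[OF n] by simp
qed

lemma havg_norm_le:
  assumes "continuous_on UNIV F" "\<And>p. cmod (F p) \<le> K"
  shows "cmod (havg F) \<le> K"
proof -
  have "cmod (integral {0..pi} F) \<le> K * (pi - 0)"
    by (rule integral_bound; use assms(2) continuous_on_subset[OF assms(1)] in auto)
  moreover have "0 \<le> K" using assms(2)[of 0] norm_ge_zero order_trans by blast
  then have "K * (pi - 0) \<le> K * (2 * pi)" by (intro mult_left_mono) auto
  ultimately have "cmod (integral {0..pi} F) \<le> K * (2 * pi)" by linarith
  then show ?thesis unfolding havg_def by (simp add: norm_divide divide_le_eq)
qed

lemma havg_diff: "continuous_on UNIV F \<Longrightarrow> continuous_on UNIV G \<Longrightarrow> havg (\<lambda>p. F p - G p) = havg F - havg G"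
  unfolding havg_def by (simp add: integral_diff integrable_cont diff_divide_distrib)

lemma havg_add: "continuous_on UNIV F \<Longrightarrow> continuous_on UNIV G \<Longrightarrow> havg (\<lambda>p. F p + G p) = havg F + havg G"
  unfolding havg_def by (simp add: integral_add integrable_cont add_divide_distrib)

lemma havg_cmult: "havg (\<lambda>p. c * F p) = c * havg F"
  unfolding havg_def by simp

lemma havg_zero [simp]: "havg (\<lambda>p. 0) = 0"
  unfolding havg_def by simp

lemma havg_sum:
  assumes "\<And>i. i \<in> I \<Longrightarrow> continuous_on UNIV (F i)"
  shows "havg (\<lambda>p. \<Sum>i\<in>I. F i p) = (\<Sum>i\<in>I. havg (F i))"
proof (cases "finite I")
  case True
  then show ?thesis unfolding havg_def
    by (simp add: integral_sum integrable_cont assms sum_divide_distrib)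
qed simp

text \<open>Resums the Fourier series of F under the half mean: its partial sums over large index
  sets are uniformly close to F.\<close>

lemma fc_havg_has_sum:
  assumes F: "continuous_on UNIV F" "periodic F" "(\<lambda>m. cmod (fc F m)) summable_on UNIV"
    and G: "continuous_on UNIV G" "\<And>p. cmod (G p) \<le> K"
  shows "((\<lambda>m. fc F m * havg (\<lambda>p. cis (- of_int m * p) * G p)) has_sum havg (\<lambda>p. F p * G p)) UNIV"
proof (rule has_sum_metricI)
  fix e :: real assume e: "0 < e"
  have K: "0 \<le> K" using G(2)[of 0] norm_ge_zero order_trans by blast
  define d where "d = e / (2 * (K + 1))"
  have d: "0 < d" using e K by (simp add: d_def)
  obtain X where X: "finite X" "dist (\<Sum>m\<in>X. cmod (fc F m)) (\<Sum>\<^sub>\<infinity>m. cmod (fc F m)) \<le> d"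
    using infsum_finite_approximation[OF F(3) d] by blast
  have "dist (\<Sum>m\<in>Y. fc F m * havg (\<lambda>p. cis (- of_int m * p) * G p)) (havg (\<lambda>p. F p * G p)) < e" if Y: "finite Y" "X \<subseteq> Y" for Y
  proof -
    define S where "S p = (\<Sum>m\<in>Y. fc F m * cis (- of_int m * p))" for p
    have Sc: "continuous_on UNIV S" unfolding S_def by (intro continuous_intros)
    have "(\<lambda>p. S p * G p) = (\<lambda>p. \<Sum>m\<in>Y. fc F m * (cis (- of_int m * p) * G p))"
      unfolding S_def by (simp only: sum_distrib_right mult.assoc)
    then have "havg (\<lambda>p. S p * G p) = (\<Sum>m\<in>Y. havg (\<lambda>p. fc F m * (cis (- of_int m * p) * G p)))"
      by (simp only:) (rule havg_sum, intro continuous_intros G)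
    then have 1: "havg (\<lambda>p. S p * G p) = (\<Sum>m\<in>Y. fc F m * havg (\<lambda>p. cis (- of_int m * p) * G p))"
      by (simp only: havg_cmult)
    have "cmod (S p - F p) \<le> d" for p
    proof -
      have "cmod (F p - (\<Sum>m\<in>Y. fc F m * cis (- of_int m * p))) \<le> (\<Sum>\<^sub>\<infinity>m. cmod (fc F m * cis (- of_int m * p))) - (\<Sum>m\<in>Y. cmod (fc F m * cis (- of_int m * p)))"
        by (rule has_sum_tail[OF Fourier_inversion[OF F] _ Y(1)]) (use F(3) in \<open>simp add: norm_mult\<close>)
      also have "\<dots> = (\<Sum>\<^sub>\<infinity>m. cmod (fc F m)) - (\<Sum>m\<in>Y. cmod (fc F m))" by (simp add: norm_mult)
      also have "\<dots> \<le> (\<Sum>\<^sub>\<infinity>m. cmod (fc F m)) - (\<Sum>m\<in>X. cmod (fc F m))"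
        using sum_mono2[OF Y, of "\<lambda>m. cmod (fc F m)"] by simp
      also have "\<dots> \<le> d" using X(2) by (simp add: dist_real_def)
      finally show ?thesis unfolding S_def by (simp add: norm_minus_commute)
    qed
    then have 2: "cmod (havg (\<lambda>p. (S p - F p) * G p)) \<le> d * K"
      using d by (intro havg_norm_le continuous_intros Sc F G) (auto simp: norm_mult intro!: mult_mono G)
    have 3: "havg (\<lambda>p. (S p - F p) * G p) = havg (\<lambda>p. S p * G p) - havg (\<lambda>p. F p * G p)"
      unfolding left_diff_distrib by (rule havg_diff) (intro continuous_intros Sc F G)+
    have "d * K < e"
    proof -
      have "d * K \<le> d * (K + 1)" using d by simp
      also have "\<dots> = e / 2" unfolding d_def using K by (simp add: field_simps)
      also have "\<dots> < e" using e by simp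
      finally show ?thesis .
    qed
    then show ?thesis using 2 unfolding 3 1 dist_norm by simp
  qed
  then show "\<exists>X. finite X \<and> X \<subseteq> UNIV \<and> (\<forall>Y. finite Y \<and> X \<subseteq> Y \<and> Y \<subseteq> UNIV \<longrightarrow> dist (\<Sum>m\<in>Y. fc F m * havg (\<lambda>p. cis (- of_int m * p) * G p)) (havg (\<lambda>p. F p * G p)) < e)"
    using X(1) by (intro exI[of _ X]) simp
qed

text \<open>Limit for each m, dominated by the coefficients of F because the propagated vectors have
  norm at most 1; the wave parts are then resummed by \<open>fc_havg_has_sum\<close>.\<close>

lemma rform_psi_limit:
  assumes \<kappa>: "0 < \<kappa>" and F: "continuous_on UNIV F" "periodic F" "(\<lambda>m. cmod (fc F m)) summable_on UNIV"
  shows "((\<lambda>t. rform F N (psi \<kappa> t x) (psi \<kappa> t y)) \<longlongrightarrow>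
    havg (\<lambda>p. F p * (cnj (scat \<kappa> x p) * scat \<kappa> y p)) + rform F N (bstate \<kappa> x) (bstate \<kappa> y)) at_top"
proof -
  have k: "\<kappa> \<noteq> 0" using \<kappa> by simp
  define G where "G p = cnj (scat \<kappa> x p) * scat \<kappa> y p" for p
  have G: "continuous_on UNIV G" unfolding G_def by (intro continuous_intros scat_cont[OF k])
  have Gp: "periodic G" using scat_periodic[of \<kappa> x] scat_periodic[of \<kappa> y] unfolding periodic_def G_def by simp
  obtain K where K: "0 < K" "\<And>p. cmod (G p) \<le> K" using cont_periodic_bounded[OF G Gp] by blast
  obtain c1 where c1: "l2le (bstate \<kappa> x) c1" using bstate_l2le[OF \<kappa>] by blast
  obtain c2 where c2: "l2le (bstate \<kappa> y) c2" using bstate_l2le[OF \<kappa>] by blast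
  have "((\<lambda>t. \<Sum>\<^sub>\<infinity>m. fc F m * dform N m (psi \<kappa> t x) (psi \<kappa> t y)) \<longlongrightarrow>
     (\<Sum>\<^sub>\<infinity>m. fc F m * (havg (\<lambda>p. cis (- of_int m * p) * G p) + dform N m (bstate \<kappa> x) (bstate \<kappa> y)))) at_top"
  proof (rule tannery_infsum[where g = "\<lambda>m. cmod (fc F m) * (1 * (1 + 1))"])
    show "((\<lambda>t. fc F m * dform N m (psi \<kappa> t x) (psi \<kappa> t y)) \<longlongrightarrow> fc F m * (havg (\<lambda>p. cis (- of_int m * p) * G p) + dform N m (bstate \<kappa> x) (bstate \<kappa> y))) at_top" for m
      unfolding G_def by (intro tendsto_mult tendsto_const dform_psi_limit[OF \<kappa>])
    show "cmod (fc F m * dform N m (psi \<kappa> t x) (psi \<kappa> t y)) \<le> cmod (fc F m) * (1 * (1 + 1))" for t m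
      unfolding norm_mult by (rule mult_left_mono[OF dform_bound[OF psi_l2le[OF \<kappa>] psi_l2le[OF \<kappa>]] norm_ge_zero])
    show "(\<lambda>m. cmod (fc F m) * (1 * (1 + 1))) summable_on UNIV" by (rule summable_on_cmult_left[OF F(3)])
  qed simp
  moreover have "(\<Sum>\<^sub>\<infinity>m. fc F m * (havg (\<lambda>p. cis (- of_int m * p) * G p) + dform N m (bstate \<kappa> x) (bstate \<kappa> y)))
     = havg (\<lambda>p. F p * G p) + rform F N (bstate \<kappa> x) (bstate \<kappa> y)"
  proof -
    have "((\<lambda>m. fc F m * dform N m (bstate \<kappa> x) (bstate \<kappa> y)) has_sum rform F N (bstate \<kappa> x) (bstate \<kappa> y)) UNIV"
      unfolding rform_def by (rule has_sum_infsum[OF abs_summable_summable[OF bounded_mult_summable[OF F(3) dform_bound[OF c1 c2]]]])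
    from infsumI[OF has_sum_add[OF fc_havg_has_sum[OF F G K(2)] this]] show ?thesis by (simp only: distrib_left)
  qed
  ultimately show ?thesis unfolding G_def rform_def[symmetric] by simp
qed

text \<open>The bound state projection has rank one, so its contribution to the limit factorises
  into decaying functions of x and of y.\<close>

lemma rform_bstate:
  "rform F N (bstate \<kappa> x) (bstate \<kappa> y) = of_real (bs_decay \<kappa> ^ nat \<bar>x\<bar> * bs_decay \<kappa> ^ nat \<bar>y\<bar>) * rform F N (bstate \<kappa> 0) (bstate \<kappa> 0)"
proof -
  define c where "c = complex_of_real (bs_decay \<kappa> ^ nat \<bar>x\<bar>)"
  define d where "d = complex_of_real (bs_decay \<kappa> ^ nat \<bar>y\<bar>)"
  have "rst N (bstate \<kappa> x) a = c * rst N (bstate \<kappa> 0) a" "rst N (bstate \<kappa> y) a = d * rst N (bstate \<kappa> 0) a" for a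
    by (auto simp: rst_def c_def d_def bstate_factor[of \<kappa> x] bstate_factor[of \<kappa> y])
  moreover have "cnj c = c" unfolding c_def by simp
  ultimately have "cnj (rst N (bstate \<kappa> x) a) * (rst N (bstate \<kappa> y) u - rst N (bstate \<kappa> y) v) = (c * d) * (cnj (rst N (bstate \<kappa> 0) a) * (rst N (bstate \<kappa> 0) u - rst N (bstate \<kappa> 0) v))" for a u v
    by (simp add: algebra_simps)
  then have "dform N m (bstate \<kappa> x) (bstate \<kappa> y) = (c * d) * dform N m (bstate \<kappa> 0) (bstate \<kappa> 0)" for m
    unfolding dform_def by (simp only: infsum_cmult_right')
  then show ?thesis unfolding rform_def by (simp only: mult.left_commute[of _ "c * d"] infsum_cmult_right') (simp add: c_def d_def)
qed

text \<open>The point interaction sits at the origin, so the propagator commutes with reflection;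
  this reduces the left half line to the right one.\<close>

lemma psi_reflect: "psi \<kappa> t x (- a) = psi \<kappa> t (- x) a"
proof -
  have "fc (\<lambda>p. cis (t * cos p)) (- a - x) = fc (\<lambda>p. cis (t * cos p)) (a + x)"
    using fc_even[of "\<lambda>p. cis (t * cos p)" "a + x"] by simp
  then show ?thesis unfolding psi_def kern_def by simp
qed

lemma bstate_reflect: "bstate \<kappa> x (- a) = bstate \<kappa> (- x) a" "bstate \<kappa> (- x) a = bstate \<kappa> x a"
  by (auto simp: bstate_def)

lemma psi_tendsto_product_same:
  assumes \<kappa>: "0 < \<kappa>"
  shows "((\<lambda>t. cnj (psi \<kappa> t x a) * psi \<kappa> t y a) \<longlongrightarrow> cnj (bstate \<kappa> x a) * bstate \<kappa> y a) at_top"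
proof (cases "0 \<le> a")
  case True
  show ?thesis by (rule psi_tendsto_product[OF \<kappa> True True])
next
  case False
  then have "((\<lambda>t. cnj (psi \<kappa> t (- x) (- a)) * psi \<kappa> t (- y) (- a)) \<longlongrightarrow> cnj (bstate \<kappa> (- x) (- a)) * bstate \<kappa> (- y) (- a)) at_top"
    by (intro psi_tendsto_product[OF \<kappa>]) auto
  then show ?thesis unfolding psi_reflect bstate_reflect(1) by simp
qed

text \<open>The initial density in the bound state. No mirror image appears in the left reservoir
  term because \<open>bstate \<kappa> 0\<close> is even.\<close>

definition Zc :: "nat \<Rightarrow> real \<Rightarrow> real \<Rightarrow> real \<Rightarrow> complex" where
  "Zc N \<kappa> \<beta>L \<beta>R = rform (fermi \<beta>R) N (bstate \<kappa> 0) (bstate \<kappa> 0)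
     + ((\<Sum>a\<in>ZS N. cnj (bstate \<kappa> 0 a) * bstate \<kappa> 0 a / 2) + rform (fermi \<beta>L) N (bstate \<kappa> 0) (bstate \<kappa> 0))"

text \<open>The three summands come from the right reservoir, from the left one in mirrored
  coordinates, and from the bound state. The half mean selects the momenta whose waves end up far
  out in the reservoir concerned.\<close>

definition Minf :: "nat \<Rightarrow> real \<Rightarrow> real \<Rightarrow> real \<Rightarrow> int \<Rightarrow> int \<Rightarrow> complex" where
  "Minf N \<kappa> \<beta>L \<beta>R x y = havg (\<lambda>p. fermi \<beta>R p * (cnj (scat \<kappa> x p) * scat \<kappa> y p))
     + havg (\<lambda>p. fermi \<beta>L p * (cnj (scat \<kappa> (- x) p) * scat \<kappa> (- y) p))
     + of_real (bs_decay \<kappa> ^ nat \<bar>x\<bar> * bs_decay \<kappa> ^ nat \<bar>y\<bar>) * Zc N \<kappa> \<beta>L \<beta>R"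

lemma sform_psi_limit:
  assumes \<kappa>: "0 < \<kappa>"
  shows "((\<lambda>t. sform N \<beta>L \<beta>R (psi \<kappa> t x) (psi \<kappa> t y)) \<longlongrightarrow> Minf N \<kappa> \<beta>L \<beta>R x y) at_top"
proof -
  define q where "q = complex_of_real (bs_decay \<kappa> ^ nat \<bar>x\<bar> * bs_decay \<kappa> ^ nat \<bar>y\<bar>)"
  note lim = rform_psi_limit[OF \<kappa> fermi_cont fermi_periodic fermi_summable]
  have R: "((\<lambda>t. rform (fermi \<beta>R) N (psi \<kappa> t x) (psi \<kappa> t y)) \<longlongrightarrow> havg (\<lambda>p. fermi \<beta>R p * (cnj (scat \<kappa> x p) * scat \<kappa> y p)) + q * rform (fermi \<beta>R) N (bstate \<kappa> 0) (bstate \<kappa> 0)) at_top"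
    using lim[of \<beta>R N x y] unfolding rform_bstate[of _ N \<kappa> x y] q_def .
  have L: "((\<lambda>t. rform (fermi \<beta>L) N (\<lambda>a. psi \<kappa> t x (- a)) (\<lambda>a. psi \<kappa> t y (- a))) \<longlongrightarrow> havg (\<lambda>p. fermi \<beta>L p * (cnj (scat \<kappa> (- x) p) * scat \<kappa> (- y) p)) + q * rform (fermi \<beta>L) N (bstate \<kappa> 0) (bstate \<kappa> 0)) at_top"
    using lim[of \<beta>L N "- x" "- y"] unfolding rform_bstate[of _ N \<kappa> "- x" "- y"] q_def psi_reflect by simp
  have S: "((\<lambda>t. \<Sum>a\<in>ZS N. cnj (psi \<kappa> t x a) * psi \<kappa> t y a / 2) \<longlongrightarrow> q * (\<Sum>a\<in>ZS N. cnj (bstate \<kappa> 0 a) * bstate \<kappa> 0 a / 2)) at_top"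
  proof -
    have "((\<lambda>t. \<Sum>a\<in>ZS N. cnj (psi \<kappa> t x a) * psi \<kappa> t y a / 2) \<longlongrightarrow> (\<Sum>a\<in>ZS N. cnj (bstate \<kappa> x a) * bstate \<kappa> y a / 2)) at_top"
      by (intro tendsto_sum tendsto_divide tendsto_const psi_tendsto_product_same[OF \<kappa>]) simp
    moreover have "(\<Sum>a\<in>ZS N. cnj (bstate \<kappa> x a) * bstate \<kappa> y a / 2) = q * (\<Sum>a\<in>ZS N. cnj (bstate \<kappa> 0 a) * bstate \<kappa> 0 a / 2)"
      unfolding sum_distrib_left by (rule sum.cong[OF refl]) (subst (1 2) bstate_factor, simp add: q_def)
    ultimately show ?thesis by simp
  qed
  show ?thesis unfolding sform_def Minf_def Zc_def
    using tendsto_add[OF R tendsto_add[OF S L]] unfolding q_def by (simp add: algebra_simps)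
qed

section \<open>Continuity of the two-point function in time\<close>

lemma rform_diff_left:
  assumes "l2le f c" "l2le f' c'" "l2le g d" "(\<lambda>m. cmod (fc F m)) summable_on UNIV"
  shows "rform F N (\<lambda>x. f x - f' x) g = rform F N f g - rform F N f' g"
proof -
  have "((\<lambda>(a, b). cnj (rst N (\<lambda>x. f x - f' x) a) * refl_kern F N a b * rst N g b) has_sum rform F N f g + - rform F N f' g) (UNIV \<times> UNIV)"
    by (rule has_sum_cong[THEN iffD1, OF _ has_sum_add[OF pair_has_sum[OF assms(1,3,4), of N] has_sum_uminusI[OF pair_has_sum[OF assms(2,3,4), of N]]]])
      (auto simp: rst_def algebra_simps)
  from has_sum_unique[OF this pair_has_sum[OF l2le_diff[OF assms(1,2)] assms(3,4)]] show ?thesis by simp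
qed

lemma rform_diff_right:
  assumes "l2le f c" "l2le g d" "l2le g' d'" "(\<lambda>m. cmod (fc F m)) summable_on UNIV"
  shows "rform F N f (\<lambda>x. g x - g' x) = rform F N f g - rform F N f g'"
proof -
  have "((\<lambda>(a, b). cnj (rst N f a) * refl_kern F N a b * rst N (\<lambda>x. g x - g' x) b) has_sum rform F N f g + - rform F N f g') (UNIV \<times> UNIV)"
    by (rule has_sum_cong[THEN iffD1, OF _ has_sum_add[OF pair_has_sum[OF assms(1,2,4), of N] has_sum_uminusI[OF pair_has_sum[OF assms(1,3,4), of N]]]])
      (auto simp: rst_def algebra_simps)
  from has_sum_unique[OF this pair_has_sum[OF assms(1) l2le_diff[OF assms(2,3)] assms(4)]] show ?thesis by simp
qed

lemma rform_continuity:
  assumes f: "l2le f 1" and f': "l2le f' 1" and g: "l2le g 1" and g': "l2le g' 1"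
    and df: "l2le (\<lambda>x. f x - f' x) c" and dg: "l2le (\<lambda>x. g x - g' x) d" and F: "(\<lambda>m. cmod (fc F m)) summable_on UNIV"
  shows "cmod (rform F N f g - rform F N f' g') \<le> (\<Sum>\<^sub>\<infinity>m. cmod (fc F m)) * 2 * (c + d)"
proof -
  have "rform F N f g - rform F N f' g' = rform F N (\<lambda>x. f x - f' x) g + rform F N f' (\<lambda>x. g x - g' x)"
    unfolding rform_diff_left[OF f f' g F] rform_diff_right[OF f' g g' F] by simp
  also have "cmod \<dots> \<le> (\<Sum>\<^sub>\<infinity>m. cmod (fc F m)) * (c * (1 + 1)) + (\<Sum>\<^sub>\<infinity>m. cmod (fc F m)) * (1 * (d + d))"
    by (intro order_trans[OF norm_triangle_ineq] add_mono rform_bound[OF df g F] rform_bound[OF f' dg F])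
  also have "\<dots> = (\<Sum>\<^sub>\<infinity>m. cmod (fc F m)) * 2 * (c + d)" by (simp add: algebra_simps)
  finally show ?thesis .
qed

lemma sform_continuity:
  assumes f: "l2le f 1" and f': "l2le f' 1" and g: "l2le g 1" and g': "l2le g' 1"
    and df: "l2le (\<lambda>x. f x - f' x) c" and dg: "l2le (\<lambda>x. g x - g' x) d"
  shows "cmod (sform N \<beta>L \<beta>R f g - sform N \<beta>L \<beta>R f' g') \<le>
    ((\<Sum>\<^sub>\<infinity>m. cmod (fc (fermi \<beta>R) m)) * 2 + (real (card (ZS N)) + (\<Sum>\<^sub>\<infinity>m. cmod (fc (fermi \<beta>L) m)) * 2)) * (c + d)"
proof -
  have re: "l2le (\<lambda>x. h (- x)) e" if "l2le h e" for h :: "int \<Rightarrow> complex" and e by (rule l2le_reindex[OF that]) (auto simp: inj_def)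
  have S: "cmod ((\<Sum>a\<in>ZS N. cnj (f a) * g a / 2) - (\<Sum>a\<in>ZS N. cnj (f' a) * g' a / 2)) \<le> real (card (ZS N)) * (c + d)"
  proof -
    have "cmod (cnj (f a) * g a / 2 - cnj (f' a) * g' a / 2) \<le> c + d" for a
    proof -
      have "cnj (f a) * g a / 2 - cnj (f' a) * g' a / 2 = (cnj (f a - f' a) * g a + cnj (f' a) * (g a - g' a)) / 2"
        by (simp add: field_simps)
      also have "cmod \<dots> \<le> (cmod (cnj (f a - f' a) * g a) + cmod (cnj (f' a) * (g a - g' a))) / 2"
        unfolding norm_divide by (simp add: norm_triangle_ineq)
      also have "\<dots> \<le> (c * 1 + 1 * d) / 2"
        unfolding norm_mult complex_mod_cnj
        by (intro divide_right_mono add_mono mult_mono l2le_bound[OF df] l2le_bound[OF g] l2le_bound[OF f'] l2le_bound[OF dg] l2le_nonneg[OF df]) auto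
      also have "\<dots> \<le> c + d" using l2le_nonneg[OF df] l2le_nonneg[OF dg] by simp
      finally show ?thesis .
    qed
    then show ?thesis unfolding sum_subtractf[symmetric] by (intro sum_norm_bound) auto
  qed
  have eq: "sform N \<beta>L \<beta>R f g - sform N \<beta>L \<beta>R f' g' = (rform (fermi \<beta>R) N f g - rform (fermi \<beta>R) N f' g') + (((\<Sum>a\<in>ZS N. cnj (f a) * g a / 2) - (\<Sum>a\<in>ZS N. cnj (f' a) * g' a / 2))
     + (rform (fermi \<beta>L) N (\<lambda>x. f (- x)) (\<lambda>x. g (- x)) - rform (fermi \<beta>L) N (\<lambda>x. f' (- x)) (\<lambda>x. g' (- x))))"
    unfolding sform_def by simp
  have "cmod (sform N \<beta>L \<beta>R f g - sform N \<beta>L \<beta>R f' g') \<le> (\<Sum>\<^sub>\<infinity>m. cmod (fc (fermi \<beta>R) m)) * 2 * (c + d) + (real (card (ZS N)) * (c + d) + (\<Sum>\<^sub>\<infinity>m. cmod (fc (fermi \<beta>L) m)) * 2 * (c + d))"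
    unfolding eq
    by (intro order_trans[OF norm_triangle_ineq] add_mono rform_continuity[OF f f' g g' df dg fermi_summable] S
      rform_continuity[OF re[OF f] re[OF f'] re[OF g] re[OF g'] re[OF df] re[OF dg] fermi_summable])
  then show ?thesis by (simp add: algebra_simps)
qed

text \<open>The form is Lipschitz in the l2 distance of its arguments, and the propagated vectors
  move continuously by \<open>psi_diff_l2le\<close> and \<open>psi_diag_tendsto\<close>. Continuity
  is what makes the time averages integrable.\<close>

lemma sform_psi_cont:
  assumes \<kappa>: "0 < \<kappa>"
  shows "continuous_on UNIV (\<lambda>t. sform N \<beta>L \<beta>R (psi \<kappa> t x) (psi \<kappa> t y))"
proof (rule continuous_at_imp_continuous_on, rule ballI)
  fix t :: real
  define C where "C = (\<Sum>\<^sub>\<infinity>m. cmod (fc (fermi \<beta>R) m)) * 2 + (real (card (ZS N)) + (\<Sum>\<^sub>\<infinity>m. cmod (fc (fermi \<beta>L) m)) * 2)"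
  have d: "((\<lambda>s. sqrt (2 - 2 * Re (psi \<kappa> (s - t) z z))) \<longlongrightarrow> 0) (at t)" for z
  proof -
    have "((\<lambda>s. psi \<kappa> (s - t) z z) \<longlongrightarrow> 1) (at t)"
      using LIM_offset[OF psi_diag_tendsto[OF \<kappa>, of z], of "- t"] by simp
    then have "((\<lambda>s. sqrt (2 - 2 * Re (psi \<kappa> (s - t) z z))) \<longlongrightarrow> sqrt (2 - 2 * Re 1)) (at t)"
      by (intro tendsto_intros)
    then show ?thesis by simp
  qed
  have b: "cmod (sform N \<beta>L \<beta>R (psi \<kappa> s x) (psi \<kappa> s y) - sform N \<beta>L \<beta>R (psi \<kappa> t x) (psi \<kappa> t y))
     \<le> C * (sqrt (2 - 2 * Re (psi \<kappa> (s - t) x x)) + sqrt (2 - 2 * Re (psi \<kappa> (s - t) y y)))" for s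
    unfolding C_def by (rule sform_continuity[OF psi_l2le[OF \<kappa>] psi_l2le[OF \<kappa>] psi_l2le[OF \<kappa>] psi_l2le[OF \<kappa>] psi_diff_l2le[OF \<kappa>] psi_diff_l2le[OF \<kappa>]])
  have "((\<lambda>s. C * (sqrt (2 - 2 * Re (psi \<kappa> (s - t) x x)) + sqrt (2 - 2 * Re (psi \<kappa> (s - t) y y)))) \<longlongrightarrow> C * (0 + 0)) (at t)"
    by (intro tendsto_intros d)
  then have l: "((\<lambda>s. C * (sqrt (2 - 2 * Re (psi \<kappa> (s - t) x x)) + sqrt (2 - 2 * Re (psi \<kappa> (s - t) y y)))) \<longlongrightarrow> 0) (at t)" by simp
  have "((\<lambda>s. sform N \<beta>L \<beta>R (psi \<kappa> s x) (psi \<kappa> s y) - sform N \<beta>L \<beta>R (psi \<kappa> t x) (psi \<kappa> t y)) \<longlongrightarrow> 0) (at t)"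
    by (rule Lim_null_comparison[OF always_eventually[OF allI[OF b]] l])
  then show "isCont (\<lambda>t. sform N \<beta>L \<beta>R (psi \<kappa> t x) (psi \<kappa> t y)) t"
    unfolding isCont_def by (rule LIM_zero_cancel)
qed

section \<open>Positivity of the limit matrix\<close>

definition cnonneg :: "complex set" where "cnonneg = {z. 0 \<le> Re z \<and> Im z = 0}"

lemma cnonneg_closed: "closed cnonneg"
proof -
  have e: "cnonneg = {z. 0 \<le> Re z} \<inter> {z. Im z = 0}" unfolding cnonneg_def by auto
  have 1: "closed {z. Im z = 0}" by (intro closed_Collect_eq continuous_intros)
  have 2: "closed {z. 0 \<le> Re z}" by (intro closed_Collect_le continuous_intros)
  show ?thesis unfolding e by (rule closed_Int[OF 2 1])
qed

lemma cnonneg_add: "a \<in> cnonneg \<Longrightarrow> b \<in> cnonneg \<Longrightarrow> a + b \<in> cnonneg"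
  by (auto simp: cnonneg_def)

lemma integral_of_real:
  fixes f :: "real \<Rightarrow> real"
  assumes "continuous_on UNIV f"
  shows "integral {a..b} (\<lambda>p. complex_of_real (f p)) = of_real (integral {a..b} f)"
  by (rule integral_linear[OF integrable_cont[OF assms] bounded_linear_of_real, unfolded o_def])

lemma avg_nonneg:
  assumes "continuous_on UNIV f" "\<And>p. 0 \<le> f p"
  shows "avg (\<lambda>p. of_real (f p)) \<in> cnonneg"
proof -
  have "avg (\<lambda>p. of_real (f p)) = of_real (integral {-pi..pi} f / (2 * pi))" unfolding avg_def by (simp add: integral_of_real assms)
  moreover have "0 \<le> integral {-pi..pi} f" by (intro integral_nonneg integrable_cont assms) 
  ultimately show ?thesis unfolding cnonneg_def by simp
qed

lemma havg_nonneg: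
  assumes "continuous_on UNIV f" "\<And>p. 0 \<le> f p"
  shows "havg (\<lambda>p. of_real (f p)) \<in> cnonneg"
proof -
  have "havg (\<lambda>p. of_real (f p)) = of_real (integral {0..pi} f / (2 * pi))" unfolding havg_def by (simp add: integral_of_real assms)
  moreover have "0 \<le> integral {0..pi} f" by (intro integral_nonneg integrable_cont assms) 
  ultimately show ?thesis unfolding cnonneg_def by simp
qed

text \<open>By cos(A - B) - cos(A + B) = 2 sin A sin B the kernel is a mean of products of one
  function taken at a and at b, hence a positive form when F is nonnegative.\<close>

lemma refl_kern_sin:
  assumes F: "continuous_on UNIV F" "\<And>p. F (- p) = F p"
  shows "refl_kern F N a b = avg (\<lambda>p. F p * of_real (2 * sin (of_int (a - int N) * p) * sin (of_int (b - int N) * p)))"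
proof -
  have c: "fc F m = avg (\<lambda>p. F p * of_real (cos (of_int m * p)))" for m
  proof -
    have "(\<lambda>p. F p * of_real (cos (of_int m * p))) = (\<lambda>p. (1/2) * (F p * cis (of_int m * p)) + (1/2) * (F p * cis (of_int (- m) * p)))"
      by (auto simp: cos_cis algebra_simps add_divide_distrib)
    then have "avg (\<lambda>p. F p * of_real (cos (of_int m * p))) = (1/2) * fc F m + (1/2) * fc F (- m)"
      unfolding fc_def by (simp only:) (subst avg_add, intro continuous_intros F, intro continuous_intros F, simp only: avg_cmult)
    then show ?thesis using fc_even[of F m, OF F(2)] by simp
  qed
  have "refl_kern F N a b = avg (\<lambda>p. F p * of_real (cos (of_int (a - b) * p)) - F p * of_real (cos (of_int (a + b - 2 * int N) * p)))"
    unfolding refl_kern_def c by (rule avg_diff[symmetric]) (intro continuous_intros F)+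
  also have "(\<lambda>p. F p * of_real (cos (of_int (a - b) * p)) - F p * of_real (cos (of_int (a + b - 2 * int N) * p)))
     = (\<lambda>p. F p * of_real (2 * sin (of_int (a - int N) * p) * sin (of_int (b - int N) * p)))"
  proof
    fix p :: real
    have e: "of_int (a - b) * p = of_int (a - int N) * p - of_int (b - int N) * p" "of_int (a + b - 2 * int N) * p = of_int (a - int N) * p + of_int (b - int N) * p"
      by (simp_all add: algebra_simps)
    have "cos (of_int (a - b) * p) - cos (of_int (a + b - 2 * int N) * p) = 2 * sin (of_int (a - int N) * p) * sin (of_int (b - int N) * p)"
      unfolding e cos_diff cos_add by simp
    then show "F p * of_real (cos (of_int (a - b) * p)) - F p * of_real (cos (of_int (a + b - 2 * int N) * p)) = F p * of_real (2 * sin (of_int (a - int N) * p) * sin (of_int (b - int N) * p))"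
      by (metis of_real_diff right_diff_distrib)
  qed
  finally show ?thesis .
qed

lemma sum_square_form:
  fixes u :: "'a \<Rightarrow> complex"
  shows "(\<Sum>x\<in>I. \<Sum>y\<in>I. cnj (u x) * u y) = of_real ((cmod (\<Sum>x\<in>I. u x))\<^sup>2)"
proof -
  have "(\<Sum>x\<in>I. \<Sum>y\<in>I. cnj (u x) * u y) = cnj (\<Sum>x\<in>I. u x) * (\<Sum>y\<in>I. u y)"
    by (simp only: cnj_sum sum_product)
  then show ?thesis using complex_norm_square by (metis mult.commute)
qed

lemma rform_nonneg:
  assumes f: "l2le f c" and F: "F = (\<lambda>p. of_real (Fr p))" "continuous_on UNIV Fr" "\<And>p. 0 \<le> Fr p" "\<And>p. Fr (- p) = Fr p"
    "(\<lambda>m. cmod (fc F m)) summable_on UNIV"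
  shows "rform F N f f \<in> cnonneg"
proof -
  have Fc: "continuous_on UNIV F" "\<And>p. F (- p) = F p" unfolding F(1) using F(4) by (auto intro!: continuous_intros F(2))
  define h where "h = (\<lambda>(a, b). cnj (rst N f a) * refl_kern F N a b * rst N f b)"
  have "((\<lambda>I. sum h I) \<longlongrightarrow> rform F N f f) (finite_subsets_at_top (UNIV \<times> UNIV))"
    using pair_has_sum[OF f f F(5)] unfolding h_def has_sum_def .
  \<comment> \<open>The squares I x I are cofinal among the finite sets of pairs, so the double sum
    is a limit along them, and on a square the form is a mean of squares.\<close>
  moreover have "filterlim (\<lambda>I. I \<times> I) (finite_subsets_at_top (UNIV \<times> UNIV)) (finite_subsets_at_top (UNIV :: int set))"
    unfolding filterlim_iff
  proof (intro allI impI)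
    fix P assume "eventually P (finite_subsets_at_top ((UNIV :: int set) \<times> (UNIV :: int set)))"
    then obtain X where X: "finite X" "\<And>Y. finite Y \<Longrightarrow> X \<subseteq> Y \<Longrightarrow> P Y"
      unfolding eventually_finite_subsets_at_top by auto
    have "P (I \<times> I)" if "finite I" "fst ` X \<union> snd ` X \<subseteq> I" for I
      by (rule X(2)) (use that in \<open>force+\<close>)
    then show "\<forall>\<^sub>F I in finite_subsets_at_top (UNIV :: int set). P (I \<times> I)"
      unfolding eventually_finite_subsets_at_top using X(1) by (intro exI[of _ "fst ` X \<union> snd ` X"]) auto
  qed
  ultimately have l: "((\<lambda>I. sum h (I \<times> I)) \<longlongrightarrow> rform F N f f) (finite_subsets_at_top UNIV)"
    by (rule filterlim_compose)
  have "sum h (I \<times> I) \<in> cnonneg" if I: "finite I" for I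
  proof -
    define u where "u p a = rst N f a * of_real (sin (of_int (a - int N) * p))" for p a
    have "sum h (I \<times> I) = (\<Sum>a\<in>I. \<Sum>b\<in>I. avg (\<lambda>p. (cnj (rst N f a) * rst N f b) * (F p * of_real (2 * sin (of_int (a - int N) * p) * sin (of_int (b - int N) * p)))))"
      unfolding h_def sum.cartesian_product[symmetric] refl_kern_sin[OF Fc] avg_cmult by (simp add: mult_ac)
    also have "\<dots> = avg (\<lambda>p. \<Sum>a\<in>I. \<Sum>b\<in>I. (cnj (rst N f a) * rst N f b) * (F p * of_real (2 * sin (of_int (a - int N) * p) * sin (of_int (b - int N) * p))))"
      by (simp add: avg_sum continuous_on_sum continuous_on_mult continuous_on_const Fc continuous_on_of_real continuous_on_sin continuous_on_id)
    also have "(\<lambda>p. \<Sum>a\<in>I. \<Sum>b\<in>I. (cnj (rst N f a) * rst N f b) * (F p * of_real (2 * sin (of_int (a - int N) * p) * sin (of_int (b - int N) * p))))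
       = (\<lambda>p. of_real (2 * Fr p * (cmod (\<Sum>a\<in>I. u p a))\<^sup>2))"
    proof
      fix p
      have "(\<Sum>a\<in>I. \<Sum>b\<in>I. (cnj (rst N f a) * rst N f b) * (F p * of_real (2 * sin (of_int (a - int N) * p) * sin (of_int (b - int N) * p))))
         = (2 * F p) * (\<Sum>a\<in>I. \<Sum>b\<in>I. cnj (u p a) * u p b)"
        unfolding u_def sum_distrib_left by (intro sum.cong refl) (simp add: mult_ac)
      then show "(\<Sum>a\<in>I. \<Sum>b\<in>I. (cnj (rst N f a) * rst N f b) * (F p * of_real (2 * sin (of_int (a - int N) * p) * sin (of_int (b - int N) * p)))) = of_real (2 * Fr p * (cmod (\<Sum>a\<in>I. u p a))\<^sup>2)"
        unfolding sum_square_form F(1) by simp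
    qed
    also have "avg \<dots> \<in> cnonneg"
      by (rule avg_nonneg) (auto intro!: continuous_intros mult_nonneg_nonneg F(2,3) simp: u_def)
    finally show ?thesis .
  qed
  then show ?thesis
    by (intro Lim_in_closed_set[OF cnonneg_closed _ _ l] eventually_finite_subsets_at_top_weakI) auto
qed

lemma Zc_nonneg:
  assumes \<kappa>: "0 < \<kappa>" shows "Zc N \<kappa> \<beta>L \<beta>R \<in> cnonneg"
proof -
  obtain c where c: "l2le (bstate \<kappa> 0) c" using bstate_l2le[OF \<kappa>] by blast
  have r: "rform (fermi \<beta>) N (bstate \<kappa> 0) (bstate \<kappa> 0) \<in> cnonneg" for \<beta>
  proof (rule rform_nonneg[OF c _ _ _ _ fermi_summable])
    show "fermi \<beta> = (\<lambda>p. of_real (1 / (1 + exp (- (\<beta> * cos p)))))" by (auto simp: fermi_def)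
    show "continuous_on UNIV (\<lambda>p. 1 / (1 + exp (- (\<beta> * cos p))))" by (intro continuous_intros ballI one_plus_exp_neq_0)
  qed (auto simp: add_nonneg_nonneg)
  have "(\<Sum>a\<in>ZS N. cnj (bstate \<kappa> 0 a) * bstate \<kappa> 0 a / 2) \<in> cnonneg"
    unfolding cnonneg_def by (auto simp: bstate_def intro!: sum_nonneg)
  then show ?thesis unfolding Zc_def by (intro cnonneg_add r)
qed

lemma Minf_hermitian: assumes "0 < \<kappa>" shows "Minf N \<kappa> \<beta>L \<beta>R y x = cnj (Minf N \<kappa> \<beta>L \<beta>R x y)"
proof -
  have cj: "cnj (havg F) = havg (\<lambda>p. cnj (F p))" for F unfolding havg_def by (simp add: integral_cnj)
  have fr: "cnj (fermi \<beta> p) = fermi \<beta> p" for \<beta> p unfolding fermi_def by simp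
  have z: "cnj (Zc N \<kappa> \<beta>L \<beta>R) = Zc N \<kappa> \<beta>L \<beta>R" using Zc_nonneg[OF assms, of N \<beta>L \<beta>R] unfolding cnonneg_def by (simp add: complex_eq_iff)
  show ?thesis unfolding Minf_def by (simp add: cj fr z mult_ac)
qed

text \<open>Each reservoir contributes the half mean of a Fermi function times the squared modulus
  of a combination of scattering states; the bound state contributes a nonnegative multiple of a
  rank one form.\<close>

lemma Minf_psd:
  assumes \<kappa>: "0 < \<kappa>" and I: "finite I"
  shows "0 \<le> Re (\<Sum>x\<in>I. \<Sum>y\<in>I. cnj (v x) * Minf N \<kappa> \<beta>L \<beta>R x y * v y)"
proof -
  have k: "\<kappa> \<noteq> 0" using \<kappa> by simp
  have h: "(\<Sum>x\<in>I. \<Sum>y\<in>I. cnj (v x) * havg (\<lambda>p. fermi \<beta> p * (cnj (scat \<kappa> (s x) p) * scat \<kappa> (s y) p)) * v y) \<in> cnonneg" for \<beta> s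
  proof -
    have "(\<Sum>x\<in>I. \<Sum>y\<in>I. cnj (v x) * havg (\<lambda>p. fermi \<beta> p * (cnj (scat \<kappa> (s x) p) * scat \<kappa> (s y) p)) * v y)
       = (\<Sum>x\<in>I. \<Sum>y\<in>I. havg (\<lambda>p. (cnj (v x) * v y) * (fermi \<beta> p * (cnj (scat \<kappa> (s x) p) * scat \<kappa> (s y) p))))"
      unfolding havg_cmult by (simp add: mult_ac)
    also have "\<dots> = havg (\<lambda>p. \<Sum>x\<in>I. \<Sum>y\<in>I. (cnj (v x) * v y) * (fermi \<beta> p * (cnj (scat \<kappa> (s x) p) * scat \<kappa> (s y) p)))"
      by (simp add: havg_sum continuous_on_sum continuous_on_mult continuous_on_const fermi_cont scat_cont[OF k] continuous_on_cnj)
    also have "(\<lambda>p. \<Sum>x\<in>I. \<Sum>y\<in>I. (cnj (v x) * v y) * (fermi \<beta> p * (cnj (scat \<kappa> (s x) p) * scat \<kappa> (s y) p)))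
       = (\<lambda>p. of_real ((1 / (1 + exp (- (\<beta> * cos p)))) * (cmod (\<Sum>x\<in>I. v x * scat \<kappa> (s x) p))\<^sup>2))"
    proof
      fix p
      have "(\<Sum>x\<in>I. \<Sum>y\<in>I. (cnj (v x) * v y) * (fermi \<beta> p * (cnj (scat \<kappa> (s x) p) * scat \<kappa> (s y) p)))
        = fermi \<beta> p * (\<Sum>x\<in>I. \<Sum>y\<in>I. cnj (v x * scat \<kappa> (s x) p) * (v y * scat \<kappa> (s y) p))"
        unfolding sum_distrib_left by (intro sum.cong refl) (simp add: mult_ac)
      then show "(\<Sum>x\<in>I. \<Sum>y\<in>I. (cnj (v x) * v y) * (fermi \<beta> p * (cnj (scat \<kappa> (s x) p) * scat \<kappa> (s y) p))) = of_real ((1 / (1 + exp (- (\<beta> * cos p)))) * (cmod (\<Sum>x\<in>I. v x * scat \<kappa> (s x) p))\<^sup>2)"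
        unfolding sum_square_form fermi_def by simp
    qed
    also have "havg \<dots> \<in> cnonneg"
    proof (rule havg_nonneg)
      have "continuous_on UNIV (\<lambda>p. scat \<kappa> (s x) p)" for x using scat_cont[OF k, of "s x"] .
      then show "continuous_on UNIV (\<lambda>p. 1 / (1 + exp (- (\<beta> * cos p))) * (cmod (\<Sum>x\<in>I. v x * scat \<kappa> (s x) p))\<^sup>2)"
        by (intro continuous_intros ballI one_plus_exp_neq_0)
    qed (auto intro!: mult_nonneg_nonneg divide_nonneg_nonneg add_nonneg_nonneg)
    finally show ?thesis .
  qed
  have z: "(\<Sum>x\<in>I. \<Sum>y\<in>I. cnj (v x) * (of_real (bs_decay \<kappa> ^ nat \<bar>x\<bar> * bs_decay \<kappa> ^ nat \<bar>y\<bar>) * Zc N \<kappa> \<beta>L \<beta>R) * v y) \<in> cnonneg"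
  proof -
    have "(\<Sum>x\<in>I. \<Sum>y\<in>I. cnj (v x) * (of_real (bs_decay \<kappa> ^ nat \<bar>x\<bar> * bs_decay \<kappa> ^ nat \<bar>y\<bar>) * Zc N \<kappa> \<beta>L \<beta>R) * v y)
      = Zc N \<kappa> \<beta>L \<beta>R * (\<Sum>x\<in>I. \<Sum>y\<in>I. cnj (v x * of_real (bs_decay \<kappa> ^ nat \<bar>x\<bar>)) * (v y * of_real (bs_decay \<kappa> ^ nat \<bar>y\<bar>)))"
      unfolding sum_distrib_left by (intro sum.cong refl) (simp add: mult_ac)
    then show ?thesis unfolding sum_square_form using Zc_nonneg[OF \<kappa>, of N \<beta>L \<beta>R] unfolding cnonneg_def by simp
  qed
  have "(\<Sum>x\<in>I. \<Sum>y\<in>I. cnj (v x) * Minf N \<kappa> \<beta>L \<beta>R x y * v y) = (\<Sum>x\<in>I. \<Sum>y\<in>I. cnj (v x) * havg (\<lambda>p. fermi \<beta>R p * (cnj (scat \<kappa> x p) * scat \<kappa> y p)) * v y)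
     + (\<Sum>x\<in>I. \<Sum>y\<in>I. cnj (v x) * havg (\<lambda>p. fermi \<beta>L p * (cnj (scat \<kappa> (- x) p) * scat \<kappa> (- y) p)) * v y)
     + (\<Sum>x\<in>I. \<Sum>y\<in>I. cnj (v x) * (of_real (bs_decay \<kappa> ^ nat \<bar>x\<bar> * bs_decay \<kappa> ^ nat \<bar>y\<bar>) * Zc N \<kappa> \<beta>L \<beta>R) * v y)"
    unfolding Minf_def distrib_left distrib_right sum.distrib ..
  also have "\<dots> \<in> cnonneg" using h[of \<beta>R "\<lambda>x. x"] h[of \<beta>L uminus] z by (intro cnonneg_add)
  finally show ?thesis unfolding cnonneg_def by simp
qed

section \<open>Pfaffians and determinants\<close>

text \<open>Rows are labelled by the first list, columns by the second; expansion along the head of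
  either list removes one element of the other, which matches the recursion of
  \<open>pf\<close>.\<close>

definition ldet :: "('a \<Rightarrow> 'a \<Rightarrow> complex) \<Rightarrow> 'a list \<Rightarrow> 'a list \<Rightarrow> complex" where
  "ldet A os es = Determinant.det (Matrix.mat (length os) (length os) (\<lambda>(i, j). A (os ! i) (es ! j)))"

lemma nth_remove:
  assumes "j < length xs" "k < length xs - 1"
  shows "(take j xs @ drop (Suc j) xs) ! k = xs ! (if k < j then k else Suc k)"
  using assms by (auto simp: nth_append min_def)

lemma ldet_row:
  assumes "length es = Suc (length os)"
  shows "ldet A (x # os) es = (\<Sum>j<length es. (-1) ^ j * A x (es ! j) * ldet A os (take j es @ drop (Suc j) es))"
proof -
  define n where "n = length es"
  define M where "M = Matrix.mat n n (\<lambda>(i, j). A ((x # os) ! i) (es ! j))"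
  have M: "M \<in> carrier_mat n n" unfolding M_def by simp
  have n0: "0 < n" using assms by (simp add: n_def)
  have "Determinant.det M = (\<Sum>j<n. M $$ (0, j) * cofactor M 0 j)"
    by (rule laplace_expansion_row[OF M n0])
  also have "\<dots> = (\<Sum>j<n. (-1) ^ j * A x (es ! j) * ldet A os (take j es @ drop (Suc j) es))"
  proof (rule sum.cong[OF refl])
    fix j assume "j \<in> {..<n}"
    then have j: "j < n" by simp
    have "mat_delete M 0 j = Matrix.mat (length os) (length os) (\<lambda>(i, k). A (os ! i) ((take j es @ drop (Suc j) es) ! k))"
    proof (rule eq_matI)
      fix i k assume ik: "i < dim_row (Matrix.mat (length os) (length os) (\<lambda>(i, k). A (os ! i) ((take j es @ drop (Suc j) es) ! k)))"
        "k < dim_col (Matrix.mat (length os) (length os) (\<lambda>(i, k). A (os ! i) ((take j es @ drop (Suc j) es) ! k)))"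
      then have ik': "i < length os" "k < length os" by auto
      have "(take j es @ drop (Suc j) es) ! k = es ! (if k < j then k else Suc k)"
        by (rule nth_remove) (use j ik' assms in \<open>auto simp: n_def\<close>)
      then show "mat_delete M 0 j $$ (i, k) = Matrix.mat (length os) (length os) (\<lambda>(i, k). A (os ! i) ((take j es @ drop (Suc j) es) ! k)) $$ (i, k)"
        using ik' j assms unfolding mat_delete_def M_def n_def by auto
    qed (use assms in \<open>auto simp: mat_delete_def M_def n_def\<close>)
    then show "M $$ (0, j) * cofactor M 0 j = (-1) ^ j * A x (es ! j) * ldet A os (take j es @ drop (Suc j) es)"
      using j unfolding cofactor_def ldet_def by (simp add: M_def)
  qed
  finally show ?thesis unfolding M_def n_def ldet_def using assms by simp
qed

lemma ldet_col:
  assumes "length os = Suc (length es)"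
  shows "ldet A os (x # es) = (\<Sum>i<length os. (-1) ^ i * A (os ! i) x * ldet A (take i os @ drop (Suc i) os) es)"
proof -
  define n where "n = length os"
  define M where "M = Matrix.mat n n (\<lambda>(i, j). A (os ! i) ((x # es) ! j))"
  have M: "M \<in> carrier_mat n n" unfolding M_def by simp
  have n0: "0 < n" using assms by (simp add: n_def)
  have "Determinant.det M = (\<Sum>i<n. M $$ (i, 0) * cofactor M i 0)"
    by (rule laplace_expansion_column[OF M n0])
  also have "\<dots> = (\<Sum>i<n. (-1) ^ i * A (os ! i) x * ldet A (take i os @ drop (Suc i) os) es)"
  proof (rule sum.cong[OF refl])
    fix j assume "j \<in> {..<n}"
    then have j: "j < n" by simp
    have l: "length (take j os @ drop (Suc j) os) = length es" using j assms by (simp add: n_def)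
    have "mat_delete M j 0 = Matrix.mat (length es) (length es) (\<lambda>(i, k). A ((take j os @ drop (Suc j) os) ! i) (es ! k))"
    proof (rule eq_matI)
      fix i k assume ik: "i < dim_row (Matrix.mat (length es) (length es) (\<lambda>(i, k). A ((take j os @ drop (Suc j) os) ! i) (es ! k)))"
        "k < dim_col (Matrix.mat (length es) (length es) (\<lambda>(i, k). A ((take j os @ drop (Suc j) os) ! i) (es ! k)))"
      then have ik': "i < length es" "k < length es" by auto
      have "(take j os @ drop (Suc j) os) ! i = os ! (if i < j then i else Suc i)"
        by (rule nth_remove) (use j ik' assms in \<open>auto simp: n_def\<close>)
      then show "mat_delete M j 0 $$ (i, k) = Matrix.mat (length es) (length es) (\<lambda>(i, k). A ((take j os @ drop (Suc j) os) ! i) (es ! k)) $$ (i, k)"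
        using ik' j assms unfolding mat_delete_def M_def n_def by auto
    qed (use assms in \<open>auto simp: mat_delete_def M_def n_def\<close>)
    then show "M $$ (j, 0) * cofactor M j 0 = (-1) ^ j * A (os ! j) x * ldet A (take j os @ drop (Suc j) os) es"
      using j l unfolding cofactor_def ldet_def by (simp add: M_def)
  qed
  finally show ?thesis unfolding M_def n_def ldet_def by simp
qed

text \<open>Counts the pairs in which an element of E precedes one outside E, that is, the
  transpositions needed to put the latter first.\<close>

fun inv_count :: "('a \<Rightarrow> bool) \<Rightarrow> 'a list \<Rightarrow> nat" where
  "inv_count E [] = 0"
| "inv_count E (x # xs) = (if E x then length (filter (\<lambda>y. \<not> E y) xs) else 0) + inv_count E xs"

lemma inv_count_remove:
  "E x \<Longrightarrow> inv_count E (ys @ x # zs) = inv_count E (ys @ zs) + length (filter (\<lambda>y. \<not> E y) zs)"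
  "\<not> E x \<Longrightarrow> inv_count E (ys @ x # zs) = inv_count E (ys @ zs) + length (filter E ys)"
  by (induction ys) auto

text \<open>Turns the expansion over positions of the whole list into one over positions of the
  filtered list; \<psi> may depend on prefix, element and suffix of the latter, so signs can be
  included.\<close>

lemma sum_filter_reindex:
  fixes \<psi> :: "'a list \<Rightarrow> 'a \<Rightarrow> 'a list \<Rightarrow> 'b::comm_monoid_add"
  shows "(\<Sum>j<length xs. if E (xs ! j) then \<psi> (filter E (take j xs)) (xs ! j) (filter E (drop (Suc j) xs)) else 0)
    = (\<Sum>j<length (filter E xs). \<psi> (take j (filter E xs)) (filter E xs ! j) (drop (Suc j) (filter E xs)))"
proof (induction xs arbitrary: \<psi>)
  case (Cons x xs)
  show ?case
  proof (cases "E x")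
    case True
    have "(\<Sum>j<length (x # xs). if E ((x # xs) ! j) then \<psi> (filter E (take j (x # xs))) ((x # xs) ! j) (filter E (drop (Suc j) (x # xs))) else 0)
       = \<psi> [] x (filter E xs) + (\<Sum>j<length xs. if E (xs ! j) then \<psi> (x # filter E (take j xs)) (xs ! j) (filter E (drop (Suc j) xs)) else 0)"
      using True by (simp add: sum.lessThan_Suc_shift del: sum.lessThan_Suc cong: if_cong)
    also have "\<dots> = \<psi> [] x (filter E xs) + (\<Sum>j<length (filter E xs). \<psi> (x # take j (filter E xs)) (filter E xs ! j) (drop (Suc j) (filter E xs)))"
      using Cons.IH[of "\<lambda>ys. \<psi> (x # ys)"] by simp
    also have "\<dots> = (\<Sum>j<length (filter E (x # xs)). \<psi> (take j (filter E (x # xs))) (filter E (x # xs) ! j) (drop (Suc j) (filter E (x # xs))))"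
      using True by (simp add: sum.lessThan_Suc_shift del: sum.lessThan_Suc cong: if_cong)
    finally show ?thesis .
  next
    case False
    then show ?thesis using Cons.IH[of \<psi>] by (simp add: sum.lessThan_Suc_shift del: sum.lessThan_Suc cong: if_cong)
  qed
qed simp

text \<open>To be used along \<open>sorted_wrt\<close>, hence for x before y; the minus sign for E
  before non-E is the antisymmetric completion of A.\<close>

definition bip_pair :: "('a \<Rightarrow> bool) \<Rightarrow> ('a \<Rightarrow> 'a \<Rightarrow> complex) \<Rightarrow> ('a \<Rightarrow> 'a \<Rightarrow> complex) \<Rightarrow> 'a \<Rightarrow> 'a \<Rightarrow> bool" where
  "bip_pair E w A x y \<longleftrightarrow> (E x = E y \<longrightarrow> w x y = 0) \<and> (\<not> E x \<longrightarrow> E y \<longrightarrow> w x y = A x y) \<and> (E x \<longrightarrow> \<not> E y \<longrightarrow> w x y = - A y x)"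

text \<open>(-1) ^ \<open>tri n\<close> is the sign in the Pfaffian of the antisymmetric block
  matrix with vanishing diagonal blocks and A in the upper right corner.\<close>

definition tri :: "nat \<Rightarrow> nat" where "tri n = n * (n - 1) div 2"

lemma tri_Suc: "tri (Suc n) = tri n + n"
proof -
  have "even (n * (n - 1))" by (cases n) auto
  moreover have "Suc n * (Suc n - 1) = n * (n - 1) + n * 2" by (cases n) (auto simp: algebra_simps)
  ultimately show ?thesis unfolding tri_def by (simp add: div_add)
qed

text \<open>Induction on the length: the first element is expanded along a row or along a column of the
  determinant according to its class.\<close>
lemma pf_bipartite:
  assumes "sorted_wrt (bip_pair E w A) xs" "length (filter E xs) = n" "length (filter (\<lambda>y. \<not> E y) xs) = n"
  shows "pf w xs = (-1) ^ (inv_count E xs + tri n) * ldet A (filter (\<lambda>y. \<not> E y) xs) (filter E xs)"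
  using assms
proof (induction "length xs" arbitrary: xs n rule: less_induct)
  case less
  show ?case
  proof (cases xs)
    case Nil
    then show ?thesis using less.prems by (simp add: tri_def ldet_def)
  next
    case (Cons x r)
    have srt: "sorted_wrt (bip_pair E w A) r" and px: "\<And>y. y \<in> set r \<Longrightarrow> bip_pair E w A x y"
      using less.prems(1) Cons by auto
    define O' where "O' = (\<lambda>y. \<not> E y)"
    have dec: "r = take j r @ r ! j # drop (Suc j) r" if "j < length r" for j
      using that by (simp add: id_take_nth_drop)
    have sub: "sorted_wrt (bip_pair E w A) (take j r @ drop (Suc j) r)" if "j < length r" for j
    proof -
      have "sorted_wrt (bip_pair E w A) (take j r @ r ! j # drop (Suc j) r)" using srt dec[OF that] by simp
      then show ?thesis by (auto simp: sorted_wrt_append)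
    qed
    show ?thesis
    proof (cases "E x")
      case False
      then obtain k where k: "n = Suc k" using less.prems(3) Cons by (cases n) auto
      have ln: "length (filter E r) = Suc k" "length (filter O' r) = k"
        using less.prems(2,3) False Cons k by (auto simp: O'_def)
      define PS where "PS = (\<lambda>ys e zs. (-1) ^ (inv_count E xs + tri n) * ((-1) ^ length ys * A x e * ldet A (filter O' r) (ys @ zs)))"
      have "pf w xs = (\<Sum>j<length r. (-1) ^ j * w x (r ! j) * pf w (take j r @ drop (Suc j) r))"
        using Cons by simp
      also have "\<dots> = (\<Sum>j<length r. if E (r ! j) then
          PS (filter E (take j r)) (r ! j) (filter E (drop (Suc j) r)) else 0)"
      proof (rule sum.cong[OF refl])
        fix j assume "j \<in> {..<length r}"
        then have j: "j < length r" by simp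
        define ys where "ys = take j r"
        define zs where "zs = drop (Suc j) r"
        have ry: "r = ys @ r ! j # zs" unfolding ys_def zs_def by (rule dec[OF j])
        have bp: "bip_pair E w A x (r ! j)" by (rule px) (use j in simp)
        show "(-1) ^ j * w x (r ! j) * pf w (take j r @ drop (Suc j) r) = (if E (r ! j) then
          PS (filter E (take j r)) (r ! j) (filter E (drop (Suc j) r)) else 0)"
        proof (cases "E (r ! j)")
          case True
          have wx: "w x (r ! j) = A x (r ! j)" using bp True False by (simp add: bip_pair_def)
          have fO: "filter O' r = filter O' ys @ filter O' zs" by (subst ry) (use True in \<open>simp add: O'_def\<close>)
          have fE: "filter E r = filter E ys @ r ! j # filter E zs" by (subst ry) (use True in simp)
          have l1: "length (filter E (ys @ zs)) = k" using ln(1) fE by simp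
          have l2: "length (filter (\<lambda>y. \<not> E y) (ys @ zs)) = k" using ln(2) fO unfolding O'_def by simp
          have IH: "pf w (ys @ zs) = (-1) ^ (inv_count E (ys @ zs) + tri k) * ldet A (filter (\<lambda>y. \<not> E y) (ys @ zs)) (filter E (ys @ zs))"
            by (rule less.hyps[OF _ _ l1 l2]) (use Cons j sub[OF j] in \<open>auto simp: ys_def zs_def\<close>)
          have iv: "inv_count E xs = inv_count E (ys @ zs) + length (filter O' zs)"
            using inv_count_remove(1)[of E "r ! j" ys zs, OF True] False Cons ry unfolding O'_def by simp
          have lj: "j = length (filter E ys) + length (filter O' ys)"
          proof -
            have "length ys = j" using j by (simp add: ys_def)
            then show ?thesis using sum_length_filter_compl[of E ys] unfolding O'_def by simp
          qed
          have lk: "length (filter O' ys) + length (filter O' zs) = k" using ln(2) fO by simp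
          \<comment> \<open>The exponents are compared after even numbers have been added, which
            avoids subtraction of natural numbers.\<close>
          have sg: "(-1 :: complex) ^ j * (-1) ^ (inv_count E (ys @ zs) + tri k) = (-1) ^ (inv_count E xs + tri n) * (-1) ^ length (filter E ys)"
          proof -
            have "inv_count E xs + tri n + length (filter E ys) + 2 * length (filter O' ys) = j + (inv_count E (ys @ zs) + tri k) + 2 * k"
              unfolding iv k tri_Suc lj using lk by simp
            then have "(-1 :: complex) ^ (inv_count E xs + tri n + length (filter E ys)) = (-1) ^ (j + (inv_count E (ys @ zs) + tri k))"
              by (metis (no_types, lifting) minus_one_power_iff even_add even_mult_iff even_numeral)
            then show ?thesis by (simp add: power_add)
          qed
          have "(-1) ^ j * w x (r ! j) * pf w (ys @ zs) = ((-1) ^ j * (-1) ^ (inv_count E (ys @ zs) + tri k)) * (A x (r ! j) * ldet A (filter O' r) (filter E ys @ filter E zs))"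
            unfolding IH wx fO by (simp add: O'_def mult_ac)
          then have "(-1) ^ j * w x (r ! j) * pf w (ys @ zs) = ((-1) ^ (inv_count E xs + tri n) * (-1) ^ length (filter E ys)) * (A x (r ! j) * ldet A (filter O' r) (filter E ys @ filter E zs))"
            by (simp only: sg)
          then show ?thesis using True unfolding ys_def zs_def PS_def by (simp only: if_True mult.assoc)
        next
          case False2: False
          then have "w x (r ! j) = 0" using bp False by (simp add: bip_pair_def)
          then show ?thesis using False2 by simp
        qed
      qed
      also have "\<dots> = (-1) ^ (inv_count E xs + tri n) * ldet A (x # filter O' r) (filter E r)"
        unfolding sum_filter_reindex ldet_row[OF ln(1)[folded ln(2)]] sum_distrib_left
        by (rule sum.cong[OF refl]) (simp add: min_def PS_def)
      finally show ?thesis using False Cons by (simp add: O'_def)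
    next
      case True
      then obtain k where k: "n = Suc k" using less.prems(2) Cons by (cases n) auto
      have ln: "length (filter E r) = k" "length (filter O' r) = Suc k"
        using less.prems(2,3) True Cons k by (auto simp: O'_def)
      define PS where "PS = (\<lambda>ys e zs. (-1) ^ (inv_count E xs + tri n) * ((-1) ^ length ys * A e x * ldet A (ys @ zs) (filter E r)))"
      have "pf w xs = (\<Sum>j<length r. (-1) ^ j * w x (r ! j) * pf w (take j r @ drop (Suc j) r))"
        using Cons by simp
      also have "\<dots> = (\<Sum>j<length r. if O' (r ! j) then
          PS (filter O' (take j r)) (r ! j) (filter O' (drop (Suc j) r)) else 0)"
      proof (rule sum.cong[OF refl])
        fix j assume "j \<in> {..<length r}"
        then have j: "j < length r" by simp
        define ys where "ys = take j r"
        define zs where "zs = drop (Suc j) r"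
        have ry: "r = ys @ r ! j # zs" unfolding ys_def zs_def by (rule dec[OF j])
        have bp: "bip_pair E w A x (r ! j)" by (rule px) (use j in simp)
        show "(-1) ^ j * w x (r ! j) * pf w (take j r @ drop (Suc j) r) = (if O' (r ! j) then
          PS (filter O' (take j r)) (r ! j) (filter O' (drop (Suc j) r)) else 0)"
        proof (cases "E (r ! j)")
          case False
          have wx: "w x (r ! j) = - A (r ! j) x" using bp True False by (simp add: bip_pair_def)
          have fO: "filter O' r = filter O' ys @ r ! j # filter O' zs" by (subst ry) (use False in \<open>simp add: O'_def\<close>)
          have fE: "filter E r = filter E ys @ filter E zs" by (subst ry) (use False in simp)
          have l1: "length (filter E (ys @ zs)) = k" using ln(1) fE by simp
          have l2: "length (filter (\<lambda>y. \<not> E y) (ys @ zs)) = k" using ln(2) fO unfolding O'_def by simp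
          have IH: "pf w (ys @ zs) = (-1) ^ (inv_count E (ys @ zs) + tri k) * ldet A (filter (\<lambda>y. \<not> E y) (ys @ zs)) (filter E (ys @ zs))"
            by (rule less.hyps[OF _ _ l1 l2]) (use Cons j sub[OF j] in \<open>auto simp: ys_def zs_def\<close>)
          \<comment> \<open>The head x, now in E, precedes all Suc k elements outside E.\<close>
          have iv: "inv_count E xs = Suc k + (inv_count E (ys @ zs) + length (filter E ys))"
            using inv_count_remove(2)[of E "r ! j" ys zs, OF False] True Cons ry ln(2) unfolding O'_def by simp
          have lj: "j = length (filter E ys) + length (filter O' ys)"
          proof -
            have "length ys = j" using j by (simp add: ys_def)
            then show ?thesis using sum_length_filter_compl[of E ys] unfolding O'_def by simp
          qed
          have sg: "(-1 :: complex) ^ j * (-1) * (-1) ^ (inv_count E (ys @ zs) + tri k) = (-1) ^ (inv_count E xs + tri n) * (-1) ^ length (filter O' ys)"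
          proof -
            have "inv_count E xs + tri n + length (filter O' ys) = j + 1 + (inv_count E (ys @ zs) + tri k) + 2 * k"
              unfolding iv k tri_Suc lj by simp
            then have "(-1 :: complex) ^ (inv_count E xs + tri n + length (filter O' ys)) = (-1) ^ (j + 1 + (inv_count E (ys @ zs) + tri k))"
              by (metis (no_types, lifting) minus_one_power_iff even_add even_mult_iff even_numeral)
            then show ?thesis by (simp add: power_add)
          qed
          have "(-1) ^ j * w x (r ! j) * pf w (ys @ zs) = ((-1) ^ j * (-1) * (-1) ^ (inv_count E (ys @ zs) + tri k)) * (A (r ! j) x * ldet A (filter O' ys @ filter O' zs) (filter E r))"
            unfolding IH wx fE by (simp add: O'_def mult_ac)
          then have "(-1) ^ j * w x (r ! j) * pf w (ys @ zs) = ((-1) ^ (inv_count E xs + tri n) * (-1) ^ length (filter O' ys)) * (A (r ! j) x * ldet A (filter O' ys @ filter O' zs) (filter E r))"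
            by (simp only: sg)
          moreover have "O' (r ! j)" using False by (simp add: O'_def)
          ultimately show ?thesis unfolding ys_def zs_def PS_def by (simp only: if_True mult.assoc)
        next
          case True2: True
          then have "w x (r ! j) = 0" using bp True by (simp add: bip_pair_def)
          then show ?thesis using True2 by (simp add: O'_def)
        qed
      qed
      also have "\<dots> = (-1) ^ (inv_count E xs + tri n) * ldet A (filter O' r) (x # filter E r)"
        unfolding sum_filter_reindex ldet_col[OF ln(2)[folded ln(1)]] sum_distrib_left
        by (rule sum.cong[OF refl]) (simp add: min_def PS_def)
      finally show ?thesis using True Cons by (simp add: O'_def)
    qed
  qed
qed

lemma pf_map: "pf w (map h xs) = pf (\<lambda>x y. w (h x) (h y)) xs"
proof (induction "length xs" arbitrary: xs rule: less_induct)
  case less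
  show ?case
  proof (cases xs)
    case (Cons x r)
    have "pf w (take j (map h r) @ drop (Suc j) (map h r)) = pf (\<lambda>x y. w (h x) (h y)) (take j r @ drop (Suc j) r)" if "j < length r" for j
      using less[of "take j r @ drop (Suc j) r"] that Cons by (simp add: take_map drop_map)
    then show ?thesis using Cons by (simp cong: sum.cong_simp)
  qed simp
qed

section \<open>Hadamard's inequality by Schur complements\<close>

definition fdet :: "nat \<Rightarrow> (nat \<Rightarrow> nat \<Rightarrow> complex) \<Rightarrow> complex" where
  "fdet n M = Determinant.det (Matrix.mat n n (\<lambda>(i, j). M i j))"

definition qform :: "nat \<Rightarrow> (nat \<Rightarrow> nat \<Rightarrow> complex) \<Rightarrow> (nat \<Rightarrow> complex) \<Rightarrow> complex" where
  "qform n M v = (\<Sum>i<n. \<Sum>j<n. cnj (v i) * M i j * v j)"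

definition psd :: "nat \<Rightarrow> (nat \<Rightarrow> nat \<Rightarrow> complex) \<Rightarrow> bool" where
  "psd n M \<longleftrightarrow> (\<forall>i<n. \<forall>j<n. M j i = cnj (M i j)) \<and> (\<forall>v. 0 \<le> Re (qform n M v))"

definition schur :: "(nat \<Rightarrow> nat \<Rightarrow> complex) \<Rightarrow> nat \<Rightarrow> nat \<Rightarrow> complex" where
  "schur M i j = M (Suc i) (Suc j) - M (Suc i) 0 * M 0 (Suc j) / M 0 0"

text \<open>One step of Gaussian elimination: a unit lower triangular matrix times a block upper
  triangular one with the Schur complement in its corner.\<close>

lemma fdet_schur:
  assumes a: "M 0 0 \<noteq> 0"
  shows "fdet (Suc n) M = M 0 0 * fdet n (schur M)"
proof -
  define L where "L = Matrix.mat (Suc n) (Suc n) (\<lambda>(i, j). if i = j then 1 else if j = 0 then M i 0 / M 0 0 else (0 :: complex))"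
  define U where "U = four_block_mat (Matrix.mat 1 1 (\<lambda>_. M 0 0)) (Matrix.mat 1 n (\<lambda>(i, j). M 0 (Suc j))) (0\<^sub>m n 1) (Matrix.mat n n (\<lambda>(i, j). schur M i j))"
  have Lc: "L \<in> carrier_mat (Suc n) (Suc n)" unfolding L_def by simp
  have Uc: "U \<in> carrier_mat (Suc n) (Suc n)" unfolding U_def by (rule carrier_matI) auto
  have "Matrix.mat (Suc n) (Suc n) (\<lambda>(i, j). M i j) = L * U"
  proof (rule eq_matI)
    fix i j assume "i < dim_row (L * U)" "j < dim_col (L * U)"
    then have i: "i < Suc n" and j: "j < Suc n" using Lc Uc by auto
    have "(L * U) $$ (i, j) = (\<Sum>k<Suc n. L $$ (i, k) * U $$ (k, j))"
      using i j Lc Uc by (simp add: scalar_prod_def lessThan_atLeast0)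
    also have "\<dots> = L $$ (i, 0) * U $$ (0, j) + (\<Sum>k<n. L $$ (i, Suc k) * U $$ (Suc k, j))"
      by (simp add: sum.lessThan_Suc_shift del: sum.lessThan_Suc)
    also have "(\<Sum>k<n. L $$ (i, Suc k) * U $$ (Suc k, j)) = (if i = 0 then 0 else U $$ (i, j))"
    proof (cases i)
      case 0
      then show ?thesis by (simp add: L_def)
    next
      case (Suc i')
      have "(\<Sum>k<n. L $$ (i, Suc k) * U $$ (Suc k, j)) = (\<Sum>k<n. if k = i' then U $$ (Suc k, j) else 0)"
        by (rule sum.cong) (use Suc i in \<open>auto simp: L_def\<close>)
      then show ?thesis using Suc i by simp
    qed
    finally have LU: "(L * U) $$ (i, j) = L $$ (i, 0) * U $$ (0, j) + (if i = 0 then 0 else U $$ (i, j))" .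
    have U0: "U $$ (0, j) = M 0 j" using j by (auto simp: U_def)
    show "Matrix.mat (Suc n) (Suc n) (\<lambda>(i, j). M i j) $$ (i, j) = (L * U) $$ (i, j)"
    proof (cases i)
      case 0
      then show ?thesis unfolding LU U0 using i j by (simp add: L_def)
    next
      case (Suc i')
      have "U $$ (i, j) = (if j = 0 then 0 else schur M i' (j - 1))" using Suc i j by (auto simp: U_def)
      then show ?thesis unfolding LU U0 using Suc i j a by (auto simp: L_def schur_def split: nat.splits) 
    qed
  qed (use Lc Uc in auto)
  then have "fdet (Suc n) M = Determinant.det L * Determinant.det U" unfolding fdet_def by (simp add: det_mult[OF Lc Uc])
  moreover have "Determinant.det L = 1"
  proof -
    have "Determinant.det L = prod_list (diag_mat L)" by (rule det_lower_triangular[OF _ Lc]) (auto simp: L_def)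
    also have "diag_mat L = map (\<lambda>i. 1) [0..<Suc n]" unfolding diag_mat_def by (auto simp: L_def)
    finally show ?thesis by (simp add: map_replicate_const)
  qed
  moreover have "Determinant.det U = M 0 0 * fdet n (schur M)"
  proof -
    have "Determinant.det U = Determinant.det (Matrix.mat 1 1 (\<lambda>_. M 0 0)) * Determinant.det (Matrix.mat n n (\<lambda>(i, j). schur M i j))"
      unfolding U_def by (rule det_four_block_mat_lower_left_zero_col) auto
    also have "Determinant.det (Matrix.mat 1 1 (\<lambda>_. M 0 0)) = M 0 0" by (subst det_single) auto
    finally show ?thesis unfolding fdet_def .
  qed
  ultimately show ?thesis by simp
qed

text \<open>Completing the square in \<open>v 0\<close>.\<close>

lemma qform_schur:
  assumes h: "\<And>i. i < n \<Longrightarrow> M (Suc i) 0 = cnj (M 0 (Suc i))" and a: "M 0 0 = of_real \<alpha>" "\<alpha> \<noteq> 0"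
  shows "qform (Suc n) M v = qform n (schur M) (\<lambda>i. v (Suc i))
    + of_real (\<alpha> * (cmod (v 0 + (\<Sum>j<n. M 0 (Suc j) * v (Suc j)) / of_real \<alpha>))\<^sup>2)"
proof -
  define s where "s = (\<Sum>j<n. M 0 (Suc j) * v (Suc j))"
  have s': "(\<Sum>i<n. cnj (v (Suc i)) * M (Suc i) 0) = cnj s"
    unfolding s_def cnj_sum by (rule sum.cong) (auto simp: h)
  have "qform (Suc n) M v = cnj (v 0) * M 0 0 * v 0 + (\<Sum>j<n. cnj (v 0) * M 0 (Suc j) * v (Suc j))
      + ((\<Sum>i<n. cnj (v (Suc i)) * M (Suc i) 0 * v 0) + (\<Sum>i<n. \<Sum>j<n. cnj (v (Suc i)) * M (Suc i) (Suc j) * v (Suc j)))"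
    unfolding qform_def by (simp add: sum.lessThan_Suc_shift sum.distrib del: sum.lessThan_Suc)
  also have "(\<Sum>j<n. cnj (v 0) * M 0 (Suc j) * v (Suc j)) = cnj (v 0) * s" unfolding s_def by (simp add: sum_distrib_left mult.assoc)
  also have "(\<Sum>i<n. cnj (v (Suc i)) * M (Suc i) 0 * v 0) = cnj s * v 0" unfolding s'[symmetric] by (simp add: sum_distrib_right)
  finally have 1: "qform (Suc n) M v = cnj (v 0) * of_real \<alpha> * v 0 + cnj (v 0) * s + (cnj s * v 0 + (\<Sum>i<n. \<Sum>j<n. cnj (v (Suc i)) * M (Suc i) (Suc j) * v (Suc j)))"
    unfolding a(1) .
  have "qform n (schur M) (\<lambda>i. v (Suc i)) = (\<Sum>i<n. \<Sum>j<n. cnj (v (Suc i)) * M (Suc i) (Suc j) * v (Suc j)) - (\<Sum>i<n. \<Sum>j<n. (cnj (v (Suc i)) * M (Suc i) 0) * (M 0 (Suc j) * v (Suc j)) / of_real \<alpha>)"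
    unfolding qform_def schur_def a(1) sum_subtractf[symmetric] by (intro sum.cong refl) (simp add: algebra_simps)
  also have "(\<Sum>i<n. \<Sum>j<n. (cnj (v (Suc i)) * M (Suc i) 0) * (M 0 (Suc j) * v (Suc j)) / of_real \<alpha>) = cnj s * s / of_real \<alpha>"
  proof -
    have "cnj s * s = (\<Sum>i<n. cnj (v (Suc i)) * M (Suc i) 0) * (\<Sum>j<n. M 0 (Suc j) * v (Suc j))"
      unfolding s' s_def ..
    then show ?thesis unfolding sum_product sum_divide_distrib[symmetric] by simp
  qed
  finally have 2: "(\<Sum>i<n. \<Sum>j<n. cnj (v (Suc i)) * M (Suc i) (Suc j) * v (Suc j)) = qform n (schur M) (\<lambda>i. v (Suc i)) + cnj s * s / of_real \<alpha>" by simp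
  have "of_real (\<alpha> * (cmod (v 0 + s / of_real \<alpha>))\<^sup>2) = of_real \<alpha> * ((v 0 + s / of_real \<alpha>) * cnj (v 0 + s / of_real \<alpha>))"
    by (simp only: of_real_mult complex_norm_square)
  also have "\<dots> = cnj (v 0) * of_real \<alpha> * v 0 + cnj (v 0) * s + cnj s * v 0 + cnj s * s / of_real \<alpha>"
    using a(2) by (simp add: field_simps)
  finally show ?thesis unfolding 1 2 s_def[symmetric] by (simp add: algebra_simps)
qed

text \<open>When the pivot vanishes, the form at s e_0 + e_j is affine in s over the reals, so it is
  bounded below only if the entry is 0.\<close>

lemma psd_zero_row:
  assumes M: "psd n M" "M 0 0 = 0" and j: "j < n"
  shows "M 0 j = 0"
proof (cases "j = 0")
  case False
  define B where "B = M 0 j"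
  have n0: "0 < n" using j by simp
  have hB: "M j 0 = cnj B" using M(1) j n0 unfolding psd_def B_def by blast
  have q: "0 \<le> Re (cnj s * B + cnj B * s + M j j)" for s
  proof -
    define v where "v i = (if i = 0 then s else if i = j then 1 else 0)" for i
    have r: "(\<Sum>k<n. g k * v k) = g 0 * s + g j" for g :: "nat \<Rightarrow> complex"
    proof -
      have "(\<Sum>k<n. g k * v k) = (\<Sum>k\<in>{0, j}. g k * v k)"
        by (rule sum.mono_neutral_right) (use j n0 in \<open>auto simp: v_def\<close>)
      then show ?thesis using False by (simp add: v_def)
    qed
    have r': "(\<Sum>k<n. cnj (v k) * g k) = cnj s * g 0 + g j" for g :: "nat \<Rightarrow> complex"
      using arg_cong[OF r[of "\<lambda>k. cnj (g k)"], of cnj] by (simp add: mult.commute)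
    have "qform n M v = (\<Sum>i<n. cnj (v i) * (\<Sum>k<n. M i k * v k))"
      unfolding qform_def by (simp add: sum_distrib_left mult.assoc)
    also have "\<dots> = cnj s * (M 0 0 * s + M 0 j) + (M j 0 * s + M j j)" unfolding r r' ..
    finally have "qform n M v = cnj s * B + cnj B * s + M j j" unfolding M(2) hB B_def[symmetric] by simp
    then show ?thesis using M(1) unfolding psd_def by metis
  qed
  show ?thesis
  proof (rule ccontr)
    assume "M 0 j \<noteq> 0"
    then have B0: "0 < (cmod B)\<^sup>2" by (simp add: B_def)
    \<comment> \<open>Makes the real part of the form equal to -1 at s = c B.\<close>
    define c where "c = - ((Re (M j j) + 1) / (2 * (cmod B)\<^sup>2))"
    have "Re (cnj (of_real c * B) * B + cnj B * (of_real c * B)) = 2 * c * (cmod B)\<^sup>2"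
      unfolding cmod_power2 by (simp add: power2_eq_square algebra_simps)
    also have "\<dots> = - (Re (M j j) + 1)" unfolding c_def using B0 by (simp add: field_simps)
    finally show False using q[of "of_real c * B"] by simp
  qed
qed (use M in simp)

text \<open>Hadamard's inequality in a basis that is unitriangular with respect to the given one.\<close>
lemma fdet_le_prod_qform:
  assumes "psd n M" "\<And>j. j < n \<Longrightarrow> V j j = 1" "\<And>j l. j < l \<Longrightarrow> V j l = 0"
  shows "cmod (fdet n M) \<le> (\<Prod>j<n. Re (qform n M (V j)))"
  using assms
proof (induction n arbitrary: M V)
  case 0
  then show ?case by (simp add: fdet_def)
next
  case (Suc n)
  have q0: "0 \<le> Re (qform (Suc n) M v)" for v using Suc.prems(1) unfolding psd_def by blast
  have herm: "M j i = cnj (M i j)" if "i < Suc n" "j < Suc n" for i j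
    using Suc.prems(1) that unfolding psd_def by blast
  \<comment> \<open>By unitriangularity \<open>V 0\<close> is the first unit vector.\<close>
  have V0: "qform (Suc n) M (V 0) = M 0 0"
  proof -
    have "cnj (V 0 i) * M i j * V 0 j = (if i = 0 then (if j = 0 then M 0 0 else 0) else 0)" for i j
      using Suc.prems(2)[of 0] Suc.prems(3)[of 0] by (auto simp: gr0_conv_Suc)
    then show ?thesis unfolding qform_def by (simp add: sum.lessThan_Suc_shift del: sum.lessThan_Suc)
  qed
  have im: "Im (M 0 0) = 0" using herm[of 0 0] by (simp add: complex_eq_iff)
  define \<alpha> where "\<alpha> = Re (M 0 0)"
  have \<alpha>: "M 0 0 = of_real \<alpha>" using im by (simp add: \<alpha>_def complex_eq_iff)
  have \<alpha>0: "0 \<le> \<alpha>" using q0[of "V 0"] V0 by (simp add: \<alpha>_def)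
  show ?case
  proof (cases "\<alpha> = 0")
    \<comment> \<open>A zero pivot forces the first row to vanish, and with it the
      determinant.\<close>
    case True
    then have z: "M 0 j = 0" if "j < Suc n" for j using psd_zero_row[OF Suc.prems(1) _ that] \<alpha> by simp
    define A where "A = Matrix.mat (Suc n) (Suc n) (\<lambda>(i, j). M i j)"
    have "Determinant.det A = (\<Sum>j<Suc n. A $$ (0, j) * cofactor A 0 j)"
      by (rule laplace_expansion_row) (auto simp: A_def)
    also have "\<dots> = 0" by (rule sum.neutral) (auto simp: A_def z)
    finally have "fdet (Suc n) M = 0" unfolding fdet_def A_def .
    then show ?thesis using q0 by (simp add: prod_nonneg del: prod.lessThan_Suc)
  next
    case False
    then have ap: "0 < \<alpha>" using \<alpha>0 by simp
    have h: "M (Suc i) 0 = cnj (M 0 (Suc i))" if "i < n" for i using herm[of 0 "Suc i"] that by simp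
    have qs: "qform (Suc n) M v = qform n (schur M) (\<lambda>i. v (Suc i))
      + of_real (\<alpha> * (cmod (v 0 + (\<Sum>j<n. M 0 (Suc j) * v (Suc j)) / of_real \<alpha>))\<^sup>2)" for v
      by (rule qform_schur) (use h \<alpha> False in auto)
    \<comment> \<open>The completed square is dropped; this is where the inequality arises.\<close>
    have le: "Re (qform n (schur M) (\<lambda>i. v (Suc i))) \<le> Re (qform (Suc n) M v)" for v
      unfolding qs[of v] using ap by simp
    have psd': "psd n (schur M)"
      unfolding psd_def
    proof (intro conjI allI impI)
      fix i j assume "i < n" "j < n"
      then show "schur M j i = cnj (schur M i j)"
        using herm[of "Suc i" "Suc j"] herm[of 0 "Suc i"] herm[of "0" "Suc j"] unfolding schur_def \<alpha> by (simp add: mult.commute)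
    next
      fix v :: "nat \<Rightarrow> complex"
      \<comment> \<open>The component at 0 is chosen to make the completed square vanish.\<close>
      define v' where "v' i = (case i of 0 \<Rightarrow> - (\<Sum>j<n. M 0 (Suc j) * v j) / of_real \<alpha> | Suc i \<Rightarrow> v i)" for i
      have "qform (Suc n) M v' = qform n (schur M) v"
        unfolding qs[of v'] by (simp add: v'_def)
      then show "0 \<le> Re (qform n (schur M) v)" using q0[of v'] by simp
    qed
    have IH: "cmod (fdet n (schur M)) \<le> (\<Prod>j<n. Re (qform n (schur M) (\<lambda>i. V (Suc j) (Suc i))))"
      by (rule Suc.IH[OF psd', of "\<lambda>j i. V (Suc j) (Suc i)"]) (use Suc.prems in auto)
    have "cmod (fdet (Suc n) M) = \<alpha> * cmod (fdet n (schur M))"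
      using fdet_schur[of M n] \<alpha> ap by (simp add: norm_mult)
    also have "\<dots> \<le> \<alpha> * (\<Prod>j<n. Re (qform n (schur M) (\<lambda>i. V (Suc j) (Suc i))))"
      by (rule mult_left_mono[OF IH \<alpha>0])
    also have "\<dots> \<le> \<alpha> * (\<Prod>j<n. Re (qform (Suc n) M (V (Suc j))))"
      by (intro mult_left_mono prod_mono conjI le \<alpha>0) (use psd' in \<open>auto simp: psd_def\<close>)
    also have "\<dots> = (\<Prod>j<Suc n. Re (qform (Suc n) M (V j)))"
      by (simp add: prod.lessThan_Suc_shift V0 \<alpha>_def del: prod.lessThan_Suc)
    finally show ?thesis .
  qed
qed

section \<open>Outer functions\<close>

inductive_set hpoly :: "(real \<Rightarrow> complex) set" where
  cis: "(\<lambda>p. cis (of_nat m * p)) \<in> hpoly"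
| add: "F \<in> hpoly \<Longrightarrow> G \<in> hpoly \<Longrightarrow> (\<lambda>p. F p + G p) \<in> hpoly"
| cmult: "F \<in> hpoly \<Longrightarrow> (\<lambda>p. c * F p) \<in> hpoly"

lemma hpoly_cont: "F \<in> hpoly \<Longrightarrow> continuous_on UNIV F"
  by (induction rule: hpoly.induct) (auto intro!: continuous_intros)

lemma hpoly_periodic: "F \<in> hpoly \<Longrightarrow> periodic F"
proof (induction rule: hpoly.induct)
  case (cis m)
  show ?case using cis_periodic[of "int m"] by (simp add: periodic_def)
qed (auto simp: periodic_def)

lemma hpoly_const: "(\<lambda>p. c) \<in> hpoly"
  using hpoly.cmult[OF hpoly.cis[of 0], of c] by simp

lemma hpoly_sum: "finite I \<Longrightarrow> (\<And>i. i \<in> I \<Longrightarrow> F i \<in> hpoly) \<Longrightarrow> (\<lambda>p. \<Sum>i\<in>I. F i p) \<in> hpoly"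
  by (induction I rule: finite_induct) (auto intro: hpoly.add hpoly_const)

text \<open>The mean of a polynomial in cis p is its constant term, hence multiplicative.\<close>

lemma hpoly_cis_mult: "F \<in> hpoly \<Longrightarrow> (\<lambda>p. cis (of_nat m * p) * F p) \<in> hpoly \<and> avg (\<lambda>p. cis (of_nat m * p) * F p) = avg (\<lambda>p. cis (of_nat m * p)) * avg F"
proof (induction rule: hpoly.induct)
  case (cis k)
  have e: "(\<lambda>p. cis (real m * p) * cis (real k * p)) = (\<lambda>p. cis (real (m + k) * p))" by (simp add: cis_mult distrib_right)
  show ?case unfolding e using hpoly.cis[of "m + k"] avg_cis[of "int (m + k)"] avg_cis[of "int m"] avg_cis[of "int k"] by simp
next
  case (add F G)
  note c = hpoly_cont[OF add.hyps(1)] hpoly_cont[OF add.hyps(2)]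
  have cc: "continuous_on UNIV (\<lambda>p. cis (real m * p) * F p)" "continuous_on UNIV (\<lambda>p. cis (real m * p) * G p)" by (intro continuous_intros c)+
  show ?case unfolding distrib_left avg_add[OF cc] avg_add[OF c] using add.IH hpoly.add by simp
next
  case (cmult F c)
  have e: "(\<lambda>p. cis (real m * p) * (c * F p)) = (\<lambda>p. c * (cis (real m * p) * F p))" by (simp add: mult_ac)
  show ?case unfolding e avg_cmult using cmult.IH hpoly.cmult by simp
qed

lemma hpoly_mult:
  assumes G: "G \<in> hpoly"
  shows "F \<in> hpoly \<Longrightarrow> (\<lambda>p. F p * G p) \<in> hpoly \<and> avg (\<lambda>p. F p * G p) = avg F * avg G"
proof (induction rule: hpoly.induct)
  case (cis m)
  then show ?case by (rule hpoly_cis_mult[OF G])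
next
  case (add F H)
  note c = hpoly_cont[OF add.hyps(1)] hpoly_cont[OF add.hyps(2)] hpoly_cont[OF G]
  have cc: "continuous_on UNIV (\<lambda>p. F p * G p)" "continuous_on UNIV (\<lambda>p. H p * G p)" by (intro continuous_intros c)+
  show ?case unfolding distrib_right avg_add[OF cc] avg_add[OF c(1,2)] using add.IH hpoly.add by simp
next
  case (cmult F c)
  show ?case unfolding mult.assoc avg_cmult using cmult.IH hpoly.cmult by simp
qed

text \<open>Continuous boundary values of functions analytic in the disc; the point is that the mean is
  multiplicative on them.\<close>
definition hardy :: "(real \<Rightarrow> complex) \<Rightarrow> bool" where
  "hardy F \<longleftrightarrow> continuous_on UNIV F \<and> periodic F \<and> (\<forall>e>0. \<exists>T\<in>hpoly. \<forall>p. cmod (F p - T p) \<le> e)"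

lemma hardy_approx:
  assumes "continuous_on UNIV F" "periodic F" "\<And>e. 0 < e \<Longrightarrow> \<exists>G. hardy G \<and> (\<forall>p. cmod (F p - G p) \<le> e)"
  shows "hardy F"
  unfolding hardy_def
proof (intro conjI assms(1,2) allI impI)
  fix e :: real assume e: "0 < e"
  obtain G where G: "hardy G" "\<And>p. cmod (F p - G p) \<le> e / 2" using assms(3)[of "e / 2"] e by auto
  obtain T where T: "T \<in> hpoly" "\<And>p. cmod (G p - T p) \<le> e / 2" using G(1) e unfolding hardy_def by (metis half_gt_zero)
  have "cmod (F p - T p) \<le> e" for p
    using norm_triangle_mono[OF G(2)[of p] T(2)[of p]] by simp
  then show "\<exists>T\<in>hpoly. \<forall>p. cmod (F p - T p) \<le> e" using T(1) by blast
qed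

lemma hpoly_hardy: "F \<in> hpoly \<Longrightarrow> hardy F"
  unfolding hardy_def using hpoly_cont hpoly_periodic by (auto intro!: bexI[of _ F])

lemma avg_close:
  assumes "continuous_on UNIV F" "continuous_on UNIV G" "\<And>p. cmod (F p - G p) \<le> e"
  shows "cmod (avg F - avg G) \<le> e"
  unfolding avg_diff[OF assms(1,2), symmetric] by (rule avg_norm_le) (use assms in \<open>auto intro!: continuous_intros\<close>)

lemma hardy_mult:
  assumes F: "hardy F" and G: "hardy G"
  shows "hardy (\<lambda>p. F p * G p) \<and> avg (\<lambda>p. F p * G p) = avg F * avg G"
proof -
  have c: "continuous_on UNIV F" "continuous_on UNIV G" "periodic F" "periodic G" using F G unfolding hardy_def by auto
  obtain K1 where K1: "0 < K1" "\<And>p. cmod (F p) \<le> K1" using cont_periodic_bounded[OF c(1,3)] by blast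
  obtain K2 where K2: "0 < K2" "\<And>p. cmod (G p) \<le> K2" using cont_periodic_bounded[OF c(2,4)] by blast
  have cp: "continuous_on UNIV (\<lambda>p. F p * G p)" by (intro continuous_intros c)
  have pp: "periodic (\<lambda>p. F p * G p)" using c(3,4) by (simp add: periodic_def)
  \<comment> \<open>The same approximants serve for membership and for the mean, which is continuous
    in the sup norm.\<close>
  have key: "\<exists>T\<in>hpoly. (\<forall>p. cmod (F p * G p - T p) \<le> e) \<and> cmod (avg (\<lambda>p. F p * G p) - avg F * avg G) \<le> 2 * e" if e: "0 < e" for e
  proof -
    define d where "d = min 1 (e / (K1 + K2 + 1))"
    have d: "0 < d" "d \<le> 1" "d * (K1 + K2 + 1) \<le> e"
    proof -
      have *: "0 < d \<and> d \<le> 1 \<and> d * L \<le> e" if "d = min 1 (e / L)" "0 < L" for L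
        using that e by (auto simp: min_def field_simps)
      have "0 < K1 + K2 + 1" using K1(1) K2(1) by simp
      from *[OF d_def this] show "0 < d" "d \<le> 1" "d * (K1 + K2 + 1) \<le> e" by auto
    qed
    obtain T where T: "T \<in> hpoly" "\<And>p. cmod (F p - T p) \<le> d" using F d(1) unfolding hardy_def by blast
    obtain S where S: "S \<in> hpoly" "\<And>p. cmod (G p - S p) \<le> d" using G d(1) unfolding hardy_def by blast
    note Tc = hpoly_cont[OF T(1)] and Sc = hpoly_cont[OF S(1)]
    have TS: "(\<lambda>p. T p * S p) \<in> hpoly" "avg (\<lambda>p. T p * S p) = avg T * avg S" using hpoly_mult[OF S(1) T(1)] by auto
    have gen: "cmod (a * b - t * s) \<le> e" if "cmod (a - t) \<le> d" "cmod (b - s) \<le> d" "cmod a \<le> K1" "cmod b \<le> K2" for a b t s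
    proof -
      have t: "cmod t \<le> K1 + d" using norm_triangle_ineq2[of t a] that(1,3) by (simp add: norm_minus_commute)
      have "a * b - t * s = (a - t) * b + t * (b - s)" by (simp add: algebra_simps)
      also have "cmod \<dots> \<le> d * K2 + (K1 + d) * d"
        by (rule order_trans[OF norm_triangle_ineq], unfold norm_mult, intro add_mono mult_mono that t) (use d K1 in auto)
      also have "\<dots> \<le> d * K2 + (K1 + 1) * d" using d by (intro add_left_mono mult_right_mono) auto
      also have "\<dots> \<le> e" using d(3) by (simp add: algebra_simps)
      finally show ?thesis .
    qed
    have 1: "cmod (F p * G p - T p * S p) \<le> e" for p by (rule gen[OF T(2) S(2) K1(2) K2(2)])
    have 2: "cmod (avg (\<lambda>p. F p * G p) - avg (\<lambda>p. T p * S p)) \<le> e"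
      by (rule avg_close[OF cp hpoly_cont[OF TS(1)] 1])
    have 3: "cmod (avg F * avg G - avg T * avg S) \<le> e"
      by (rule gen[OF avg_close[OF c(1) Tc T(2)] avg_close[OF c(2) Sc S(2)] avg_norm_le[OF c(1) K1(2)] avg_norm_le[OF c(2) K2(2)]])
    have "cmod (avg (\<lambda>p. F p * G p) - avg F * avg G) \<le> e + e"
      using norm_triangle_mono[OF 2 3[unfolded norm_minus_commute[of "avg F * avg G"]]] unfolding TS(2) by simp
    then show ?thesis using 1 TS(1) by (intro bexI[of _ "\<lambda>p. T p * S p"]) auto
  qed
  have "cmod (avg (\<lambda>p. F p * G p) - avg F * avg G) \<le> 0"
  proof (rule field_le_epsilon)
    fix e :: real assume "0 < e"
    then show "cmod (avg (\<lambda>p. F p * G p) - avg F * avg G) \<le> 0 + e" using key[of "e / 2"] by auto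
  qed
  then show ?thesis unfolding hardy_def using cp pp key by fastforce
qed

lemma hardy_power: "hardy F \<Longrightarrow> hardy (\<lambda>p. F p ^ n) \<and> avg (\<lambda>p. F p ^ n) = avg F ^ n"
proof (induction n)
  case 0
  have "avg (\<lambda>p. 1) = 1" using avg_cis[of 0] by simp
  then show ?case using hpoly_hardy[OF hpoly_const[of 1]] by simp
next
  case (Suc n)
  then show ?case using hardy_mult[of F "\<lambda>p. F p ^ n"] by simp
qed

lemma hardy_add: "hardy F \<Longrightarrow> hardy G \<Longrightarrow> hardy (\<lambda>p. F p + G p)"
  unfolding hardy_def
proof (intro conjI allI impI)
  fix e :: real
  assume h: "continuous_on UNIV F \<and> periodic F \<and> (\<forall>e>0. \<exists>T\<in>hpoly. \<forall>p. cmod (F p - T p) \<le> e)"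
    "continuous_on UNIV G \<and> periodic G \<and> (\<forall>e>0. \<exists>T\<in>hpoly. \<forall>p. cmod (G p - T p) \<le> e)" and "0 < e"
  then have "0 < e / 2" by simp
  then obtain T S where T: "T \<in> hpoly" "\<And>p. cmod (F p - T p) \<le> e / 2" and S: "S \<in> hpoly" "\<And>p. cmod (G p - S p) \<le> e / 2"
    using h by meson
  have "cmod (F p + G p - (T p + S p)) \<le> e" for p
    using norm_triangle_mono[OF T(2)[of p] S(2)[of p]] by (simp add: algebra_simps)
  then show "\<exists>T\<in>hpoly. \<forall>p. cmod (F p + G p - T p) \<le> e" using hpoly.add[OF T(1) S(1)] by (intro bexI[of _ "\<lambda>p. T p + S p"]) auto
qed (auto intro: continuous_on_add simp: periodic_def)

lemma hardy_cmult: "hardy F \<Longrightarrow> hardy (\<lambda>p. c * F p)"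
  using hardy_mult[OF hpoly_hardy[OF hpoly_const[of c]]] by blast

lemma exp_partial_uniform:
  assumes "\<And>p::real. cmod (F p) \<le> K"
  shows "uniform_limit UNIV (\<lambda>n p. \<Sum>k<n. F p ^ k /\<^sub>R fact k) (\<lambda>p. exp (F p)) sequentially"
proof -
  have K: "0 \<le> K" using assms[of 0] norm_ge_zero order_trans by blast
  have "uniform_limit UNIV (\<lambda>n p. \<Sum>k<n. F p ^ k /\<^sub>R fact k) (\<lambda>p. \<Sum>k. F p ^ k /\<^sub>R fact k) sequentially"
  proof (rule Weierstrass_m_test)
    show "norm (F p ^ k /\<^sub>R fact k) \<le> K ^ k / fact k" for k p
    proof -
      have "cmod (F p) ^ k \<le> K ^ k" by (rule power_mono[OF assms]) simp
      then show ?thesis by (simp add: norm_power divide_inverse mult.commute mult_left_mono)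
    qed
    show "summable (\<lambda>k. K ^ k / fact k)" using summable_exp[of K] by (simp add: field_simps)
  qed
  then show ?thesis unfolding exp_def .
qed

text \<open>The partial sums of the exponential series stay in the class and have multiplicative
  means; uniform convergence does the rest. The identity for the mean is what normalises the outer
  function to mean 1.\<close>

lemma hardy_exp:
  assumes F: "hardy F"
  shows "hardy (\<lambda>p. exp (F p)) \<and> avg (\<lambda>p. exp (F p)) = exp (avg F)"
proof -
  have c: "continuous_on UNIV F" "periodic F" using F unfolding hardy_def by auto
  obtain K where K: "0 < K" "\<And>p. cmod (F p) \<le> K" using cont_periodic_bounded[OF c] by blast
  define S where "S n p = (\<Sum>k<n. F p ^ k /\<^sub>R fact k)" for n p
  have S: "hardy (S n) \<and> avg (S n) = (\<Sum>k<n. avg F ^ k /\<^sub>R fact k)" for n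
  proof (induction n)
    case 0
    then show ?case using hpoly_hardy[OF hpoly_const[of 0]] unfolding S_def by simp
  next
    case (Suc n)
    have e: "S (Suc n) = (\<lambda>p. S n p + of_real (inverse (fact n)) * F p ^ n)" unfolding S_def by (auto simp: scaleR_conv_of_real)
    have h: "hardy (\<lambda>p. of_real (inverse (fact n)) * F p ^ n)" using hardy_cmult hardy_power[OF F] by blast
    have cc: "continuous_on UNIV (S n)" "continuous_on UNIV (\<lambda>p. of_real (inverse (fact n)) * F p ^ n)" using Suc h unfolding hardy_def by auto
    show ?case unfolding e using hardy_add[OF _ h] avg_add[OF cc] Suc hardy_power[OF F, of n]
      by (simp add: avg_cmult scaleR_conv_of_real)
  qed
  have u: "uniform_limit UNIV S (\<lambda>p. exp (F p)) sequentially" unfolding S_def by (rule exp_partial_uniform[OF K(2)])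
  have ec: "continuous_on UNIV (\<lambda>p. exp (F p))" by (intro continuous_intros c)
  have close: "\<exists>N. \<forall>n\<ge>N. \<forall>p. cmod (exp (F p) - S n p) \<le> e" if "0 < e" for e
    using uniform_limitD[OF u that] unfolding eventually_sequentially dist_norm by (force simp: norm_minus_commute intro: less_imp_le)
  have h: "hardy (\<lambda>p. exp (F p))"
  proof (rule hardy_approx[OF ec])
    show "periodic (\<lambda>p. exp (F p))" using c(2) by (simp add: periodic_def)
    show "\<exists>G. hardy G \<and> (\<forall>p. cmod (exp (F p) - G p) \<le> e)" if "0 < e" for e
      using close[OF that] S by blast
  qed
  have "(\<lambda>n. avg (S n)) \<longlonglongrightarrow> avg (\<lambda>p. exp (F p))"
  proof (rule LIMSEQ_I)
    fix e :: real assume e: "0 < e"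
    then obtain N where N: "\<And>n p. N \<le> n \<Longrightarrow> cmod (exp (F p) - S n p) \<le> e / 2" using close[of "e / 2"] by auto
    have "norm (avg (S n) - avg (\<lambda>p. exp (F p))) < e" if "N \<le> n" for n
    proof -
      have "cmod (avg (\<lambda>p. exp (F p)) - avg (S n)) \<le> e / 2"
        by (rule avg_close[OF ec _ N[OF that]]) (use S[of n] in \<open>simp add: hardy_def\<close>)
      then show ?thesis using e by (simp add: norm_minus_commute)
    qed
    then show "\<exists>N. \<forall>n\<ge>N. norm (avg (S n) - avg (\<lambda>p. exp (F p))) < e" by blast
  qed
  moreover have "(\<lambda>n. avg (S n)) \<longlonglongrightarrow> exp (avg F)"
    using exp_converges[of "avg F"] S unfolding sums_def by simp
  ultimately show ?thesis using h LIMSEQ_unique by blast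
qed

text \<open>By multiplicativity the mean of F times cis(k p) contains the factor avg(cis(k p)) =
  0.\<close>

lemma hardy_fc_zero:
  assumes F: "hardy F" and k: "0 < k"
  shows "fc F k = 0"
proof -
  have "fc F k = avg (\<lambda>p. cis (of_nat (nat k) * p) * F p)" using k unfolding fc_def by (simp add: mult.commute)
  also have "\<dots> = avg (\<lambda>p. cis (of_nat (nat k) * p)) * avg F"
    using hardy_mult[OF hpoly_hardy[OF hpoly.cis[of "nat k"]] F] by simp
  also have "avg (\<lambda>p. cis (of_nat (nat k) * p)) = 0" using avg_cis[of k] k by simp
  finally show ?thesis by simp
qed

section \<open>Exponentials of analytic series and the outer function\<close>

lemma fc_sum:
  assumes "\<And>i. i \<in> I \<Longrightarrow> continuous_on UNIV (F i)"
  shows "fc (\<lambda>p. \<Sum>i\<in>I. F i p) k = (\<Sum>i\<in>I. fc (F i) k)"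
  unfolding fc_def sum_distrib_right by (rule avg_sum) (intro continuous_intros assms)

lemma fc_close:
  assumes "continuous_on UNIV F" "continuous_on UNIV G" "\<And>p. cmod (F p - G p) \<le> e"
  shows "cmod (fc F k - fc G k) \<le> e"
  unfolding fc_diff[OF assms(1,2), symmetric] by (rule fc_norm_le) (use assms in \<open>auto intro!: continuous_intros\<close>)

lemma exp_lipschitz:
  fixes a b :: complex
  assumes "cmod a \<le> S" "cmod (b - a) \<le> 1"
  shows "cmod (exp b - exp a) \<le> exp S * (2 * cmod (b - a))"
proof -
  have "cmod (exp (b - a) - 1) \<le> 2 * cmod (b - a)"
  proof -
    have "cmod (exp (b - a) - 1) \<le> exp (cmod (b - a)) - 1"
    proof (rule norm_sums_le)
      show "(\<lambda>n. (b - a) ^ Suc n /\<^sub>R fact (Suc n)) sums (exp (b - a) - 1)"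
        using exp_converges[of "b - a"] sums_Suc_iff[of "\<lambda>n. (b - a) ^ n /\<^sub>R fact n" "exp (b - a) - 1"] by simp
      show "(\<lambda>n. cmod (b - a) ^ Suc n /\<^sub>R fact (Suc n)) sums (exp (cmod (b - a)) - 1)"
        using exp_converges[of "cmod (b - a)"] sums_Suc_iff[of "\<lambda>n. cmod (b - a) ^ n /\<^sub>R fact n" "exp (cmod (b - a)) - 1"] by simp
    qed (simp add: norm_mult norm_power del: fact_Suc)
    also have "\<dots> \<le> 2 * cmod (b - a)"
    proof -
      have "exp (cmod (b - a)) \<le> 1 + cmod (b - a) + (cmod (b - a))\<^sup>2" by (rule exp_bound) (use assms in auto)
      moreover have "(cmod (b - a))\<^sup>2 \<le> cmod (b - a) * 1" unfolding power2_eq_square by (intro mult_left_mono) (use assms in auto)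
      ultimately show ?thesis by linarith
    qed
    finally show ?thesis .
  qed
  moreover have "exp b - exp a = exp a * (exp (b - a) - 1)" by (simp add: exp_diff field_simps)
  moreover have "cmod (exp a) \<le> exp S" using norm_exp[of a] assms(1) by (meson exp_le_cancel_iff order_trans)
  ultimately show ?thesis by (simp add: norm_mult mult_mono)
qed

text \<open>Up to the factor -i, the weighted coefficients are formally those of the derivative of
  exp \<Lambda>, but \<Lambda> itself need not be differentiable. So the bound is proved for finite
  truncations, with the constant exp S times the weighted norm of L, and passes to the limit on each
  finite index set.\<close>

lemma exp_weighted_l2:
  fixes L :: "int \<Rightarrow> complex"
  assumes s: "(\<lambda>m. cmod (L m)) summable_on {0<..}" and w: "l2le (\<lambda>m. of_int m * L m) KL"
    and \<Lambda>: "\<And>p. ((\<lambda>m. L m * cis (of_int m * p)) has_sum \<Lambda> p) {0<..}" and \<Lambda>c: "continuous_on UNIV \<Lambda>"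
  shows "\<exists>K. l2le (\<lambda>m. of_int m * fc (\<lambda>p. exp (\<Lambda> p)) m) K"
proof -
  define S where "S = (\<Sum>\<^sub>\<infinity>m\<in>{0<..}. cmod (L m))"
  define K where "K = exp S * KL"
  define T where "T J p = (\<Sum>m\<in>J. L m * cis (of_int m * p))" for J p
  have Tc: "continuous_on UNIV (T J)" for J unfolding T_def by (intro continuous_intros)
  have Tp: "periodic (T J)" for J unfolding T_def periodic_def by (auto simp only: cis_periodic)
  have TS: "cmod (T J p) \<le> S" if "finite J" "J \<subseteq> {0<..}" for J p
  proof -
    have "cmod (T J p) \<le> (\<Sum>m\<in>J. cmod (L m))" unfolding T_def by (rule sum_norm_le) (simp add: norm_mult)
    also have "\<dots> \<le> S" unfolding S_def by (rule finite_sum_le_infsum[OF s that]) auto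
    finally show ?thesis .
  qed
  have K0: "0 \<le> KL" by (rule l2le_nonneg[OF w])
  have trunc: "l2le (\<lambda>m. of_int m * fc (\<lambda>p. exp (T J p)) m) K" if J: "finite J" "J \<subseteq> {0<..}" for J
  proof -
    define D where "D p = (\<Sum>m\<in>J. \<i> * of_int m * L m * cis (of_int m * p))" for p
    have Dc: "continuous_on UNIV D" unfolding D_def by (intro continuous_intros)
    have Dp: "periodic D" unfolding D_def periodic_def by (auto simp only: cis_periodic)
    have dT: "(T J has_vector_derivative D p) (at p)" for p
    proof -
      have "((\<lambda>p. L m * cis (of_int m * p)) has_vector_derivative \<i> * of_int m * L m * cis (of_int m * p)) (at p)" for m
      proof -
        have "((\<lambda>z. L m * exp (\<i> * of_int m * z)) has_field_derivative \<i> * of_int m * L m * exp (\<i> * of_int m * of_real p)) (at (of_real p))"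
          by (auto intro!: derivative_eq_intros)
        from has_vector_derivative_real_field[OF this] show ?thesis
          by (simp add: cis_conv_exp mult.assoc)
      qed
      then show ?thesis unfolding T_def D_def by (intro has_vector_derivative_sum)
    qed
    have dE: "((\<lambda>p. exp (T J p)) has_vector_derivative D p * exp (T J p)) (at p)" for p
      using field_vector_diff_chain_at[OF dT[of p] DERIV_exp[of "T J p"]] by (simp add: o_def mult.commute)
    have "l2le (\<lambda>m. of_int m * fc (\<lambda>p. exp (T J p)) m) (sqrt (msq (\<lambda>p. D p * exp (T J p))))"
    proof (rule fc_weighted_l2[OF dE])
      show "continuous_on UNIV (\<lambda>p. D p * exp (T J p))" by (intro continuous_intros Dc Tc)
      show "periodic (\<lambda>p. exp (T J p))" using Tp by (simp add: periodic_def)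
    qed
    moreover have "sqrt (msq (\<lambda>p. D p * exp (T J p))) \<le> K"
    proof -
      have "cmod (exp (T J p)) \<le> exp S" for p
        using norm_exp[of "T J p"] TS[OF J, of p] by (meson exp_le_cancel_iff order_trans)
      then have "msq (\<lambda>p. D p * exp (T J p)) \<le> (exp S)\<^sup>2 * msq D"
        by (intro msq_mult_le Dc continuous_intros Tc)
      also have "msq D \<le> KL\<^sup>2"
      proof -
        have fcD: "fc D k = (if - k \<in> J then \<i> * of_int (- k) * L (- k) else 0)" for k
        proof -
          have "fc D k = (\<Sum>m\<in>J. \<i> * of_int m * L m * fc (\<lambda>p. cis (of_int m * p)) k)"
            unfolding D_def by (subst fc_sum) (auto intro!: continuous_intros simp: fc_cmult)
          also have "\<dots> = (\<Sum>m\<in>J. if m = - k then \<i> * of_int m * L m else 0)"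
            by (rule sum.cong) (auto simp: fc_cis)
          finally show ?thesis using J(1) by simp
        qed
        have "((\<lambda>k. cnj (fc D k) * fc D k) has_sum of_real (msq D)) UNIV"
          using Parseval[OF Dc Dp Dc Dp] unfolding avg_norm_sq_msq[OF Dc] .
        from has_sum_Re[OF this] have h: "((\<lambda>k. (cmod (fc D k))\<^sup>2) has_sum msq D) UNIV"
          unfolding cmod_power2 by (simp add: power2_eq_square)
        have l: "l2le (fc D) KL"
        proof (rule l2le_mono[OF l2le_reindex[OF w, of uminus]])
          show "inj (uminus :: int \<Rightarrow> int)" by (auto simp: inj_def)
          show "cmod (fc D k) \<le> cmod (of_int (- k) * L (- k))" for k unfolding fcD by (simp add: norm_mult)
        qed simp
        show ?thesis
          using infsum_le_finite_sums[OF has_sum_imp_summable[OF h], of "KL\<^sup>2"] l2le_sum_sq[OF l] infsumI[OF h] by simp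
      qed
      finally have "msq (\<lambda>p. D p * exp (T J p)) \<le> K\<^sup>2" unfolding K_def power_mult_distrib by (simp add: mult_left_mono)
      then show ?thesis using K0 unfolding K_def by (intro real_le_lsqrt) auto
    qed
    ultimately show ?thesis by (rule l2le_mono[OF _ order_refl])
  qed
  have "l2le (\<lambda>m. of_int m * fc (\<lambda>p. exp (\<Lambda> p)) m) K"
    unfolding l2le_def
  proof (intro allI impI)
    fix I :: "int set" assume I: "finite I"
    have ec: "continuous_on UNIV (\<lambda>p. exp (\<Lambda> p))" by (intro continuous_intros \<Lambda>c)
    have lim: "((\<lambda>J. fc (\<lambda>p. exp (T J p)) m) \<longlongrightarrow> fc (\<lambda>p. exp (\<Lambda> p)) m) (finite_subsets_at_top {0<..})" for m
    proof (rule tendstoI)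
      fix e :: real assume e: "0 < e"
      define d where "d = min 1 (e / (3 * exp S))"
      have d: "0 < d" "d \<le> 1" "exp S * (2 * d) < e"
      proof -
        have *: "0 < d \<and> d \<le> 1 \<and> X * (2 * d) < e" if "d = min 1 (e / (3 * X))" "0 < X" for X
        proof -
          have "d \<le> e / (3 * X)" using that by simp
          then have "X * (2 * d) \<le> X * (2 * (e / (3 * X)))" using that by (intro mult_left_mono) auto
          also have "\<dots> = 2 * e / 3" using that by simp
          finally show ?thesis using that e by auto
        qed
        from *[OF d_def exp_gt_zero] show "0 < d" "d \<le> 1" "exp S * (2 * d) < e" by auto
      qed
      obtain X where X: "finite X" "X \<subseteq> {0<..}" "dist (\<Sum>m\<in>X. cmod (L m)) S \<le> d"
        using infsum_finite_approximation[OF s d(1)] unfolding S_def by blast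
      have "dist (fc (\<lambda>p. exp (T Y p)) m) (fc (\<lambda>p. exp (\<Lambda> p)) m) < e" if Y: "finite Y" "X \<subseteq> Y" "Y \<subseteq> {0<..}" for Y
      proof -
        have cl: "cmod (\<Lambda> p - T Y p) \<le> d" for p
        proof -
          have n: "(\<lambda>m. cmod (L m * cis (of_int m * p))) summable_on ({0<..} - Y)"
            using summable_on_subset_banach[OF s, of "{0<..} - Y"] by (simp add: norm_mult)
          have "\<Lambda> p = T Y p + (\<Sum>\<^sub>\<infinity>m\<in>{0<..} - Y. L m * cis (of_int m * p))"
            using infsum_Un_disjoint[of "\<lambda>m. L m * cis (of_int m * p)" Y "{0<..} - Y"] Y abs_summable_summable[OF n] infsumI[OF \<Lambda>[of p]]
            unfolding T_def by (simp add: Un_absorb1)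
          moreover have "cmod (\<Sum>\<^sub>\<infinity>m\<in>{0<..} - Y. L m * cis (of_int m * p)) \<le> (\<Sum>\<^sub>\<infinity>m\<in>{0<..} - Y. cmod (L m))"
            using norm_infsum_bound[OF n] by (simp add: norm_mult)
          moreover have "S = (\<Sum>m\<in>Y. cmod (L m)) + (\<Sum>\<^sub>\<infinity>m\<in>{0<..} - Y. cmod (L m))"
            using infsum_Un_disjoint[of "\<lambda>m. cmod (L m)" Y "{0<..} - Y"] Y summable_on_subset_banach[OF s, of "{0<..} - Y"]
            unfolding S_def by (simp add: Un_absorb1)
          moreover have "(\<Sum>m\<in>X. cmod (L m)) \<le> (\<Sum>m\<in>Y. cmod (L m))" by (rule sum_mono2) (use Y in auto)
          ultimately show ?thesis using X(3) by (simp add: dist_real_def)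
        qed
        have "cmod (fc (\<lambda>p. exp (\<Lambda> p)) m - fc (\<lambda>p. exp (T Y p)) m) \<le> exp S * (2 * d)"
        proof (rule fc_close[OF ec])
          show "continuous_on UNIV (\<lambda>p. exp (T Y p))" by (intro continuous_intros Tc)
          show "cmod (exp (\<Lambda> p) - exp (T Y p)) \<le> exp S * (2 * d)" for p
            by (rule order_trans[OF exp_lipschitz[OF TS[OF Y(1,3)]]]) (use cl[of p] d(2) in auto)
        qed
        then show ?thesis using d(3) by (simp add: dist_norm norm_minus_commute)
      qed
      then show "\<forall>\<^sub>F J in finite_subsets_at_top {0<..}. dist (fc (\<lambda>p. exp (T J p)) m) (fc (\<lambda>p. exp (\<Lambda> p)) m) < e"
        unfolding eventually_finite_subsets_at_top using X by blast
    qed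
    have "((\<lambda>J. L2_set (\<lambda>m. cmod (of_int m * fc (\<lambda>p. exp (T J p)) m)) I) \<longlongrightarrow> L2_set (\<lambda>m. cmod (of_int m * fc (\<lambda>p. exp (\<Lambda> p)) m)) I) (finite_subsets_at_top {0<..})"
      unfolding L2_set_def by (intro tendsto_intros lim)
    then show "L2_set (\<lambda>m. cmod (of_int m * fc (\<lambda>p. exp (\<Lambda> p)) m)) I \<le> K"
      by (rule tendsto_upperbound) (use trunc I in \<open>auto intro!: eventually_finite_subsets_at_top_weakI simp: l2le_def\<close>)
  qed
  then show ?thesis by blast
qed

text \<open>\<Lambda> is the analytic half of -la without its constant term, so that \<Lambda> + cnj
  \<Lambda> = a 0 - la. Take C = exp \<Lambda> and D = 1 / C: then exp la times |C|^2 is the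
  geometric mean exp(a 0), which is the last conclusion multiplied by C. Means 1 say that the
  analytic extensions take the value 1 at the centre of the disc.\<close>

lemma outer_function:
  fixes la :: "real \<Rightarrow> real"
  assumes d: "\<And>p. ((\<lambda>p. complex_of_real (la p)) has_vector_derivative la' p) (at p)" and c': "continuous_on UNIV la'"
    and per: "\<And>p. la (p + 2 * pi) = la p"
  obtains C D K where "hardy C" "hardy D" "avg C = 1" "avg D = 1" "l2le (\<lambda>m. of_int m * fc C m) K"
    "\<And>p. D p * C p = 1"
    "\<And>p. of_real (exp (la p)) * cnj (C p) = of_real (exp (Re (avg (\<lambda>p. of_real (la p))))) * D p"
proof -
  define a where "a = fc (\<lambda>p. complex_of_real (la p))"
  have lc: "continuous_on UNIV (\<lambda>p. complex_of_real (la p))"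
    by (intro continuous_at_imp_continuous_on ballI has_vector_derivative_continuous[OF d])
  have lp: "periodic (\<lambda>p. complex_of_real (la p))" using per by (simp add: periodic_def)
  have as: "(\<lambda>m. cmod (a m)) summable_on UNIV" unfolding a_def by (rule fc_summable[OF d c' lp])
  have aw: "l2le (\<lambda>m. of_int m * a m) (sqrt (msq la'))" unfolding a_def by (rule fc_weighted_l2[OF d c' lp])
  have ar: "a (- m) = cnj (a m)" for m
    unfolding a_def fc_def avg_cnj[symmetric] by (simp add: cis_cnj)
  have inv: "((\<lambda>m. a m * cis (- of_int m * p)) has_sum of_real (la p)) UNIV" for p
    unfolding a_def by (rule Fourier_inversion[OF lc lp as[unfolded a_def]])
  \<comment> \<open>The term of la with cis(m p) has coefficient a(-m), by the sign convention of
    \<open>fc\<close>.\<close>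
  define L where "L m = - a (- m)" for m
  have asm: "(\<lambda>m. cmod (a (- m))) summable_on UNIV"
    using summable_on_reindex_bij_betw[of uminus UNIV UNIV "\<lambda>m. cmod (a m)"] as by (simp add: bij_uminus)
  have Ls: "(\<lambda>m. cmod (L m)) summable_on {0<..}"
    unfolding L_def norm_minus_cancel by (rule summable_on_subset_banach[OF asm]) simp
  have Lw: "l2le (\<lambda>m. of_int m * L m) (sqrt (msq la'))"
  proof (rule l2le_mono[OF l2le_reindex[OF aw, of uminus]])
    show "inj (uminus :: int \<Rightarrow> int)" by (auto simp: inj_def)
  qed (auto simp: L_def norm_mult)
  define \<Lambda> where "\<Lambda> p = (\<Sum>\<^sub>\<infinity>m\<in>{0<..}. L m * cis (of_int m * p))" for p
  have Labs: "(\<lambda>m. cmod (L m * cis (of_int m * p))) summable_on {0<..}" for p using Ls by (simp add: norm_mult)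
  have h\<Lambda>: "((\<lambda>m. L m * cis (of_int m * p)) has_sum \<Lambda> p) {0<..}" for p
    unfolding \<Lambda>_def by (rule has_sum_infsum[OF abs_summable_summable[OF Labs]])
  define T where "T J p = (\<Sum>m\<in>J. L m * cis (of_int m * p))" for J p
  have app: "\<exists>X. finite X \<and> X \<subseteq> {0<..} \<and> (\<forall>p. cmod (\<Lambda> p - T X p) \<le> e)" if e: "0 < e" for e
  proof -
    obtain X where X: "finite X" "X \<subseteq> {0<..}" "dist (\<Sum>m\<in>X. cmod (L m)) (\<Sum>\<^sub>\<infinity>m\<in>{0<..}. cmod (L m)) \<le> e"
      using infsum_finite_approximation[OF Ls e] by blast
    have "cmod (\<Lambda> p - T X p) \<le> e" for p
    proof -
      have n: "(\<lambda>m. cmod (L m * cis (of_int m * p))) summable_on ({0<..} - X)"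
        by (rule summable_on_subset_banach[OF Labs]) auto
      have "\<Lambda> p = T X p + (\<Sum>\<^sub>\<infinity>m\<in>{0<..} - X. L m * cis (of_int m * p))"
        using infsum_Un_disjoint[of "\<lambda>m. L m * cis (of_int m * p)" X "{0<..} - X"] X abs_summable_summable[OF n]
        unfolding T_def \<Lambda>_def by (simp add: Un_absorb1)
      moreover have "cmod (\<Sum>\<^sub>\<infinity>m\<in>{0<..} - X. L m * cis (of_int m * p)) \<le> (\<Sum>\<^sub>\<infinity>m\<in>{0<..} - X. cmod (L m))"
        using norm_infsum_bound[OF n] by (simp add: norm_mult)
      moreover have "(\<Sum>\<^sub>\<infinity>m\<in>{0<..}. cmod (L m)) = (\<Sum>m\<in>X. cmod (L m)) + (\<Sum>\<^sub>\<infinity>m\<in>{0<..} - X. cmod (L m))"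
        using infsum_Un_disjoint[of "\<lambda>m. cmod (L m)" X "{0<..} - X"] X summable_on_subset_banach[OF Ls, of "{0<..} - X"]
        by (simp add: Un_absorb1)
      ultimately show ?thesis using X(3) by (simp add: dist_real_def)
    qed
    then show ?thesis using X by blast
  qed
  have Th: "T X \<in> hpoly \<and> avg (T X) = 0" if X: "finite X" "X \<subseteq> {0<..}" for X
  proof
    have "(\<lambda>p. L m * cis (of_int m * p)) \<in> hpoly" if "m \<in> X" for m
      using hpoly.cmult[OF hpoly.cis[of "nat m"], of "L m"] that X by (force simp: subset_iff)
    then show "T X \<in> hpoly" unfolding T_def by (intro hpoly_sum X)
    have "avg (T X) = (\<Sum>m\<in>X. avg (\<lambda>p. L m * cis (of_int m * p)))" unfolding T_def by (rule avg_sum) (intro continuous_intros)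
    also have "\<dots> = 0" by (rule sum.neutral) (use X in \<open>auto simp: avg_cmult avg_cis\<close>)
    finally show "avg (T X) = 0" .
  qed
  have \<Lambda>p: "periodic \<Lambda>" unfolding periodic_def \<Lambda>_def by (auto simp only: cis_periodic)
  have \<Lambda>c: "continuous_on UNIV \<Lambda>"
  proof -
    have "\<exists>X. finite X \<and> X \<subseteq> {0<..} \<and> (\<forall>p. cmod (\<Lambda> p - T X p) \<le> 1 / real (Suc n))" for n by (rule app) simp
    then obtain X where X: "\<And>n. finite (X n)" "\<And>n. X n \<subseteq> {0<..}" "\<And>n p. cmod (\<Lambda> p - T (X n) p) \<le> 1 / real (Suc n)" by metis
    show ?thesis
    proof (rule uniform_limit_theorem[where F = sequentially and f = "\<lambda>n. T (X n)"])
      show "\<forall>\<^sub>F n in sequentially. continuous_on UNIV (T (X n))" unfolding T_def by (intro always_eventually allI continuous_intros)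
      show "uniform_limit UNIV (\<lambda>n. T (X n)) \<Lambda> sequentially"
      proof (rule uniform_limitI)
        fix e :: real assume "0 < e"
        then have "\<forall>\<^sub>F n in sequentially. 1 / real (Suc n) < e" using order_tendstoD(2)[OF LIMSEQ_Suc[OF lim_1_over_n]] by blast
        then show "\<forall>\<^sub>F n in sequentially. \<forall>p\<in>UNIV. dist (T (X n) p) (\<Lambda> p) < e"
        proof eventually_elim
          case (elim n)
          show ?case using le_less_trans[OF X(3) elim] by (auto simp: dist_norm norm_minus_commute)
        qed
      qed
    qed simp
  qed
  have \<Lambda>h: "hardy \<Lambda>"
    by (rule hardy_approx[OF \<Lambda>c \<Lambda>p]) (use app Th hpoly_hardy in blast)
  have \<Lambda>a: "avg \<Lambda> = 0"
  proof -
    have "cmod (avg \<Lambda>) \<le> 0"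
    proof (rule field_le_epsilon)
      fix e :: real assume "0 < e"
      then obtain X where X: "finite X" "X \<subseteq> {0<..}" "\<And>p. cmod (\<Lambda> p - T X p) \<le> e" using app by blast
      show "cmod (avg \<Lambda>) \<le> 0 + e"
        using avg_close[OF \<Lambda>c hpoly_cont X(3)] Th[OF X(1,2)] by simp
    qed
    then show ?thesis by simp
  qed
  have re: "\<Lambda> p + cnj (\<Lambda> p) = a 0 - of_real (la p)" for p
  proof -
    have 1: "((\<lambda>m. a m * cis (- of_int m * p)) has_sum - \<Lambda> p) {..<0}"
    proof -
      have "((\<lambda>m. a (- m) * cis (of_int m * p)) has_sum - \<Lambda> p) {0<..}"
        using has_sum_uminusI[OF h\<Lambda>[of p]] unfolding L_def by simp
      moreover have "bij_betw uminus {0<..} {..<(0::int)}" by (rule bij_betw_byWitness[where f' = uminus]) auto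
      ultimately show ?thesis using has_sum_reindex_bij_betw[of uminus "{0<..}" "{..<0}" "\<lambda>m. a m * cis (- of_int m * p)" "- \<Lambda> p"] by simp
    qed
    have 2: "((\<lambda>m. a m * cis (- of_int m * p)) has_sum - cnj (\<Lambda> p)) {0<..}"
    proof -
      have "((\<lambda>m. cnj (L m * cis (of_int m * p))) has_sum cnj (\<Lambda> p)) {0<..}" using h\<Lambda>[of p] by (simp only: has_sum_cnj_iff)
      from has_sum_uminusI[OF this] show ?thesis unfolding L_def by (simp add: cis_cnj ar)
    qed
    have 3: "((\<lambda>m. a m * cis (- of_int m * p)) has_sum a 0) {0}" by (rule has_sum_finiteI) auto
    have "((\<lambda>m. a m * cis (- of_int m * p)) has_sum (- \<Lambda> p + (a 0 + - cnj (\<Lambda> p)))) ({..<0} \<union> ({0} \<union> {0<..}))"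
      by (intro has_sum_Un_disjoint 1 2 3) auto
    moreover have "{..<0} \<union> ({0} \<union> {0<..}) = (UNIV :: int set)" by auto
    ultimately have "of_real (la p) = - \<Lambda> p + (a 0 + - cnj (\<Lambda> p))" using has_sum_unique[OF inv] by simp
    then show ?thesis by simp
  qed
  have a0: "a 0 = of_real (Re (avg (\<lambda>p. of_real (la p))))"
  proof -
    have "a 0 = avg (\<lambda>p. of_real (la p))" unfolding a_def fc_def by simp
    moreover have "Im (a 0) = 0" using ar[of 0] by (simp add: complex_eq_iff)
    ultimately show ?thesis by (simp add: complex_eq_iff)
  qed
  have m\<Lambda>h: "hardy (\<lambda>p. - \<Lambda> p)" "avg (\<lambda>p. - \<Lambda> p) = 0" using hardy_cmult[OF \<Lambda>h, of "-1"] avg_cmult[of "-1" \<Lambda>] \<Lambda>a by auto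
  obtain K where K: "l2le (\<lambda>m. of_int m * fc (\<lambda>p. exp (\<Lambda> p)) m) K" using exp_weighted_l2[OF Ls Lw h\<Lambda> \<Lambda>c] by blast
  show thesis
  proof (rule that[of "\<lambda>p. exp (\<Lambda> p)" "\<lambda>p. exp (- \<Lambda> p)" K])
    show "hardy (\<lambda>p. exp (\<Lambda> p))" "avg (\<lambda>p. exp (\<Lambda> p)) = 1" using hardy_exp[OF \<Lambda>h] \<Lambda>a by auto
    show "hardy (\<lambda>p. exp (- \<Lambda> p))" "avg (\<lambda>p. exp (- \<Lambda> p)) = 1" using hardy_exp[OF m\<Lambda>h(1)] m\<Lambda>h(2) by auto
    show "exp (- \<Lambda> p) * exp (\<Lambda> p) = 1" for p by (simp add: exp_minus)
    show "of_real (exp (la p)) * cnj (exp (\<Lambda> p)) = of_real (exp (Re (avg (\<lambda>p. of_real (la p))))) * exp (- \<Lambda> p)" for p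
    proof -
      have "of_real (exp (la p)) * cnj (exp (\<Lambda> p)) = exp (of_real (la p) + cnj (\<Lambda> p))" by (simp add: exp_add exp_of_real exp_cnj)
      also have "of_real (la p) + cnj (\<Lambda> p) = a 0 + - \<Lambda> p" using re[of p] by (simp add: algebra_simps)
      also have "exp \<dots> = of_real (exp (Re (avg (\<lambda>p. of_real (la p))))) * exp (- \<Lambda> p)" unfolding exp_add a0 exp_of_real ..
      finally show ?thesis .
    qed
  qed (rule K)
qed

section \<open>Determinants of Toeplitz plus Hankel matrices\<close>

text \<open>Taylor polynomial of degree n of the analytic function with boundary values C.\<close>

definition hsum :: "(real \<Rightarrow> complex) \<Rightarrow> nat \<Rightarrow> real \<Rightarrow> complex" where
  "hsum C n p = (\<Sum>l\<le>n. fc C (- int l) * cis (of_int (int l) * p))"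

lemma hsum_hpoly: "hsum C n \<in> hpoly"
proof -
  have "(\<lambda>p. \<Sum>l\<in>{..n}. fc C (- int l) * cis (of_nat l * p)) \<in> hpoly"
    by (intro hpoly_sum hpoly.cmult hpoly.cis) simp
  then show ?thesis unfolding hsum_def[abs_def] by simp
qed

lemma fc_hsum: "fc (hsum C n) k = (if - int n \<le> k \<and> k \<le> 0 then fc C k else 0)"
proof -
  have "fc (hsum C n) k = (\<Sum>l\<le>n. fc C (- int l) * fc (\<lambda>p. cis (of_int (int l) * p)) k)"
    unfolding hsum_def by (subst fc_sum) (auto intro!: continuous_intros simp: fc_cmult)
  also have "\<dots> = (\<Sum>l\<le>n. if int l = - k then fc C k else 0)"
  proof (rule sum.cong)
    fix l
    show "fc C (- int l) * fc (\<lambda>p. cis (of_int (int l) * p)) k = (if int l = - k then fc C k else 0)"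
    proof (cases "int l + k = 0")
      case True
      then have "k = - int l" by linarith
      then show ?thesis unfolding fc_cis by simp
    next
      case False
      then show ?thesis unfolding fc_cis by auto
    qed
  qed simp
  also have "\<dots> = (if - int n \<le> k \<and> k \<le> 0 then fc C k else 0)"
  proof (cases "- int n \<le> k \<and> k \<le> 0")
    case True
    have "(\<Sum>l\<le>n. if int l = - k then fc C k else 0) = (\<Sum>l\<le>n. if l = nat (- k) then fc C k else 0)"
      by (rule sum.cong) (use True in auto)
    then show ?thesis using True by (simp add: nat_le_iff)
  next
    case False
    then show ?thesis by (auto intro!: sum.neutral)
  qed
  finally show ?thesis .
qed

text \<open>The remainder has only coefficients of order beyond n, each of which gains a factor 1/(n
  + 1) from the weight; the square of this factor is summable over n.\<close>

lemma hsum_tail_msq: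
  assumes C: "hardy C" and w: "l2le (\<lambda>m. of_int m * fc C m) K"
  shows "msq (\<lambda>p. C p - hsum C n p) \<le> (K / real (Suc n))\<^sup>2"
proof -
  have Cc: "continuous_on UNIV C" "periodic C" using C by (auto simp: hardy_def)
  note Sc = hpoly_cont[OF hsum_hpoly[of C n]] and Sp = hpoly_periodic[OF hsum_hpoly[of C n]]
  define T where "T p = C p - hsum C n p" for p
  have Tc: "continuous_on UNIV T" unfolding T_def by (intro continuous_intros Cc Sc)
  have Tp: "periodic T" using Cc Sp by (simp add: periodic_def T_def)
  have fcT: "fc T k = fc C k - (if - int n \<le> k \<and> k \<le> 0 then fc C k else 0)" for k
    unfolding T_def fc_diff[OF Cc(1) Sc] fc_hsum ..
  have "((\<lambda>k. cnj (fc T k) * fc T k) has_sum of_real (msq T)) UNIV"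
    using Parseval[OF Tc Tp Tc Tp] unfolding avg_norm_sq_msq[OF Tc] .
  from has_sum_Re[OF this] have h: "((\<lambda>k. (cmod (fc T k))\<^sup>2) has_sum msq T) UNIV"
    unfolding cmod_power2 by (simp add: power2_eq_square)
  have "l2le (fc T) (cmod (1 / of_nat (Suc n)) * K)"
  proof (rule l2le_mono[OF l2le_cmult[OF w, of "1 / of_nat (Suc n)"]])
    fix k :: int
    consider "0 < k" | "- int n \<le> k \<and> k \<le> 0" | "k < - int n" by linarith
    then show "cmod (fc T k) \<le> cmod (1 / of_nat (Suc n) * (of_int k * fc C k))"
    proof cases
      case 1
      then show ?thesis using hardy_fc_zero[OF C 1] by (simp add: fcT)
    next
      case 2
      then show ?thesis by (simp add: fcT)
    next
      case 3
      have "1 \<le> \<bar>real_of_int k\<bar> / real (Suc n)" using 3 by (simp add: field_simps)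
      then have "1 * cmod (fc C k) \<le> \<bar>real_of_int k\<bar> / real (Suc n) * cmod (fc C k)" by (intro mult_right_mono) auto
      then show ?thesis using 3 by (simp add: fcT norm_mult norm_divide del: of_nat_Suc)
    qed
  qed simp
  then have l: "l2le (fc T) (K / real (Suc n))" by (simp add: norm_divide del: of_nat_Suc)
  show ?thesis unfolding T_def[symmetric]
    using infsum_le_finite_sums[OF has_sum_imp_summable[OF h], of "(K / real (Suc n))\<^sup>2"] l2le_sum_sq[OF l] infsumI[OF h] by simp
qed

lemma avg_hsum_form:
  assumes F: "continuous_on UNIV F"
  shows "avg (\<lambda>p. F p * (cnj (hsum C n p) * hsum C n p)) =
    (\<Sum>l\<le>n. \<Sum>l'\<le>n. cnj (fc C (- int l)) * fc F (int l' - int l) * fc C (- int l'))"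
proof -
  have e: "F p * (cnj (hsum C n p) * hsum C n p) =
    (\<Sum>l\<le>n. \<Sum>l'\<le>n. (cnj (fc C (- int l)) * fc C (- int l')) * (F p * cis (of_int (int l' - int l) * p)))" for p
  proof -
    have "F p * (cnj (hsum C n p) * hsum C n p) =
      (\<Sum>l\<le>n. \<Sum>l'\<le>n. F p * ((cnj (fc C (- int l)) * cis (- (of_int (int l) * p))) * (fc C (- int l') * cis (of_int (int l') * p))))"
      unfolding hsum_def cnj_sum sum_product unfolding sum_distrib_left by (simp add: cis_cnj)
    also have "\<dots> = (\<Sum>l\<le>n. \<Sum>l'\<le>n. (cnj (fc C (- int l)) * fc C (- int l')) * (F p * cis (of_int (int l' - int l) * p)))"
    proof (intro sum.cong refl)
      fix l l'
      have "cis (of_int (int l' - int l) * p) = cis (- (of_int (int l) * p)) * cis (of_int (int l') * p)"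
        by (simp add: cis_mult algebra_simps)
      then show "F p * ((cnj (fc C (- int l)) * cis (- (of_int (int l) * p))) * (fc C (- int l') * cis (of_int (int l') * p))) = (cnj (fc C (- int l)) * fc C (- int l')) * (F p * cis (of_int (int l' - int l) * p))"
        by (simp only: mult_ac)
    qed
    finally show ?thesis .
  qed
  have c: "continuous_on UNIV (\<lambda>p. c * (F p * cis (of_int m * p)))" for m c by (intro continuous_intros F)
  have "avg (\<lambda>p. F p * (cnj (hsum C n p) * hsum C n p)) =
    (\<Sum>l\<le>n. \<Sum>l'\<le>n. (cnj (fc C (- int l)) * fc C (- int l')) * fc F (int l' - int l))"
    unfolding e fc_def[of F]
    by (subst avg_sum, intro continuous_intros F, rule sum.cong, rule refl, subst avg_sum, intro continuous_intros F, simp only: avg_cmult)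
  then show ?thesis by (simp only: mult_ac)
qed

text \<open>Write the Taylor polynomial as C - T. The weight times |C|^2 is E; the cross terms are E
  times D T and its conjugate, of mean zero since D and T are analytic and T vanishes at the centre;
  what is left is the weighted mean square of T.\<close>

lemma avg_hsum_bound:
  fixes la :: "real \<Rightarrow> real"
  assumes C: "hardy C" and D: "hardy D" and a: "avg C = 1" "avg D = 1"
    and w: "l2le (\<lambda>m. of_int m * fc C m) K" and DC: "\<And>p. D p * C p = 1"
    and f: "\<And>p. of_real (exp (la p)) * cnj (C p) = of_real E * D p"
    and lc: "continuous_on UNIV la" and A: "\<And>p. exp (la p) \<le> A\<^sup>2" "0 \<le> A"
  shows "Re (avg (\<lambda>p. of_real (exp (la p)) * (cnj (hsum C n p) * hsum C n p))) \<le> E + A\<^sup>2 * (K / real (Suc n))\<^sup>2"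
proof -
  define T where "T p = C p - hsum C n p" for p
  define e where "e p = complex_of_real (exp (la p))" for p
  define s where "s p = complex_of_real (sqrt (exp (la p)))" for p
  have Cc: "continuous_on UNIV C" and Dc: "continuous_on UNIV D" using C D by (auto simp: hardy_def)
  note Sc = hpoly_cont[OF hsum_hpoly[of C n]]
  have Tc: "continuous_on UNIV T" unfolding T_def by (intro continuous_intros Cc Sc)
  have ec: "continuous_on UNIV e" "continuous_on UNIV s" unfolding e_def s_def by (intro continuous_intros lc)+
  have Th: "hardy T"
    using hardy_add[OF C hardy_cmult[OF hpoly_hardy[OF hsum_hpoly[of C n]], of "-1"]] unfolding T_def[abs_def] by simp
  have fc0: "fc F 0 = avg F" for F unfolding fc_def by simp
  have "avg T = 0" unfolding T_def avg_diff[OF Cc Sc] using fc_hsum[of C n 0] by (simp add: fc0)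
  then have DT: "avg (\<lambda>p. D p * T p) = 0" using hardy_mult[OF D Th] by simp
  have pt: "e p * (cnj (hsum C n p) * hsum C n p) =
    (of_real E - of_real E * (D p * T p)) - (cnj (of_real E * (D p * T p)) - cnj (s p * T p) * (s p * T p))" for p
  proof -
    have h: "hsum C n p = C p - T p" by (simp add: T_def)
    have f': "e p * C p = of_real E * cnj (D p)" using arg_cong[OF f[of p], of cnj] unfolding e_def by simp
    have ss: "cnj (s p) * s p = e p"
    proof -
      have "sqrt (exp (la p)) * sqrt (exp (la p)) = exp (la p)" by simp
      then show ?thesis unfolding s_def e_def complex_cnj_complex_of_real of_real_mult[symmetric] by simp
    qed
    have "e p * (cnj (hsum C n p) * hsum C n p) =
      (e p * cnj (C p)) * C p - (e p * cnj (C p)) * T p - (e p * C p) * cnj (T p) + e p * (cnj (T p) * T p)"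
      unfolding h by (simp add: algebra_simps)
    also have "(e p * cnj (C p)) * C p = of_real E" using f[of p] DC[of p] unfolding e_def by (simp add: mult.assoc)
    also have "(e p * cnj (C p)) * T p = of_real E * (D p * T p)" using f[of p] unfolding e_def by (simp add: mult.assoc)
    also have "(e p * C p) * cnj (T p) = cnj (of_real E * (D p * T p))" unfolding f' by simp
    also have "e p * (cnj (T p) * T p) = cnj (s p * T p) * (s p * T p)" unfolding ss[symmetric] by simp
    finally show ?thesis by simp
  qed
  have sTc: "continuous_on UNIV (\<lambda>p. s p * T p)" by (intro continuous_intros ec Tc)
  have c1: "continuous_on UNIV (\<lambda>p. complex_of_real E)" "continuous_on UNIV (\<lambda>p. of_real E * (D p * T p))"
    "continuous_on UNIV (\<lambda>p. cnj (of_real E * (D p * T p)))" "continuous_on UNIV (\<lambda>p. cnj (s p * T p) * (s p * T p))"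
    by (intro continuous_intros Dc Tc ec)+
  have c2: "continuous_on UNIV (\<lambda>p. of_real E - of_real E * (D p * T p))"
    "continuous_on UNIV (\<lambda>p. cnj (of_real E * (D p * T p)) - cnj (s p * T p) * (s p * T p))"
    by (intro continuous_intros c1 sTc Dc Tc)+
  have aE: "avg (\<lambda>p. complex_of_real E) = of_real E"
    using avg_cmult[of "of_real E" "\<lambda>p. cis (of_int 0 * p)"] avg_cis[of 0] by simp
  have "avg (\<lambda>p. e p * (cnj (hsum C n p) * hsum C n p)) = of_real E + of_real (msq (\<lambda>p. s p * T p))"
    unfolding pt avg_diff[OF c2] avg_diff[OF c1(1,2)] avg_diff[OF c1(3,4)] avg_norm_sq_msq[OF sTc] avg_cnj avg_cmult DT aE by simp
  then have "Re (avg (\<lambda>p. e p * (cnj (hsum C n p) * hsum C n p))) = E + msq (\<lambda>p. T p * s p)" by (simp add: mult.commute)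
  moreover have "msq (\<lambda>p. T p * s p) \<le> A\<^sup>2 * msq T"
  proof (rule msq_mult_le[OF Tc ec(2)])
    show "cmod (s p) \<le> A" for p unfolding s_def using real_le_lsqrt[OF A(2) A(1)[of p]] by simp
  qed
  moreover have "A\<^sup>2 * msq T \<le> A\<^sup>2 * (K / real (Suc n))\<^sup>2"
    unfolding T_def by (intro mult_left_mono hsum_tail_msq[OF C w]) simp
  ultimately show ?thesis unfolding e_def by linarith
qed

text \<open>For fixed l and l' the arguments of h are distinct for distinct j, so the sum over j
  costs at most the l1 norm of h.\<close>

lemma hankel_form_summable:
  fixes h c :: "int \<Rightarrow> complex" and b :: int
  assumes c: "(\<lambda>m. cmod (c m)) summable_on UNIV" and h: "(\<lambda>m. cmod (h m)) summable_on UNIV"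
  shows "(\<Sum>j<n. \<Sum>l\<le>j. \<Sum>l'\<le>j. cmod (c (- int l)) * cmod (h (2 * int j + b - int l - int l')) * cmod (c (- int l')))
    \<le> (\<Sum>\<^sub>\<infinity>m. cmod (c m)) * (\<Sum>\<^sub>\<infinity>m. cmod (h m)) * (\<Sum>\<^sub>\<infinity>m. cmod (c m))"
proof -
  define S where "S = (\<Sum>\<^sub>\<infinity>m. cmod (c m))"
  define H where "H = (\<Sum>\<^sub>\<infinity>m. cmod (h m))"
  have H0: "0 \<le> H" unfolding H_def by (intro infsum_nonneg) auto
  have S0: "0 \<le> S" unfolding S_def by (intro infsum_nonneg) auto
  have cs: "(\<Sum>l\<le>n. cmod (c (- int l))) \<le> S"
  proof -
    have "(\<Sum>l\<le>n. cmod (c (- int l))) = (\<Sum>m\<in>(\<lambda>l. - int l) ` {..n}. cmod (c m))"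
      by (subst sum.reindex) (auto simp: inj_on_def)
    also have "\<dots> \<le> S" unfolding S_def by (rule finite_sum_le_infsum[OF c]) auto
    finally show ?thesis .
  qed
  have hs: "(\<Sum>j<n. cmod (h (2 * int j + b - int l - int l'))) \<le> H" for l l'
  proof -
    have "(\<Sum>j<n. cmod (h (2 * int j + b - int l - int l'))) = (\<Sum>m\<in>(\<lambda>j. 2 * int j + b - int l - int l') ` {..<n}. cmod (h m))"
      by (subst sum.reindex) (auto simp: inj_on_def)
    also have "\<dots> \<le> H" unfolding H_def by (rule finite_sum_le_infsum[OF h]) auto
    finally show ?thesis .
  qed
  let ?t = "\<lambda>j l l'. cmod (c (- int l)) * cmod (h (2 * int j + b - int l - int l')) * cmod (c (- int l'))"
  have "(\<Sum>j<n. \<Sum>l\<le>j. \<Sum>l'\<le>j. ?t j l l') \<le> (\<Sum>j<n. \<Sum>l\<le>n. \<Sum>l'\<le>n. ?t j l l')"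
  proof (rule sum_mono)
    fix j assume j: "j \<in> {..<n}"
    have "(\<Sum>l\<le>j. \<Sum>l'\<le>j. ?t j l l') \<le> (\<Sum>l\<le>j. \<Sum>l'\<le>n. ?t j l l')"
      by (intro sum_mono sum_mono2) (use j in auto)
    also have "\<dots> \<le> (\<Sum>l\<le>n. \<Sum>l'\<le>n. ?t j l l')"
      by (intro sum_mono2) (use j in \<open>auto intro!: sum_nonneg\<close>)
    finally show "(\<Sum>l\<le>j. \<Sum>l'\<le>j. ?t j l l') \<le> (\<Sum>l\<le>n. \<Sum>l'\<le>n. ?t j l l')" .
  qed
  also have "\<dots> = (\<Sum>l\<le>n. \<Sum>l'\<le>n. \<Sum>j<n. ?t j l l')"
    by (subst sum.swap, rule sum.cong, rule refl, subst sum.swap, rule refl)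
  also have "\<dots> = (\<Sum>l\<le>n. \<Sum>l'\<le>n. cmod (c (- int l)) * (\<Sum>j<n. cmod (h (2 * int j + b - int l - int l'))) * cmod (c (- int l')))"
    by (simp only: sum_distrib_left sum_distrib_right)
  also have "\<dots> \<le> (\<Sum>l\<le>n. \<Sum>l'\<le>n. cmod (c (- int l)) * H * cmod (c (- int l')))"
    by (intro sum_mono mult_right_mono mult_left_mono hs) auto
  also have "\<dots> = (\<Sum>l\<le>n. cmod (c (- int l))) * H * (\<Sum>l\<le>n. cmod (c (- int l)))"
    unfolding sum_distrib_right[of _ _ H] sum_product ..
  also have "\<dots> \<le> S * H * S"
    using cs H0 S0 by (intro mult_mono) (auto intro!: sum_nonneg mult_nonneg_nonneg)
  finally show ?thesis unfolding S_def H_def .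
qed

lemma toeplitz_hankel_det_bound:
  fixes la :: "real \<Rightarrow> real" and M :: "int \<Rightarrow> int \<Rightarrow> complex" and x0 :: int
  assumes d: "\<And>p. ((\<lambda>p. complex_of_real (la p)) has_vector_derivative la' p) (at p)" and c': "continuous_on UNIV la'"
    and per: "\<And>p. la (p + 2 * pi) = la p"
    and herm: "\<And>x y. M y x = cnj (M x y)"
    and pos: "\<And>I v. finite I \<Longrightarrow> 0 \<le> Re (\<Sum>x\<in>I. \<Sum>y\<in>I. cnj (v x) * M x y * v y)"
    and M: "\<And>x y. 1 \<le> x \<Longrightarrow> 1 \<le> y \<Longrightarrow> M x y = fc (\<lambda>p. of_real (exp (la p))) (x - y) + h (x + y)"
    and h: "(\<lambda>m. cmod (h m)) summable_on UNIV"
  shows "\<exists>B. \<forall>n. cmod (fdet n (\<lambda>i j. M (x0 + int i) (x0 + int j))) \<le> B * exp (Re (avg (\<lambda>p. of_real (la p))) * real n)"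
proof -
  obtain C D K where C: "hardy C" and D: "hardy D" and a: "avg C = 1" "avg D = 1" and w: "l2le (\<lambda>m. of_int m * fc C m) K"
    and DC: "\<And>p. D p * C p = 1"
    and f: "\<And>p. of_real (exp (la p)) * cnj (C p) = of_real (exp (Re (avg (\<lambda>p. of_real (la p))))) * D p"
    by (rule outer_function[of la la', OF d c' per]) blast
  define lm where "lm = Re (avg (\<lambda>p. complex_of_real (la p)))"
  define c where "c = fc C"
  define F where "F p = complex_of_real (exp (la p))" for p
  have lcc: "continuous_on UNIV (\<lambda>p. complex_of_real (la p))"
    by (intro continuous_at_imp_continuous_on ballI has_vector_derivative_continuous[OF d])
  have lc: "continuous_on UNIV la" using continuous_on_Re[OF lcc] by simp
  have Fc: "continuous_on UNIV F" unfolding F_def by (intro continuous_intros lc)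
  have Fp: "periodic F" unfolding periodic_def F_def by (simp add: per)
  obtain A where A: "0 < A" "\<And>p. exp (la p) \<le> A\<^sup>2"
  proof -
    obtain k where k: "0 < k" "\<And>p. cmod (F p) \<le> k" using cont_periodic_bounded[OF Fc Fp] by blast
    show thesis by (rule that[of "sqrt k"]) (use k in \<open>auto simp: F_def\<close>)
  qed
  have c0: "c 0 = 1" unfolding c_def fc_def using a by simp
  have cs: "(\<lambda>m. cmod (c m)) summable_on UNIV" unfolding c_def by (rule summable_of_weighted_l2[OF w])
  \<comment> \<open>Number of indices whose site is below 1, where M is not given as Toeplitz plus
    Hankel.\<close>
  define m where "m = nat (1 - x0)"
  define b where "b = 2 * (x0 + int m)"
  define N where "N i j = M (x0 + int i) (x0 + int j)" for i j :: nat
  \<comment> \<open>Unit vectors for the first m indices; afterwards the Taylor coefficients of C in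
    reverse order, ending at index j and cut off at m. The entry at j is c 0 = 1.\<close>
  define V where "V j i = (if j < m then if i = j then 1 else 0 else if m \<le> i \<and> i \<le> j then c (- int (j - i)) else 0)" for j i :: nat
  have psd: "psd n N" for n
    unfolding psd_def
  proof (intro conjI allI impI)
    fix v :: "nat \<Rightarrow> complex"
    have inj: "inj_on (\<lambda>i. x0 + int i) {..<n}" by (auto simp: inj_on_def)
    have "0 \<le> Re (\<Sum>x\<in>(\<lambda>i. x0 + int i) ` {..<n}. \<Sum>y\<in>(\<lambda>i. x0 + int i) ` {..<n}. cnj (v (nat (x - x0))) * M x y * v (nat (y - x0)))"
      by (rule pos) simp
    then show "0 \<le> Re (qform n N v)" unfolding sum.reindex[OF inj] o_def qform_def N_def by simp
  qed (auto simp: N_def intro: herm)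
  define H where "H j = (\<Sum>l\<le>j. \<Sum>l'\<le>j. cmod (c (- int l)) * cmod (h (2 * int j + b - int l - int l')) * cmod (c (- int l')))" for j :: nat
  \<comment> \<open>Excess of factor j over exp lm: a trivial bound for the first m factors, then
    the Taylor remainder plus the Hankel part.\<close>
  define \<delta> where "\<delta> j = (if j < m then cmod (N j j) else A\<^sup>2 * (K / real (Suc (j - m)))\<^sup>2 + H (j - m))" for j
  have H0: "0 \<le> H j" for j unfolding H_def by (intro sum_nonneg mult_nonneg_nonneg) auto
  have \<delta>0: "0 \<le> \<delta> j" for j unfolding \<delta>_def using H0 by auto
  have fac: "Re (qform n N (V j)) \<le> exp lm + \<delta> j" if j: "j < n" for n j
  proof (cases "j < m")
    case True
    have "qform n N (V j) = (\<Sum>i<n. if i = j then N j j else 0)"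
      unfolding qform_def
    proof (rule sum.cong)
      fix i
      have "(\<Sum>k<n. cnj (V j i) * N i k * V j k) = (\<Sum>k<n. if k = j then cnj (V j i) * N i j else 0)"
        by (rule sum.cong) (auto simp: V_def True)
      then show "(\<Sum>k<n. cnj (V j i) * N i k * V j k) = (if i = j then N j j else 0)"
        using j by (simp add: V_def True)
    qed simp
    then have "qform n N (V j) = N j j" using j by simp
    then show ?thesis using complex_Re_le_cmod[of "N j j"] True unfolding \<delta>_def by (simp add: add_increasing)
  next
    case False
    define k where "k = j - m"
    \<comment> \<open>Reindexes by the distance l = j - i from the last entry, which is the order of
      the Taylor coefficient.\<close>
    have re: "(\<Sum>i<n. g i * (if m \<le> i \<and> i \<le> j then G (j - i) i else 0)) = (\<Sum>l\<le>k. g (j - l) * G l (j - l))" for g and G :: "nat \<Rightarrow> nat \<Rightarrow> complex"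
    proof -
      have "(\<Sum>i<n. g i * (if m \<le> i \<and> i \<le> j then G (j - i) i else 0)) = (\<Sum>i\<in>{m..j}. g i * G (j - i) i)"
        by (rule sum.mono_neutral_cong_right) (use j in auto)
      also have "\<dots> = (\<Sum>l\<le>k. g (j - l) * G l (j - l))"
        by (rule sum.reindex_bij_witness[where i = "\<lambda>l. j - l" and j = "\<lambda>i. j - i"]) (use False in \<open>auto simp: k_def\<close>)
      finally show ?thesis .
    qed
    have "qform n N (V j) = (\<Sum>i<n. 1 * (if m \<le> i \<and> i \<le> j then cnj (c (- int (j - i))) * (\<Sum>k'<n. N i k' * (if m \<le> k' \<and> k' \<le> j then c (- int (j - k')) else 0)) else 0))"
      unfolding qform_def
    proof (rule sum.cong)
      fix i
      show "(\<Sum>k<n. cnj (V j i) * N i k * V j k) = 1 * (if m \<le> i \<and> i \<le> j then cnj (c (- int (j - i))) * (\<Sum>k'<n. N i k' * (if m \<le> k' \<and> k' \<le> j then c (- int (j - k')) else 0)) else 0)"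
        using False by (simp add: V_def sum_distrib_left mult.assoc)
    qed simp
    also have "\<dots> = (\<Sum>l\<le>k. cnj (c (- int l)) * (\<Sum>l'\<le>k. N (j - l) (j - l') * c (- int l')))"
      using re[of "\<lambda>i. 1" "\<lambda>l i. cnj (c (- int l)) * (\<Sum>k'<n. N i k' * (if m \<le> k' \<and> k' \<le> j then c (- int (j - k')) else 0))"]
        re[of "N (j - l)" "\<lambda>l i. c (- int l)" for l]
      by (simp only: mult_1_left)
    also have "\<dots> = (\<Sum>l\<le>k. \<Sum>l'\<le>k. cnj (c (- int l)) * fc F (int l' - int l) * c (- int l')
        + cnj (c (- int l)) * h (2 * int k + b - int l - int l') * c (- int l'))"
      unfolding sum_distrib_left
    proof (intro sum.cong refl)
      fix l l' assume l: "l \<in> {..k}" "l' \<in> {..k}"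
      have g: "1 \<le> x0 + int (j - l)" "1 \<le> x0 + int (j - l')" using l False unfolding k_def m_def by auto
      have e: "(x0 + int (j - l)) - (x0 + int (j - l')) = int l' - int l"
        "(x0 + int (j - l)) + (x0 + int (j - l')) = 2 * int k + b - int l - int l'" using l False unfolding k_def b_def by auto
      have "N (j - l) (j - l') = fc F (int l' - int l) + h (2 * int k + b - int l - int l')"
        unfolding N_def M[OF g] e F_def ..
      then show "cnj (c (- int l)) * (N (j - l) (j - l') * c (- int l')) = cnj (c (- int l)) * fc F (int l' - int l) * c (- int l')
        + cnj (c (- int l)) * h (2 * int k + b - int l - int l') * c (- int l')" by (simp add: algebra_simps)
    qed
    also have "\<dots> = avg (\<lambda>p. F p * (cnj (hsum C k p) * hsum C k p)) + (\<Sum>l\<le>k. \<Sum>l'\<le>k. cnj (c (- int l)) * h (2 * int k + b - int l - int l') * c (- int l'))"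
      unfolding avg_hsum_form[OF Fc] sum.distrib c_def ..
    finally have q: "qform n N (V j) = \<dots>" .
    have "Re (avg (\<lambda>p. F p * (cnj (hsum C k p) * hsum C k p))) \<le> exp lm + A\<^sup>2 * (K / real (Suc k))\<^sup>2"
      unfolding F_def lm_def by (rule avg_hsum_bound[OF C D a w DC f lc A(2)]) (use A in auto)
    moreover have "Re (\<Sum>l\<le>k. \<Sum>l'\<le>k. cnj (c (- int l)) * h (2 * int k + b - int l - int l') * c (- int l')) \<le> H k"
      unfolding H_def by (rule order_trans[OF complex_Re_le_cmod]) (intro sum_norm_le, simp add: norm_mult)
    ultimately show ?thesis unfolding q \<delta>_def using False by (simp add: k_def)
  qed
  obtain S where S: "\<And>n. (\<Sum>j<n. \<delta> j) \<le> S"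
  proof -
    define S1 where "S1 = (\<Sum>j<m. cmod (N j j))"
    define S2 where "S2 = (\<Sum>k. 1 / (real (Suc k))\<^sup>2)"
    define S3 where "S3 = (\<Sum>\<^sub>\<infinity>m. cmod (c m)) * (\<Sum>\<^sub>\<infinity>m. cmod (h m)) * (\<Sum>\<^sub>\<infinity>m. cmod (c m))"
    have sm: "summable (\<lambda>k. 1 / (real (Suc k))\<^sup>2)"
      using inverse_power_summable[of 2, where 'a = real] by (subst summable_Suc_iff) (simp add: inverse_eq_divide)
    have "(\<Sum>j<n. \<delta> j) \<le> S1 + (A\<^sup>2 * K\<^sup>2 * S2 + S3)" for n
    proof -
      have "(\<Sum>j<n. \<delta> j) \<le> (\<Sum>j<m + n. \<delta> j)" by (rule sum_mono2) (use \<delta>0 in auto)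
      also have "\<dots> = (\<Sum>j<m. \<delta> j) + (\<Sum>k<n. \<delta> (m + k))"
        by (induction n) auto
      also have "(\<Sum>j<m. \<delta> j) = S1" unfolding S1_def \<delta>_def by simp
      also have "(\<Sum>k<n. \<delta> (m + k)) = A\<^sup>2 * K\<^sup>2 * (\<Sum>k<n. 1 / (real (Suc k))\<^sup>2) + (\<Sum>k<n. H k)"
        unfolding \<delta>_def by (simp add: sum.distrib sum_distrib_left power_divide del: of_nat_Suc)
      also have "S1 + \<dots> \<le> S1 + (A\<^sup>2 * K\<^sup>2 * S2 + S3)"
      proof (intro add_left_mono add_mono mult_left_mono)
        show "(\<Sum>k<n. 1 / (real (Suc k))\<^sup>2) \<le> S2" unfolding S2_def by (rule sum_le_suminf[OF sm]) auto
        show "(\<Sum>k<n. H k) \<le> S3" unfolding H_def S3_def by (rule hankel_form_summable[OF cs h])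
      qed simp
      finally show ?thesis .
    qed
    then show thesis by (rule that)
  qed
  have "cmod (fdet n N) \<le> exp (exp (- lm) * S) * exp (lm * real n)" for n
  proof -
    have "cmod (fdet n N) \<le> (\<Prod>j<n. Re (qform n N (V j)))"
      by (rule fdet_le_prod_qform[OF psd]) (auto simp: V_def c0)
    \<comment> \<open>1 + x <= exp x converts the summable excess into a constant factor, uniform in
      n.\<close>
    also have "\<dots> \<le> (\<Prod>j<n. exp lm * exp (exp (- lm) * \<delta> j))"
    proof (rule prod_mono)
      fix j assume "j \<in> {..<n}"
      then have "Re (qform n N (V j)) \<le> exp lm + \<delta> j" using fac by simp
      also have "\<dots> = exp lm * (1 + exp (- lm) * \<delta> j)" by (simp add: distrib_left mult.assoc[symmetric] exp_add[symmetric])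
      also have "\<dots> \<le> exp lm * exp (exp (- lm) * \<delta> j)" by (intro mult_left_mono exp_ge_add_one_self) auto
      finally show "0 \<le> Re (qform n N (V j)) \<and> Re (qform n N (V j)) \<le> exp lm * exp (exp (- lm) * \<delta> j)"
        using psd[of n] unfolding psd_def by blast
    qed
    also have "\<dots> = exp (lm * real n) * exp (exp (- lm) * (\<Sum>j<n. \<delta> j))"
      by (simp add: prod.distrib exp_sum[symmetric] sum_distrib_left exp_of_nat_mult[symmetric] mult.commute)
    also have "\<dots> \<le> exp (lm * real n) * exp (exp (- lm) * S)"
      using S[of n] by (intro mult_left_mono) auto
    finally show ?thesis by (simp add: mult.commute)
  qed
  then show ?thesis unfolding N_def lm_def by blast
qed

section \<open>The symbol of the steady state\<close>

definition mix :: "real \<Rightarrow> real \<Rightarrow> real \<Rightarrow> real \<Rightarrow> real" where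
  "mix \<kappa> \<beta>L \<beta>R p = sigmaB \<kappa> p * rfermi \<beta>L p + (1 - sigmaB \<kappa> p) * rfermi \<beta>R p"

text \<open>Equals the right Fermi function where sin p is nonnegative and the mixture of both Fermi functions
  elsewhere; written so as to show that it is continuously differentiable.\<close>
definition symb :: "real \<Rightarrow> real \<Rightarrow> real \<Rightarrow> real \<Rightarrow> real" where
  "symb \<kappa> \<beta>L \<beta>R p = rfermi \<beta>R p + (min (sin p) 0)\<^sup>2 / ((sin p)\<^sup>2 + \<kappa>\<^sup>2) * (rfermi \<beta>L p - rfermi \<beta>R p)"

lemma rfermi_even: "rfermi \<beta> (- p) = rfermi \<beta> p"
  unfolding rfermi_def by simp

lemma rfermi_pos: "0 < rfermi \<beta> p"
  unfolding rfermi_def by (simp add: add_pos_pos)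

lemma rfermi_le: "0 \<le> \<beta> \<Longrightarrow> \<beta> \<le> \<gamma> \<Longrightarrow> rfermi \<beta> p \<le> 1 / (1 + exp (- \<gamma>))"
proof -
  assume b: "0 \<le> \<beta>" "\<beta> \<le> \<gamma>"
  have "\<beta> * cos p \<le> \<beta> * 1" using b by (intro mult_left_mono) auto
  then show ?thesis unfolding rfermi_def using b by (intro divide_left_mono add_left_mono) (auto intro!: mult_pos_pos add_pos_pos)
qed

lemma rfermi_cont: "continuous_on S (rfermi \<beta>)"
  unfolding rfermi_def by (intro continuous_intros ballI one_plus_exp_neq_0)

text \<open>cos(pi - k) = -cos k accounts for the opposite sign in the exponent; integrals over a
  full period do not see the substitution.\<close>

lemma s_hat_minus_eq: "s_hat_minus \<beta> k = rfermi \<beta> (pi - k)"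
proof -
  have t: "(1 - tanh (x / 2)) / 2 = 1 / (1 + exp x)" for x :: real
  proof -
    have p: "0 < exp x" by simp
    have "tanh (x / 2) = (1 - exp (- x)) / (1 + exp (- x))" using tanh_real_altdef[of "x / 2"] by simp
    also have "\<dots> = (exp x - 1) / (exp x + 1)"
      using p by (simp add: exp_minus divide_simps)
    finally have "tanh (x / 2) = (exp x - 1) / (exp x + 1)" .
    moreover have "1 + exp x \<noteq> 0" by (rule one_plus_exp_neq_0)
    ultimately show ?thesis by (simp add: divide_simps add.commute) (simp add: algebra_simps)
  qed
  show ?thesis unfolding s_hat_minus_def t rfermi_def by simp
qed

lemma sum_sq_pos: "0 < \<kappa> \<Longrightarrow> 0 < (x::real)\<^sup>2 + \<kappa>\<^sup>2"
  by (rule add_nonneg_pos) auto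

lemma sigmaB_bounds: "0 < \<kappa> \<Longrightarrow> 0 \<le> sigmaB \<kappa> p \<and> sigmaB \<kappa> p \<le> 1"
  unfolding sigmaB_def using sum_sq_pos[of \<kappa> "sin p"] by (auto simp: divide_le_eq_1)

lemma sigmaB_cont: "0 < \<kappa> \<Longrightarrow> continuous_on S (sigmaB \<kappa>)"
  unfolding sigmaB_def by (intro continuous_intros ballI) (use sum_sq_pos[of \<kappa>] in \<open>auto simp: less_le\<close>)

lemma mix_cont: "0 < \<kappa> \<Longrightarrow> continuous_on S (mix \<kappa> \<beta>L \<beta>R)"
  unfolding mix_def by (intro continuous_intros sigmaB_cont rfermi_cont)

lemma mix_pos: "0 < \<kappa> \<Longrightarrow> 0 < mix \<kappa> \<beta>L \<beta>R p"
proof -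
  assume "0 < \<kappa>"
  then have s: "0 \<le> sigmaB \<kappa> p" "sigmaB \<kappa> p \<le> 1" using sigmaB_bounds by auto
  show ?thesis
  proof (cases "sigmaB \<kappa> p = 0")
    case True
    then show ?thesis unfolding mix_def by (simp add: rfermi_pos)
  next
    case False
    then show ?thesis unfolding mix_def using s rfermi_pos[of \<beta>L p] rfermi_pos[of \<beta>R p] by (intro add_pos_nonneg mult_pos_pos) auto
  qed
qed

lemma mix_even: "mix \<kappa> \<beta>L \<beta>R (- p) = mix \<kappa> \<beta>L \<beta>R p"
  unfolding mix_def by (simp add: rfermi_even sigmaB_def)

lemma mix_le:
  assumes "0 < \<kappa>" "0 < \<beta>L" "\<beta>L \<le> \<beta>R"
  shows "mix \<kappa> \<beta>L \<beta>R p \<le> 1 / (1 + exp (- \<beta>R))"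
proof -
  have "mix \<kappa> \<beta>L \<beta>R p \<le> sigmaB \<kappa> p * (1 / (1 + exp (- \<beta>R))) + (1 - sigmaB \<kappa> p) * (1 / (1 + exp (- \<beta>R)))"
    unfolding mix_def using sigmaB_bounds[OF assms(1), of p] assms
    by (intro add_mono mult_left_mono rfermi_le) auto
  then show ?thesis by (simp only: distrib_right[symmetric])  simp
qed

lemma symb_nonneg_sin: "0 \<le> sin p \<Longrightarrow> symb \<kappa> \<beta>L \<beta>R p = rfermi \<beta>R p"
  unfolding symb_def by (simp add: min_def)

lemma symb_nonpos_sin: "sin p \<le> 0 \<Longrightarrow> symb \<kappa> \<beta>L \<beta>R p = mix \<kappa> \<beta>L \<beta>R p"
  proof -
  assume "sin p \<le> 0"
  then have "(min (sin p) 0)\<^sup>2 / ((sin p)\<^sup>2 + \<kappa>\<^sup>2) = sigmaB \<kappa> p" unfolding sigmaB_def by simp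
  then show ?thesis unfolding symb_def mix_def by (simp add: algebra_simps)
qed

lemma symb_pos: "0 < \<kappa> \<Longrightarrow> 0 < symb \<kappa> \<beta>L \<beta>R p"
  using symb_nonneg_sin[of p] symb_nonpos_sin[of p] rfermi_pos mix_pos by (metis linear)

lemma symb_periodic: "symb \<kappa> \<beta>L \<beta>R (p + 2 * pi) = symb \<kappa> \<beta>L \<beta>R p"
  unfolding symb_def rfermi_def by simp

text \<open>Unlike the negative part itself, its square is differentiable at 0; this makes the
  symbol differentiable where sin p changes sign.\<close>

lemma negative_part_sq_deriv: "((\<lambda>s::real. (min s 0)\<^sup>2) has_real_derivative 2 * min s 0) (at s)"
proof -
  consider "s < 0" | "s = 0" | "0 < s" by linarith
  then show ?thesis
  proof cases
    case 1
    have "((\<lambda>s::real. s\<^sup>2) has_real_derivative 2 * s) (at s)" by (auto intro!: derivative_eq_intros)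
    then have "((\<lambda>s::real. (min s 0)\<^sup>2) has_real_derivative 2 * s) (at s)"
      by (rule has_field_derivative_transform_within_open[of _ _ _ "{..<0}"]) (use 1 in auto)
    then show ?thesis using 1 by simp
  next
    case 2
    have "((\<lambda>h::real. ((min (0 + h) 0)\<^sup>2 - (min 0 0)\<^sup>2) / h) \<longlongrightarrow> 0) (at 0)"
    proof (rule Lim_null_comparison)
      show "\<forall>\<^sub>F h::real in at 0. norm (((min (0 + h) 0)\<^sup>2 - (min 0 0)\<^sup>2) / h) \<le> \<bar>h\<bar>"
        by (rule always_eventually) (auto simp: min_def power2_eq_square)
      show "((\<lambda>h::real. \<bar>h\<bar>) \<longlongrightarrow> 0) (at 0)" by (rule tendsto_rabs_zero[OF tendsto_ident_at])
    qed
    then show ?thesis using 2 unfolding DERIV_def by simp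
  next
    case 3
    have "((\<lambda>s::real. 0) has_real_derivative 0) (at s)" by simp
    then have "((\<lambda>s::real. (min s 0)\<^sup>2) has_real_derivative 0) (at s)"
      by (rule has_field_derivative_transform_within_open[of _ _ _ "{0<..}"]) (use 3 in auto)
    then show ?thesis using 3 by simp
  qed
qed

lemma ln_symb_deriv:
  assumes \<kappa>: "0 < \<kappa>"
  shows "\<exists>D. continuous_on UNIV D \<and> (\<forall>p. ((\<lambda>p. complex_of_real (ln (symb \<kappa> \<beta>L \<beta>R p))) has_vector_derivative D p) (at p))"
proof -
  obtain DL where DL: "continuous_on UNIV DL" "\<And>p. (rfermi \<beta>L has_real_derivative DL p) (at p)" using rfermi_deriv by blast
  obtain DR where DR: "continuous_on UNIV DR" "\<And>p. (rfermi \<beta>R has_real_derivative DR p) (at p)" using rfermi_deriv by blast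
  note nz = less_imp_neq[OF sum_sq_pos[OF \<kappa>], symmetric]
  define W where "W p = (2 * min (sin p) 0 * cos p * ((sin p)\<^sup>2 + \<kappa>\<^sup>2) - (min (sin p) 0)\<^sup>2 * (2 * sin p * cos p)) / (((sin p)\<^sup>2 + \<kappa>\<^sup>2) * ((sin p)\<^sup>2 + \<kappa>\<^sup>2))" for p
  have dm: "((\<lambda>p. (min (sin p) 0)\<^sup>2) has_real_derivative 2 * min (sin p) 0 * cos p) (at p)" for p
    by (rule DERIV_chain2[OF negative_part_sq_deriv DERIV_sin])
  have ds: "((\<lambda>p. (sin p)\<^sup>2 + \<kappa>\<^sup>2) has_real_derivative 2 * sin p * cos p) (at p)" for p
    by (auto intro!: derivative_eq_intros)
  have dW: "((\<lambda>p. (min (sin p) 0)\<^sup>2 / ((sin p)\<^sup>2 + \<kappa>\<^sup>2)) has_real_derivative W p) (at p)" for p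
    unfolding W_def by (rule DERIV_divide[OF dm ds nz])
  define S where "S p = DR p + (W p * (rfermi \<beta>L p - rfermi \<beta>R p) + (DL p - DR p) * ((min (sin p) 0)\<^sup>2 / ((sin p)\<^sup>2 + \<kappa>\<^sup>2)))" for p
  have dS: "(symb \<kappa> \<beta>L \<beta>R has_real_derivative S p) (at p)" for p
    unfolding S_def symb_def[abs_def] by (intro DERIV_add DERIV_mult DERIV_diff dW DL DR)
  have sc: "continuous_on UNIV (symb \<kappa> \<beta>L \<beta>R)"
    by (intro continuous_at_imp_continuous_on ballI DERIV_isCont[OF dS])
  have Sc: "continuous_on UNIV S"
    unfolding S_def W_def by (intro continuous_intros DL DR rfermi_cont ballI) (use nz in auto)
  have "((\<lambda>p. ln (symb \<kappa> \<beta>L \<beta>R p)) has_real_derivative S p / symb \<kappa> \<beta>L \<beta>R p) (at p)" for p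
    using DERIV_chain2[OF DERIV_ln_divide[OF symb_pos[OF \<kappa>]] dS] by simp
  then have "((\<lambda>p. complex_of_real (ln (symb \<kappa> \<beta>L \<beta>R p))) has_vector_derivative of_real (S p / symb \<kappa> \<beta>L \<beta>R p)) (at p)" for p
    by (intro has_vector_derivative_of_real)
  moreover have "continuous_on UNIV (\<lambda>p. complex_of_real (S p / symb \<kappa> \<beta>L \<beta>R p))"
    by (intro continuous_intros Sc sc ballI) (use symb_pos[OF \<kappa>] in \<open>auto simp: less_le\<close>)
  ultimately show ?thesis by blast
qed

lemma symb_cont: "0 < \<kappa> \<Longrightarrow> continuous_on S (symb \<kappa> \<beta>L \<beta>R)"
  unfolding symb_def by (intro continuous_intros rfermi_cont ballI) (use sum_sq_pos[of \<kappa>] in \<open>auto simp: less_le\<close>)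

section \<open>Identification and positivity of the decay rate\<close>

lemma integral_split_reflect:
  fixes g :: "real \<Rightarrow> 'a::banach"
  assumes c: "continuous_on UNIV g"
  shows "integral {-pi..pi} g = integral {0..pi} g + integral {0..pi} (\<lambda>p. g (- p))"
proof -
  have "integral {-pi..pi} g = integral {-pi..0} g + integral {0..pi} g"
    by (rule Henstock_Kurzweil_Integration.integral_combine[symmetric])
      (auto intro!: integrable_continuous_real continuous_on_subset[OF c])
  moreover have "integral {-pi..-0} (\<lambda>x. g (- (- x))) = integral {0..pi} (\<lambda>p. g (- p))"
    by (rule Henstock_Kurzweil_Integration.integral_reflect_real)
  ultimately show ?thesis by simp
qed

text \<open>An even function has the same integral over both half periods; the resulting factor 2
  absorbs the 1/2 in \<open>GammaR\<close> and \<open>GammaB\<close>.\<close>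

lemma integral_even_reflect:
  fixes g :: "real \<Rightarrow> real"
  assumes c: "continuous_on UNIV g" and e: "\<And>p. g (- p) = g p" and per: "\<And>p. g (p + 2 * pi) = g p"
  shows "integral {-pi..pi} (\<lambda>k. g (pi - k)) = 2 * integral {0..pi} g"
proof -
  have c2: "continuous_on UNIV (\<lambda>k. g (pi - k))"
    by (rule continuous_on_compose2[OF c]) (auto intro!: continuous_intros)
  have "integral {-pi..-0} (\<lambda>x. g (pi - (- x))) = integral {0..pi} (\<lambda>k. g (pi - k))"
    by (rule Henstock_Kurzweil_Integration.integral_reflect_real)
  then have r: "integral {0..pi} (\<lambda>k. g (pi - k)) = integral {0..pi} g"
    using integral_shift_Icc_real[of "-pi" 0 g pi] by (simp add: o_def)
  have "g (pi - - k) = g (pi - k)" for k using per[of "k - pi"] e[of "k - pi"] by (simp add: algebra_simps)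
  then show ?thesis using integral_split_reflect[OF c2] r by simp
qed

lemma GammaR_eq: "GammaR \<beta> = - integral {0..pi} (\<lambda>p. ln (rfermi \<beta> p)) / (2 * pi)"
proof -
  have c: "continuous_on UNIV (\<lambda>p. ln (rfermi \<beta> p))"
    by (intro continuous_intros rfermi_cont ballI) (use rfermi_pos[of \<beta>] in \<open>auto simp: less_le\<close>)
  have "integral {-pi..pi} (\<lambda>k. ln (rfermi \<beta> (pi - k))) = 2 * integral {0..pi} (\<lambda>p. ln (rfermi \<beta> p))"
    by (rule integral_even_reflect[OF c]) (auto simp: rfermi_def)
  then show ?thesis unfolding GammaR_def s_hat_minus_eq by simp
qed

lemma GammaB_eq: "0 < \<kappa> \<Longrightarrow> GammaB \<kappa> \<beta>L \<beta>R = - integral {0..pi} (\<lambda>p. ln (mix \<kappa> \<beta>L \<beta>R p)) / (2 * pi)"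
proof -
  assume \<kappa>: "0 < \<kappa>"
  have c: "continuous_on UNIV (\<lambda>p. ln (mix \<kappa> \<beta>L \<beta>R p))"
    by (intro continuous_intros mix_cont[OF \<kappa>] ballI) (use mix_pos[OF \<kappa>] in \<open>auto simp: less_le\<close>)
  have "integral {-pi..pi} (\<lambda>k. ln (mix \<kappa> \<beta>L \<beta>R (pi - k))) = 2 * integral {0..pi} (\<lambda>p. ln (mix \<kappa> \<beta>L \<beta>R p))"
    by (rule integral_even_reflect[OF c]) (auto simp: mix_def rfermi_def sigmaB_def)
  moreover have "sigmaB \<kappa> k * s_hat_minus \<beta>L k + (1 - sigmaB \<kappa> k) * s_hat_minus \<beta>R k = mix \<kappa> \<beta>L \<beta>R (pi - k)" for k
    unfolding s_hat_minus_eq mix_def sigmaB_def by simp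
  ultimately show ?thesis unfolding GammaB_def by simp
qed

text \<open>The half circle with sin p >= 0 yields \<open>GammaR\<close>, the other half
  \<open>GammaB\<close>.\<close>

lemma decay_rate:
  assumes \<kappa>: "0 < \<kappa>"
  shows "Re (avg (\<lambda>p. of_real (ln (symb \<kappa> \<beta>L \<beta>R p)))) = - (GammaR \<beta>R + GammaB \<kappa> \<beta>L \<beta>R)"
proof -
  have c: "continuous_on UNIV (\<lambda>p. ln (symb \<kappa> \<beta>L \<beta>R p))"
    by (intro continuous_intros symb_cont[OF \<kappa>] ballI) (use symb_pos[OF \<kappa>] in \<open>auto simp: less_le\<close>)
  have "integral {0..pi} (\<lambda>p. ln (symb \<kappa> \<beta>L \<beta>R p)) = integral {0..pi} (\<lambda>p. ln (rfermi \<beta>R p))"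
    by (rule Henstock_Kurzweil_Integration.integral_cong) (simp add: symb_nonneg_sin sin_ge_zero)
  moreover have "integral {0..pi} (\<lambda>p. ln (symb \<kappa> \<beta>L \<beta>R (- p))) = integral {0..pi} (\<lambda>p. ln (mix \<kappa> \<beta>L \<beta>R p))"
    by (rule Henstock_Kurzweil_Integration.integral_cong) (simp add: symb_nonpos_sin sin_ge_zero mix_even)
  ultimately show ?thesis
    unfolding avg_def integral_of_real[OF c] integral_split_reflect[OF c] GammaR_eq GammaB_eq[OF \<kappa>]
    by (simp add: add_divide_distrib)
qed

lemma decay_rate_pos:
  assumes \<kappa>: "0 < \<kappa>" and \<beta>: "0 < \<beta>L" "\<beta>L \<le> \<beta>R"
  shows "GammaR \<beta>R + GammaB \<kappa> \<beta>L \<beta>R > 0"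
proof -
  \<comment> \<open>Both symbols stay below 1 / (1 + exp(-\<beta>R)) < 1, for the second one because
    \<beta>L <= \<beta>R; -c is the logarithm of this bound.\<close>
  define c where "c = ln (1 + exp (- \<beta>R))"
  have c0: "0 < c" unfolding c_def by (simp add: ln_gt_zero)
  have neg: "0 < - integral {0..pi} (\<lambda>p. ln (g p)) / (2 * pi)"
    if g: "continuous_on UNIV g" "\<And>p. 0 < g p" "\<And>p. g p \<le> 1 / (1 + exp (- \<beta>R))" for g :: "real \<Rightarrow> real"
  proof -
    have gc: "continuous_on UNIV (\<lambda>p. ln (g p))" by (intro continuous_intros g ballI) (use g(2) in \<open>auto simp: less_le\<close>)
    have "integral {0..pi} (\<lambda>p. ln (g p)) \<le> integral {0..pi} (\<lambda>p. - c)"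
    proof (rule integral_le)
      show "(\<lambda>p. ln (g p)) integrable_on {0..pi}" by (rule integrable_cont[OF gc])
      fix p
      have "ln (g p) \<le> ln (1 / (1 + exp (- \<beta>R)))" using g(2,3)[of p] by (subst ln_le_cancel_iff) (auto simp: add_pos_pos)
      also have "\<dots> = - c" unfolding c_def by (simp add: ln_div add_pos_pos)
      finally show "ln (g p) \<le> - c" .
    qed (auto intro!: integrable_const_ivl)
    then have "integral {0..pi} (\<lambda>p. ln (g p)) \<le> - (pi * c)" by simp
    moreover have "0 < pi * c" using c0 by simp
    ultimately show ?thesis by (intro divide_pos_pos) auto
  qed
  have "0 < GammaR \<beta>R" unfolding GammaR_eq by (rule neg) (use \<beta> in \<open>auto intro!: rfermi_cont rfermi_pos rfermi_le\<close>)
  moreover have "0 < GammaB \<kappa> \<beta>L \<beta>R" unfolding GammaB_eq[OF \<kappa>]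
    by (rule neg) (use \<beta> \<kappa> in \<open>auto intro!: mix_cont mix_pos mix_le\<close>)
  ultimately show ?thesis by simp
qed

section \<open>The limit matrix at positive sites\<close>

lemma avg_split: "continuous_on UNIV F \<Longrightarrow> avg F = havg F + havg (\<lambda>p. F (- p))"
  unfolding avg_def havg_def by (simp add: integral_split_reflect add_divide_distrib)

lemma havg_cong: "(\<And>p. 0 \<le> sin p \<Longrightarrow> F p = G p) \<Longrightarrow> havg F = havg G"
  unfolding havg_def by (subst Henstock_Kurzweil_Integration.integral_cong[of _ F G]) (auto simp: sin_ge_zero)

lemma rcoef_minus: "rcoef \<kappa> (- p) = cnj (rcoef \<kappa> p)"
  unfolding rcoef_def by simp

text \<open>Reflection probability of the point interaction.\<close>

lemma rcoef_refl_norm: "0 < \<kappa> \<Longrightarrow> cnj (rcoef \<kappa> p) * rcoef \<kappa> p = of_real (1 - sigmaB \<kappa> p)"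
proof -
  assume k: "0 < \<kappa>"
  have "cnj (rcoef \<kappa> p) * rcoef \<kappa> p = of_real ((cmod (rcoef \<kappa> p))\<^sup>2)" by (metis complex_norm_square mult.commute)
  also have "(cmod (rcoef \<kappa> p))\<^sup>2 = 1 - sigmaB \<kappa> p"
    using k sum_sq_pos[OF k, of "sin p"] rcoef_norm[of \<kappa> p] unfolding sigmaB_def by (simp add: field_simps)
  finally show ?thesis .
qed

text \<open>Transmission probability: 1 + \<open>rcoef\<close> is the transmission
  amplitude.\<close>

lemma rcoef_trans_norm: "0 < \<kappa> \<Longrightarrow> cnj (1 + rcoef \<kappa> p) * (1 + rcoef \<kappa> p) = of_real (sigmaB \<kappa> p)"
proof -
  assume k: "0 < \<kappa>"
  have nz: "of_real \<kappa> + \<i> * of_real (sin p) \<noteq> (0::complex)" using k by (simp add: complex_eq_iff)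
  have "1 + rcoef \<kappa> p = \<i> * of_real (sin p) / (of_real \<kappa> + \<i> * of_real (sin p))"
    unfolding rcoef_def using nz by (simp add: field_simps)
  then have "(cmod (1 + rcoef \<kappa> p))\<^sup>2 = sigmaB \<kappa> p"
    unfolding sigmaB_def by (simp add: norm_divide norm_mult power_divide cmod_power2 add.commute)
  then show ?thesis by (metis complex_norm_square mult.commute)
qed

text \<open>The Toeplitz part collects the incoming and the outgoing term, the latter fed by
  reflection from the right with weight 1 - \<open>sigmaB\<close> and by transmission from the left
  with weight \<open>sigmaB\<close>. The interference of the incoming with the reflected wave gives
  the Hankel part, to which the bound state adds a geometric term.\<close>

lemma Minf_toeplitz_hankel:
  assumes \<kappa>: "0 < \<kappa>" and x: "1 \<le> x" and y: "1 \<le> y"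
  shows "Minf N \<kappa> \<beta>L \<beta>R x y = fc (\<lambda>p. of_real (symb \<kappa> \<beta>L \<beta>R p)) (x - y)
    + (fc (\<lambda>p. fermi \<beta>R p * rcoef \<kappa> p) (x + y) + of_real (bs_decay \<kappa> ^ nat \<bar>x + y\<bar>) * Zc N \<kappa> \<beta>L \<beta>R)"
proof -
  have k: "\<kappa> \<noteq> 0" using \<kappa> by simp
  define E where "E p = of_real (symb \<kappa> \<beta>L \<beta>R p) * cis (of_int (x - y) * p) + (fermi \<beta>R p * rcoef \<kappa> p) * cis (of_int (x + y) * p)" for p
  have c1: "continuous_on UNIV (\<lambda>p. of_real (symb \<kappa> \<beta>L \<beta>R p) * cis (of_int (x - y) * p))"
    "continuous_on UNIV (\<lambda>p. (fermi \<beta>R p * rcoef \<kappa> p) * cis (of_int (x + y) * p))"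
    by (intro continuous_intros symb_cont[OF \<kappa>] fermi_cont rcoef_cont[OF k])+
  have Ec: "continuous_on UNIV E" unfolding E_def by (intro continuous_intros c1)
  have Em: "continuous_on UNIV (\<lambda>p. E (- p))" by (rule continuous_on_compose2[OF Ec]) (auto intro!: continuous_intros)
  have c3: "continuous_on UNIV (\<lambda>p. fermi \<beta> p * (cnj (scat \<kappa> a p) * scat \<kappa> b p))" for \<beta> a b
    by (intro continuous_intros fermi_cont scat_cont[OF k])
  \<comment> \<open>Means over the circle are folded onto the half circle by p -> -p, so that they
    can be compared with the half means in \<open>Minf\<close>.\<close>
  have "fc (\<lambda>p. of_real (symb \<kappa> \<beta>L \<beta>R p)) (x - y) + fc (\<lambda>p. fermi \<beta>R p * rcoef \<kappa> p) (x + y) = havg (\<lambda>p. E p + E (- p))"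
    unfolding fc_def avg_add[OF c1, symmetric] E_def[symmetric] avg_split[OF Ec] havg_add[OF Ec Em] ..
  also have "\<dots> = havg (\<lambda>p. fermi \<beta>R p * (cnj (scat \<kappa> x p) * scat \<kappa> y p) + fermi \<beta>L p * (cnj (scat \<kappa> (- x) p) * scat \<kappa> (- y) p))"
  proof (rule havg_cong)
    fix p :: real assume s: "0 \<le> sin p"
    define r where "r = rcoef \<kappa> p"
    define u where "u = cis (of_int x * p)"
    define v where "v = cis (of_int y * p)"
    define s where "s = complex_of_real (sigmaB \<kappa> p)"
    have uv: "cnj u * u = 1" "cnj v * v = 1" unfolding u_def v_def by (simp_all add: cis_cnj cis_mult)
    have cc: "cis (of_int (x - y) * p) = u * cnj v" "cis (of_int (x + y) * p) = u * v"
      "cis (of_int (x - y) * - p) = cnj u * v" "cis (of_int (x + y) * - p) = cnj u * cnj v"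
      unfolding u_def v_def by (simp_all add: cis_cnj cis_mult algebra_simps)
    \<comment> \<open>For positive sites the modulus in \<open>scat\<close> disappears; at the
      mirrored site -x the incoming and the reflected phase coincide, which leaves the transmission
      amplitude.\<close>
    have sc: "scat \<kappa> x p = cnj u + u * r" "scat \<kappa> y p = cnj v + v * r" "scat \<kappa> (- x) p = u * (1 + r)" "scat \<kappa> (- y) p = v * (1 + r)"
      unfolding scat_def u_def v_def r_def using x y by (simp_all add: cis_cnj distrib_left)
    have rr: "cnj r * r = 1 - s" "cnj (1 + r) * (1 + r) = s"
      unfolding r_def s_def using rcoef_refl_norm[OF \<kappa>, of p] rcoef_trans_norm[OF \<kappa>, of p] by simp_all
    have E1: "E p = fermi \<beta>R p * (u * cnj v) + fermi \<beta>R p * r * (u * v)"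
      unfolding E_def cc symb_nonneg_sin[OF s] fermi_rfermi r_def ..
    have "symb \<kappa> \<beta>L \<beta>R (- p) = mix \<kappa> \<beta>L \<beta>R p" using s by (subst symb_nonpos_sin) (auto simp: mix_even)
    then have E2: "E (- p) = (s * fermi \<beta>L p + (1 - s) * fermi \<beta>R p) * (cnj u * v) + fermi \<beta>R p * cnj r * (cnj u * cnj v)"
      unfolding E_def cc rcoef_minus fermi_even r_def[symmetric] by (simp add: mix_def s_def fermi_rfermi)
    have f1: "cnj (scat \<kappa> x p) * scat \<kappa> y p = u * cnj v + r * (u * v) + cnj r * (cnj u * cnj v) + (cnj r * r) * (cnj u * v)"
      unfolding sc by (simp add: algebra_simps)
    have f2: "cnj (scat \<kappa> (- x) p) * scat \<kappa> (- y) p = (cnj (1 + r) * (1 + r)) * (cnj u * v)"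
      unfolding sc by (simp only: complex_cnj_mult mult_ac)
    show "E p + E (- p) = fermi \<beta>R p * (cnj (scat \<kappa> x p) * scat \<kappa> y p) + fermi \<beta>L p * (cnj (scat \<kappa> (- x) p) * scat \<kappa> (- y) p)"
      unfolding E1 E2 f1 f2 rr by (simp add: algebra_simps)
  qed
  also have "\<dots> = havg (\<lambda>p. fermi \<beta>R p * (cnj (scat \<kappa> x p) * scat \<kappa> y p)) + havg (\<lambda>p. fermi \<beta>L p * (cnj (scat \<kappa> (- x) p) * scat \<kappa> (- y) p))"
    by (rule havg_add[OF c3 c3])
  finally have "havg (\<lambda>p. fermi \<beta>R p * (cnj (scat \<kappa> x p) * scat \<kappa> y p)) + havg (\<lambda>p. fermi \<beta>L p * (cnj (scat \<kappa> (- x) p) * scat \<kappa> (- y) p))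
    = fc (\<lambda>p. of_real (symb \<kappa> \<beta>L \<beta>R p)) (x - y) + fc (\<lambda>p. fermi \<beta>R p * rcoef \<kappa> p) (x + y)" by simp
  moreover have "bs_decay \<kappa> ^ nat \<bar>x\<bar> * bs_decay \<kappa> ^ nat \<bar>y\<bar> = bs_decay \<kappa> ^ nat \<bar>x + y\<bar>"
    using x y by (simp add: power_add[symmetric] nat_add_distrib)
  ultimately show ?thesis unfolding Minf_def by simp
qed

lemma hankel_symbol_summable:
  assumes \<kappa>: "0 < \<kappa>"
  shows "(\<lambda>m. cmod (fc (\<lambda>p. fermi \<beta>R p * rcoef \<kappa> p) m + of_real (bs_decay \<kappa> ^ nat \<bar>m\<bar>) * Zc N \<kappa> \<beta>L \<beta>R)) summable_on UNIV"
proof -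
  have nz: "of_real \<kappa> + \<i> * of_real (sin p) \<noteq> (0::complex)" for p using \<kappa> by (simp add: complex_eq_iff)
  obtain F' where F': "continuous_on UNIV F'" "\<And>p. (fermi \<beta>R has_vector_derivative F' p) (at p)" using fermi_deriv by blast
  define R where "R p = of_real \<kappa> * (\<i> * of_real (cos p)) / (of_real \<kappa> + \<i> * of_real (sin p))\<^sup>2" for p
  have dR: "(rcoef \<kappa> has_vector_derivative R p) (at p)" for p
  proof -
    have "((\<lambda>z. - of_real \<kappa> / (of_real \<kappa> + \<i> * sin z)) has_field_derivative of_real \<kappa> * (\<i> * cos (of_real p)) / (of_real \<kappa> + \<i> * sin (of_real p))\<^sup>2) (at (of_real p))"
      using nz[of p] by (auto intro!: derivative_eq_intros simp: sin_of_real power2_eq_square)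
    from has_vector_derivative_real_field[OF this] show ?thesis
      unfolding R_def rcoef_def[abs_def] by (simp add: sin_of_real cos_of_real)
  qed
  have Rc: "continuous_on UNIV R" unfolding R_def by (intro continuous_intros) (use nz in auto)
  have s1: "(\<lambda>m. cmod (fc (\<lambda>p. fermi \<beta>R p * rcoef \<kappa> p) m)) summable_on UNIV"
  proof (rule fc_summable)
    show "((\<lambda>p. fermi \<beta>R p * rcoef \<kappa> p) has_vector_derivative fermi \<beta>R p * R p + F' p * rcoef \<kappa> p) (at p)" for p
      by (rule has_vector_derivative_mult[OF F'(2) dR])
    show "continuous_on UNIV (\<lambda>p. fermi \<beta>R p * R p + F' p * rcoef \<kappa> p)"
      by (intro continuous_intros fermi_cont Rc F' rcoef_cont) (use \<kappa> in auto)
    show "periodic (\<lambda>p. fermi \<beta>R p * rcoef \<kappa> p)" using fermi_periodic rcoef_periodic by (simp add: periodic_def)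
  qed
  have s2: "(\<lambda>m. bs_decay \<kappa> ^ nat \<bar>m\<bar> * cmod (Zc N \<kappa> \<beta>L \<beta>R)) summable_on (UNIV :: int set)"
    by (rule summable_on_cmult_left[OF bs_geometric[OF \<kappa>]])
  show ?thesis
  proof (rule summable_on_comparison_test[OF summable_on_add[OF s1 s2]])
    show "cmod (fc (\<lambda>p. fermi \<beta>R p * rcoef \<kappa> p) m + of_real (bs_decay \<kappa> ^ nat \<bar>m\<bar>) * Zc N \<kappa> \<beta>L \<beta>R)
      \<le> cmod (fc (\<lambda>p. fermi \<beta>R p * rcoef \<kappa> p) m) + bs_decay \<kappa> ^ nat \<bar>m\<bar> * cmod (Zc N \<kappa> \<beta>L \<beta>R)" for m
      using norm_triangle_ineq[of "fc (\<lambda>p. fermi \<beta>R p * rcoef \<kappa> p) m" "of_real (bs_decay \<kappa> ^ nat \<bar>m\<bar>) * Zc N \<kappa> \<beta>L \<beta>R"] bs_facts[OF \<kappa>]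
      by (simp add: norm_mult norm_power)
  qed simp
qed

lemma Minf_det_bound:
  assumes \<kappa>: "0 < \<kappa>"
  shows "\<exists>B. \<forall>n. cmod (fdet n (\<lambda>i j. Minf N \<kappa> \<beta>L \<beta>R (x0 + int i) (x0 + int j))) \<le> B * exp (- (GammaR \<beta>R + GammaB \<kappa> \<beta>L \<beta>R) * real n)"
proof -
  obtain D where D: "continuous_on UNIV D" "\<And>p. ((\<lambda>p. complex_of_real (ln (symb \<kappa> \<beta>L \<beta>R p))) has_vector_derivative D p) (at p)"
    using ln_symb_deriv[OF \<kappa>] by blast
  show ?thesis unfolding decay_rate[OF \<kappa>, symmetric]
  proof (rule toeplitz_hankel_det_bound[OF D(2,1)])
    show "ln (symb \<kappa> \<beta>L \<beta>R (p + 2 * pi)) = ln (symb \<kappa> \<beta>L \<beta>R p)" for p by (simp add: symb_periodic)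
    show "Minf N \<kappa> \<beta>L \<beta>R y x = cnj (Minf N \<kappa> \<beta>L \<beta>R x y)" for x y by (rule Minf_hermitian[OF \<kappa>])
    show "0 \<le> Re (\<Sum>x\<in>I. \<Sum>y\<in>I. cnj (v x) * Minf N \<kappa> \<beta>L \<beta>R x y * v y)" if "finite I" for I v by (rule Minf_psd[OF \<kappa> that])
    have e: "(\<lambda>p. complex_of_real (exp (ln (symb \<kappa> \<beta>L \<beta>R p)))) = (\<lambda>p. of_real (symb \<kappa> \<beta>L \<beta>R p))"
      using symb_pos[OF \<kappa>] by simp
    show "Minf N \<kappa> \<beta>L \<beta>R x y = fc (\<lambda>p. of_real (exp (ln (symb \<kappa> \<beta>L \<beta>R p)))) (x - y)
      + (fc (\<lambda>p. fermi \<beta>R p * rcoef \<kappa> p) (x + y) + of_real (bs_decay \<kappa> ^ nat \<bar>x + y\<bar>) * Zc N \<kappa> \<beta>L \<beta>R)" if "1 \<le> x" "1 \<le> y" for x y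
      unfolding e by (rule Minf_toeplitz_hankel[OF \<kappa> that])
  qed (rule hankel_symbol_summable[OF \<kappa>])
qed

section \<open>The steady state\<close>

text \<open>As a finite sum of finite products the determinant inherits continuity and limits from
  its entries.\<close>

lemma fdet_leibniz:
  "fdet n M = (\<Sum>p | p permutes {0..<n}. signof p * (\<Prod>i=0..<n. M i (p i)))"
proof -
  have "(\<Prod>i=0..<n. Matrix.mat n n (\<lambda>(i, j). M i j) $$ (i, p i)) = (\<Prod>i=0..<n. M i (p i))" if "p permutes {0..<n}" for p
    by (rule prod.cong) (use permutes_in_image[OF that] in auto)
  then show ?thesis unfolding fdet_def by (subst det_def'[of _ n]) (auto intro!: sum.cong)
qed

lemma cesaro_limit:
  fixes f :: "real \<Rightarrow> complex"
  assumes c: "continuous_on UNIV f" and l: "(f \<longlongrightarrow> L) at_top"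
  shows "((\<lambda>T. of_real (1 / T) * integral {0..T} f) \<longlongrightarrow> L) at_top"
proof (rule tendstoI)
  fix e :: real assume e: "0 < e"
  define g where "g t = f t - L" for t
  have gc: "continuous_on UNIV g" unfolding g_def by (intro continuous_intros c)
  have "\<forall>\<^sub>F t in at_top. cmod (g t) < e / 2"
    using tendstoD[OF l, of "e / 2"] e unfolding g_def by (simp add: dist_norm)
  then obtain A where A: "\<And>t. A \<le> t \<Longrightarrow> cmod (g t) < e / 2" unfolding eventually_at_top_linorder by blast
  define B where "B = max A 0"
  define C where "C = cmod (integral {0..B} g)"
  have "dist (of_real (1 / T) * integral {0..T} f) L < e" if T: "B < T" "2 * C / e < T" for T
  proof -
    have T0: "0 < T" using T(1) unfolding B_def by simp
    have sp: "integral {0..T} g = integral {0..B} g + integral {B..T} g"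
      by (rule Henstock_Kurzweil_Integration.integral_combine[symmetric]) (use T in \<open>auto simp: B_def intro: integrable_cont[OF gc]\<close>)
    have "cmod (integral {B..T} g) \<le> e / 2 * (T - B)"
    proof (rule integral_bound)
      show "continuous_on {B..T} g" by (rule continuous_on_subset[OF gc]) simp
      show "cmod (g t) \<le> e / 2" if "t \<in> {B..T}" for t using A[of t] that by (simp add: B_def)
    qed (use T in simp)
    moreover have "e / 2 * (T - B) \<le> e / 2 * T" using e by (intro mult_left_mono) (auto simp: B_def)
    ultimately have "cmod (integral {0..T} g) \<le> C + e / 2 * T"
      unfolding C_def sp using norm_triangle_ineq[of "integral {0..B} g" "integral {B..T} g"] by linarith
    also have "\<dots> < e * T" using T(2) e by (simp add: field_simps)
    finally have b: "cmod (integral {0..T} g) < e * T" .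
    have "integral {0..T} f = integral {0..T} g + of_real T * L"
    proof -
      have "integral {0..T} g = integral {0..T} f - integral {0..T} (\<lambda>t. L)"
        unfolding g_def by (rule Henstock_Kurzweil_Integration.integral_diff) (auto intro: integrable_cont[OF c])
      then show ?thesis using T0 by (simp add: scaleR_conv_of_real)
    qed
    then have "of_real (1 / T) * integral {0..T} f - L = of_real (1 / T) * integral {0..T} g"
      using T0 by (simp add: field_simps)
    then show ?thesis using b T0 by (simp add: dist_norm norm_mult norm_divide field_simps)
  qed
  then show "\<forall>\<^sub>F T in at_top. dist (of_real (1 / T) * integral {0..T} f) L < e"
    using eventually_conj[OF eventually_gt_at_top[of B] eventually_gt_at_top[of "2 * C / e"]]
    by (auto elim: eventually_mono)
qed

lemma cnj_fc_fermi: "cnj (fc (fermi \<beta>) m) = fc (fermi \<beta>) m"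
proof -
  have "cnj (fc (fermi \<beta>) m) = fc (fermi \<beta>) (- m)"
    unfolding fc_def avg_cnj[symmetric] by (simp add: cis_cnj fermi_def)
  then show ?thesis using fc_even[of "fermi \<beta>" m, OF fermi_even] by simp
qed

text \<open>The kernels are real. This serves the lower component, where conjugated vectors
  occur.\<close>

lemma s0_val_cnj: "s0_val N \<beta>L \<beta>R (\<lambda>x. cnj (f x)) x = cnj (s0_val N \<beta>L \<beta>R f x)"
proof -
  have k: "cnj (refl_kern (fermi \<beta>) N a b) = refl_kern (fermi \<beta>) N a b" for \<beta> a b
    unfolding refl_kern_def by (simp add: cnj_fc_fermi)
  have "(\<Sum>\<^sub>\<infinity>b\<in>ZR N. refl_kern (fermi \<beta>) N a b * cnj (g b)) = cnj (\<Sum>\<^sub>\<infinity>b\<in>ZR N. refl_kern (fermi \<beta>) N a b * g b)" for \<beta> a g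
    unfolding infsum_cnj[symmetric] by (simp add: k)
  then show ?thesis unfolding s0_val_def by simp
qed

text \<open>\<open>True\<close> marks the upper component, evolved by exp(i t hB),
  \<open>False\<close> the lower one, evolved by exp(-i t hB), which gives the conjugate vector
  since \<open>hB\<close> is real. The flag is the class used in
  \<open>pf_bipartite\<close>.\<close>

definition evolved :: "real \<Rightarrow> real \<Rightarrow> bool \<times> int \<Rightarrow> vec2" where
  "evolved \<kappa> t z = (if fst z then (psi \<kappa> t (snd z), \<lambda>_. 0) else (\<lambda>_. 0, \<lambda>x. cnj (psi \<kappa> t (snd z) x)))"

lemma hB_uminus: "hB \<kappa> (\<lambda>x. - f x) = (\<lambda>x. - hB \<kappa> f x)"
proof
  fix x :: int
  have i: "(if x = 0 then - f 0 else 0) = - (if x = 0 then f 0 else 0)" by simp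
  have e: "(- a + - b) / 2 + k * - c = - ((a + b) / 2 + k * c)" for a b c k :: complex by (simp add: add_divide_distrib diff_divide_distrib)
  show "hB \<kappa> (\<lambda>x. - f x) x = - hB \<kappa> f x" unfolding hB_apply i e ..
qed

lemma hB_zero: "hB \<kappa> (\<lambda>x. 0) = (\<lambda>x. 0)"
  by (rule ext) (simp add: hB_apply)

lemma HB_power_left: "(HB \<kappa> ^^ n) (f, \<lambda>_. 0) = ((hB \<kappa> ^^ n) f, \<lambda>_. 0)"
  by (induction n) (auto simp: HB_def hB_zero)

lemma hB_sign: "hB \<kappa> (\<lambda>x. (- 1) ^ n * f x) = (\<lambda>x. (- 1) ^ n * hB \<kappa> f x)"
  by (cases "even n") (auto simp: hB_uminus)

lemma HB_power_right: "(HB \<kappa> ^^ n) (\<lambda>_. 0, f) = (\<lambda>_. 0, \<lambda>x. (- 1) ^ n * (hB \<kappa> ^^ n) f x)"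
  by (induction n) (auto simp: HB_def hB_zero hB_sign)

lemma expHB_delta:
  assumes \<kappa>: "0 < \<kappa>"
  shows "expHB \<kappa> t (delta y, \<lambda>_. 0) = evolved \<kappa> t (True, y)" "expHB \<kappa> t (\<lambda>_. 0, delta y) = evolved \<kappa> t (False, y)"
proof -
  show "expHB \<kappa> t (delta y, \<lambda>_. 0) = evolved \<kappa> t (True, y)"
    unfolding expHB_def HB_power_left evolved_def by (simp add: sums_unique[OF psi_sums[OF \<kappa>], symmetric] del: of_nat_fact times_divide_eq_left)
  have e: "(\<i> * of_real t) ^ n / of_nat (fact n) * ((- 1) ^ n * z) = (\<i> * of_real (- t)) ^ n / of_nat (fact n) * z" for n z
    by (simp add: power_minus[of "\<i> * of_real t"])
  have f: "(\<lambda>x. \<Sum>n. (\<i> * of_real t) ^ n / of_nat (fact n) * ((- 1) ^ n * (hB \<kappa> ^^ n) (delta y) x)) = psi \<kappa> (- t) y"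
    unfolding e sums_unique[OF psi_sums[OF \<kappa>], symmetric] ..
  show "expHB \<kappa> t (\<lambda>_. 0, delta y) = evolved \<kappa> t (False, y)"
    unfolding expHB_def HB_power_right evolved_def fst_conv snd_conv f cnj_psi[OF \<kappa>] by simp
qed

lemma shift_power_delta: "(shift ^^ i) (delta a) = delta (a + int i)"
  by (induction i) (auto simp: shift_def delta_def)

lemma shift_power_zero: "(shift ^^ i) (\<lambda>_. 0) = (\<lambda>_. 0)"
  by (induction i) (auto simp: shift_def)

definition interleave :: "int list \<Rightarrow> (bool \<times> int) list" where
  "interleave xs = concat (map (\<lambda>y. [(False, y), (True, y)]) xs)"

lemma interleave_Cons: "interleave (y # xs) = (False, y) # (True, y) # interleave xs"
  by (simp add: interleave_def)

lemma interleave_set: "z \<in> set (interleave xs) \<Longrightarrow> snd z \<in> set xs"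
  by (auto simp: interleave_def)

lemma interleave_filter:
  "filter fst (interleave xs) = map (Pair True) xs" "filter (\<lambda>z. \<not> fst z) (interleave xs) = map (Pair False) xs"
  by (induction xs) (auto simp: interleave_def)

text \<open>Equals the other sign exponent in \<open>pf_bipartite\<close>, so that the two signs
  cancel.\<close>

lemma interleave_inv_count: "inv_count fst (interleave xs) = tri (length xs)"
proof (induction xs)
  case Nil
  show ?case by (simp add: interleave_def tri_def)
next
  case (Cons y xs)
  then show ?case by (simp add: interleave_Cons interleave_filter tri_Suc)
qed

lemma interleave_sorted:
  assumes "\<And>y b z. y < z \<Longrightarrow> R (False, y) (b, z)" "\<And>y b z. y < z \<Longrightarrow> R (True, y) (b, z)" "\<And>y. R (False, y) (True, y)"
  shows "sorted_wrt (<) xs \<Longrightarrow> sorted_wrt R (interleave xs)"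
proof (induction xs)
  case Nil
  show ?case by (simp add: interleave_def)
next
  case (Cons y xs)
  have "R (False, y) z \<and> R (True, y) z" if "z \<in> set (interleave xs)" for z
    using assms(1,2)[of y "snd z" "fst z"] interleave_set[OF that] Cons.prems by simp
  then show ?case using Cons assms(3) by (simp add: interleave_Cons)
qed

lemma evolved_Fs:
  assumes \<kappa>: "0 < \<kappa>"
  shows "map (expHB \<kappa> t) (Fs x0 n) = map (evolved \<kappa> t) (interleave (map (\<lambda>i. x0 + int i) [0..<n]))"
proof -
  have 1: "shift2 i (G1 x0) = (\<lambda>_. 0, delta (x0 - 1 + int i))" for i
    unfolding shift2_def G1_def by (simp add: shift_power_delta shift_power_zero)
  have "G2 x0 = (delta (x0 - 1), \<lambda>_. 0)" unfolding G2_def G1_def Jop_def by (auto simp: delta_def)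
  then have 2: "shift2 i (G2 x0) = (delta (x0 - 1 + int i), \<lambda>_. 0)" for i
    unfolding shift2_def by (simp add: shift_power_delta shift_power_zero)
  \<comment> \<open>The index in \<open>Fs\<close> starts at 1, which compensates the site x0 - 1 in
    \<open>G1\<close>: the sites are x0, ..., x0 + n - 1.\<close>
  have "[1..<n+1] = map Suc [0..<n]" by (simp add: map_Suc_upt)
  then show ?thesis unfolding Fs_def interleave_def map_concat 1 2 by (simp add: o_def expHB_delta[OF \<kappa>])
qed

text \<open>Only indices in increasing order occur in the Pfaffian, so the other half may be filled in by
  hermitian symmetry without proving that the two-point function is hermitian.\<close>
definition pairing :: "nat \<Rightarrow> real \<Rightarrow> real \<Rightarrow> real \<Rightarrow> real \<Rightarrow> int \<Rightarrow> int \<Rightarrow> complex" where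
  "pairing N \<kappa> \<beta>L \<beta>R t x y = (if x \<le> y then sform N \<beta>L \<beta>R (psi \<kappa> t x) (psi \<kappa> t y) else cnj (sform N \<beta>L \<beta>R (psi \<kappa> t y) (psi \<kappa> t x)))"

lemma pairing_cont:
  assumes \<kappa>: "0 < \<kappa>"
  shows "continuous_on UNIV (\<lambda>t. pairing N \<kappa> \<beta>L \<beta>R t x y)"
  unfolding pairing_def by (cases "x \<le> y") (auto intro!: continuous_on_cnj sform_psi_cont[OF \<kappa>])

lemma pairing_limit:
  assumes \<kappa>: "0 < \<kappa>"
  shows "((\<lambda>t. pairing N \<kappa> \<beta>L \<beta>R t x y) \<longlongrightarrow> Minf N \<kappa> \<beta>L \<beta>R x y) at_top"
proof (cases "x \<le> y")
  case True
  then show ?thesis unfolding pairing_def using sform_psi_limit[OF \<kappa>] by simp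
next
  case False
  then show ?thesis unfolding pairing_def using tendsto_cnj[OF sform_psi_limit[OF \<kappa>, of N \<beta>L \<beta>R y x]] Minf_hermitian[OF \<kappa>, of N \<beta>L \<beta>R x y] by simp
qed

text \<open>\<open>S0\<close> preserves the components and \<open>Jop\<close> exchanges them, so
  equal classes do not pair. In the last case the density of the lower component is 1 minus that of
  the upper one; the 1 drops out because propagated vectors at different sites are
  orthogonal.\<close>

lemma evolved_pairs:
  fixes t :: real and N :: nat
  assumes \<kappa>: "0 < \<kappa>" and \<beta>: "0 < \<beta>L" "0 < \<beta>R"
  defines "w \<equiv> \<lambda>z z'. ip (Jop (evolved \<kappa> t z)) (S0 N \<beta>L \<beta>R (evolved \<kappa> t z'))"
  shows "w (b, y) (b, z) = 0" "w (False, y) (True, z) = sform N \<beta>L \<beta>R (psi \<kappa> t y) (psi \<kappa> t z)"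
    "y \<noteq> z \<Longrightarrow> w (True, y) (False, z) = - cnj (sform N \<beta>L \<beta>R (psi \<kappa> t y) (psi \<kappa> t z))"
proof -
  note l = psi_l2le[OF \<kappa>]
  have l0: "l2le (\<lambda>_::int. 0) 0" by (simp add: l2le_def L2_set_def)
  have lc: "l2le (\<lambda>x. cnj (psi \<kappa> t y x)) 1" for y by (rule l2le_mono[OF l]) auto
  have z: "s0_val N \<beta>L \<beta>R (\<lambda>_. 0) x = 0" for x unfolding s0_val_def by simp
  have m: "s0m N \<beta>L \<beta>R (psi \<kappa> t y) x = s0_val N \<beta>L \<beta>R (psi \<kappa> t y) x" for y x by (rule s0m_eq[OF l \<beta>])
  have p: "s0p N \<beta>L \<beta>R (\<lambda>x. cnj (psi \<kappa> t y x)) x = cnj (psi \<kappa> t y x) - cnj (s0_val N \<beta>L \<beta>R (psi \<kappa> t y) x)" for y x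
    unfolding s0p_eq[OF lc \<beta>] s0_val_cnj ..
  have z2: "s0m N \<beta>L \<beta>R (\<lambda>_. 0) x = 0" "s0p N \<beta>L \<beta>R (\<lambda>_. 0) x = 0" for x
    using s0m_eq[OF l0 \<beta>] s0p_eq[OF l0 \<beta>] z by simp_all
  show "w (b, y) (b, z) = 0" unfolding w_def ip_def Jop_def S0_def evolved_def by (cases b) (simp_all add: z2)
  show "w (False, y) (True, z) = sform N \<beta>L \<beta>R (psi \<kappa> t y) (psi \<kappa> t z)"
    unfolding w_def ip_def Jop_def S0_def evolved_def by (simp add: m infsumI[OF sform_has_sum[OF l l]])
  assume yz: "y \<noteq> z"
  have a1: "((\<lambda>x. psi \<kappa> t y x * cnj (psi \<kappa> t z x)) has_sum 0) UNIV"
    using psi_orthonormal[OF \<kappa>, of t z y] yz by (simp add: mult.commute)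
  have a2: "((\<lambda>x. psi \<kappa> t y x * cnj (s0_val N \<beta>L \<beta>R (psi \<kappa> t z) x)) has_sum cnj (sform N \<beta>L \<beta>R (psi \<kappa> t y) (psi \<kappa> t z))) UNIV"
  proof -
    have "((\<lambda>x. cnj (cnj (psi \<kappa> t y x) * s0_val N \<beta>L \<beta>R (psi \<kappa> t z) x)) has_sum cnj (sform N \<beta>L \<beta>R (psi \<kappa> t y) (psi \<kappa> t z))) UNIV"
      unfolding has_sum_cnj_iff by (rule sform_has_sum[OF l l])
    then show ?thesis by simp
  qed
  have "((\<lambda>x. psi \<kappa> t y x * cnj (psi \<kappa> t z x) - psi \<kappa> t y x * cnj (s0_val N \<beta>L \<beta>R (psi \<kappa> t z) x)) has_sum
    0 - cnj (sform N \<beta>L \<beta>R (psi \<kappa> t y) (psi \<kappa> t z))) UNIV"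
    using has_sum_add[OF a1 has_sum_uminusI[OF a2]] by simp
  from infsumI[OF this] show "w (True, y) (False, z) = - cnj (sform N \<beta>L \<beta>R (psi \<kappa> t y) (psi \<kappa> t z))"
    unfolding w_def ip_def Jop_def S0_def evolved_def by (simp add: p right_diff_distrib)
qed

lemma evolved_value_eq:
  assumes \<kappa>: "0 < \<kappa>" and \<beta>: "0 < \<beta>L" "0 < \<beta>R"
  shows "evolved_value N \<kappa> \<beta>L \<beta>R x0 n t = fdet n (\<lambda>i j. pairing N \<kappa> \<beta>L \<beta>R t (x0 + int i) (x0 + int j))"
proof -
  define xs where "xs = map (\<lambda>i. x0 + int i) [0..<n]"
  define w where "w z z' = ip (Jop (evolved \<kappa> t z)) (S0 N \<beta>L \<beta>R (evolved \<kappa> t z'))" for z z'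
  define A where "A z z' = pairing N \<kappa> \<beta>L \<beta>R t (snd z) (snd z')" for z z' :: "bool \<times> int"
  note ep = evolved_pairs[OF \<kappa> \<beta>, where t = t and N = N, folded w_def]
  have "sorted_wrt (<) xs" unfolding xs_def sorted_wrt_map by (rule sorted_wrt_mono_rel[OF _ sorted_wrt_upt]) auto
  then have "sorted_wrt (bip_pair fst w A) (interleave xs)"
  proof (rule interleave_sorted[rotated -1])
    show "bip_pair fst w A (False, y) (b, z)" if "y < z" for y b z
      unfolding bip_pair_def A_def pairing_def using that ep by simp
    show "bip_pair fst w A (True, y) (b, z)" if "y < z" for y b z
      unfolding bip_pair_def A_def pairing_def using that ep by simp
    show "bip_pair fst w A (False, y) (True, y)" for y
      unfolding bip_pair_def A_def pairing_def using ep by simp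
  qed
  then have "pf w (interleave xs) = (-1) ^ (inv_count fst (interleave xs) + tri n) * ldet A (filter (\<lambda>y. \<not> fst y) (interleave xs)) (filter fst (interleave xs))"
    by (rule pf_bipartite) (auto simp: interleave_filter xs_def)
  \<comment> \<open>The exponent of -1 is twice \<open>tri n\<close>.\<close>
  also have "\<dots> = ldet A (map (Pair False) xs) (map (Pair True) xs)"
    unfolding interleave_inv_count interleave_filter by (simp add: xs_def)
  also have "\<dots> = fdet n (\<lambda>i j. pairing N \<kappa> \<beta>L \<beta>R t (x0 + int i) (x0 + int j))"
    unfolding ldet_def fdet_def by (rule arg_cong[where f = Determinant.det]) (rule eq_matI, auto simp: xs_def A_def)
  finally show ?thesis
    unfolding evolved_value_def qf_state_def evolved_Fs[OF \<kappa>] pf_map w_def xs_def .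
qed

theorem mainTheorem1:
  fixes N :: nat and \<kappa> \<beta>L \<beta>R :: real and x0 :: int
  assumes "0 < \<beta>L" and "\<beta>L \<le> \<beta>R" and "0 < \<kappa>"
  shows "GammaR \<beta>R + GammaB \<kappa> \<beta>L \<beta>R > 0 \<and>
    (\<exists>P :: nat \<Rightarrow> complex.
       (\<forall>n. (cesaro_value N \<kappa> \<beta>L \<beta>R x0 n \<longlongrightarrow> P n) at_top) \<and>
       (\<lambda>n. cmod (P n)) \<in> O(\<lambda>n. exp (- (GammaR \<beta>R + GammaB \<kappa> \<beta>L \<beta>R) * real n)))"
proof
  note \<kappa> = assms(3)
  have \<beta>R: "0 < \<beta>R" using assms by linarith
  show "GammaR \<beta>R + GammaB \<kappa> \<beta>L \<beta>R > 0" by (rule decay_rate_pos[OF \<kappa> assms(1,2)])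
  define P where "P n = fdet n (\<lambda>i j. Minf N \<kappa> \<beta>L \<beta>R (x0 + int i) (x0 + int j))" for n
  \<comment> \<open>The values at time t converge themselves, entry by entry in the Leibniz formula,
    and averaging preserves the limit.\<close>
  have lim: "(cesaro_value N \<kappa> \<beta>L \<beta>R x0 n \<longlongrightarrow> P n) at_top" for n
  proof -
    note ev = evolved_value_eq[OF \<kappa> assms(1) \<beta>R, of N x0 n, unfolded fdet_leibniz]
    have "continuous_on UNIV (evolved_value N \<kappa> \<beta>L \<beta>R x0 n)"
      unfolding ev[abs_def] by (intro continuous_intros pairing_cont[OF \<kappa>])
    moreover have "(evolved_value N \<kappa> \<beta>L \<beta>R x0 n \<longlongrightarrow> P n) at_top"
      unfolding ev[abs_def] P_def fdet_leibniz by (intro tendsto_intros pairing_limit[OF \<kappa>])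
    ultimately show ?thesis unfolding cesaro_value_def[abs_def] by (rule cesaro_limit)
  qed
  obtain B where B: "\<And>n. cmod (P n) \<le> B * exp (- (GammaR \<beta>R + GammaB \<kappa> \<beta>L \<beta>R) * real n)"
    using Minf_det_bound[OF \<kappa>, of N \<beta>L \<beta>R x0] unfolding P_def by blast
  have "(\<lambda>n. cmod (P n)) \<in> O(\<lambda>n. exp (- (GammaR \<beta>R + GammaB \<kappa> \<beta>L \<beta>R) * real n))"
    by (rule bigoI[of _ B], rule always_eventually) (use B in auto)
  then show "\<exists>P :: nat \<Rightarrow> complex. (\<forall>n. (cesaro_value N \<kappa> \<beta>L \<beta>R x0 n \<longlongrightarrow> P n) at_top) \<and>
       (\<lambda>n. cmod (P n)) \<in> O(\<lambda>n. exp (- (GammaR \<beta>R + GammaB \<kappa> \<beta>L \<beta>R) * real n))"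
    using lim by blast
qed

end
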